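(* Let $n\ge2$, let $\Omega\subset\mathbb{R}^n$ be a bounded Lipschitz domain with boundary $\Gamma$, and let $0<s<1$, $0<p,q\le\infty$. Then $f\in L_p(\Gamma)$ belongs to $\mathbf{B}^s_{p,q}(\Gamma)$ if, and only if, $$f=\sum_{j=0}^\infty\ \sum_{m\in\mathbb{Z}^n:\,Q_{j,m}\cap\Gamma\ne\emptyset}\lambda_{j,m}a_{j,m},\qquad(\ast)$$ where the $a_{j,m}$ are $\mathrm{Lip}^\Gamma$-atoms with $\operatorname{supp}a_{j,m}\subset Q^\Gamma_{j,m}$ and $\lambda=\{\lambda_{j,m}\}\in b^s_{p,q}(\Gamma)$, the convergence being in $L_p(\Gamma)$. Furthermore, $\inf\|\lambda|b^s_{p,q}(\Gamma)\|$, where the infimum is taken over all possible representations $(\ast)$, is an equivalent quasi-norm on $\mathbf{B}^s_{p,q}(\Gamma)$.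
   Context: Notation: $\mathbb{N}_0=\{0,1,2,\dots\}$. For $j\in\mathbb{N}_0$, $m\in\mathbb{Z}^n$, $Q_{j,m}$ is the cube in $\mathbb{R}^n$ with sides parallel to the axes, centre $2^{-j}m$, side length $2^{-j+1}$; $dQ_{j,m}$ is the concentric cube with side length $d$ times as large. $[s]$ is the integer part of $s$. Besov spaces on domains. Let $\Omega\subset\mathbb{R}^n$ be a domain ($\Omega=\mathbb{R}^n$ allowed), $s>0$, $0<p,q\le\infty$. For complex $\lambda=\{\lambda_{j,m}\}$ put $\|\lambda|b^s_{p,q}(\Omega)\|=\big(\sum_{j=0}^\infty2^{j(s-n/p)q}(\sum_{m:\,Q_{j,m}\cap\Omega\ne\emptyset}|\lambda_{j,m}|^p)^{q/p}\big)^{1/q}$ (usual modification for $\infty$). Fix $d>1$ and $K\in\mathbb{N}_0$, $K\ge1+[s]$. A $K$-atom located at $Q_{j,m}$ is a $C^K$ function $a:\mathbb{R}^n\to\mathbb{C}$ with $\operatorname{supp}a\subset dQ_{j,m}$ and $|D^\alpha a|\le2^{|\alpha|j}$ for $|\alpha|\le K$. $\mathbf{B}^s_{p,q}(\Omega)$ is the set of $f\in L_p(\Omega)$ with $f=\sum_{j}\sum_{m:\,Q_{j,m}\cap\Omega\neq\emptyset}\lambda_{j,m}a_{j,m}$ (convergence in $L_p(\Omega)$), $a_{j,m}$ $K$-atoms located at $Q_{j,m}$, $\|\lambda|b^s_{p,q}(\Omega)\|<\infty$; its quasi-norm is the infimum of $\|\lambda|b^s_{p,q}(\Omega)\|$ over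 all such representations (independent of $d,K$ up to equivalence). Lipschitz domains. A Lipschitz diffeomorphism is a one-to-one map $\Phi$ of $\mathbb{R}^n$ onto itself with Lipschitz components and $|\Phi(x)-\Phi(y)|\sim|x-y|$ for $|x-y|\le1$. A bounded domain $\Omega\subset\mathbb{R}^n$ is a Lipschitz domain if its boundary $\Gamma=\partial\Omega$ is covered by finitely many open balls $K_1,\dots,K_N$, $K_j\cap\Gamma\ne\emptyset$, and there are Lipschitz diffeomorphisms $\psi^{(j)}$ with $\psi^{(j)}(K_j\cap\Omega)\subset\mathbb{R}^n_+=\{x_n>0\}$ and $\psi^{(j)}(K_j\cap\Gamma)\subset\mathbb{R}^{n-1}$ (identified with $\mathbb{R}^{n-1}\times\{0\}$). Let $K_0$ be an inner domain, $\overline{K_0}\subset\Omega$, $\Omega\subset K_0\cup\bigcup_{j=1}^NK_j$, and let $\{\varphi_j\}_{j=0}^N$ be smooth non-negative functions, $\operatorname{supp}\varphi_j\subset K_j$, $\sum_{j=0}^N\varphi_j=1$ on $\overline\Omega$. $\Gamma$ carries the surface measure $d\sigma$, used to define $L_p(\Gamma)$. Besov spaces on $\Gamma$ ($n\ge2$, $0<s<1$, $0<p,q\le\infty$). Put $W_j=\psi^{(j)}(\Gamma\cap K_j)\subset\mathbb{R}^{n-1}$ and, for $f\in L_p(\Gamma)$, $g_j=(\varphi_jf)\circ(\psi^{(j)})^{-1}$ on $W_j$. Then $\mathbf{B}^s_{p,q}(\Gamma)=\{f\in L_p(\Gamma): g_j\in\mathbf{B}^s_{p,q}(W_j),\ j=1,\dots,N\}$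 with quasi-norm $\sum_{j=1}^N\|g_j|\mathbf{B}^s_{p,q}(W_j)\|$, where $W_j$ is regarded as a domain in $\mathbb{R}^{n-1}$ (equivalently, extend $g_j$ by zero and use $\mathbf{B}^s_{p,q}(\mathbb{R}^{n-1})$). Up to equivalence this does not depend on the choice of $\varphi_j,\psi^{(j)}$. Sequence spaces on $\Gamma$: $\lambda=\{\lambda_{j,m}\in\mathbb{C}\}\in b^s_{p,q}(\Gamma)$ iff $$\|\lambda|b^s_{p,q}(\Gamma)\|=\Big(\sum_{j=0}^\infty2^{j(s-\frac{n-1}{p})q}\Big(\sum_{m\in\mathbb{Z}^n:\,Q_{j,m}\cap\Gamma\ne\emptyset}|\lambda_{j,m}|^p\Big)^{q/p}\Big)^{1/q}<\infty$$ (usual modification for $\infty$). $\mathrm{Lip}^\Gamma$-atoms: let $d>1$ and $Q^\Gamma_{j,m}=dQ_{j,m}\cap\Gamma\ne\emptyset$. A Lipschitz function $a$ on $\Gamma$ is a $\mathrm{Lip}^\Gamma$-atom (located at $Q^\Gamma_{j,m}$) if $\operatorname{supp}a\subset Q^\Gamma_{j,m}$, $\|a|L_\infty(\Gamma)\|\le1$ and $\sup_{x\ne y\in\Gamma}|a(x)-a(y)|/|x-y|\le2^j$. *)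

theory Defs
  imports "HOL-Analysis.Analysis" "HOL-Probability.Essential_Supremum"
begin

section \<open>Lebesgue and sequence spaces for exponents in (0, infinity]\<close>

definition ennpowr :: "ennreal \<Rightarrow> real \<Rightarrow> ennreal" where
  "ennpowr x r = (if x = \<infinity> then \<infinity> else ennreal (enn2real x powr r))"

text \<open>Used with positive exponents only. On counting measures this is the little-l quasi-norm,
  the essential supremum then being a plain supremum.\<close>

definition Lp_qnorm :: "'a measure \<Rightarrow> ennreal \<Rightarrow> ('a \<Rightarrow> ennreal) \<Rightarrow> ennreal" where
  "Lp_qnorm M p g =
     (if p = \<infinity> then esssup M g
      else ennpowr (\<integral>\<^sup>+ x. ennpowr (g x) (enn2real p) \<partial>M) (1 / enn2real p))"

definition Lp_space :: "'a measure \<Rightarrow> ennreal \<Rightarrow> ('a \<Rightarrow> complex) set" where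
  "Lp_space M p =
     {f \<in> borel_measurable M. Lp_qnorm M p (\<lambda>x. ennreal (norm (f x))) < \<infinity>}"

text \<open>Functions are not identified almost everywhere, so a quasi-norm is required to be
  invariant under changes on null sets and definite up to null sets.\<close>

definition quasi_norm_on ::
  "'a measure \<Rightarrow> ('a \<Rightarrow> complex) set \<Rightarrow> (('a \<Rightarrow> complex) \<Rightarrow> ennreal) \<Rightarrow> bool" where
  "quasi_norm_on M V \<nu> \<longleftrightarrow>
     (\<forall>f\<in>V. \<nu> f < \<infinity>) \<and>
     (\<forall>f\<in>V. \<forall>g\<in>V. (AE x in M. f x = g x) \<longrightarrow> \<nu> f = \<nu> g) \<and>
     (\<forall>f\<in>V. \<nu> f = 0 \<longleftrightarrow> (AE x in M. f x = 0)) \<and>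
     (\<forall>f\<in>V. \<forall>c. \<nu> (\<lambda>x. c * f x) = ennreal (norm c) * \<nu> f) \<and>
     (\<exists>C::real. \<forall>f\<in>V. \<forall>g\<in>V. \<nu> (\<lambda>x. f x + g x) \<le> ennreal C * (\<nu> f + \<nu> g))"

definition equivalent_quasi_norm_on ::
  "'a measure \<Rightarrow> ('a \<Rightarrow> complex) set \<Rightarrow> (('a \<Rightarrow> complex) \<Rightarrow> ennreal) \<Rightarrow>
   (('a \<Rightarrow> complex) \<Rightarrow> ennreal) \<Rightarrow> bool" where
  "equivalent_quasi_norm_on M V \<nu>\<^sub>0 \<nu> \<longleftrightarrow>
     quasi_norm_on M V \<nu> \<and>
     (\<exists>c C::real. 0 < c \<and> 0 < C \<and>
        (\<forall>f\<in>V. ennreal c * \<nu>\<^sub>0 f \<le> \<nu> f \<and> \<nu> f \<le> ennreal C * \<nu>\<^sub>0 f))"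

section \<open>Dyadic cubes and sequence spaces\<close>

definition int_lattice :: "'a::euclidean_space set" where
  "int_lattice = {m. \<forall>b\<in>Basis. m \<bullet> b \<in> \<int>}"

text \<open>The closed cube with centre \<open>2\<^sup>-\<^sup>j m\<close> and side length \<open>d * 2\<^sup>-\<^sup>j\<^sup>+\<^sup>1\<close>, that is, half side
  length \<open>d * 2\<^sup>-\<^sup>j\<close>.\<close>

definition dcube :: "real \<Rightarrow> nat \<Rightarrow> 'a::euclidean_space \<Rightarrow> 'a set" where
  "dcube d j m = {x. \<forall>b\<in>Basis. \<bar>x \<bullet> b - m \<bullet> b / 2 ^ j\<bar> \<le> d / 2 ^ j}"

definition cube_indices :: "'a::euclidean_space set \<Rightarrow> nat \<Rightarrow> 'a set" where
  "cube_indices S j = {m \<in> int_lattice. dcube 1 j m \<inter> S \<noteq> {}}"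

text \<open>The parameter \<open>k\<close> is the dimension in the weight \<open>2\<^sup>j\<^sup>(\<^sup>s\<^sup>-\<^sup>k\<^sup>/\<^sup>p\<^sup>)\<close>: the full dimension for
  open sets, one less for boundaries. Note that \<open>inverse \<infinity> = 0\<close>.\<close>

definition b_qnorm ::
  "nat \<Rightarrow> real \<Rightarrow> ennreal \<Rightarrow> ennreal \<Rightarrow> 'a::euclidean_space set \<Rightarrow>
   (nat \<Rightarrow> 'a \<Rightarrow> complex) \<Rightarrow> ennreal" where
  "b_qnorm k s p q S lam =
     Lp_qnorm (count_space UNIV) q
       (\<lambda>j. ennreal (2 powr (real j * (s - real k * enn2real (inverse p)))) *
            Lp_qnorm (count_space (cube_indices S j)) p (\<lambda>m. ennreal (norm (lam j m))))"

text \<open>The inner series is a locally finite pointwise sum, the outer one converges in \<open>L\<^sub>p\<close>.\<close>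

definition atomic_series_Lp ::
  "'a::euclidean_space measure \<Rightarrow> ennreal \<Rightarrow> 'a set \<Rightarrow> (nat \<Rightarrow> 'a \<Rightarrow> complex) \<Rightarrow>
   (nat \<Rightarrow> 'a \<Rightarrow> 'a \<Rightarrow> complex) \<Rightarrow> ('a \<Rightarrow> complex) \<Rightarrow> bool" where
  "atomic_series_Lp M p S lam a f \<longleftrightarrow>
     (\<lambda>J. Lp_qnorm M p (\<lambda>x. ennreal (norm
        (f x - (\<Sum>j<J. \<Sum>\<^sub>\<infinity>m\<in>cube_indices S j. lam j m * a j m x))))) \<longlonglongrightarrow> 0"

section \<open>Besov spaces on open sets\<close>

text \<open>A list of basis vectors plays the role of a multi-index: for a function of class \<open>C\<^sup>K\<close> the
  order of at most \<open>K\<close> partial derivatives is immaterial, and the length of the list is the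
  order of the multi-index.\<close>

primrec iter_partial ::
  "'a::euclidean_space list \<Rightarrow> ('a \<Rightarrow> 'c::real_normed_vector) \<Rightarrow> 'a \<Rightarrow> 'c" where
  "iter_partial [] f = f"
| "iter_partial (b # bs) f =
     (\<lambda>x. vector_derivative (\<lambda>t. iter_partial bs f (x + t *\<^sub>R b)) (at 0))"

definition C_class :: "nat \<Rightarrow> ('a::euclidean_space \<Rightarrow> 'c::real_normed_vector) \<Rightarrow> bool" where
  "C_class K f \<longleftrightarrow>
     (\<forall>bs. set bs \<subseteq> Basis \<and> length bs \<le> K \<longrightarrow>
        continuous_on UNIV (iter_partial bs f) \<and>
        (length bs < K \<longrightarrow>
           (\<forall>x. \<forall>b\<in>Basis. (\<lambda>t. iter_partial bs f (x + t *\<^sub>R b)) differentiable (at 0))))"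

definition K_atom ::
  "real \<Rightarrow> nat \<Rightarrow> nat \<Rightarrow> 'a::euclidean_space \<Rightarrow> ('a \<Rightarrow> complex) \<Rightarrow> bool" where
  "K_atom d K j m a \<longleftrightarrow>
     C_class K a \<and>
     closure {x. a x \<noteq> 0} \<subseteq> dcube d j m \<and>
     (\<forall>bs x. set bs \<subseteq> Basis \<and> length bs \<le> K \<longrightarrow> norm (iter_partial bs a x) \<le> 2 ^ (length bs * j))"

definition K_atomic_repr ::
  "real \<Rightarrow> nat \<Rightarrow> ennreal \<Rightarrow> 'a::euclidean_space set \<Rightarrow> ('a \<Rightarrow> complex) \<Rightarrow>
   (nat \<Rightarrow> 'a \<Rightarrow> complex) \<Rightarrow> (nat \<Rightarrow> 'a \<Rightarrow> 'a \<Rightarrow> complex) \<Rightarrow> bool" where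
  "K_atomic_repr d K p S f lam a \<longleftrightarrow>
     (\<forall>j. \<forall>m\<in>cube_indices S j. K_atom d K j m (a j m)) \<and>
     atomic_series_Lp (lebesgue_on S) p S lam a f"

definition besov_space ::
  "real \<Rightarrow> nat \<Rightarrow> real \<Rightarrow> ennreal \<Rightarrow> ennreal \<Rightarrow> 'a::euclidean_space set \<Rightarrow> ('a \<Rightarrow> complex) set" where
  "besov_space d K s p q S =
     {f \<in> Lp_space (lebesgue_on S) p.
        \<exists>lam a. K_atomic_repr d K p S f lam a \<and> b_qnorm DIM('a) s p q S lam < \<infinity>}"

definition besov_qnorm ::
  "real \<Rightarrow> nat \<Rightarrow> real \<Rightarrow> ennreal \<Rightarrow> ennreal \<Rightarrow> 'a::euclidean_space set \<Rightarrow>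
   ('a \<Rightarrow> complex) \<Rightarrow> ennreal" where
  "besov_qnorm d K s p q S f =
     (INF (lam, a) \<in> {(lam, a). K_atomic_repr d K p S f lam a}. b_qnorm DIM('a) s p q S lam)"

section \<open>Surface measure\<close>

text \<open>The Hausdorff measure, normalised to agree with Lebesgue measure in integer dimensions.\<close>

definition hausdorff_premeasure :: "nat \<Rightarrow> real \<Rightarrow> 'a::metric_space set \<Rightarrow> ennreal" where
  "hausdorff_premeasure k \<delta> A =
     (INF U \<in> {U :: nat \<Rightarrow> 'a set.
                A \<subseteq> (\<Union>i. U i) \<and> (\<forall>i. bounded (U i) \<and> diameter (U i) \<le> \<delta>)}.
        \<Sum>i. if U i = {} then 0
             else ennreal (unit_ball_vol (real k) * (diameter (U i) / 2) ^ k))"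

definition hausdorff_outer :: "nat \<Rightarrow> 'a::metric_space set \<Rightarrow> ennreal" where
  "hausdorff_outer k A = (SUP \<delta>\<in>{0<..}. hausdorff_premeasure k \<delta> A)"

text \<open>\<open>hausdorff_outer k\<close> is a metric outer measure, hence countably additive on Borel sets.\<close>

definition hausdorff_measure :: "nat \<Rightarrow> 'a::metric_space measure" where
  "hausdorff_measure k = measure_of UNIV (sets borel) (hausdorff_outer k)"

text \<open>Completed, in accordance with the use of Lebesgue measure for open sets.\<close>

definition surface_measure :: "'a::euclidean_space set \<Rightarrow> 'a measure" where
  "surface_measure \<Gamma> = completion (restrict_space (hausdorff_measure (DIM('a) - 1)) \<Gamma>)"

section \<open>Lipschitz domains\<close>

text \<open>Euclidean \<open>n\<close>-space is a product \<open>'b \<times> real\<close>, where \<open>'b\<close> has dimension \<open>n - 1 \<ge> 1\<close> and \<open>snd\<close>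
  is the last coordinate.\<close>

definition lipschitz_diffeo :: "('a::euclidean_space \<Rightarrow> 'a) \<Rightarrow> bool" where
  "lipschitz_diffeo \<Phi> \<longleftrightarrow>
     bij \<Phi> \<and>
     (\<forall>b\<in>Basis. \<exists>L. L-lipschitz_on UNIV (\<lambda>x. \<Phi> x \<bullet> b)) \<and>
     (\<exists>c C. 0 < c \<and> 0 < C \<and>
        (\<forall>x y. dist x y \<le> 1 \<longrightarrow>
           c * dist x y \<le> dist (\<Phi> x) (\<Phi> y) \<and> dist (\<Phi> x) (\<Phi> y) \<le> C * dist x y))"

text \<open>Only the sets \<open>U 1, ..., U N\<close> matter here; \<open>U 0\<close> is reserved for the inner domain below.\<close>

definition lipschitz_atlas ::
  "('b::euclidean_space \<times> real) set \<Rightarrow> nat \<Rightarrow> (nat \<Rightarrow> ('b \<times> real) set) \<Rightarrow>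
   (nat \<Rightarrow> 'b \<times> real \<Rightarrow> 'b \<times> real) \<Rightarrow> bool" where
  "lipschitz_atlas \<Omega> N U \<psi> \<longleftrightarrow>
     frontier \<Omega> \<subseteq> (\<Union>i\<in>{1..N}. U i) \<and>
     (\<forall>i\<in>{1..N}.
        (\<exists>c r. 0 < r \<and> U i = ball c r) \<and>
        U i \<inter> frontier \<Omega> \<noteq> {} \<and>
        lipschitz_diffeo (\<psi> i) \<and>
        \<psi> i ` (U i \<inter> \<Omega>) \<subseteq> {x. snd x > 0} \<and>
        \<psi> i ` (U i \<inter> frontier \<Omega>) \<subseteq> {x. snd x = 0})"

text \<open>A domain is a nonempty open set; connectedness is not required.\<close>

definition bounded_lipschitz_domain :: "('b::euclidean_space \<times> real) set \<Rightarrow> bool" where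
  "bounded_lipschitz_domain \<Omega> \<longleftrightarrow>
     open \<Omega> \<and> \<Omega> \<noteq> {} \<and> bounded \<Omega> \<and> (\<exists>N U \<psi>. lipschitz_atlas \<Omega> N U \<psi>)"

definition subordinate_partition ::
  "'a::euclidean_space set \<Rightarrow> nat \<Rightarrow> (nat \<Rightarrow> 'a set) \<Rightarrow> (nat \<Rightarrow> 'a \<Rightarrow> real) \<Rightarrow> bool" where
  "subordinate_partition \<Omega> N U \<phi> \<longleftrightarrow>
     open (U 0) \<and> closure (U 0) \<subseteq> \<Omega> \<and> \<Omega> \<subseteq> (\<Union>i\<le>N. U i) \<and>
     (\<forall>i\<le>N. (\<forall>K. C_class K (\<phi> i)) \<and> (\<forall>x. 0 \<le> \<phi> i x) \<and> closure {x. \<phi> i x \<noteq> 0} \<subseteq> U i) \<and>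
     (\<forall>x\<in>closure \<Omega>. (\<Sum>i\<le>N. \<phi> i x) = 1)"

section \<open>Besov spaces on the boundary\<close>

definition chart_image ::
  "('b \<times> real) set \<Rightarrow> ('b \<times> real) set \<Rightarrow> ('b \<times> real \<Rightarrow> 'b \<times> real) \<Rightarrow> 'b set" where
  "chart_image \<Gamma> V \<psi> = {y. (y, 0) \<in> \<psi> ` (\<Gamma> \<inter> V)}"

definition local_piece ::
  "('b \<times> real \<Rightarrow> real) \<Rightarrow> ('b \<times> real \<Rightarrow> 'b \<times> real) \<Rightarrow> ('b \<times> real \<Rightarrow> complex) \<Rightarrow> 'b \<Rightarrow> complex" where
  "local_piece \<phi> \<psi> f = (\<lambda>y. of_real (\<phi> (inv \<psi> (y, 0))) * f (inv \<psi> (y, 0)))"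

definition besov_space_bd ::
  "real \<Rightarrow> nat \<Rightarrow> real \<Rightarrow> ennreal \<Rightarrow> ennreal \<Rightarrow> ('b::euclidean_space \<times> real) set \<Rightarrow> nat \<Rightarrow>
   (nat \<Rightarrow> ('b \<times> real) set) \<Rightarrow> (nat \<Rightarrow> 'b \<times> real \<Rightarrow> 'b \<times> real) \<Rightarrow> (nat \<Rightarrow> 'b \<times> real \<Rightarrow> real) \<Rightarrow>
   ('b \<times> real \<Rightarrow> complex) set" where
  "besov_space_bd d K s p q \<Gamma> N U \<psi> \<phi> =
     {f \<in> Lp_space (surface_measure \<Gamma>) p.
        \<forall>i\<in>{1..N}. local_piece (\<phi> i) (\<psi> i) f \<in> besov_space d K s p q (chart_image \<Gamma> (U i) (\<psi> i))}"

definition besov_qnorm_bd ::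
  "real \<Rightarrow> nat \<Rightarrow> real \<Rightarrow> ennreal \<Rightarrow> ennreal \<Rightarrow> ('b::euclidean_space \<times> real) set \<Rightarrow> nat \<Rightarrow>
   (nat \<Rightarrow> ('b \<times> real) set) \<Rightarrow> (nat \<Rightarrow> 'b \<times> real \<Rightarrow> 'b \<times> real) \<Rightarrow> (nat \<Rightarrow> 'b \<times> real \<Rightarrow> real) \<Rightarrow>
   ('b \<times> real \<Rightarrow> complex) \<Rightarrow> ennreal" where
  "besov_qnorm_bd d K s p q \<Gamma> N U \<psi> \<phi> f =
     (\<Sum>i=1..N. besov_qnorm d K s p q (chart_image \<Gamma> (U i) (\<psi> i)) (local_piece (\<phi> i) (\<psi> i) f))"

section \<open>Lipschitz atoms on the boundary\<close>

text \<open>Only the values of \<open>a\<close> on \<open>\<Gamma>\<close> matter. As \<open>\<Gamma>\<close> is closed in all uses, the closure below is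
  the support of \<open>a\<close> relative to \<open>\<Gamma>\<close>.\<close>

definition Lip_atom ::
  "real \<Rightarrow> nat \<Rightarrow> 'a::euclidean_space \<Rightarrow> 'a set \<Rightarrow> ('a \<Rightarrow> complex) \<Rightarrow> bool" where
  "Lip_atom d j m \<Gamma> a \<longleftrightarrow>
     closure {x\<in>\<Gamma>. a x \<noteq> 0} \<subseteq> dcube d j m \<inter> \<Gamma> \<and>
     Lp_qnorm (surface_measure \<Gamma>) \<infinity> (\<lambda>x. ennreal (norm (a x))) \<le> 1 \<and>
     (2 ^ j)-lipschitz_on \<Gamma> a"

definition Lip_atomic_repr ::
  "real \<Rightarrow> ennreal \<Rightarrow> 'a::euclidean_space set \<Rightarrow> ('a \<Rightarrow> complex) \<Rightarrow>
   (nat \<Rightarrow> 'a \<Rightarrow> complex) \<Rightarrow> (nat \<Rightarrow> 'a \<Rightarrow> 'a \<Rightarrow> complex) \<Rightarrow> bool" where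
  "Lip_atomic_repr d p \<Gamma> f lam a \<longleftrightarrow>
     (\<forall>j. \<forall>m\<in>cube_indices \<Gamma> j. Lip_atom d j m \<Gamma> (a j m)) \<and>
     atomic_series_Lp (surface_measure \<Gamma>) p \<Gamma> lam a f"

definition b_qnorm_bd ::
  "real \<Rightarrow> ennreal \<Rightarrow> ennreal \<Rightarrow> 'a::euclidean_space set \<Rightarrow> (nat \<Rightarrow> 'a \<Rightarrow> complex) \<Rightarrow> ennreal" where
  "b_qnorm_bd s p q \<Gamma> = b_qnorm (DIM('a) - 1) s p q \<Gamma>"

definition Lip_atomic_qnorm ::
  "real \<Rightarrow> real \<Rightarrow> ennreal \<Rightarrow> ennreal \<Rightarrow> 'a::euclidean_space set \<Rightarrow> ('a \<Rightarrow> complex) \<Rightarrow> ennreal" where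
  "Lip_atomic_qnorm d s p q \<Gamma> f =
     (INF (lam, a) \<in> {(lam, a). Lip_atomic_repr d p \<Gamma> f lam a}. b_qnorm_bd s p q \<Gamma> lam)"

end

theory Submission
  imports Defs
begin

text \<open>
  In each chart the boundary is a bi-Lipschitz copy of a bounded open set \<open>W\<close> of dimension \<open>n - 1\<close>,
  so the theorem compares series of Lipschitz building blocks with series of smooth atoms on \<open>W\<close>. A
  Lipschitz block of level \<open>j\<close> varies by at most a multiple of \<open>2\<^sup>j\<^sup>-\<^sup>l\<close> over a cube of level \<open>l \<ge> j\<close>. This
  gain of one order of smoothness is the reason for the assumption \<open>s < 1\<close>; the assumption \<open>s > 0\<close>
  makes the approximations below converge in \<open>L\<^sub>p\<close>.

  A Lipschitz atom that is multiplied by a function of the partition of unity and read in the chart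
  becomes a Lipschitz function with compact support in \<open>W\<close> (\<open>besov_of_Lip_atoms\<close>). Sampling the partial
  sum up to level \<open>l\<close> at the lattice points of level \<open>l\<close>, and interpolating with a smooth partition of
  unity of the same scale, produces smooth functions that converge to the same limit. Their successive
  differences, localised to cubes, are multiples of smooth atoms, and the coefficients are sums over
  \<open>j \<le> l\<close> of \<open>2\<^sup>j\<^sup>-\<^sup>l\<close> times the coefficients of neighbouring cubes of level \<open>j\<close>
  (\<open>smooth_atoms_of_lipschitz_blocks\<close>). Such sums are bounded on the sequence spaces because \<open>s < 1\<close>
  (\<open>sequence_norm_refinement\<close>).

  Conversely, a smooth atom composed with the chart and multiplied by a cutoff function is Lipschitz
  at the right scale. A partition of unity on the lattice of the ambient
  space redistributes it to the cubes that meet the boundary (\<open>Lip_atoms_of_smooth_atoms\<close>), and the local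
  pieces \<open>\<phi>\<^sub>i f\<close> add up to \<open>f\<close> on the boundary.

  Convergence in \<open>L\<^sub>p\<close> passes between the boundary and \<open>W\<close> because a bi-Lipschitz
  chart makes surface measure and Lebesgue measure comparable (\<open>surface_measure_comparable\<close>). This
  needs Caratheodory's criterion, by which Hausdorff measure is a measure on the Borel sets, and
  covering arguments for both inequalities.

  For exponents below 1 there is no triangle inequality, and for exponents above 1 there is no
  subadditivity of powers. All exponents are treated alike by giving away a geometric factor and
  estimating sums by weighted suprema (\<open>Lp_qnorm_suminf_le\<close>), or sums of boundedly many terms by
  their maximum (\<open>Lp_qnorm_neighbour_sum_le\<close>).

  The quasi-norm axioms are direct, except that a vanishing quasi-norm forces the function to vanish.
  This follows from the embedding of the local spaces into \<open>L\<^sub>p\<close> (\<open>Lp_qnorm_le_b_qnorm\<close>).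
\<close>

section \<open>Quasi-norms of Lebesgue and sequence spaces\<close>

lemma ennpowr_ennreal: "0 \<le> x \<Longrightarrow> ennpowr (ennreal x) r = ennreal (x powr r)"
  by (simp add: ennpowr_def)

lemma ennpowr_zero [simp]: "ennpowr 0 r = 0"
  by (simp add: ennpowr_def)

lemma ennpowr_top [simp]: "ennpowr top r = top"
  by (simp add: ennpowr_def)

lemma ennpowr_mono: "0 \<le> r \<Longrightarrow> x \<le> y \<Longrightarrow> ennpowr x r \<le> ennpowr y r"
  by (cases x; cases y) (auto simp: ennpowr_ennreal powr_mono2 top_unique)

lemma ennpowr_ennpowr: "ennpowr (ennpowr x a) b = ennpowr x (a * b)"
  by (cases x) (auto simp: ennpowr_ennreal powr_powr)

lemma ennpowr_one [simp]: "ennpowr x 1 = x"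
  by (cases x) (auto simp: ennpowr_ennreal)

lemma ennpowr_mult: "ennpowr (x * y) r = ennpowr x r * ennpowr y r"
  by (cases x; cases y)
    (auto simp: ennpowr_ennreal powr_mult ennreal_mult[symmetric] ennreal_mult_top ennreal_top_mult)

lemma ennpowr_le_iff: "0 < r \<Longrightarrow> ennpowr x r \<le> y \<longleftrightarrow> x \<le> ennpowr y (1 / r)"
  using ennpowr_mono[of r x "ennpowr y (1 / r)"] ennpowr_mono[of "1 / r" "ennpowr x r" y]
  by (auto simp: ennpowr_ennpowr)

lemma ennpowr_le_cancel: "0 < r \<Longrightarrow> ennpowr x r \<le> ennpowr y r \<longleftrightarrow> x \<le> y"
  by (simp add: ennpowr_le_iff ennpowr_ennpowr)

lemma ennpowr_eq_0_iff [simp]: "ennpowr x r = 0 \<longleftrightarrow> x = 0"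
  by (cases x) (auto simp: ennpowr_ennreal ennreal_eq_0_iff[of "_ powr _"] simp flip: less_eq_real_def)

lemma ennpowr_SUP:
  assumes "0 < r"
  shows "ennpowr (SUP i\<in>I. u i) r = (SUP i\<in>I. ennpowr (u i) r)"
proof (rule antisym)
  show "ennpowr (SUP i\<in>I. u i) r \<le> (SUP i\<in>I. ennpowr (u i) r)"
    unfolding ennpowr_le_iff[OF assms]
    by (rule SUP_least, subst ennpowr_le_iff[OF assms, symmetric]) (rule SUP_upper)
  show "(SUP i\<in>I. ennpowr (u i) r) \<le> ennpowr (SUP i\<in>I. u i) r"
    using assms by (intro SUP_least ennpowr_mono SUP_upper) auto
qed

lemma borel_measurable_ennpowr [measurable (raw)]:
  assumes [measurable]: "f \<in> borel_measurable M"
  shows "(\<lambda>x. ennpowr (f x) r) \<in> borel_measurable M"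
  unfolding ennpowr_def by measurable

lemma Lp_qnorm_le_iff_finite:
  assumes "0 < p" "p < \<infinity>"
  shows "Lp_qnorm M p g \<le> z \<longleftrightarrow>
    (\<integral>\<^sup>+ x. ennpowr (g x) (enn2real p) \<partial>M) \<le> ennpowr z (enn2real p)"
proof -
  have "0 < enn2real p"
    using assms by (simp add: enn2real_positive_iff)
  then show ?thesis
    using assms by (auto simp: Lp_qnorm_def ennpowr_le_iff)
qed

lemma Lp_qnorm_le_iff_infinite:
  assumes "g \<in> borel_measurable M"
  shows "Lp_qnorm M \<infinity> g \<le> z \<longleftrightarrow> (AE x in M. g x \<le> z)"
  using esssup_AE[of g M] esssup_I[OF assms, of z]
  by (auto simp: Lp_qnorm_def elim!: eventually_mono intro: order_trans)

lemma Lp_qnorm_powr: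
  assumes "0 < p" "p < \<infinity>"
  shows "(\<integral>\<^sup>+ x. ennpowr (g x) (enn2real p) \<partial>M) = ennpowr (Lp_qnorm M p g) (enn2real p)"
proof -
  have "0 < enn2real p"
    using assms by (simp add: enn2real_positive_iff)
  then show ?thesis
    using assms by (auto simp: Lp_qnorm_def ennpowr_ennpowr)
qed

lemma Lp_qnorm_cases [case_names finite infinite]:
  assumes "0 < p"
  obtains r where "0 < r" "p = ennreal r" "p < \<infinity>" "enn2real p = r"
      "enn2real (inverse p) = 1 / r"
  | "p = \<infinity>" "enn2real (inverse p) = 0"
proof (cases p)
  case (real r)
  then have r: "0 < r" using assms by (cases "r = 0") auto
  have "enn2real (inverse p) = 1 / r"
    using real r by (simp add: inverse_ennreal divide_inverse)
  then show ?thesis using that(1)[of r] real r by auto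
next
  case top
  then show ?thesis using that(2) by simp
qed

lemma Lp_qnorm_mono_AE:
  assumes "0 < p" "f \<in> borel_measurable M" "g \<in> borel_measurable M" "AE x in M. f x \<le> g x"
  shows "Lp_qnorm M p f \<le> Lp_qnorm M p g"
  using assms(1)
proof (cases rule: Lp_qnorm_cases)
  case (finite r)
  have "AE x in M. ennpowr (f x) r \<le> ennpowr (g x) r"
    using assms(4) by eventually_elim (use finite in \<open>auto intro: ennpowr_mono\<close>)
  then show ?thesis
    using finite unfolding Lp_qnorm_le_iff_finite[OF assms(1) finite(3)]
      Lp_qnorm_powr[OF assms(1) finite(3), symmetric]
    by (auto intro: nn_integral_mono_AE)
next
  case infinite
  then show ?thesis
    using assms by (simp add: Lp_qnorm_def esssup_AE_mono)
qed

lemma Lp_qnorm_mono: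
  assumes "0 < p" "f \<in> borel_measurable M" "g \<in> borel_measurable M"
    and "\<And>x. x \<in> space M \<Longrightarrow> f x \<le> g x"
  shows "Lp_qnorm M p f \<le> Lp_qnorm M p g"
  using assms by (intro Lp_qnorm_mono_AE) auto

lemma Lp_qnorm_cong_AE:
  assumes "0 < p" "f \<in> borel_measurable M" "g \<in> borel_measurable M" "AE x in M. f x = g x"
  shows "Lp_qnorm M p f = Lp_qnorm M p g"
  using assms(4) by (intro antisym Lp_qnorm_mono_AE assms) (auto elim: eventually_mono)

lemma Lp_qnorm_cong:
  assumes "\<And>x. x \<in> space M \<Longrightarrow> f x = g x"
  shows "Lp_qnorm M p f = Lp_qnorm M p g"
proof -
  have "f \<in> borel_measurable M \<longleftrightarrow> g \<in> borel_measurable M"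
    using assms by (rule measurable_cong)
  moreover have "AE x in M. f x = g x" using assms by auto
  ultimately have "esssup M f = esssup M g"
    by (cases "f \<in> borel_measurable M") (auto simp: esssup_non_measurable intro: esssup_AE_cong)
  then show ?thesis
    using assms by (auto simp: Lp_qnorm_def intro!: arg_cong[where f="\<lambda>x. ennpowr x _"] nn_integral_cong)
qed

lemma Lp_qnorm_eq_0_iff:
  assumes "0 < p" "f \<in> borel_measurable M"
  shows "Lp_qnorm M p f = 0 \<longleftrightarrow> (AE x in M. f x = 0)"
  using assms(1)
proof (cases rule: Lp_qnorm_cases)
  case (finite r)
  then show ?thesis
    using Lp_qnorm_le_iff_finite[OF assms(1) finite(3), of M f 0] assms(2)
    by (simp add: nn_integral_0_iff_AE)
next
  case infinite
  then show ?thesis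
    using Lp_qnorm_le_iff_infinite[OF assms(2), of 0] by simp
qed

lemma Lp_qnorm_cmult_le:
  assumes "0 < p" "f \<in> borel_measurable M"
  shows "Lp_qnorm M p (\<lambda>x. c * f x) \<le> c * Lp_qnorm M p f"
  using assms(1)
proof (cases rule: Lp_qnorm_cases)
  case (finite r)
  have "(\<integral>\<^sup>+ x. ennpowr (c * f x) r \<partial>M) = ennpowr c r * (\<integral>\<^sup>+ x. ennpowr (f x) r \<partial>M)"
    using assms(2) by (simp add: ennpowr_mult nn_integral_cmult borel_measurable_ennpowr)
  then show ?thesis
    using finite Lp_qnorm_powr[OF assms(1) finite(3), where g=f and M=M]
    unfolding Lp_qnorm_le_iff_finite[OF assms(1) finite(3)] finite(4) ennpowr_mult by simp
next
  case infinite
  have "AE x in M. f x \<le> Lp_qnorm M p f"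
    using infinite Lp_qnorm_le_iff_infinite[OF assms(2)] by auto
  then have "AE x in M. c * f x \<le> c * Lp_qnorm M p f"
    by eventually_elim (rule mult_left_mono, auto)
  then show ?thesis
    using infinite Lp_qnorm_le_iff_infinite[of "\<lambda>x. c * f x" M] assms by auto
qed

lemma le_suminf_ennreal: "f i \<le> (\<Sum>i. f i)" for f :: "nat \<Rightarrow> ennreal"
  using sum_le_suminf[of f "{i}"] by simp

lemma SUP_le_suminf_ennreal: "(SUP i. f i) \<le> (\<Sum>i. f i)" for f :: "nat \<Rightarrow> ennreal"
  by (rule SUP_least) (rule le_suminf_ennreal)

lemma suminf_two_powr:
  assumes "0 < a"
  shows "(\<Sum>i. ennreal (2 powr (- (a * real i)))) = ennreal (1 / (1 - 2 powr (- a)))"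
    and "0 < 1 / (1 - (2::real) powr (- a))"
proof -
  have 1: "(2::real) powr (- a) < 1"
    using assms by (simp add: powr_minus_divide)
  have "2 powr (- (a * real i)) = (2 powr (- a)) ^ i" for i
    by (simp add: powr_powr flip: powr_realpow)
  moreover have "(\<lambda>i. ((2::real) powr (- a)) ^ i) sums (1 / (1 - 2 powr (- a)))"
    by (rule geometric_sums) (use 1 in auto)
  ultimately show "(\<Sum>i. ennreal (2 powr (- (a * real i)))) = ennreal (1 / (1 - 2 powr (- a)))"
    by (subst suminf_ennreal_eq) auto
  show "0 < 1 / (1 - (2::real) powr (- a))" using 1 by simp
qed

lemma le_two_powr_SUP:
  fixes u :: "nat \<Rightarrow> ennreal"
  shows "u i \<le> ennreal (2 powr (- (a * real i))) * (SUP i. ennreal (2 powr (a * real i)) * u i)"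
proof -
  have "u i = ennreal (2 powr (- (a * real i))) * (ennreal (2 powr (a * real i)) * u i)"
    by (simp add: mult.assoc[symmetric] ennreal_mult[symmetric] powr_add[symmetric])
  also have "\<dots> \<le> ennreal (2 powr (- (a * real i))) * (SUP i. ennreal (2 powr (a * real i)) * u i)"
    by (intro mult_left_mono SUP_upper) auto
  finally show ?thesis .
qed

lemma suminf_le_two_powr_SUP:
  fixes u :: "nat \<Rightarrow> ennreal"
  assumes "0 < a"
  shows "(\<Sum>i. u i) \<le> ennreal (1 / (1 - 2 powr (- a))) * (SUP i. ennreal (2 powr (a * real i)) * u i)"
proof -
  have "(\<Sum>i. u i) \<le>
      (\<Sum>i. ennreal (2 powr (- (a * real i))) * (SUP i. ennreal (2 powr (a * real i)) * u i))"
    by (intro suminf_le le_two_powr_SUP) auto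
  then show ?thesis unfolding ennreal_suminf_multc suminf_two_powr(1)[OF assms] .
qed

text \<open>This replaces Minkowski's inequality. Giving away a geometric factor, a sum is bounded by a
  weighted supremum, and the \<open>p\<close>-th power of a supremum is at most the sum of the \<open>p\<close>-th powers;
  so one argument covers all exponents, below 1 as well as above.\<close>

lemma Lp_qnorm_suminf_le:
  assumes "0 < p" "0 < e"
  shows "\<exists>C::real. 0 < C \<and> (\<forall>(M::'a measure) u. (\<forall>i. u i \<in> borel_measurable M) \<longrightarrow>
    Lp_qnorm M p (\<lambda>x. \<Sum>i. u i x) \<le>
      ennreal C * (SUP i. ennreal (2 powr (e * real i)) * Lp_qnorm M p (u i)))"
  using assms(1)
proof (cases rule: Lp_qnorm_cases)
  case (finite r)
  define A where "A = 1 / (1 - (2::real) powr (- (e / 2)))"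
  define B where "B = 1 / (1 - (2::real) powr (- (e * r / 2)))"
  have AB: "0 < A" "0 < B"
    using suminf_two_powr(2)[of "e / 2"] suminf_two_powr(2)[of "e * r / 2"] assms finite
    by (auto simp: A_def B_def)
  show ?thesis
  proof (intro exI[of _ "A * B powr (1 / r)"] conjI allI impI)
    show "0 < A * B powr (1 / r)" using AB by simp
    fix M :: "'a measure" and u :: "nat \<Rightarrow> 'a \<Rightarrow> ennreal"
    assume "\<forall>i. u i \<in> borel_measurable M"
    then have [measurable]: "\<And>i. u i \<in> borel_measurable M" by auto
    define S where "S = (SUP i. ennreal (2 powr (e * real i)) * Lp_qnorm M p (u i))"
    \<comment> \<open>Half of the exponent \<open>e\<close> is spent on the pointwise supremum, half on the sum of the integrals.\<close>
    let ?w = "\<lambda>i. ennreal (2 powr (e / 2 * real i))"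
    have pointwise: "ennpowr (\<Sum>i. u i x) r \<le> ennpowr A r * (\<Sum>i. ennpowr (?w i) r * ennpowr (u i x) r)"
      for x
    proof -
      have "ennpowr (\<Sum>i. u i x) r \<le> ennpowr (ennreal A * (SUP i. ?w i * u i x)) r"
        unfolding A_def using suminf_le_two_powr_SUP[of "e / 2" "\<lambda>i. u i x"] assms finite
        by (intro ennpowr_mono) auto
      also have "\<dots> = ennpowr A r * (SUP i. ennpowr (?w i) r * ennpowr (u i x) r)"
        using finite by (simp add: ennpowr_mult ennpowr_SUP)
      also have "\<dots> \<le> ennpowr A r * (\<Sum>i. ennpowr (?w i) r * ennpowr (u i x) r)"
        by (rule mult_left_mono[OF SUP_le_suminf_ennreal]) simp
      finally show ?thesis .
    qed
    have level: "ennpowr (?w i) r * ennpowr (Lp_qnorm M p (u i)) r \<le>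
        ennreal (2 powr (- (e * r / 2 * real i))) * ennpowr S r" for i
    proof -
      have "ennpowr (?w i) r * ennpowr (Lp_qnorm M p (u i)) r \<le>
        ennpowr (?w i) r * ennpowr (ennreal (2 powr (- (e * real i))) * S) r"
        unfolding S_def using finite
        by (intro mult_left_mono ennpowr_mono le_two_powr_SUP[of "\<lambda>i. Lp_qnorm M p (u i)"]) auto
      also have "\<dots> = ennreal (2 powr (e / 2 * real i * r) * 2 powr (- (e * real i) * r)) * ennpowr S r"
        by (simp add: ennpowr_mult ennpowr_ennreal powr_powr ennreal_mult mult.assoc)
      also have "2 powr (e / 2 * real i * r) * 2 powr (- (e * real i) * r) =
          2 powr (- (e * r / 2 * real i))"
        by (simp add: powr_add[symmetric] mult_ac)
      finally show ?thesis .
    qed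
    have "(\<integral>\<^sup>+ x. ennpowr (\<Sum>i. u i x) r \<partial>M) \<le>
        (\<integral>\<^sup>+ x. ennpowr A r * (\<Sum>i. ennpowr (?w i) r * ennpowr (u i x) r) \<partial>M)"
      by (intro nn_integral_mono pointwise)
    also have "\<dots> = ennpowr A r * (\<Sum>i. ennpowr (?w i) r * (\<integral>\<^sup>+ x. ennpowr (u i x) r \<partial>M))"
      by (simp add: nn_integral_cmult nn_integral_suminf)
    also have "\<dots> = ennpowr A r * (\<Sum>i. ennpowr (?w i) r * ennpowr (Lp_qnorm M p (u i)) r)"
      by (simp only: Lp_qnorm_powr[OF assms(1) finite(3), unfolded finite(4)])
    also have "\<dots> \<le> ennpowr A r * (\<Sum>i. ennreal (2 powr (- (e * r / 2 * real i))) * ennpowr S r)"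
      by (intro mult_left_mono suminf_le level) auto
    also have "\<dots> = ennpowr A r * (ennreal B * ennpowr S r)"
    proof -
      have "0 < e * r / 2" using assms finite by simp
      then show ?thesis unfolding ennreal_suminf_multc B_def by (simp only: suminf_two_powr(1))
    qed
    also have "\<dots> = ennpowr (ennreal (A * B powr (1 / r)) * S) r"
      using AB finite
      by (simp add: ennpowr_mult ennpowr_ennreal powr_mult powr_powr ennreal_mult mult.assoc)
    finally show "Lp_qnorm M p (\<lambda>x. \<Sum>i. u i x) \<le> ennreal (A * B powr (1 / r)) *
        (SUP i. ennreal (2 powr (e * real i)) * Lp_qnorm M p (u i))"
      unfolding Lp_qnorm_le_iff_finite[OF assms(1) finite(3)] finite(4) S_def .
  qed
next
  case infinite
  define A where "A = 1 / (1 - (2::real) powr (- e))"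
  show ?thesis
  proof (intro exI[of _ A] conjI allI impI)
    show "0 < A" using suminf_two_powr(2)[OF assms(2)] by (simp add: A_def)
    fix M :: "'a measure" and u :: "nat \<Rightarrow> 'a \<Rightarrow> ennreal"
    assume "\<forall>i. u i \<in> borel_measurable M"
    then have [measurable]: "\<And>i. u i \<in> borel_measurable M" by auto
    have "AE x in M. \<forall>i. u i x \<le> Lp_qnorm M \<infinity> (u i)"
      unfolding AE_all_countable by (intro allI Lp_qnorm_le_iff_infinite[THEN iffD1]) auto
    then have "AE x in M. (\<Sum>i. u i x) \<le>
        ennreal A * (SUP i. ennreal (2 powr (e * real i)) * Lp_qnorm M \<infinity> (u i))"
    proof eventually_elim
      case (elim x)
      have "(\<Sum>i. u i x) \<le> ennreal A * (SUP i. ennreal (2 powr (e * real i)) * u i x)"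
        unfolding A_def by (rule suminf_le_two_powr_SUP[OF assms(2)])
      also have "\<dots> \<le> ennreal A * (SUP i. ennreal (2 powr (e * real i)) * Lp_qnorm M \<infinity> (u i))"
        using elim by (intro mult_left_mono SUP_mono') auto
      finally show ?case .
    qed
    moreover have "(\<lambda>x. \<Sum>i. u i x) \<in> borel_measurable M" by measurable
    ultimately show "Lp_qnorm M p (\<lambda>x. \<Sum>i. u i x) \<le>
        ennreal A * (SUP i. ennreal (2 powr (e * real i)) * Lp_qnorm M p (u i))"
      unfolding infinite(1) by (rule Lp_qnorm_le_iff_infinite[THEN iffD2, rotated])
  qed
qed

lemma Lp_qnorm_add_le:
  assumes "0 < p"
  shows "\<exists>C::real. 0 < C \<and> (\<forall>(M::'a measure) f g.
    f \<in> borel_measurable M \<longrightarrow> g \<in> borel_measurable M \<longrightarrow>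
    Lp_qnorm M p (\<lambda>x. f x + g x) \<le> ennreal C * (Lp_qnorm M p f + Lp_qnorm M p g))"
proof -
  obtain C :: real where "0 < C" and C: "\<forall>(M::'a measure) u. (\<forall>i. u i \<in> borel_measurable M) \<longrightarrow>
    Lp_qnorm M p (\<lambda>x. \<Sum>i. u i x) \<le>
      ennreal C * (SUP i. ennreal (2 powr (1 * real i)) * Lp_qnorm M p (u i))"
    using Lp_qnorm_suminf_le[OF assms zero_less_one, where 'a='a] by (elim exE conjE) (rule that)
  show ?thesis
  proof (intro exI[of _ "C * 2"] conjI allI impI)
    show "0 < C * 2" using \<open>0 < C\<close> by simp
    fix M :: "'a measure" and f g :: "'a \<Rightarrow> ennreal"
    assume f: "f \<in> borel_measurable M" and g: "g \<in> borel_measurable M"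
    define u where "u = (\<lambda>i::nat. if i = 0 then f else if i = 1 then g else (\<lambda>x. 0))"
    have u0: "u i = (\<lambda>x. 0)" if "i \<notin> {0, 1}" for i using that by (auto simp: u_def)
    have "(\<Sum>i. u i x) = (\<Sum>i\<in>{0, 1}. u i x)" for x
      by (rule suminf_finite) (auto simp: u_def)
    then have sum: "(\<Sum>i. u i x) = f x + g x" for x by (simp add: u_def)
    have zero: "Lp_qnorm M p (\<lambda>x. 0) = 0" using assms by (simp add: Lp_qnorm_eq_0_iff)
    have "Lp_qnorm M p (\<lambda>x. \<Sum>i. u i x) \<le>
      ennreal C * (SUP i. ennreal (2 powr (1 * real i)) * Lp_qnorm M p (u i))"
      by (rule C[rule_format]) (auto simp: u_def f g)
    also have "\<dots> \<le> ennreal C * (2 * (Lp_qnorm M p f + Lp_qnorm M p g))"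
    proof (intro mult_left_mono SUP_least)
      fix i :: nat
      show "ennreal (2 powr (1 * real i)) * Lp_qnorm M p (u i) \<le> 2 * (Lp_qnorm M p f + Lp_qnorm M p g)"
      proof (cases "i \<in> {0, 1}")
        case True
        then consider "i = 0" | "i = 1" by auto
        then show ?thesis
        proof cases
          case 1
          have "1 * Lp_qnorm M p f \<le> 2 * (Lp_qnorm M p f + Lp_qnorm M p g)"
            by (intro mult_mono) auto
          then show ?thesis using 1 by (simp add: u_def)
        next
          case 2
          then show ?thesis by (auto simp: u_def intro!: mult_left_mono)
        qed
      qed (simp add: u0 zero)
    qed auto
    finally show "Lp_qnorm M p (\<lambda>x. f x + g x) \<le> ennreal (C * 2) * (Lp_qnorm M p f + Lp_qnorm M p g)"
      using \<open>0 < C\<close> by (simp add: sum ennreal_mult mult.assoc)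
  qed
qed

lemma Lp_qnorm_count_space_le_infinite:
  "Lp_qnorm (count_space I) \<infinity> g \<le> z \<longleftrightarrow> (\<forall>m\<in>I. g m \<le> z)"
  by (subst Lp_qnorm_le_iff_infinite) (auto simp: AE_count_space)

lemma le_Lp_qnorm_count_space:
  assumes "0 < p" "m \<in> I"
  shows "g m \<le> Lp_qnorm (count_space I) p g"
  using assms(1)
proof (cases rule: Lp_qnorm_cases)
  case (finite r)
  have "ennpowr (g m) r \<le> (\<integral>\<^sup>+ i. ennpowr (g i) r \<partial>count_space I)"
    using nn_integral_ge_point[OF assms(2), of "\<lambda>i. ennpowr (g i) r"] .
  also have "\<dots> = ennpowr (Lp_qnorm (count_space I) p g) r"
    using Lp_qnorm_powr[OF assms(1) finite(3), where g=g and M="count_space I"] finite(4) by simp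
  finally show ?thesis
    unfolding ennpowr_le_cancel[OF finite(1)] .
next
  case infinite
  then show ?thesis
    using Lp_qnorm_count_space_le_infinite[of I g "Lp_qnorm (count_space I) p g"] assms by simp
qed

lemma sum_le_card_mult_SUP:
  fixes f :: "'b \<Rightarrow> ennreal"
  assumes "finite F" "card F \<le> A"
  shows "(\<Sum>m\<in>F. f m) \<le> of_nat A * (SUP m\<in>F. f m)"
proof -
  have "(\<Sum>m\<in>F. f m) \<le> of_nat (card F) * (SUP m\<in>F. f m)"
    using sum_bounded_above[of F f "SUP m\<in>F. f m"] by (simp add: SUP_upper)
  also have "\<dots> \<le> of_nat A * (SUP m\<in>F. f m)"
    using assms by (intro mult_right_mono) auto
  finally show ?thesis .
qed

text \<open>A sum over boundedly many neighbours is at most a multiple of its largest term, whose \<open>p\<close>-th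
  power is at most the sum of all of them; integration then only sees the measures of the sets
  \<open>B m\<close>. The measure may be Lebesgue or surface measure, or the counting measure of another
  family of cubes.\<close>

lemma Lp_qnorm_neighbour_sum_le:
  fixes A :: nat and b :: real and lam :: "'b \<Rightarrow> ennreal"
  assumes "0 < p" "0 < b" "countable I" "g \<in> borel_measurable M"
    and R: "\<And>x. x \<in> space M \<Longrightarrow> finite (R x) \<and> card (R x) \<le> A \<and> R x \<subseteq> I"
    and RB: "\<And>x m. x \<in> space M \<Longrightarrow> m \<in> R x \<Longrightarrow> x \<in> B m"
    and B: "\<And>m. m \<in> I \<Longrightarrow> B m \<in> sets M" "\<And>m. m \<in> I \<Longrightarrow> emeasure M (B m) \<le> ennreal b"
    and g: "\<And>x. x \<in> space M \<Longrightarrow> g x \<le> (\<Sum>m\<in>R x. lam m)"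
  shows "Lp_qnorm M p g \<le>
    ennreal (real A * b powr (enn2real (inverse p))) * Lp_qnorm (count_space I) p lam"
  using assms(1)
proof (cases rule: Lp_qnorm_cases)
  case (finite r)
  have pointwise: "ennpowr (g x) r \<le>
      ennpowr (of_nat A) r * (\<integral>\<^sup>+ m. ennpowr (lam m) r * indicator (B m) x \<partial>count_space I)"
    if x: "x \<in> space M" for x
  proof -
    have "ennpowr (g x) r \<le> ennpowr (of_nat A * (SUP m\<in>R x. lam m)) r"
      using g[OF x] sum_le_card_mult_SUP[of "R x" A lam] R[OF x] finite
      by (intro ennpowr_mono) (auto intro: order_trans)
    also have "\<dots> = ennpowr (of_nat A) r * (SUP m\<in>R x. ennpowr (lam m) r)"
      using finite by (simp add: ennpowr_mult ennpowr_SUP)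
    also have "\<dots> \<le> ennpowr (of_nat A) r *
        (\<integral>\<^sup>+ m. ennpowr (lam m) r * indicator (B m) x \<partial>count_space I)"
    proof (intro mult_left_mono SUP_least)
      fix m assume m: "m \<in> R x"
      then have "m \<in> I" "x \<in> B m" using R[OF x] RB[OF x] by auto
      then show "ennpowr (lam m) r \<le> (\<integral>\<^sup>+ m. ennpowr (lam m) r * indicator (B m) x \<partial>count_space I)"
        using nn_integral_ge_point[of m I "\<lambda>m. ennpowr (lam m) r * indicator (B m) x"] by simp
    qed auto
    finally show ?thesis .
  qed
  have meas: "(\<lambda>x. ennpowr (lam m) r * indicator (B m) x) \<in> borel_measurable M" if "m \<in> I" for m
    using B(1)[OF that] by measurable

  have "(\<integral>\<^sup>+ x. ennpowr (g x) r \<partial>M) \<le>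
      (\<integral>\<^sup>+ x. ennpowr (of_nat A) r * (\<integral>\<^sup>+ m. ennpowr (lam m) r * indicator (B m) x \<partial>count_space I) \<partial>M)"
    by (intro nn_integral_mono pointwise)
  also have "\<dots> = (\<integral>\<^sup>+ x. (\<integral>\<^sup>+ m. ennpowr (of_nat A) r * (ennpowr (lam m) r * indicator (B m) x)
      \<partial>count_space I) \<partial>M)"
    by (intro nn_integral_cong nn_integral_cmult[symmetric]) simp
  also have "\<dots> = (\<integral>\<^sup>+ m. (\<integral>\<^sup>+ x. ennpowr (of_nat A) r * (ennpowr (lam m) r * indicator (B m) x) \<partial>M)
      \<partial>count_space I)"
    by (intro nn_integral_count_space_nn_integral[OF \<open>countable I\<close>] borel_measurable_times_ennreal meas)
      simp
  also have "\<dots> \<le> (\<integral>\<^sup>+ m. ennpowr (of_nat A) r * (ennpowr (lam m) r * ennreal b) \<partial>count_space I)"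
  proof (intro nn_integral_mono)
    fix m assume "m \<in> space (count_space I)"
    then have m: "m \<in> I" by simp
    have "(\<integral>\<^sup>+ x. ennpowr (of_nat A) r * (ennpowr (lam m) r * indicator (B m) x) \<partial>M) =
        ennpowr (of_nat A) r * (ennpowr (lam m) r * emeasure M (B m))"
      by (subst nn_integral_cmult[OF meas[OF m]], subst nn_integral_cmult_indicator[OF B(1)[OF m]]) simp
    also have "\<dots> \<le> ennpowr (of_nat A) r * (ennpowr (lam m) r * ennreal b)"
      by (intro mult_left_mono B(2) m) auto
    finally show "(\<integral>\<^sup>+ x. ennpowr (of_nat A) r * (ennpowr (lam m) r * indicator (B m) x) \<partial>M) \<le>
        ennpowr (of_nat A) r * (ennpowr (lam m) r * ennreal b)" .
  qed
  also have "\<dots> = ennpowr (of_nat A) r * (\<integral>\<^sup>+ m. ennpowr (lam m) r * ennreal b \<partial>count_space I)"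
    by (rule nn_integral_cmult) simp
  also have "\<dots> = ennpowr (of_nat A) r * (ennpowr (Lp_qnorm (count_space I) p lam) r * ennreal b)"
    using Lp_qnorm_powr[OF assms(1) finite(3), where g=lam and M="count_space I"] finite
    by (simp add: nn_integral_multc)
  also have "\<dots> = ennpowr (ennreal (real A * b powr (1 / r)) * Lp_qnorm (count_space I) p lam) r"
    using \<open>0 < b\<close> finite by (simp add: ennpowr_mult ennpowr_ennreal powr_mult powr_powr ennreal_mult
        ac_simps ennreal_of_nat_eq_real_of_nat)
  finally show ?thesis
    unfolding Lp_qnorm_le_iff_finite[OF assms(1) finite(3)] finite(4,5) .
next
  case infinite
  have "g x \<le> of_nat A * Lp_qnorm (count_space I) p lam" if x: "x \<in> space M" for x
  proof -
    have "g x \<le> of_nat A * (SUP m\<in>R x. lam m)"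
      using g[OF x] sum_le_card_mult_SUP[of "R x" A lam] R[OF x] by (auto intro: order_trans)
    also have "\<dots> \<le> of_nat A * Lp_qnorm (count_space I) p lam"
      using R[OF x] assms(1) by (intro mult_left_mono SUP_least le_Lp_qnorm_count_space) auto
    finally show ?thesis .
  qed
  then have "AE x in M. g x \<le> of_nat A * Lp_qnorm (count_space I) p lam" by (rule AE_I2)
  then have "Lp_qnorm M p g \<le> of_nat A * Lp_qnorm (count_space I) p lam"
    using Lp_qnorm_le_iff_infinite[OF \<open>g \<in> borel_measurable M\<close>] infinite(1) by blast
  moreover have "ennreal (real A * b powr enn2real (inverse p)) = of_nat A"
    using \<open>0 < b\<close> infinite(2) by (simp add: ennreal_of_nat_eq_real_of_nat)
  ultimately show ?thesis by simp
qed

lemma Lp_qnorm_shift_le: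
  fixes \<alpha> :: "nat \<Rightarrow> ennreal"
  assumes "0 < q"
  shows "Lp_qnorm (count_space UNIV) q (\<lambda>l. if i \<le> l then \<alpha> (l - i) else 0) \<le>
    Lp_qnorm (count_space UNIV) q \<alpha>"
  using assms
proof (cases rule: Lp_qnorm_cases)
  case (finite r)
  have "(\<integral>\<^sup>+ l. ennpowr (if i \<le> l then \<alpha> (l - i) else 0) r \<partial>count_space UNIV) =
      (\<Sum>l. ennpowr (if i \<le> l then \<alpha> (l - i) else 0) r)"
    by (rule nn_integral_count_space_nat)
  also have "\<dots> = (\<Sum>l. ennpowr (\<alpha> l) r)"
    by (subst suminf_offset[of _ i]) (auto intro!: sum.neutral)
  also have "\<dots> = (\<integral>\<^sup>+ l. ennpowr (\<alpha> l) r \<partial>count_space UNIV)"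
    by (rule nn_integral_count_space_nat[symmetric])
  also have "\<dots> = ennpowr (Lp_qnorm (count_space UNIV) q \<alpha>) r"
    using Lp_qnorm_powr[OF assms(1) finite(3), where g=\<alpha> and M="count_space UNIV"] finite(4)
    by simp
  finally show ?thesis
    unfolding Lp_qnorm_le_iff_finite[OF assms finite(3)] finite(4) by simp
next
  case infinite
  show ?thesis
    unfolding infinite(1) Lp_qnorm_count_space_le_infinite
    by (auto intro: le_Lp_qnorm_count_space[where m="_ - i"])
qed

text \<open>Passing from coefficients on cubes of levels \<open>j \<le> l\<close> to coefficients on the finer cubes of
  level \<open>l\<close>: a factor \<open>2\<^sup>j\<^sup>-\<^sup>l\<close> comes from the smoothness one of the coarse building blocks, and each
  coarse cube has about \<open>2\<^sup>(\<^sup>l\<^sup>-\<^sup>j\<^sup>)\<^sup>D\<close> fine neighbours. Since \<open>s < 1\<close> the exponents leave a geometric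
  decay in \<open>l - j\<close>, which pays for both sums over \<open>j\<close>.\<close>

lemma sequence_norm_refinement:
  fixes D A :: nat and s C :: real
  assumes "0 < p" "0 < q" "s < 1" "0 \<le> C"
  shows "\<exists>C'>0. \<forall>(I :: nat \<Rightarrow> 'b set) (J :: nat \<Rightarrow> 'c set) (R :: nat \<Rightarrow> nat \<Rightarrow> 'c \<Rightarrow> 'b set)
      (lam :: nat \<Rightarrow> 'b \<Rightarrow> ennreal) (c :: nat \<Rightarrow> 'c \<Rightarrow> ennreal).
    (\<forall>j. countable (I j)) \<longrightarrow>
    (\<forall>j l k. k \<in> J l \<longrightarrow> finite (R j l k) \<and> card (R j l k) \<le> A \<and> R j l k \<subseteq> I j) \<longrightarrow>
    (\<forall>j l m. j \<le> l \<longrightarrow> m \<in> I j \<longrightarrow> finite {k\<in>J l. m \<in> R j l k} \<and>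
       real (card {k\<in>J l. m \<in> R j l k}) \<le> real A * 2 ^ ((l - j) * D)) \<longrightarrow>
    (\<forall>l k. k \<in> J l \<longrightarrow>
       c l k \<le> ennreal C * (\<Sum>j\<le>l. ennreal (2 powr - real (l - j)) * (\<Sum>m\<in>R j l k. lam j m))) \<longrightarrow>
    Lp_qnorm (count_space UNIV) q (\<lambda>l. ennreal (2 powr (real l * (s - real D * enn2real (inverse p)))) *
        Lp_qnorm (count_space (J l)) p (c l)) \<le>
    ennreal C' * Lp_qnorm (count_space UNIV) q
      (\<lambda>j. ennreal (2 powr (real j * (s - real D * enn2real (inverse p)))) *
        Lp_qnorm (count_space (I j)) p (lam j))"
proof -
  \<comment> \<open>Half of the available decay \<open>1 - s\<close> pays for each of the two sums over \<open>i = l - j\<close>, the one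
    inside the \<open>p\<close>-norm and the one inside the \<open>q\<close>-norm.\<close>
  define e where "e = (1 - s) / 2"
  have e: "0 < e" using assms by (simp add: e_def)
  define P where "P = enn2real (inverse p)"
  have P: "0 \<le> P" by (simp add: P_def)
  from Lp_qnorm_suminf_le[OF \<open>0 < p\<close> e, where 'a='c] obtain C1 :: real where C1: "0 < C1"
    and G1: "\<forall>(M::'c measure) u. (\<forall>i. u i \<in> borel_measurable M) \<longrightarrow>
      Lp_qnorm M p (\<lambda>x. \<Sum>i. u i x) \<le>
        ennreal C1 * (SUP i. ennreal (2 powr (e * real i)) * Lp_qnorm M p (u i))"
    by (elim exE conjE)
  from Lp_qnorm_suminf_le[OF \<open>0 < q\<close> e, where 'a=nat] obtain C2 :: real where C2: "0 < C2"
    and G2: "\<forall>(M::nat measure) u. (\<forall>i. u i \<in> borel_measurable M) \<longrightarrow>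
      Lp_qnorm M q (\<lambda>x. \<Sum>i. u i x) \<le>
        ennreal C2 * (SUP i. ennreal (2 powr (e * real i)) * Lp_qnorm M q (u i))"
    by (elim exE conjE)
  define A' where "A' = real A + 1"
  have A': "0 < A'" "real A \<le> A'" by (auto simp: A'_def)
  define C3 where "C3 = C * C1 * (real A * A' powr P)"
  have C3: "0 \<le> C3" using assms C1 by (simp add: C3_def)
  show ?thesis
  proof (intro exI[of _ "C2 * C3 + 1"] conjI allI impI)
    show "0 < C2 * C3 + 1" using C2 C3 by (simp add: add_nonneg_pos)
    fix I :: "nat \<Rightarrow> 'b set" and J :: "nat \<Rightarrow> 'c set" and R :: "nat \<Rightarrow> nat \<Rightarrow> 'c \<Rightarrow> 'b set"
      and lam :: "nat \<Rightarrow> 'b \<Rightarrow> ennreal" and c :: "nat \<Rightarrow> 'c \<Rightarrow> ennreal"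
    assume I: "\<forall>j. countable (I j)"
      and R: "\<forall>j l k. k \<in> J l \<longrightarrow> finite (R j l k) \<and> card (R j l k) \<le> A \<and> R j l k \<subseteq> I j"
      and B: "\<forall>j l m. j \<le> l \<longrightarrow> m \<in> I j \<longrightarrow> finite {k\<in>J l. m \<in> R j l k} \<and>
         real (card {k\<in>J l. m \<in> R j l k}) \<le> real A * 2 ^ ((l - j) * D)"
      and c: "\<forall>l k. k \<in> J l \<longrightarrow>
        c l k \<le> ennreal C * (\<Sum>j\<le>l. ennreal (2 powr - real (l - j)) * (\<Sum>m\<in>R j l k. lam j m))"
    define \<alpha> where "\<alpha> = (\<lambda>j. ennreal (2 powr (real j * (s - real D * P))) *
        Lp_qnorm (count_space (I j)) p (lam j))"
    let ?v = "\<lambda>i l k. if i \<le> l then \<Sum>m\<in>R (l - i) l k. lam (l - i) m else 0"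
    let ?\<beta> = "\<lambda>i l. ennreal (2 powr (- (e * real i))) * (if i \<le> l then \<alpha> (l - i) else 0)"
    have v: "ennreal (2 powr (real l * (s - real D * P))) *
        (ennreal (2 powr (e * real i)) * (ennreal (2 powr - real i) * Lp_qnorm (count_space (J l)) p (?v i l)))
        \<le> ennreal (real A * A' powr P) * ?\<beta> i l" (is "?L \<le> ?R") for i l
    proof (cases "i \<le> l")
      case True
      define j where "j = l - i"
      have l: "l = j + i" using True by (simp add: j_def)
      have "Lp_qnorm (count_space (J l)) p (?v i l) \<le>
        ennreal (real A * (A' * 2 ^ (i * D)) powr P) * Lp_qnorm (count_space (I j)) p (lam j)"
        unfolding P_def
      proof (rule Lp_qnorm_neighbour_sum_le[where R="R j l" and B="\<lambda>m. {k\<in>J l. m \<in> R j l k}"])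
        fix m assume "m \<in> I j"
        then have *: "finite {k\<in>J l. m \<in> R j l k}"
          "real (card {k\<in>J l. m \<in> R j l k}) \<le> real A * 2 ^ (i * D)"
          using B[rule_format, of j l m] by (auto simp: l)
        have "real (card {k\<in>J l. m \<in> R j l k}) \<le> A' * 2 ^ (i * D)"
          by (rule order_trans[OF *(2)]) (simp add: A'(2) mult_right_mono)
        then show "emeasure (count_space (J l)) {k\<in>J l. m \<in> R j l k} \<le> ennreal (A' * 2 ^ (i * D))"
          using *(1) by (simp add: emeasure_count_space ennreal_of_nat_eq_real_of_nat ennreal_leI)
      qed (use assms I R A' True in \<open>auto simp: j_def\<close>)
      then have "?L \<le> ennreal (2 powr (real l * (s - real D * P))) *
        (ennreal (2 powr (e * real i)) * (ennreal (2 powr - real i) *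
          (ennreal (real A * (A' * 2 ^ (i * D)) powr P) * Lp_qnorm (count_space (I j)) p (lam j))))"
        by (intro mult_left_mono) auto
      also have "\<dots> = ennreal (2 powr (real l * (s - real D * P)) * (2 powr (e * real i) * (2 powr - real i *
          (real A * (A' * 2 ^ (i * D)) powr P)))) * Lp_qnorm (count_space (I j)) p (lam j)"
        by (simp add: ennreal_mult mult.assoc)
      also have "2 powr (real l * (s - real D * P)) * (2 powr (e * real i) * (2 powr - real i *
          (real A * (A' * 2 ^ (i * D)) powr P))) =
          real A * A' powr P * (2 powr (- (e * real i)) * 2 powr (real j * (s - real D * P)))"
      proof -
        have "((2::real) ^ (i * D)) powr P = 2 powr (real i * real D * P)"
          by (simp add: powr_powr flip: powr_realpow)
        then have "(A' * 2 ^ (i * D)) powr P = A' powr P * 2 powr (real i * real D * P)"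
          by (simp add: powr_mult)
        then have "2 powr (real l * (s - real D * P)) * (2 powr (e * real i) * (2 powr - real i *
          (real A * (A' * 2 ^ (i * D)) powr P))) = real A * A' powr P *
            (2 powr (real l * (s - real D * P)) * 2 powr (e * real i) * 2 powr - real i *
             2 powr (real i * real D * P))"
          by simp
        also have "2 powr (real l * (s - real D * P)) * 2 powr (e * real i) * 2 powr - real i *
             2 powr (real i * real D * P) =
             2 powr (real l * (s - real D * P) + e * real i + - real i + real i * real D * P)"
          by (simp only: powr_add)
        also have "real l * (s - real D * P) + e * real i + - real i + real i * real D * P =
            - (e * real i) + real j * (s - real D * P)"
          by (simp add: l e_def field_simps)
        finally show ?thesis by (simp only: powr_add)
      qed
      also have "ennreal (real A * A' powr P * (2 powr (- (e * real i)) * 2 powr (real j * (s - real D * P)))) *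
          Lp_qnorm (count_space (I j)) p (lam j) = ?R"
        using True by (simp add: \<alpha>_def j_def[symmetric] ennreal_mult mult.assoc)
      finally show ?thesis .
    next
      case False
      then show ?thesis using assms(1) by (simp add: Lp_qnorm_eq_0_iff)
    qed
    have level: "ennreal (2 powr (real l * (s - real D * P))) * Lp_qnorm (count_space (J l)) p (c l) \<le>
        ennreal C3 * (\<Sum>i. ?\<beta> i l)" for l
    proof -
      have ac: "x * (a * (b * y)) = a * b * (x * y)" for x a b y :: ennreal
        by (simp only: mult_ac)
      have "c l k \<le> ennreal C * (\<Sum>i. ennreal (2 powr - real i) * ?v i l k)" if "k \<in> J l" for k
      proof -
        have "(\<Sum>j\<le>l. ennreal (2 powr - real (l - j)) * (\<Sum>m\<in>R j l k. lam j m)) =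
            (\<Sum>i\<le>l. ennreal (2 powr - real i) * ?v i l k)"
          by (rule sum.reindex_bij_witness[of _ "\<lambda>i. l - i" "\<lambda>j. l - j"]) auto
        also have "\<dots> \<le> (\<Sum>i. ennreal (2 powr - real i) * ?v i l k)"
          by (rule sum_le_suminf) auto
        finally show ?thesis
          using c that by (meson mult_left_mono order_trans zero_le)
      qed
      then have "Lp_qnorm (count_space (J l)) p (c l) \<le>
          Lp_qnorm (count_space (J l)) p (\<lambda>k. ennreal C * (\<Sum>i. ennreal (2 powr - real i) * ?v i l k))"
        using assms(1) by (intro Lp_qnorm_mono) auto
      also have "\<dots> \<le> ennreal C *
          Lp_qnorm (count_space (J l)) p (\<lambda>k. \<Sum>i. ennreal (2 powr - real i) * ?v i l k)"
        using assms(1) by (intro Lp_qnorm_cmult_le) auto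
      also have "\<dots> \<le> ennreal C * (ennreal C1 * (SUP i. ennreal (2 powr (e * real i)) *
          Lp_qnorm (count_space (J l)) p (\<lambda>k. ennreal (2 powr - real i) * ?v i l k)))"
        by (intro mult_left_mono G1[rule_format]) auto
      also have "\<dots> \<le> ennreal C * (ennreal C1 * (SUP i. ennreal (2 powr (e * real i)) *
          (ennreal (2 powr - real i) * Lp_qnorm (count_space (J l)) p (?v i l))))"
        using assms(1) by (intro mult_left_mono SUP_mono' Lp_qnorm_cmult_le) auto
      finally have "ennreal (2 powr (real l * (s - real D * P))) * Lp_qnorm (count_space (J l)) p (c l) \<le>
          ennreal (2 powr (real l * (s - real D * P))) *
          (ennreal C * (ennreal C1 * (SUP i. ennreal (2 powr (e * real i)) *
          (ennreal (2 powr - real i) * Lp_qnorm (count_space (J l)) p (?v i l)))))"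
        by (rule mult_left_mono) simp
      also have "\<dots> =
          ennreal C * ennreal C1 * (ennreal (2 powr (real l * (s - real D * P))) *
          (SUP i. (ennreal (2 powr (e * real i)) *
          (ennreal (2 powr - real i) * Lp_qnorm (count_space (J l)) p (?v i l)))))"
        by (rule ac)
      also have "\<dots> = ennreal C * ennreal C1 * (SUP i. ennreal (2 powr (real l * (s - real D * P))) *
          (ennreal (2 powr (e * real i)) *
          (ennreal (2 powr - real i) * Lp_qnorm (count_space (J l)) p (?v i l))))"
        by (simp only: SUP_mult_left_ennreal)
      also have "\<dots> \<le> ennreal C * ennreal C1 * (ennreal (real A * A' powr P) * (\<Sum>i. ?\<beta> i l))"
      proof (intro mult_left_mono SUP_least)
        fix i
        have "?\<beta> i l \<le> (\<Sum>i. ?\<beta> i l)" by (rule le_suminf_ennreal[of "\<lambda>i. ?\<beta> i l"])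
        then show "ennreal (2 powr (real l * (s - real D * P))) * (ennreal (2 powr (e * real i)) *
          (ennreal (2 powr - real i) * Lp_qnorm (count_space (J l)) p (?v i l))) \<le>
          ennreal (real A * A' powr P) * (\<Sum>i. ?\<beta> i l)"
          by (intro order_trans[OF v] mult_left_mono) auto
      qed auto
      also have "\<dots> = ennreal C3 * (\<Sum>i. ?\<beta> i l)"
        using assms C1 A' by (simp add: C3_def ennreal_mult mult.assoc)
      finally show ?thesis .
    qed
    have "Lp_qnorm (count_space UNIV) q (\<lambda>l. ennreal (2 powr (real l * (s - real D * P))) *
        Lp_qnorm (count_space (J l)) p (c l)) \<le>
      Lp_qnorm (count_space UNIV) q (\<lambda>l. ennreal C3 * (\<Sum>i. ?\<beta> i l))"
      using assms(2) by (intro Lp_qnorm_mono level) auto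
    also have "\<dots> \<le> ennreal C3 * Lp_qnorm (count_space UNIV) q (\<lambda>l. \<Sum>i. ?\<beta> i l)"
      using assms(2) by (intro Lp_qnorm_cmult_le) auto
    also have "\<dots> \<le> ennreal C3 * (ennreal C2 *
        (SUP i. ennreal (2 powr (e * real i)) * Lp_qnorm (count_space UNIV) q (?\<beta> i)))"
      by (intro mult_left_mono G2[rule_format]) auto
    also have "\<dots> \<le> ennreal C3 * (ennreal C2 * Lp_qnorm (count_space UNIV) q \<alpha>)"
    proof (intro mult_left_mono SUP_least)
      fix i
      have "Lp_qnorm (count_space UNIV) q (?\<beta> i) \<le> ennreal (2 powr (- (e * real i))) *
          Lp_qnorm (count_space UNIV) q (\<lambda>l. if i \<le> l then \<alpha> (l - i) else 0)"
        using assms(2) by (intro Lp_qnorm_cmult_le) auto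
      also have "\<dots> \<le> ennreal (2 powr (- (e * real i))) * Lp_qnorm (count_space UNIV) q \<alpha>"
        using assms(2) by (intro mult_left_mono Lp_qnorm_shift_le) auto
      finally have "ennreal (2 powr (e * real i)) * Lp_qnorm (count_space UNIV) q (?\<beta> i) \<le>
          ennreal (2 powr (e * real i)) *
            (ennreal (2 powr (- (e * real i))) * Lp_qnorm (count_space UNIV) q \<alpha>)"
        by (rule mult_left_mono) simp
      also have "\<dots> = Lp_qnorm (count_space UNIV) q \<alpha>"
        by (simp add: mult.assoc[symmetric] ennreal_mult[symmetric] powr_add[symmetric])
      finally show "ennreal (2 powr (e * real i)) * Lp_qnorm (count_space UNIV) q (?\<beta> i) \<le>
          Lp_qnorm (count_space UNIV) q \<alpha>" .
    qed auto
    also have "\<dots> = ennreal (C2 * C3) * Lp_qnorm (count_space UNIV) q \<alpha>"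
      using C2 C3 by (simp add: ennreal_mult mult_ac)
    also have "\<dots> \<le> ennreal (C2 * C3 + 1) * Lp_qnorm (count_space UNIV) q \<alpha>"
      by (intro mult_right_mono ennreal_leI) auto
    finally show "Lp_qnorm (count_space UNIV) q
        (\<lambda>l. ennreal (2 powr (real l * (s - real D * enn2real (inverse p)))) *
        Lp_qnorm (count_space (J l)) p (c l)) \<le>
      ennreal (C2 * C3 + 1) * Lp_qnorm (count_space UNIV) q
        (\<lambda>j. ennreal (2 powr (real j * (s - real D * enn2real (inverse p)))) *
        Lp_qnorm (count_space (I j)) p (lam j))"
      by (simp add: P_def \<alpha>_def)
  qed
qed

section \<open>Counting lattice points near dyadic cubes\<close>

lemma dist_le_DIM_mult:
  fixes x y :: "'a::euclidean_space"
  assumes "\<And>b. b \<in> Basis \<Longrightarrow> \<bar>x \<bullet> b - y \<bullet> b\<bar> \<le> r"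
  shows "dist x y \<le> real DIM('a) * r"
proof -
  have "dist x y \<le> (\<Sum>b\<in>Basis. \<bar>(x - y) \<bullet> b\<bar>)"
    unfolding dist_norm by (rule norm_le_l1)
  also have "\<dots> \<le> (\<Sum>b\<in>(Basis :: 'a set). r)"
    using assms by (intro sum_mono) (simp add: inner_diff_left)
  finally show ?thesis by simp
qed

lemma abs_inner_diff_le_dist: "b \<in> Basis \<Longrightarrow> \<bar>x \<bullet> b - y \<bullet> b\<bar> \<le> dist x y"
  using Basis_le_norm[of b "x - y"] by (simp add: dist_norm inner_diff_left)

lemma dist_dcube_le:
  fixes x y m :: "'a::euclidean_space"
  assumes "x \<in> dcube d j m" "y \<in> dcube d j m"
  shows "dist x y \<le> real DIM('a) * (2 * d / 2 ^ j)"
proof (rule dist_le_DIM_mult)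
  fix b :: 'a assume "b \<in> Basis"
  then have "\<bar>x \<bullet> b - m \<bullet> b / 2 ^ j\<bar> \<le> d / 2 ^ j" "\<bar>y \<bullet> b - m \<bullet> b / 2 ^ j\<bar> \<le> d / 2 ^ j"
    using assms by (auto simp: dcube_def)
  then show "\<bar>x \<bullet> b - y \<bullet> b\<bar> \<le> 2 * d / 2 ^ j" by linarith
qed

lemma dcube_centre_mem: "0 \<le> d \<Longrightarrow> m /\<^sub>R 2 ^ j \<in> dcube d j m"
  by (simp add: dcube_def divide_inverse mult.commute)

lemma mem_dcube_iff:
  "x \<in> dcube d j m \<longleftrightarrow> (\<forall>b\<in>Basis. \<bar>2 ^ j * (x \<bullet> b) - m \<bullet> b\<bar> \<le> d)"
proof -
  have "\<bar>x \<bullet> b - m \<bullet> b / 2 ^ j\<bar> \<le> d / 2 ^ j \<longleftrightarrow> \<bar>2 ^ j * (x \<bullet> b) - m \<bullet> b\<bar> \<le> d" for b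
  proof -
    have "\<bar>2 ^ j * (x \<bullet> b) - m \<bullet> b\<bar> = \<bar>2 ^ j * (x \<bullet> b - m \<bullet> b / 2 ^ j)\<bar>"
      by (simp add: right_diff_distrib)
    also have "\<dots> = 2 ^ j * \<bar>x \<bullet> b - m \<bullet> b / 2 ^ j\<bar>" by (simp add: abs_mult)
    finally show ?thesis by (simp add: pos_le_divide_eq mult.commute)
  qed
  then show ?thesis by (simp add: dcube_def)
qed

lemma dcube_mono: "d \<le> d' \<Longrightarrow> dcube d j m \<subseteq> dcube d' j m"
  unfolding mem_dcube_iff subset_iff by (meson order_trans)

lemma dcube_eq_cbox:
  "dcube d j m = cbox (m /\<^sub>R 2 ^ j - (d / 2 ^ j) *\<^sub>R One) (m /\<^sub>R 2 ^ j + (d / 2 ^ j) *\<^sub>R One)"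
  unfolding dcube_def cbox_def
  by (auto simp: inner_diff_left inner_add_left divide_inverse mult.commute abs_le_iff)

lemma closed_dcube: "closed (dcube d j m)"
  unfolding dcube_eq_cbox by (rule closed_cbox)

lemma ex_dcube: "\<exists>m\<in>int_lattice. x \<in> dcube 1 j m"
proof -
  define m where "m = (\<Sum>b\<in>Basis. of_int \<lfloor>2 ^ j * (x \<bullet> b)\<rfloor> *\<^sub>R b)"
  have m: "m \<bullet> b = of_int \<lfloor>2 ^ j * (x \<bullet> b)\<rfloor>" if "b \<in> Basis" for b
    using that by (simp add: m_def inner_sum_left_Basis)
  have "m \<in> int_lattice" by (simp add: int_lattice_def m)
  moreover have "x \<in> dcube 1 j m"
  proof -
    have "\<bar>y - of_int \<lfloor>y\<rfloor>\<bar> \<le> 1" for y :: real by linarith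
    then show ?thesis by (simp add: mem_dcube_iff m)
  qed
  ultimately show ?thesis ..
qed

lemma card_int_interval_le:
  assumes "0 \<le> r"
  shows "real (card {\<lceil>z - r\<rceil>..\<lfloor>z + r\<rfloor>}) \<le> 2 * r + 1"
  using assms by simp linarith

lemma lattice_box_count:
  fixes z :: "'a::euclidean_space"
  assumes "0 \<le> r"
  shows "finite {k \<in> int_lattice. \<forall>b\<in>Basis. \<bar>k \<bullet> b - z \<bullet> b\<bar> \<le> r}" (is "finite ?S")
    and "real (card {k \<in> int_lattice. \<forall>b\<in>Basis. \<bar>k \<bullet> b - z \<bullet> b\<bar> \<le> r}) \<le> (2 * r + 1) ^ DIM('a)"
proof -
  let ?P = "PiE (Basis :: 'a set) (\<lambda>b. {\<lceil>z \<bullet> b - r\<rceil>..\<lfloor>z \<bullet> b + r\<rfloor>})"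
  let ?f = "\<lambda>k. restrict (\<lambda>b. \<lfloor>k \<bullet> b\<rfloor>) (Basis :: 'a set)"
  have P: "finite ?P" by (intro finite_PiE) auto
  have inj: "inj_on ?f ?S"
  proof (rule inj_onI)
    fix k l assume kl: "k \<in> ?S" "l \<in> ?S" and eq: "?f k = ?f l"
    show "k = l"
    proof (rule euclidean_eqI)
      fix b :: 'a assume b: "b \<in> Basis"
      then have "\<lfloor>k \<bullet> b\<rfloor> = \<lfloor>l \<bullet> b\<rfloor>" using fun_cong[OF eq, of b] by simp
      moreover have "k \<bullet> b \<in> \<int>" "l \<bullet> b \<in> \<int>" using kl b by (auto simp: int_lattice_def)
      ultimately show "k \<bullet> b = l \<bullet> b" by (auto elim!: Ints_cases)
    qed
  qed
  have "?f k \<in> ?P" if "k \<in> ?S" for k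
  proof (rule restrict_PiE_iff[THEN iffD2], rule ballI)
    fix b :: 'a assume b: "b \<in> Basis"
    have "\<bar>k \<bullet> b - z \<bullet> b\<bar> \<le> r" "k \<bullet> b \<in> \<int>" using that b by (auto simp: int_lattice_def)
    then show "\<lfloor>k \<bullet> b\<rfloor> \<in> {\<lceil>z \<bullet> b - r\<rceil>..\<lfloor>z \<bullet> b + r\<rfloor>}"
      by (auto elim!: Ints_cases simp: ceiling_le_iff le_floor_iff abs_le_iff)
  qed
  then have im: "?f ` ?S \<subseteq> ?P" by blast
  show "finite ?S" using finite_imageD[OF finite_subset[OF im P] inj] .
  have "real (card ?S) \<le> real (card ?P)"
    using card_inj_on_le[OF inj im P] by simp
  also have "\<dots> = (\<Prod>b\<in>(Basis :: 'a set). real (card {\<lceil>z \<bullet> b - r\<rceil>..\<lfloor>z \<bullet> b + r\<rfloor>}))"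
    by (simp only: card_PiE[OF finite_Basis] of_nat_prod)
  also have "\<dots> \<le> (\<Prod>b\<in>(Basis :: 'a set). 2 * r + 1)"
    by (intro prod_mono conjI card_int_interval_le assms) auto
  finally show "real (card ?S) \<le> (2 * r + 1) ^ DIM('a)" by simp
qed

lemma lattice_subset_box_count:
  fixes z :: "'a::euclidean_space"
  assumes "0 \<le> r" "S \<subseteq> int_lattice" "\<And>k b. k \<in> S \<Longrightarrow> b \<in> Basis \<Longrightarrow> \<bar>k \<bullet> b - z \<bullet> b\<bar> \<le> r"
  shows "finite S" and "real (card S) \<le> (2 * r + 1) ^ DIM('a)"
proof -
  have sub: "S \<subseteq> {k \<in> int_lattice. \<forall>b\<in>Basis. \<bar>k \<bullet> b - z \<bullet> b\<bar> \<le> r}" using assms by auto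
  show "finite S" using finite_subset[OF sub lattice_box_count(1)[OF assms(1)]] .
  show "real (card S) \<le> (2 * r + 1) ^ DIM('a)"
    using card_mono[OF lattice_box_count(1)[OF assms(1)] sub] lattice_box_count(2)[OF assms(1), of z]
    by linarith
qed

lemma countable_int_lattice: "countable (int_lattice :: 'a::euclidean_space set)"
proof -
  have "int_lattice \<subseteq> (\<Union>n::nat. {k \<in> int_lattice. \<forall>b\<in>Basis. \<bar>k \<bullet> b - (0::'a) \<bullet> b\<bar> \<le> real n})"
  proof
    fix k :: 'a assume "k \<in> int_lattice"
    moreover obtain n :: nat where "norm k \<le> real n" using real_arch_simple by blast
    ultimately show "k \<in> (\<Union>n::nat. {k \<in> int_lattice. \<forall>b\<in>Basis. \<bar>k \<bullet> b - (0::'a) \<bullet> b\<bar> \<le> real n})"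
      using Basis_le_norm[of _ k] by (auto intro: order_trans)
  qed
  then show ?thesis
    by (rule countable_subset) (intro countable_UN countable_finite lattice_box_count(1) of_nat_0_le_iff
        countableI_type)
qed

lemma countable_cube_indices: "countable (cube_indices S j)"
  by (rule countable_subset[OF _ countable_int_lattice]) (auto simp: cube_indices_def)

lemma finite_cube_indices:
  assumes "bounded (S :: 'a::euclidean_space set)"
  shows "finite (cube_indices S j)"
proof -
  obtain r where r: "\<And>x. x \<in> S \<Longrightarrow> norm x \<le> r" using assms by (auto simp: bounded_iff)
  show ?thesis
  proof (rule lattice_subset_box_count(1)[where r="2 ^ j * \<bar>r\<bar> + 1" and z=0])
    fix k b :: 'a assume "k \<in> cube_indices S j" and b: "b \<in> Basis"
    then obtain x where x: "x \<in> S" "x \<in> dcube 1 j k" by (auto simp: cube_indices_def)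
    have "\<bar>x \<bullet> b\<bar> \<le> \<bar>r\<bar>" using Basis_le_norm[OF b, of x] r[OF x(1)] by linarith
    then have "\<bar>2 ^ j * (x \<bullet> b)\<bar> \<le> 2 ^ j * \<bar>r\<bar>" by (simp add: abs_mult)
    moreover have "\<bar>2 ^ j * (x \<bullet> b) - k \<bullet> b\<bar> \<le> 1" using x(2) b by (simp add: mem_dcube_iff)
    ultimately show "\<bar>k \<bullet> b - 0 \<bullet> b\<bar> \<le> 2 ^ j * \<bar>r\<bar> + 1" unfolding inner_zero_left by linarith
  qed (auto simp: cube_indices_def)
qed

section \<open>An algebra of functions with controlled partial derivatives\<close>

text \<open>All partial derivatives of order \<open>k \<le> K\<close> exist, are continuous and bounded by \<open>A R\<^sup>k\<close>. The
  recursion differentiates the innermost direction first, so that sums and products are handled by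
  induction on \<open>K\<close>, without a Leibniz formula for higher derivatives.\<close>

primrec smooth_bd :: "nat \<Rightarrow> real \<Rightarrow> real \<Rightarrow> ('a::euclidean_space \<Rightarrow> complex) \<Rightarrow> bool" where
  "smooth_bd 0 R A F \<longleftrightarrow> continuous_on UNIV F \<and> (\<forall>x. norm (F x) \<le> A)"
| "smooth_bd (Suc K) R A F \<longleftrightarrow> continuous_on UNIV F \<and> (\<forall>x. norm (F x) \<le> A) \<and>
     (\<forall>b\<in>Basis. \<exists>G. (\<forall>x. ((\<lambda>t. F (x + t *\<^sub>R b)) has_vector_derivative G x) (at 0)) \<and>
       smooth_bd K R (R * A) G)"

lemma smooth_bd_continuous: "smooth_bd K R A F \<Longrightarrow> continuous_on UNIV F"
  by (cases K) auto

lemma smooth_bd_bound: "smooth_bd K R A F \<Longrightarrow> norm (F x) \<le> A"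
  by (cases K) auto

lemma smooth_bd_nonneg: "smooth_bd K R A F \<Longrightarrow> 0 \<le> A"
  using smooth_bd_bound[of K R A F undefined] by (meson norm_ge_zero order_trans)

lemma smooth_bd_mono: "smooth_bd K R A F \<Longrightarrow> A \<le> B \<Longrightarrow> 0 \<le> R \<Longrightarrow> smooth_bd K R B F"
proof (induction K arbitrary: A B F)
  case 0
  then show ?case by (auto intro: order_trans)
next
  case (Suc K)
  have "\<exists>G. (\<forall>x. ((\<lambda>t. F (x + t *\<^sub>R b)) has_vector_derivative G x) (at 0)) \<and> smooth_bd K R (R * B) G"
    if "b \<in> Basis" for b
  proof -
    obtain G where "\<forall>x. ((\<lambda>t. F (x + t *\<^sub>R b)) has_vector_derivative G x) (at 0)"
      "smooth_bd K R (R * A) G"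
      using Suc.prems(1) \<open>b \<in> Basis\<close> by auto
    moreover have "R * A \<le> R * B" using Suc.prems by (intro mult_left_mono) auto
    ultimately show ?thesis using Suc.IH Suc.prems(3) by blast
  qed
  then show ?case using Suc.prems by (auto intro: order_trans)
qed

lemma smooth_bd_lower: "smooth_bd (Suc K) R A F \<Longrightarrow> smooth_bd K R A F"
proof (induction K arbitrary: A F)
  case (Suc K)
  show ?case
    unfolding smooth_bd.simps(2)[of K]
  proof (intro conjI ballI)
    fix b :: 'a assume "b \<in> Basis"
    then obtain G where "\<forall>x. ((\<lambda>t. F (x + t *\<^sub>R b)) has_vector_derivative G x) (at 0)"
      "smooth_bd (Suc K) R (R * A) G"
      using Suc.prems unfolding smooth_bd.simps(2)[of "Suc K"] by blast
    then show "\<exists>G. (\<forall>x. ((\<lambda>t. F (x + t *\<^sub>R b)) has_vector_derivative G x) (at 0)) \<and>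
        smooth_bd K R (R * A) G"
      using Suc.IH by blast
  qed (use Suc.prems smooth_bd_continuous smooth_bd_bound in blast)+
qed auto

lemma smooth_bd_zero: "0 \<le> A \<Longrightarrow> 0 \<le> R \<Longrightarrow> smooth_bd K R A (\<lambda>x. 0)"
  by (induction K arbitrary: A) (auto intro!: exI[of _ "\<lambda>x. 0"])

lemma smooth_bd_const: "norm c \<le> A \<Longrightarrow> 0 \<le> R \<Longrightarrow> smooth_bd K R A (\<lambda>x. c)"
proof (cases K)
  case (Suc k)
  assume "norm c \<le> A" "0 \<le> R"
  moreover have "0 \<le> A" using \<open>norm c \<le> A\<close> norm_ge_zero order_trans by blast
  ultimately show ?thesis
    using Suc by (auto intro!: exI[of _ "\<lambda>x. 0"] smooth_bd_zero)
qed auto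

lemma smooth_bd_add:
  "smooth_bd K R A F \<Longrightarrow> smooth_bd K R B G \<Longrightarrow> smooth_bd K R (A + B) (\<lambda>x. F x + G x)"
proof (induction K arbitrary: A B F G)
  case 0
  then show ?case by (auto intro!: continuous_intros norm_triangle_mono)
next
  case (Suc K)
  have "\<exists>H. (\<forall>x. ((\<lambda>t. F (x + t *\<^sub>R b) + G (x + t *\<^sub>R b)) has_vector_derivative H x) (at 0)) \<and>
      smooth_bd K R (R * (A + B)) H" if "b \<in> Basis" for b
  proof -
    obtain F' where F': "\<forall>x. ((\<lambda>t. F (x + t *\<^sub>R b)) has_vector_derivative F' x) (at 0)"
      "smooth_bd K R (R * A) F'"
      using Suc.prems(1) \<open>b \<in> Basis\<close> by auto
    obtain G' where G': "\<forall>x. ((\<lambda>t. G (x + t *\<^sub>R b)) has_vector_derivative G' x) (at 0)"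
      "smooth_bd K R (R * B) G'"
      using Suc.prems(2) \<open>b \<in> Basis\<close> by auto
    show ?thesis
      using F' G' Suc.IH[OF F'(2) G'(2)]
      by (intro exI[of _ "\<lambda>x. F' x + G' x"]) (auto simp: distrib_left intro!: has_vector_derivative_add)
  qed
  then show ?case
    using Suc.prems by (auto intro!: continuous_intros norm_triangle_mono)
qed

lemma smooth_bd_sum:
  assumes "finite S" "0 \<le> R" "\<And>i. i \<in> S \<Longrightarrow> smooth_bd K R (A i) (F i)"
  shows "smooth_bd K R (\<Sum>i\<in>S. A i) (\<lambda>x. \<Sum>i\<in>S. F i x)"
  using assms(1,3)
  by (induction S rule: finite_induct) (auto intro!: smooth_bd_zero smooth_bd_add assms(2))

lemma smooth_bd_mult:
  "smooth_bd K R A F \<Longrightarrow> smooth_bd K R B G \<Longrightarrow> 0 \<le> R \<Longrightarrow>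
    smooth_bd K R (2 ^ K * A * B) (\<lambda>x. F x * G x)"
proof (induction K arbitrary: A B F G)
  case 0
  then have "0 \<le> A" using smooth_bd_nonneg by blast
  then show ?case
    using 0 by (auto intro!: continuous_intros mult_mono simp: norm_mult)
next
  case (Suc K)
  have AB: "0 \<le> A" "0 \<le> B" using Suc.prems smooth_bd_nonneg by blast+
  have "\<exists>H. (\<forall>x. ((\<lambda>t. F (x + t *\<^sub>R b) * G (x + t *\<^sub>R b)) has_vector_derivative H x) (at 0)) \<and>
      smooth_bd K R (R * (2 ^ Suc K * A * B)) H" if b: "b \<in> Basis" for b
  proof -
    obtain F' where F': "\<forall>x. ((\<lambda>t. F (x + t *\<^sub>R b)) has_vector_derivative F' x) (at 0)"
      "smooth_bd K R (R * A) F'"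
      using Suc.prems(1) b by auto
    obtain G' where G': "\<forall>x. ((\<lambda>t. G (x + t *\<^sub>R b)) has_vector_derivative G' x) (at 0)"
      "smooth_bd K R (R * B) G'"
      using Suc.prems(2) b by auto
    have "smooth_bd K R (2 ^ K * A * (R * B) + 2 ^ K * (R * A) * B) (\<lambda>x. F x * G' x + F' x * G x)"
      using Suc.prems F' G'
      by (intro smooth_bd_add Suc.IH smooth_bd_lower[OF Suc.prems(1)] smooth_bd_lower[OF Suc.prems(2)])
    moreover have "2 ^ K * A * (R * B) + 2 ^ K * (R * A) * B = R * (2 ^ Suc K * A * B)"
      by (simp add: algebra_simps)
    moreover have "((\<lambda>t. F (x + t *\<^sub>R b) * G (x + t *\<^sub>R b)) has_vector_derivative
        F x * G' x + F' x * G x) (at 0)" for x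
      using has_vector_derivative_mult[OF F'(1)[rule_format, of x] G'(1)[rule_format, of x]] by simp
    ultimately show ?thesis by (intro exI[of _ "\<lambda>x. F x * G' x + F' x * G x"]) auto
  qed
  moreover have "norm (F x * G x) \<le> 2 ^ Suc K * A * B" for x
  proof -
    have "norm (F x * G x) \<le> A * B"
      unfolding norm_mult
      using AB smooth_bd_bound[OF Suc.prems(1)] smooth_bd_bound[OF Suc.prems(2)]
      by (intro mult_mono) auto
    also have "\<dots> \<le> 2 ^ Suc K * (A * B)"
      using AB mult_right_mono[of 1 "2 ^ Suc K" "A * B"] by (simp del: power_Suc)
    finally show ?thesis by (simp add: mult.assoc)
  qed
  ultimately show ?case
    using Suc.prems(1,2) by (auto intro!: continuous_intros)
qed

lemma smooth_bd_cmult: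
  assumes "smooth_bd K R A F" "0 \<le> R"
  shows "smooth_bd K R (norm c * A) (\<lambda>x. c * F x)"
  using assms
proof (induction K arbitrary: A F)
  case 0
  then show ?case by (auto intro!: continuous_intros mult_left_mono simp: norm_mult)
next
  case (Suc K)
  have "\<exists>G. (\<forall>x. ((\<lambda>t. c * F (x + t *\<^sub>R b)) has_vector_derivative G x) (at 0)) \<and>
      smooth_bd K R (R * (norm c * A)) G" if b: "b \<in> Basis" for b
  proof -
    obtain F' where F': "\<forall>x. ((\<lambda>t. F (x + t *\<^sub>R b)) has_vector_derivative F' x) (at 0)"
      "smooth_bd K R (R * A) F'"
      using Suc.prems(1) b by auto
    show ?thesis
      using F' Suc.IH[OF F'(2) Suc.prems(2)]
      by (intro exI[of _ "\<lambda>x. c * F' x"]) (auto simp: mult.left_commute intro!: has_vector_derivative_mult_right)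
  qed
  then show ?case
    using Suc.prems by (auto intro!: continuous_intros mult_left_mono simp: norm_mult)
qed

lemma smooth_bd_prod:
  assumes "finite S" "0 \<le> R" "\<And>i. i \<in> S \<Longrightarrow> smooth_bd K R A (F i)"
  shows "smooth_bd K R ((2 ^ K * A) ^ card S) (\<lambda>x. \<Prod>i\<in>S. F i x)"
  using assms(1,3)
proof (induction S rule: finite_induct)
  case empty
  then show ?case using assms(2) by (auto intro!: smooth_bd_const)
next
  case (insert i S)
  have "smooth_bd K R (2 ^ K * A * (2 ^ K * A) ^ card S) (\<lambda>x. F i x * (\<Prod>i\<in>S. F i x))"
    using insert by (intro smooth_bd_mult assms(2)) auto
  then show ?case using insert by simp
qed

lemma smooth_bd_iter_partial:
  assumes "smooth_bd K R A F" "set bs \<subseteq> Basis" "length bs \<le> K"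
  shows "smooth_bd (K - length bs) R (R ^ length bs * A) (iter_partial bs F)"
    and "length bs < K \<Longrightarrow> b \<in> Basis \<Longrightarrow>
      (\<lambda>t. iter_partial bs F (x + t *\<^sub>R b)) differentiable (at 0)"
proof -
  have deriv: "(\<lambda>t. iter_partial bs F (x + t *\<^sub>R b)) differentiable (at 0)"
    if "smooth_bd (K - length bs) R (R ^ length bs * A) (iter_partial bs F)" "length bs < K" "b \<in> Basis"
    for bs b x
  proof (cases "K - length bs")
    case (Suc k)
    show ?thesis using that(1,3) unfolding Suc smooth_bd.simps by (blast intro: differentiableI_vector)
  qed (use that(2) in simp)
  show *: "smooth_bd (K - length bs) R (R ^ length bs * A) (iter_partial bs F)"
    using assms(2,3)
  proof (induction bs)
    case (Cons b bs)
    obtain k where k: "K - length bs = Suc k" using Cons.prems(2)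
      by (metis Suc_diff_Suc Suc_le_lessD length_Cons)
    have "smooth_bd (Suc k) R (R ^ length bs * A) (iter_partial bs F)"
      using Cons k by auto
    then obtain G where G: "\<forall>x. ((\<lambda>t. iter_partial bs F (x + t *\<^sub>R b)) has_vector_derivative G x) (at 0)"
      "smooth_bd k R (R * (R ^ length bs * A)) G"
      using Cons.prems(1) by auto
    have "iter_partial (b # bs) F = G"
      using G(1) by (auto simp: fun_eq_iff intro: vector_derivative_at)
    moreover have "K - length (b # bs) = k" using k by simp
    ultimately show ?case using G(2) by (simp add: mult.assoc)
  qed (use assms in auto)
  show "length bs < K \<Longrightarrow> b \<in> Basis \<Longrightarrow>
      (\<lambda>t. iter_partial bs F (x + t *\<^sub>R b)) differentiable (at 0)"
    by (rule deriv[OF *])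
qed

lemma K_atom_of_smooth_bd:
  assumes "smooth_bd K (2 ^ j) 1 F" "closure {x. F x \<noteq> 0} \<subseteq> dcube d j m"
  shows "K_atom d K j m F"
proof -
  have "norm (iter_partial bs F x) \<le> 2 ^ (length bs * j)" if "set bs \<subseteq> Basis" "length bs \<le> K" for bs x
    using smooth_bd_bound[OF smooth_bd_iter_partial(1)[OF assms(1) that], of x]
    by (simp add: power_mult[symmetric] mult.commute)
  then show ?thesis
    using assms smooth_bd_iter_partial[OF assms(1)] smooth_bd_continuous
    unfolding K_atom_def C_class_def by blast
qed

text \<open>Moving along one coordinate at a time only needs the first partial derivatives.\<close>

lemma lipschitz_of_bounded_partials:
  fixes F :: "'a::euclidean_space \<Rightarrow> 'c::real_normed_vector"
  assumes "\<And>x b. b \<in> Basis \<Longrightarrow>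
      \<exists>v. ((\<lambda>t. F (x + t *\<^sub>R b)) has_vector_derivative v) (at 0) \<and> norm v \<le> B"
  shows "norm (F x - F y) \<le> B * real DIM('a) * dist x y"
proof -
  have B: "0 \<le> B" using assms[OF SOME_Basis] norm_ge_zero order_trans by blast
  have line: "norm (F (x + c *\<^sub>R b) - F x) \<le> B * \<bar>c\<bar>" if b: "b \<in> Basis" for x b c
  proof -
    obtain v where v: "\<And>x. ((\<lambda>t. F (x + t *\<^sub>R b)) has_vector_derivative v x) (at 0)"
      "\<And>x. norm (v x) \<le> B"
      using assms[OF b] by metis
    have "((\<lambda>t. F (x + t *\<^sub>R b)) has_vector_derivative v (x + u *\<^sub>R b)) (at u)" for u
    proof -
      have "((\<lambda>t. F (x + u *\<^sub>R b + (t - u) *\<^sub>R b)) has_vector_derivative 1 *\<^sub>R v (x + u *\<^sub>R b)) (at u)"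
        by (rule vector_diff_chain_at[where g="\<lambda>t. F (x + u *\<^sub>R b + t *\<^sub>R b)" and f="\<lambda>t. t - u",
              unfolded o_def]) (auto intro!: derivative_eq_intros simp: v)
      then show ?thesis by (simp add: algebra_simps)
    qed
    then have "norm ((\<lambda>t. F (x + t *\<^sub>R b)) c - (\<lambda>t. F (x + t *\<^sub>R b)) 0) \<le> B * norm (c - 0)"
      by (intro differentiable_bound[where S=UNIV and f'="\<lambda>u h. h *\<^sub>R v (x + u *\<^sub>R b)"])
        (auto simp: has_vector_derivative_def v(2) intro!: onorm_bound B mult_left_mono
          simp: mult.commute[of B])
    then show ?thesis by simp
  qed
  have part: "norm (F (x + (\<Sum>b\<in>S. c b *\<^sub>R b)) - F x) \<le> B * (\<Sum>b\<in>S. \<bar>c b\<bar>)" if "S \<subseteq> Basis" for S c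
    using finite_subset[OF that finite_Basis] that
  proof (induction S rule: finite_induct)
    case (insert b S)
    have "norm (F (x + (\<Sum>b\<in>S. c b *\<^sub>R b) + c b *\<^sub>R b) - F (x + (\<Sum>b\<in>S. c b *\<^sub>R b))) \<le> B * \<bar>c b\<bar>"
      using insert.prems by (intro line) auto
    then have "norm ((F (x + (\<Sum>b\<in>S. c b *\<^sub>R b) + c b *\<^sub>R b) - F (x + (\<Sum>b\<in>S. c b *\<^sub>R b))) +
        (F (x + (\<Sum>b\<in>S. c b *\<^sub>R b)) - F x)) \<le> B * \<bar>c b\<bar> + B * (\<Sum>b\<in>S. \<bar>c b\<bar>)"
      using insert by (intro norm_triangle_mono) auto
    then show ?case using insert by (simp add: algebra_simps)
  qed simp
  have "norm (F (x + (\<Sum>b\<in>Basis. ((y - x) \<bullet> b) *\<^sub>R b)) - F x) \<le> B * (\<Sum>b\<in>Basis. \<bar>(y - x) \<bullet> b\<bar>)"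
    by (rule part) simp
  also have "\<dots> \<le> B * (\<Sum>b\<in>(Basis::'a set). dist x y)"
    by (intro mult_left_mono sum_mono B) (simp add: dist_norm norm_minus_commute[of x] Basis_le_norm)
  finally show ?thesis
    by (simp add: euclidean_representation norm_minus_commute mult.assoc)
qed

lemma smooth_bd_lipschitz:
  fixes F :: "'a::euclidean_space \<Rightarrow> complex"
  assumes "smooth_bd K R A F" "1 \<le> K"
  shows "norm (F x - F y) \<le> R * A * real DIM('a) * dist x y"
proof (rule lipschitz_of_bounded_partials)
  obtain k where k: "K = Suc k" using assms(2) by (cases K) auto
  show "\<exists>v. ((\<lambda>t. F (x + t *\<^sub>R b)) has_vector_derivative v) (at 0) \<and> norm v \<le> R * A"
    if "b \<in> Basis" for x b
    using assms(1) that smooth_bd_bound unfolding k smooth_bd.simps by blast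
qed

lemma K_atom_lipschitz:
  fixes a :: "'a::euclidean_space \<Rightarrow> complex"
  assumes "K_atom d K j m a" "1 \<le> K"
  shows "norm (a x - a y) \<le> 2 ^ j * real DIM('a) * dist x y"
proof (rule lipschitz_of_bounded_partials)
  fix x b :: 'a assume b: "b \<in> Basis"
  have "(\<lambda>t. iter_partial [] a (x + t *\<^sub>R b)) differentiable (at 0)"
    using assms b unfolding K_atom_def C_class_def
    by (metis empty_subsetI length_0_conv less_le_trans list.set(1) zero_le zero_less_one)
  then have "((\<lambda>t. a (x + t *\<^sub>R b)) has_vector_derivative
      vector_derivative (\<lambda>t. a (x + t *\<^sub>R b)) (at 0)) (at 0)"
    by (simp add: vector_derivative_works)
  moreover have "norm (iter_partial [b] a x) \<le> 2 ^ (length [b] * j)"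
    using assms b unfolding K_atom_def by (metis bot.extremum insert_subset length_0_conv
        length_Suc_conv list.set(1) list.simps(15) One_nat_def)
  ultimately show "\<exists>v. ((\<lambda>t. a (x + t *\<^sub>R b)) has_vector_derivative v) (at 0) \<and> norm v \<le> 2 ^ j"
    by auto
qed

section \<open>Smooth partitions of unity on dyadic lattices\<close>

lemma power_dvd_pderiv:
  assumes "q ^ Suc n dvd (p :: real poly)"
  shows "q ^ n dvd pderiv p"
proof -
  obtain c where "p = q ^ Suc n * c" using assms by (elim dvdE)
  then have "pderiv p = q ^ n * (q * pderiv c + smult (of_nat (Suc n)) (pderiv q * c))"
    unfolding \<open>p = _\<close> pderiv_mult pderiv_power_Suc by (simp add: algebra_simps)
  then show ?thesis by simp
qed

lemma power_dvd_funpow_pderiv: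
  "q ^ (n + r) dvd (p :: real poly) \<Longrightarrow> q ^ n dvd (pderiv ^^ r) p"
proof (induction r arbitrary: n)
  case (Suc r)
  then have "q ^ Suc n dvd (pderiv ^^ r) p" by (intro Suc.IH) simp
  then show ?case using power_dvd_pderiv by simp
qed simp

text \<open>The polynomial \<open>1 - (1 - t\<^sup>M)\<^sup>M\<close> equals 0 at 0 and 1 at 1, and its derivatives of order below
  \<open>M\<close> vanish at both points.\<close>

lemma smooth_step_poly:
  "\<exists>Q :: real poly. \<forall>r\<le>n. poly ((pderiv ^^ r) Q) 0 = 0 \<and>
     poly ((pderiv ^^ r) Q) 1 = (if r = 0 then 1 else 0)"
proof -
  define M where "M = Suc n"
  define X where "X = ([:0, 1:] :: real poly)"
  define Q where "Q = 1 - (1 - X ^ M) ^ M"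
  have dvd0: "[:- 0, 1:] ^ M dvd Q"
    using one_diff_power_eq[of "1 - X ^ M" M] by (simp add: Q_def X_def)
  have "(1 - X) dvd 1 - X ^ M" using one_diff_power_eq[of X M] by simp
  moreover have "[:- 1, 1:] dvd 1 - X"
  proof -
    have "1 - X = [:- 1, 1:] * - 1" by (simp add: X_def one_pCons)
    then show ?thesis by (rule dvdI)
  qed
  ultimately have dvd1: "[:- 1, 1:] ^ M dvd (1 - X ^ M) ^ M"
    by (intro dvd_power_same) (rule dvd_trans)
  have root: "poly ((pderiv ^^ r) p) a = 0" if "[:- a, 1:] ^ M dvd p" "r \<le> n" for a :: real and p r
  proof -
    have "[:- a, 1:] ^ Suc (n - r) dvd (pderiv ^^ r) p"
      by (rule power_dvd_funpow_pderiv) (use that in \<open>simp add: M_def\<close>)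
    then have "[:- a, 1:] dvd (pderiv ^^ r) p"
      by (metis dvd_trans dvd_triv_left power_Suc)
    then show ?thesis by (simp add: poly_eq_0_iff_dvd)
  qed
  have "(pderiv ^^ Suc r) Q = - (pderiv ^^ Suc r) ((1 - X ^ M) ^ M)" for r
    by (induction r) (auto simp: Q_def pderiv_diff pderiv_minus)
  then have "(pderiv ^^ r) Q = (if r = 0 then 1 else 0) - (pderiv ^^ r) ((1 - X ^ M) ^ M)" for r
    by (cases r) (auto simp: Q_def)
  then show ?thesis
    using root[OF dvd0] root[OF dvd1] by (intro exI[of _ Q]) auto
qed

lemma has_real_derivative_join:
  fixes f g :: "real \<Rightarrow> real"
  assumes "\<And>t. (f has_real_derivative f' t) (at t)" "\<And>t. (g has_real_derivative g' t) (at t)"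
    and "f a = g a" "f' a = g' a"
  shows "((\<lambda>t. if t \<le> a then f t else g t) has_real_derivative (if t \<le> a then f' t else g' t)) (at t)"
proof -
  have "((\<lambda>t. if t \<in> {..a} then f t else g t) has_vector_derivative (if t \<in> {..a} then f' t else g' t))
      (at t within UNIV)"
  proof (rule has_vector_derivative_If_within_closures[where T="{a<..}"])
    show "f t = g t" "f' t = g' t" if "t \<in> closure {..a}" "t \<in> closure {a<..}"
      using that assms by (auto simp: closure_greaterThan)
  qed (use assms in \<open>auto simp: has_real_derivative_iff_has_vector_derivative
        intro: has_vector_derivative_at_within\<close>)
  then show ?thesis by (simp add: has_real_derivative_iff_has_vector_derivative)
qed

lemma smooth_step:
  "\<exists>(H :: nat \<Rightarrow> real \<Rightarrow> real) A. (\<forall>r\<le>K. \<forall>t. (H r has_real_derivative H (Suc r) t) (at t)) \<and>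
    (\<forall>t\<le>0. H 0 t = 0) \<and> (\<forall>t\<ge>1. H 0 t = 1) \<and> (\<forall>r\<le>K. \<forall>t. \<bar>H r t\<bar> \<le> A)"
proof -
  obtain Q :: "real poly" where Q: "\<forall>r\<le>Suc K. poly ((pderiv ^^ r) Q) 0 = 0 \<and>
     poly ((pderiv ^^ r) Q) 1 = (if r = 0 then 1 else 0)"
    using smooth_step_poly by blast
  define H :: "nat \<Rightarrow> real \<Rightarrow> real" where "H = (\<lambda>r t. if t \<le> 0 then 0 else if t \<le> 1
    then poly ((pderiv ^^ r) Q) t else if r = 0 then 1 else 0)"
  have H': "(H r has_real_derivative H (Suc r) t) (at t)" if "r \<le> K" for r t
    unfolding H_def using that Q
    by (intro has_real_derivative_join) (auto intro!: derivative_eq_intros)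
  have "\<exists>A. \<forall>t. \<bar>H r t\<bar> \<le> A" for r
  proof -
    have "compact ((\<lambda>t. poly ((pderiv ^^ r) Q) t) ` {0..1})"
      by (intro compact_continuous_image continuous_intros) auto
    from compact_imp_bounded[OF this] obtain B
      where B: "\<And>t. t \<in> {0..1} \<Longrightarrow> \<bar>poly ((pderiv ^^ r) Q) t\<bar> \<le> B"
      unfolding bounded_iff by (metis image_eqI real_norm_def)
    show ?thesis
    proof (intro exI[of _ "1 + \<bar>B\<bar>"] allI)
      fix t show "\<bar>H r t\<bar> \<le> 1 + \<bar>B\<bar>"
        using B[of t] by (auto simp: H_def)
    qed
  qed
  then obtain A where A: "\<And>r t. \<bar>H r t\<bar> \<le> A r" by metis
  have "\<bar>H r t\<bar> \<le> (\<Sum>r\<le>K. \<bar>A r\<bar>)" if "r \<le> K" for r t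
    using A[of r t] member_le_sum[of r "{..K}" "\<lambda>r. \<bar>A r\<bar>"] that by auto
  moreover have "\<forall>t\<ge>1. H 0 t = 1"
  proof (intro allI impI)
    fix t :: real assume "1 \<le> t"
    then consider "t = 1" | "1 < t" by linarith
    then show "H 0 t = 1"
      using Q[rule_format, of 0] by cases (auto simp: H_def)
  qed
  ultimately show ?thesis
    using H' by (intro exI[of _ H] exI[of _ "\<Sum>r\<le>K. \<bar>A r\<bar>"]) (auto simp: H_def)
qed

text \<open>The translates of \<open>h t = H (t + 1) - H t\<close> telescope, hence sum up to 1.\<close>

lemma smooth_hat:
  obtains h :: "nat \<Rightarrow> real \<Rightarrow> real" and A
    where "\<And>r t. r \<le> K \<Longrightarrow> (h r has_real_derivative h (Suc r) t) (at t)"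
    and "\<And>r t. r \<le> K \<Longrightarrow> \<bar>h r t\<bar> \<le> A"
    and "\<And>t. 1 \<le> \<bar>t\<bar> \<Longrightarrow> h 0 t = 0"
    and "\<And>t. h 0 (t - of_int \<lfloor>t\<rfloor>) + h 0 (t - of_int (\<lfloor>t\<rfloor> + 1)) = 1"
    and "\<And>t k. k \<noteq> \<lfloor>t\<rfloor> \<Longrightarrow> k \<noteq> \<lfloor>t\<rfloor> + 1 \<Longrightarrow> h 0 (t - of_int k) = 0"
proof -
  obtain H :: "nat \<Rightarrow> real \<Rightarrow> real" and A
    where H: "\<And>r t. r \<le> K \<Longrightarrow> (H r has_real_derivative H (Suc r) t) (at t)"
    and H0: "\<And>t. t \<le> 0 \<Longrightarrow> H 0 t = 0" and H1: "\<And>t. 1 \<le> t \<Longrightarrow> H 0 t = 1"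
    and A: "\<And>r t. r \<le> K \<Longrightarrow> \<bar>H r t\<bar> \<le> A"
    using smooth_step[of K] by metis
  define h where "h = (\<lambda>r t. H r (t + 1) - H r t)"
  have "(h r has_real_derivative h (Suc r) t) (at t)" if "r \<le> K" for r t
    unfolding h_def using H[OF that] DERIV_shift[of "H r" _ t 1]
    by (intro derivative_intros) auto
  moreover have "\<bar>h r t\<bar> \<le> 2 * A" if "r \<le> K" for r t
    using A[OF that, of "t + 1"] A[OF that, of t] by (simp add: h_def)
  moreover have h0: "h 0 t = 0" if "1 \<le> \<bar>t\<bar>" for t
  proof (cases "0 \<le> t")
    case True
    then show ?thesis using that H1[of t] H1[of "t + 1"] by (simp add: h_def)
  next
    case False
    then show ?thesis using that H0[of t] H0[of "t + 1"] by (simp add: h_def)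
  qed
  moreover have "h 0 (t - of_int \<lfloor>t\<rfloor>) + h 0 (t - of_int (\<lfloor>t\<rfloor> + 1)) = 1" for t
  proof -
    have "H 0 (t - of_int \<lfloor>t\<rfloor> + 1) = 1" by (rule H1) linarith
    moreover have "H 0 (t - of_int (\<lfloor>t\<rfloor> + 1)) = 0" by (rule H0) linarith
    moreover have "t - of_int (\<lfloor>t\<rfloor> + 1) + 1 = t - of_int \<lfloor>t\<rfloor>" by simp
    ultimately show ?thesis by (simp only: h_def)
  qed
  moreover have "h 0 (t - of_int k) = 0" if "k \<noteq> \<lfloor>t\<rfloor>" "k \<noteq> \<lfloor>t\<rfloor> + 1" for t and k :: int
  proof (rule h0)
    have "k \<le> \<lfloor>t\<rfloor> - 1 \<or> \<lfloor>t\<rfloor> + 2 \<le> k" using that by linarith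
    then show "1 \<le> \<bar>t - of_int k\<bar>" by linarith
  qed
  ultimately show ?thesis by (rule that[of h "2 * A"])
qed

lemma smooth_bd_ridge:
  fixes h :: "nat \<Rightarrow> real \<Rightarrow> real" and b' :: "'a::euclidean_space"
  assumes "\<And>r t. r \<le> L \<Longrightarrow> (h r has_real_derivative h (Suc r) t) (at t)"
    and "\<And>r t. r \<le> L \<Longrightarrow> \<bar>h r t\<bar> \<le> A" and "0 \<le> R" "b' \<in> Basis" "r + K \<le> L" "0 \<le> B"
  shows "smooth_bd K R (B * A) (\<lambda>x. of_real (B * h r (R * (x \<bullet> b') - c)))"
  using assms(5,6)
proof (induction K arbitrary: r B)
  case (0 r B)
  have "continuous_on UNIV (h r)"
    using assms(1)[of r] 0 by (auto intro!: continuous_at_imp_continuous_on DERIV_isCont)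
  then have "continuous_on UNIV (\<lambda>x::'a. h r (R * (x \<bullet> b') - c))"
    by (rule continuous_on_compose2[where f="\<lambda>x. R * (x \<bullet> b') - c"])
      (auto intro!: continuous_intros)
  then show ?case using assms(2)[of r] 0
    by (auto intro!: continuous_intros mult_left_mono simp: norm_mult)
next
  case (Suc K r B)
  have r: "r \<le> L" using Suc by simp
  have A: "0 \<le> A" using assms(2)[OF r, of 0] by linarith
  have "continuous_on UNIV (h r)"
    using assms(1)[of r] Suc by (auto intro!: continuous_at_imp_continuous_on DERIV_isCont)
  then have cont: "continuous_on UNIV (\<lambda>x::'a. h r (R * (x \<bullet> b') - c))"
    by (rule continuous_on_compose2[where f="\<lambda>x. R * (x \<bullet> b') - c"])
      (auto intro!: continuous_intros)
  show ?case
    unfolding smooth_bd.simps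
  proof (intro conjI ballI)
    show "continuous_on UNIV (\<lambda>x. of_real (B * h r (R * (x \<bullet> b') - c)) :: complex)"
      by (intro continuous_intros cont)
    show "\<forall>x. norm (of_real (B * h r (R * (x \<bullet> b') - c)) :: complex) \<le> B * A"
      using assms(2)[OF r] Suc.prems(2) by (auto simp: abs_mult intro!: mult_left_mono simp del: of_real_mult)
    fix b :: 'a assume b: "b \<in> Basis"
    show "\<exists>G. (\<forall>x. ((\<lambda>t. of_real (B * h r (R * ((x + t *\<^sub>R b) \<bullet> b') - c)) :: complex)
        has_vector_derivative G x) (at 0)) \<and> smooth_bd K R (R * (B * A)) G"
    proof (cases "b = b'")
      case True
      have "((\<lambda>t. of_real (B * h r (R * ((x + t *\<^sub>R b) \<bullet> b') - c)) :: complex)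
          has_vector_derivative of_real (R * B * h (Suc r) (R * (x \<bullet> b') - c))) (at 0)" for x
      proof -
        have "((\<lambda>t. h r (R * (x \<bullet> b' + t) - c)) has_real_derivative
            h (Suc r) (R * (x \<bullet> b' + 0) - c) * R) (at 0)"
          by (rule DERIV_chain2[of "h r"]) (auto intro!: derivative_eq_intros assms(1) r)
        then have "((\<lambda>t. B * h r (R * (x \<bullet> b' + t) - c)) has_real_derivative
            B * (h (Suc r) (R * (x \<bullet> b' + 0) - c) * R)) (at 0)"
          by (rule DERIV_cmult)
        then have "((\<lambda>t. B * h r (R * (x \<bullet> b' + t) - c)) has_real_derivative
            R * B * h (Suc r) (R * (x \<bullet> b') - c)) (at 0)"
          by (simp add: mult_ac)
        then show ?thesis
          using True b by (intro has_vector_derivative_of_real)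
            (simp add: inner_add_left inner_Basis has_real_derivative_iff_has_vector_derivative)
      qed
      moreover have "smooth_bd K R ((R * B) * A) (\<lambda>x. of_real ((R * B) * h (Suc r) (R * (x \<bullet> b') - c)))"
        using Suc.prems assms(3) by (intro Suc.IH) auto
      ultimately show ?thesis
        by (intro exI[of _ "\<lambda>x. of_real (R * B * h (Suc r) (R * (x \<bullet> b') - c))"])
          (simp add: mult.assoc del: of_real_mult)
    next
      case False
      then show ?thesis
        using b assms(3,4) A Suc.prems
        by (intro exI[of _ "\<lambda>x. 0"]) (auto simp: inner_add_left inner_Basis intro!: smooth_bd_zero)
    qed
  qed
qed

text \<open>The functions are products of one-dimensional hats, and the product over the coordinates of the
  sums over the integers expands into the sum over the lattice.\<close>

lemma smooth_dyadic_partition: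
  "\<exists>(\<eta> :: nat \<Rightarrow> 'a::euclidean_space \<Rightarrow> 'a \<Rightarrow> complex) A. 0 < A \<and>
    (\<forall>l k. smooth_bd K (2 ^ l) A (\<eta> l k)) \<and>
    (\<forall>l k x. \<eta> l k x \<noteq> 0 \<longrightarrow> x \<in> dcube 1 l k) \<and>
    (\<forall>l x S. finite S \<longrightarrow> S \<subseteq> int_lattice \<longrightarrow> {k \<in> int_lattice. x \<in> dcube 1 l k} \<subseteq> S \<longrightarrow>
      (\<Sum>k\<in>S. \<eta> l k x) = 1)"
proof (rule smooth_hat[of K])
  fix h :: "nat \<Rightarrow> real \<Rightarrow> real" and A :: real
  assume h: "\<And>r t. r \<le> K \<Longrightarrow> (h r has_real_derivative h (Suc r) t) (at t)"
    and A: "\<And>r t. r \<le> K \<Longrightarrow> \<bar>h r t\<bar> \<le> A"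
    and supp: "\<And>t. 1 \<le> \<bar>t\<bar> \<Longrightarrow> h 0 t = 0"
    and one: "\<And>t. h 0 (t - of_int \<lfloor>t\<rfloor>) + h 0 (t - of_int (\<lfloor>t\<rfloor> + 1)) = 1"
    and zero: "\<And>t k. k \<noteq> \<lfloor>t\<rfloor> \<Longrightarrow> k \<noteq> \<lfloor>t\<rfloor> + 1 \<Longrightarrow> h 0 (t - of_int k) = 0"
  have A0: "0 \<le> A" using A[of 0 0] by linarith
  define \<eta> :: "nat \<Rightarrow> 'a \<Rightarrow> 'a \<Rightarrow> complex"
    where "\<eta> = (\<lambda>l k x. \<Prod>b\<in>Basis. of_real (h 0 (2 ^ l * (x \<bullet> b) - k \<bullet> b)))"
  have bd: "smooth_bd K (2 ^ l) ((2 ^ K * A) ^ DIM('a) + 1) (\<eta> l k)" for l k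
  proof -
    have "smooth_bd K (2 ^ l) ((2 ^ K * A) ^ DIM('a)) (\<eta> l k)"
      unfolding \<eta>_def
    proof (intro smooth_bd_prod)
      fix b :: 'a assume "b \<in> Basis"
      then have "smooth_bd K (2 ^ l) (1 * A) (\<lambda>x. of_real (1 * h 0 (2 ^ l * (x \<bullet> b) - k \<bullet> b)))"
        by (intro smooth_bd_ridge[where L=K] h A) auto
      then show "smooth_bd K (2 ^ l) A (\<lambda>x. of_real (h 0 (2 ^ l * (x \<bullet> b) - k \<bullet> b)))"
        by (simp only: mult_1)
    qed auto
    then show ?thesis by (rule smooth_bd_mono) auto
  qed
  have supp': "x \<in> dcube 1 l k" if "\<eta> l k x \<noteq> 0" for l k x
    unfolding mem_dcube_iff
  proof
    fix b :: 'a assume "b \<in> Basis"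
    then have "h 0 (2 ^ l * (x \<bullet> b) - k \<bullet> b) \<noteq> 0" using that by (auto simp: \<eta>_def)
    then show "\<bar>2 ^ l * (x \<bullet> b) - k \<bullet> b\<bar> \<le> 1" using supp by force
  qed
  have sum: "(\<Sum>k\<in>S. \<eta> l k x) = 1"
    if S: "finite S" "S \<subseteq> int_lattice" "{k \<in> int_lattice. x \<in> dcube 1 l k} \<subseteq> S" for l x S
  proof -
    define B where "B = (\<lambda>b::'a. {\<lfloor>2 ^ l * (x \<bullet> b)\<rfloor>, \<lfloor>2 ^ l * (x \<bullet> b)\<rfloor> + 1})"
    define \<iota> where "\<iota> = (\<lambda>g. \<Sum>b\<in>(Basis::'a set). of_int (g b) *\<^sub>R b)"
    have \<iota>: "\<iota> g \<bullet> b = of_int (g b)" if "b \<in> Basis" for g b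
      using that by (simp add: \<iota>_def inner_sum_left_Basis)
    have inj: "inj_on \<iota> (PiE Basis B)"
    proof (rule inj_onI)
      fix f g assume f: "f \<in> PiE Basis B" and g: "g \<in> PiE Basis B" and eq: "\<iota> f = \<iota> g"
      show "f = g" by (rule PiE_ext[OF f g]) (use \<iota>[of _ f] \<iota>[of _ g] eq in force)
    qed
    have "(\<Prod>b\<in>Basis. \<Sum>i\<in>B b. h 0 (2 ^ l * (x \<bullet> b) - of_int i)) = (\<Prod>b\<in>(Basis::'a set). 1)"
      using one by (intro prod.cong) (auto simp: B_def)
    moreover have "(\<Prod>b\<in>Basis. \<Sum>i\<in>B b. h 0 (2 ^ l * (x \<bullet> b) - of_int i)) =
        (\<Sum>g\<in>PiE Basis B. \<Prod>b\<in>Basis. h 0 (2 ^ l * (x \<bullet> b) - of_int (g b)))"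
      by (rule prod_sum_PiE) (auto simp: B_def)
    ultimately have "(\<Sum>g\<in>PiE Basis B. \<Prod>b\<in>Basis. h 0 (2 ^ l * (x \<bullet> b) - of_int (g b))) = 1"
      by simp
    then have "of_real (\<Sum>g\<in>PiE Basis B. \<Prod>b\<in>Basis. h 0 (2 ^ l * (x \<bullet> b) - of_int (g b))) = (1::complex)"
      by simp
    then have "(\<Sum>g\<in>PiE Basis B. \<eta> l (\<iota> g) x) = 1"
      by (simp add: \<eta>_def \<iota>)
    then have 1: "(\<Sum>k\<in>\<iota> ` PiE Basis B. \<eta> l k x) = 1"
      by (simp add: sum.reindex[OF inj])
    have fin: "finite (\<iota> ` PiE Basis B)" by (auto simp: B_def intro!: finite_PiE)
    have lat: "\<iota> g \<in> int_lattice" for g by (simp add: int_lattice_def \<iota>)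
    have "\<eta> l k x = 0" if k: "k \<in> S" "k \<notin> \<iota> ` PiE Basis B" for k
    proof (rule ccontr)
      assume nz: "\<eta> l k x \<noteq> 0"
      have kb: "k \<bullet> b = of_int \<lfloor>k \<bullet> b\<rfloor>" if "b \<in> Basis" for b
        using S(2) k(1) that by (auto simp: int_lattice_def elim!: Ints_cases)
      have "\<lfloor>k \<bullet> b\<rfloor> \<in> B b" if b: "b \<in> Basis" for b
      proof (rule ccontr)
        assume "\<lfloor>k \<bullet> b\<rfloor> \<notin> B b"
        then have "h 0 (2 ^ l * (x \<bullet> b) - of_int \<lfloor>k \<bullet> b\<rfloor>) = 0" by (intro zero) (auto simp: B_def)
        with nz kb[OF b] b show False by (auto simp: \<eta>_def)
      qed
      then have "restrict (\<lambda>b. \<lfloor>k \<bullet> b\<rfloor>) Basis \<in> PiE Basis B" by auto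
      moreover have "\<iota> (restrict (\<lambda>b. \<lfloor>k \<bullet> b\<rfloor>) Basis) = k"
        by (rule euclidean_eqI) (simp add: \<iota> kb[symmetric])
      ultimately show False using k(2) by (metis image_eqI)
    qed
    moreover have "\<eta> l k x = 0" if "k \<in> \<iota> ` PiE Basis B" "k \<notin> S" for k
      using that S(3) supp'[of l k x] lat by blast
    ultimately have "(\<Sum>k\<in>S. \<eta> l k x) = (\<Sum>k\<in>\<iota> ` PiE Basis B. \<eta> l k x)"
      by (intro sum.mono_neutral_cong S(1) fin) auto
    then show ?thesis using 1 by simp
  qed
  show ?thesis
    using bd supp' sum A0 by (intro exI[of _ \<eta>] exI[of _ "(2 ^ K * A) ^ DIM('a) + 1"]) (auto intro!: add_nonneg_pos)
qed

section \<open>Hausdorff measure is a Borel measure\<close>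

text \<open>Caratheodory's criterion. The part of \<open>A\<close> off \<open>C\<close> is exhausted by sets \<open>D n\<close> at a positive
  distance from \<open>C\<close>. Every other ring \<open>R k = D (k + 1) - D k\<close> is separated from the previous ones,
  so the outer measures of the rings have a finite sum and the exhaustion loses nothing.\<close>

lemma metric_outer_measure_closed:
  fixes \<nu> :: "'a::metric_space set \<Rightarrow> ennreal"
  assumes mono: "\<And>A B. A \<subseteq> B \<Longrightarrow> \<nu> A \<le> \<nu> B"
    and subadd: "\<And>A :: nat \<Rightarrow> 'a set. \<nu> (\<Union>i. A i) \<le> (\<Sum>i. \<nu> (A i))"
    and sep: "\<And>A B e. 0 < e \<Longrightarrow> (\<And>x y. x \<in> A \<Longrightarrow> y \<in> B \<Longrightarrow> e \<le> dist x y) \<Longrightarrow> \<nu> A + \<nu> B \<le> \<nu> (A \<union> B)"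
    and "closed C" "C \<noteq> {}"
  shows "\<nu> (A \<inter> C) + \<nu> (A - C) \<le> \<nu> A"
proof (cases "\<nu> A = top")
  case False
  define D where "D n = {x \<in> A. 1 / real (Suc n) \<le> infdist x C}" for n
  define R where "R k = D (Suc k) - D k" for k
  have R: "1 / real (Suc (Suc k)) \<le> infdist x C" "infdist x C < 1 / real (Suc k)" "x \<in> A"
    if "x \<in> R k" for x k
    using that by (auto simp: R_def D_def not_le)
  have D_mono: "D m \<subseteq> D n" if "m \<le> n" for m n
  proof -
    have "1 / real (Suc n) \<le> 1 / real (Suc m)" using that by (intro divide_left_mono) auto
    then show ?thesis by (auto simp: D_def)
  qed
  have rings: "(\<Sum>k<n. \<nu> (R (2 * k + p))) \<le> \<nu> (\<Union>k<n. R (2 * k + p))" for n p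
  proof (induction n)
    case (Suc n)

    have "(\<Sum>k<Suc n. \<nu> (R (2 * k + p))) \<le> \<nu> (\<Union>k<n. R (2 * k + p)) + \<nu> (R (2 * n + p))"
      using Suc by (simp add: add_right_mono)
    also have "\<dots> \<le> \<nu> ((\<Union>k<n. R (2 * k + p)) \<union> R (2 * n + p))"
    proof (rule sep)
      \<comment> \<open>For \<open>2 * n + p = 0\<close> there are no previous rings to be separated from, and as \<open>1 / 0 = 0\<close> the
        difference would be negative.\<close>
      show "0 < (if 2 * n + p = 0 then 1 else 1 / real (2 * n + p) - 1 / real (Suc (2 * n + p)))"
        by (auto simp: field_simps)
      fix x y assume "x \<in> (\<Union>k<n. R (2 * k + p))" and y: "y \<in> R (2 * n + p)"
      then obtain k where k: "k < n" "x \<in> R (2 * k + p)" by auto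
      have "1 / real (2 * n + p) \<le> 1 / real (Suc (Suc (2 * k + p)))"
        using k(1) by (intro divide_left_mono) auto
      then have "1 / real (2 * n + p) - 1 / real (Suc (2 * n + p)) \<le> infdist x C - infdist y C"
        using R(1)[OF k(2)] R(2)[OF y] by linarith
      also have "\<dots> \<le> dist x y" using infdist_triangle[of x C y] by linarith
      finally show "(if 2 * n + p = 0 then 1 else 1 / real (2 * n + p) - 1 / real (Suc (2 * n + p)))
          \<le> dist x y"
        using k(1) by simp
    qed
    also have "(\<Union>k<n. R (2 * k + p)) \<union> R (2 * n + p) = (\<Union>k<Suc n. R (2 * k + p))"
      by (auto simp: less_Suc_eq)
    finally show ?case .
  qed simp
  define T where "T = (\<Sum>k. \<nu> (R k))"
  have partial: "(\<Sum>k<n. \<nu> (R k)) \<le> 2 * \<nu> A" for n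
  proof -
    have "(\<Sum>k<n. \<nu> (R k)) \<le> (\<Sum>k<2 * n. \<nu> (R k))" by (intro sum_mono2) auto
    also have "\<dots> = (\<Sum>k<n. \<nu> (R (2 * k + 0))) + (\<Sum>k<n. \<nu> (R (2 * k + 1)))"
      by (induction n) (auto simp: ac_simps)
    also have "\<dots> \<le> \<nu> A + \<nu> A"
      using R(3) by (intro add_mono order_trans[OF rings] mono) auto
    finally show ?thesis by (simp add: mult_2)
  qed
  have "T \<le> 2 * \<nu> A"
    unfolding T_def suminf_eq_SUP by (intro SUP_least partial)
  then have T: "T \<noteq> top" using False by (auto simp: top_unique ennreal_mult_eq_top_iff)
  have tail: "\<nu> (A - C) \<le> \<nu> (D n) + (\<Sum>k. \<nu> (R (k + n)))" for n
  proof -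
    have "A - C \<subseteq> (\<Union>i. case_nat (D n) (\<lambda>k. R (k + n)) i)"
    proof
      fix x assume x: "x \<in> A - C"
      then have "0 < infdist x C"
        using in_closed_iff_infdist_zero[OF assms(4,5), of x] infdist_nonneg[of x C] by auto
      then obtain m where "1 / real (Suc m) < infdist x C" using nat_approx_posE by metis
      then have "x \<in> D m" using x by (auto simp: D_def)
      define l where "l = (LEAST m. x \<in> D m)"
      have l: "x \<in> D l" unfolding l_def by (rule LeastI[of _ m]) fact
      show "x \<in> (\<Union>i. case_nat (D n) (\<lambda>k. R (k + n)) i)"
      proof (cases "l \<le> n")
        case True
        then have "x \<in> case_nat (D n) (\<lambda>k. R (k + n)) 0" using l D_mono by auto
        then show ?thesis by (rule UN_I[OF UNIV_I])
      next
        case False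
        then obtain k where k: "l = Suc (k + n)"
          by (metis add.commute less_imp_Suc_add not_le_imp_less)
        have "x \<notin> D (k + n)" using not_less_Least[of "k + n" "\<lambda>m. x \<in> D m"] k by (auto simp: l_def)
        then have "x \<in> case_nat (D n) (\<lambda>k. R (k + n)) (Suc k)" using l k by (simp add: R_def)
        then show ?thesis by (rule UN_I[OF UNIV_I])
      qed
    qed
    then have "\<nu> (A - C) \<le> (\<Sum>i. \<nu> (case_nat (D n) (\<lambda>k. R (k + n)) i))"
      by (intro order_trans[OF mono subadd])
    also have "\<dots> = \<nu> (D n) + (\<Sum>k. \<nu> (R (k + n)))"
      by (subst suminf_offset[of _ 1]) (auto simp: add.commute)
    finally show ?thesis .
  qed
  have "\<nu> (A \<inter> C) + \<nu> (A - C) + (\<Sum>k<n. \<nu> (R k)) \<le> \<nu> A + T" for n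
  proof -
    have "\<nu> (A \<inter> C) + \<nu> (D n) \<le> \<nu> (A \<inter> C \<union> D n)"
    proof (rule sep)
      show "0 < 1 / real (Suc n)" by simp
      show "1 / real (Suc n) \<le> dist x y" if "x \<in> A \<inter> C" "y \<in> D n" for x y
        using that infdist_le[of x C y] by (auto simp: D_def dist_commute)
    qed
    also have "\<dots> \<le> \<nu> A" by (intro mono) (auto simp: D_def)
    finally have 1: "\<nu> (A \<inter> C) + \<nu> (D n) \<le> \<nu> A" .
    have "\<nu> (A \<inter> C) + \<nu> (A - C) + (\<Sum>k<n. \<nu> (R k)) \<le>
        \<nu> (A \<inter> C) + (\<nu> (D n) + (\<Sum>k. \<nu> (R (k + n)))) + (\<Sum>k<n. \<nu> (R k))"
      by (intro add_mono tail order_refl)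
    also have "\<dots> = (\<nu> (A \<inter> C) + \<nu> (D n)) + T"
      unfolding T_def by (subst suminf_offset[of "\<lambda>k. \<nu> (R k)" n]) (auto simp: ac_simps)
    also have "\<dots> \<le> \<nu> A + T" by (intro add_mono 1 order_refl)
    finally show ?thesis .
  qed
  then have "\<nu> (A \<inter> C) + \<nu> (A - C) + T \<le> \<nu> A + T"
    unfolding T_def[unfolded suminf_eq_SUP]
    by (subst ennreal_SUP_add_right) (auto intro!: SUP_least)
  then have "T + (\<nu> (A \<inter> C) + \<nu> (A - C)) \<le> T + \<nu> A" by (simp only: add.commute)
  then show ?thesis using T by (simp only: ennreal_add_left_cancel_le) simp
qed simp

lemma metric_outer_measure_space:
  fixes \<nu> :: "'a::metric_space set \<Rightarrow> ennreal"
  assumes empty: "\<nu> {} = 0" and mono: "\<And>A B. A \<subseteq> B \<Longrightarrow> \<nu> A \<le> \<nu> B"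
    and subadd: "\<And>A :: nat \<Rightarrow> 'a set. \<nu> (\<Union>i. A i) \<le> (\<Sum>i. \<nu> (A i))"
    and sep: "\<And>A B e. 0 < e \<Longrightarrow> (\<And>x y. x \<in> A \<Longrightarrow> y \<in> B \<Longrightarrow> e \<le> dist x y) \<Longrightarrow> \<nu> A + \<nu> B \<le> \<nu> (A \<union> B)"
    and A: "A \<in> sets borel"
  shows "emeasure (measure_of UNIV (sets borel) \<nu>) A = \<nu> A"
proof -
  let ?L = "lambda_system UNIV (UNIV :: 'a set set) \<nu>"
  have "outer_measure_space (Pow UNIV) \<nu>"
    unfolding outer_measure_space_def positive_def increasing_def countably_subadditive_def
    by (simp add: empty mono subadd)
  then have L: "measure_space UNIV ?L \<nu>"
    using sigma_algebra.caratheodory_lemma[OF sigma_algebra_Pow, of UNIV \<nu>] by simp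
  have "Collect closed \<subseteq> ?L"
  proof
    fix C :: "'a set" assume "C \<in> Collect closed"
    then have C: "closed C" by simp
    have "\<nu> (C \<inter> A) + \<nu> ((UNIV - C) \<inter> A) = \<nu> A" for A :: "'a set"
    proof (rule antisym)
      show "\<nu> (C \<inter> A) + \<nu> ((UNIV - C) \<inter> A) \<le> \<nu> A"
      proof (cases "C = {}")
        case False
        have "(UNIV - C) \<inter> A = A - C" by auto
        then show ?thesis
          using metric_outer_measure_closed[where \<nu>=\<nu> and A=A, OF mono subadd sep C False]
          by (simp add: Int_commute)
      qed (simp add: empty)
      have "A = (\<Union>i::nat. if i = 0 then C \<inter> A else if i = 1 then (UNIV - C) \<inter> A else {})"
        by (auto split: if_splits)
      then have "\<nu> A \<le> (\<Sum>i::nat. \<nu> (if i = 0 then C \<inter> A else if i = 1 then (UNIV - C) \<inter> A else {}))"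
        using subadd by metis
      also have "\<dots> = (\<Sum>i\<in>{0, 1::nat}. \<nu> (if i = 0 then C \<inter> A else if i = 1 then (UNIV - C) \<inter> A else {}))"
        by (rule suminf_finite) (auto simp: empty)
      finally show "\<nu> A \<le> \<nu> (C \<inter> A) + \<nu> ((UNIV - C) \<inter> A)" by simp
    qed
    then show "C \<in> ?L" by (simp add: lambda_system_def)
  qed
  moreover have "sigma_algebra UNIV ?L" using L by (simp add: measure_space_def)
  ultimately have borel: "sets borel \<subseteq> ?L"
    unfolding borel_eq_closed by (simp add: sigma_algebra.sigma_sets_subset)
  have "countably_additive (sets borel) \<nu>"
    unfolding countably_additive_def
  proof (intro allI impI)
    fix F :: "nat \<Rightarrow> 'a set" assume "range F \<subseteq> sets borel" "disjoint_family F" "(\<Union>i. F i) \<in> sets borel"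
    then show "(\<Sum>i. \<nu> (F i)) = \<nu> (\<Union>i. F i)"
      using L borel unfolding measure_space_def countably_additive_def by (meson subset_trans subsetD)
  qed
  moreover have "sigma_algebra UNIV (sets (borel :: 'a measure))"
    using sets.sigma_algebra_axioms[of "borel :: 'a measure"] by simp
  ultimately show ?thesis
    using A empty by (intro emeasure_measure_of_sigma) (auto simp: positive_def)
qed

definition hausdorff_gauge :: "nat \<Rightarrow> 'a::metric_space set \<Rightarrow> ennreal" where
  "hausdorff_gauge k V =
     (if V = {} then 0 else ennreal (unit_ball_vol (real k) * (diameter V / 2) ^ k))"

lemma hausdorff_premeasure_le:
  assumes "A \<subseteq> (\<Union>i. U i)" "\<And>i::nat. bounded (U i)" "\<And>i. diameter (U i) \<le> \<delta>"
  shows "hausdorff_premeasure k \<delta> A \<le> (\<Sum>i. hausdorff_gauge k (U i))"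
  unfolding hausdorff_premeasure_def hausdorff_gauge_def using assms by (intro INF_lower) auto

lemma hausdorff_premeasure_greatest:
  assumes "\<And>U. A \<subseteq> (\<Union>i::nat. U i) \<Longrightarrow> (\<And>i. bounded (U i)) \<Longrightarrow> (\<And>i. diameter (U i) \<le> \<delta>) \<Longrightarrow>
    z \<le> (\<Sum>i. hausdorff_gauge k (U i))"
  shows "z \<le> hausdorff_premeasure k \<delta> A"
  unfolding hausdorff_premeasure_def using assms
  by (intro INF_greatest) (auto simp: hausdorff_gauge_def)

lemma hausdorff_premeasure_mono:
  "A \<subseteq> B \<Longrightarrow> \<delta>' \<le> \<delta> \<Longrightarrow> hausdorff_premeasure k \<delta> A \<le> hausdorff_premeasure k \<delta>' B"
  by (rule hausdorff_premeasure_greatest, rule hausdorff_premeasure_le) (blast, blast, metis order_trans)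

lemma hausdorff_premeasure_le_gauge:
  assumes "0 < \<delta>" "bounded V" "diameter V \<le> \<delta>"
  shows "hausdorff_premeasure k \<delta> V \<le> hausdorff_gauge k V"
proof -
  have "hausdorff_premeasure k \<delta> V \<le> (\<Sum>i::nat. hausdorff_gauge k (if i = 0 then V else {}))"
    using assms by (intro hausdorff_premeasure_le) (auto split: if_splits)
  also have "\<dots> = (\<Sum>i\<in>{0::nat}. hausdorff_gauge k (if i = 0 then V else {}))"
    by (rule suminf_finite) (auto simp: hausdorff_gauge_def)
  finally show ?thesis by simp
qed

lemma hausdorff_premeasure_empty: "0 < \<delta> \<Longrightarrow> hausdorff_premeasure k \<delta> {} = 0"
  using hausdorff_premeasure_le_gauge[of \<delta> "{}" k] by (simp add: hausdorff_gauge_def)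

lemma hausdorff_premeasure_countable_subadditive:
  "hausdorff_premeasure k \<delta> (\<Union>i::nat. A i) \<le> (\<Sum>i. hausdorff_premeasure k \<delta> (A i))"
proof (rule ennreal_le_epsilon)
  fix e :: real assume fin: "(\<Sum>i. hausdorff_premeasure k \<delta> (A i)) < top" and e: "0 < e"
  have "\<exists>U. A i \<subseteq> (\<Union>n. U n) \<and> (\<forall>n::nat. bounded (U n) \<and> diameter (U n) \<le> \<delta>) \<and>
      (\<Sum>n. hausdorff_gauge k (U n)) \<le> hausdorff_premeasure k \<delta> (A i) + ennreal (e * (1 / 2) ^ Suc i)" for i
  proof (rule ccontr)
    assume neg: "\<not> ?thesis"
    have "hausdorff_premeasure k \<delta> (A i) + ennreal (e * (1 / 2) ^ Suc i) \<le> hausdorff_premeasure k \<delta> (A i)"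
      using neg by (intro hausdorff_premeasure_greatest) (meson linear)
    moreover have "hausdorff_premeasure k \<delta> (A i) < top"
      using fin ennreal_suminf_lessD by blast
    moreover have "0 < ennreal (e * (1 / 2) ^ Suc i)" using e by simp
    ultimately show False
      by (metis add.right_neutral ennreal_add_left_cancel_le leD order_less_le infinity_ennreal_def)
  qed
  then obtain U where U: "\<And>i. A i \<subseteq> (\<Union>n. U i n)" "\<And>i n::nat. bounded (U i n)"
    "\<And>i n. diameter (U i n) \<le> \<delta>"
    "\<And>i. (\<Sum>n. hausdorff_gauge k (U i n)) \<le> hausdorff_premeasure k \<delta> (A i) + ennreal (e * (1 / 2) ^ Suc i)"
    by metis
  define V where "V n = (case prod_decode n of (i, j) \<Rightarrow> U i j)" for n
  have "hausdorff_premeasure k \<delta> (\<Union>i. A i) \<le> (\<Sum>n. hausdorff_gauge k (V n))"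
  proof (rule hausdorff_premeasure_le)
    show "(\<Union>i. A i) \<subseteq> (\<Union>n. V n)"
    proof
      fix x assume "x \<in> (\<Union>i. A i)"
      then obtain i j where "x \<in> U i j" using U(1) by blast
      then have "x \<in> V (prod_encode (i, j))" by (simp add: V_def)
      then show "x \<in> (\<Union>n. V n)" by blast
    qed
  qed (auto simp: V_def U split: prod.split)
  also have "\<dots> = (\<Sum>i. \<Sum>j. hausdorff_gauge k (U i j))"
    using suminf_ennreal_2dimen[of "\<lambda>i. \<Sum>j. hausdorff_gauge k (U i j)" "\<lambda>(i, j). hausdorff_gauge k (U i j)"]
    by (simp add: V_def case_prod_beta)
  also have "\<dots> \<le> (\<Sum>i. hausdorff_premeasure k \<delta> (A i) + ennreal (e * (1 / 2) ^ Suc i))"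
    by (intro suminf_le U) auto
  also have "\<dots> = (\<Sum>i. hausdorff_premeasure k \<delta> (A i)) + (\<Sum>i. ennreal (e * (1 / 2) ^ Suc i))"
    by (intro suminf_add[symmetric]) auto
  also have "(\<Sum>i. ennreal (e * (1 / 2) ^ Suc i)) = ennreal e"
    using power_half_series e sums_mult[OF power_half_series, of e]
    by (intro suminf_ennreal_eq) auto
  finally show "hausdorff_premeasure k \<delta> (\<Union>i. A i) \<le>
      (\<Sum>i. hausdorff_premeasure k \<delta> (A i)) + ennreal e" .
qed

lemma hausdorff_premeasure_finite_subadditive:
  assumes "0 < \<delta>" "finite I"
  shows "hausdorff_premeasure k \<delta> (\<Union>i\<in>I. A i) \<le> (\<Sum>i\<in>I. hausdorff_premeasure k \<delta> (A i))"
proof -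
  obtain f where f: "bij_betw f {..<card I} I"
    using assms(2) ex_bij_betw_nat_finite[of I] by (auto simp: atLeast0LessThan)
  have "hausdorff_premeasure k \<delta> (\<Union>i\<in>I. A i) =
      hausdorff_premeasure k \<delta> (\<Union>n. if n < card I then A (f n) else {})"
    using f by (intro arg_cong[where f="hausdorff_premeasure k \<delta>"])
      (auto simp: bij_betw_def split: if_splits; force)
  also have "\<dots> \<le> (\<Sum>n. hausdorff_premeasure k \<delta> (if n < card I then A (f n) else {}))"
    by (rule hausdorff_premeasure_countable_subadditive)
  also have "\<dots> = (\<Sum>n<card I. hausdorff_premeasure k \<delta> (if n < card I then A (f n) else {}))"
    using assms(1) by (intro suminf_finite) (auto simp: hausdorff_premeasure_empty)
  also have "\<dots> = (\<Sum>n<card I. hausdorff_premeasure k \<delta> (A (f n)))"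
    by (intro sum.cong) auto
  also have "\<dots> = (\<Sum>i\<in>I. hausdorff_premeasure k \<delta> (A i))"
    by (rule sum.reindex_bij_betw[OF f])
  finally show ?thesis .
qed

lemma hausdorff_premeasure_le_outer: "0 < \<delta> \<Longrightarrow> hausdorff_premeasure k \<delta> A \<le> hausdorff_outer k A"
  unfolding hausdorff_outer_def by (intro SUP_upper) auto

lemma hausdorff_outer_least:
  "(\<And>\<delta>. 0 < \<delta> \<Longrightarrow> hausdorff_premeasure k \<delta> A \<le> z) \<Longrightarrow> hausdorff_outer k A \<le> z"
  unfolding hausdorff_outer_def by (intro SUP_least) auto

lemma hausdorff_outer_mono: "A \<subseteq> B \<Longrightarrow> hausdorff_outer k A \<le> hausdorff_outer k B"
  by (rule hausdorff_outer_least)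
    (meson hausdorff_premeasure_le_outer hausdorff_premeasure_mono order_refl order_trans)

lemma hausdorff_outer_countable_subadditive:
  "hausdorff_outer k (\<Union>i::nat. A i) \<le> (\<Sum>i. hausdorff_outer k (A i))"
proof (rule hausdorff_outer_least)
  fix \<delta> :: real assume "0 < \<delta>"
  then show "hausdorff_premeasure k \<delta> (\<Union>i. A i) \<le> (\<Sum>i. hausdorff_outer k (A i))"
    by (intro order_trans[OF hausdorff_premeasure_countable_subadditive] suminf_le
        hausdorff_premeasure_le_outer) auto
qed

text \<open>A set of diameter less than the distance of \<open>A\<close> and \<open>B\<close> meets at most one of them, so every
  fine cover of the union splits into covers of the two.\<close>

lemma hausdorff_outer_separated:
  assumes e: "0 < e" and sep: "\<And>x y. x \<in> A \<Longrightarrow> y \<in> B \<Longrightarrow> e \<le> dist x y"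
  shows "hausdorff_outer k A + hausdorff_outer k B \<le> hausdorff_outer k (A \<union> B)"
proof -
  have split: "hausdorff_premeasure k \<delta> A + hausdorff_premeasure k \<delta> B \<le> hausdorff_premeasure k \<delta> (A \<union> B)"
    if \<delta>: "0 < \<delta>" "\<delta> < e" for \<delta>
  proof (rule hausdorff_premeasure_greatest)
    fix U :: "nat \<Rightarrow> 'a set"
    assume U: "A \<union> B \<subseteq> (\<Union>i. U i)" "\<And>i. bounded (U i)" "\<And>i. diameter (U i) \<le> \<delta>"
    have meets: "U i \<inter> A = {} \<or> U i \<inter> B = {}" for i
    proof (rule ccontr)
      assume "\<not> ?thesis"
      then obtain x y where "x \<in> U i" "x \<in> A" "y \<in> U i" "y \<in> B" by auto
      then show False
        using sep[of x y] diameter_bounded_bound[OF U(2), of x i y] U(3)[of i] \<delta> by auto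
    qed
    let ?U = "\<lambda>S i. if U i \<inter> S = {} then {} else U i"
    have cover: "hausdorff_premeasure k \<delta> S \<le> (\<Sum>i. hausdorff_gauge k (?U S i))" if S: "S \<subseteq> A \<union> B" for S
    proof (rule hausdorff_premeasure_le)
      show "S \<subseteq> (\<Union>i. ?U S i)"
      proof
        fix x assume "x \<in> S"
        then obtain i where "x \<in> U i" using U(1) S by blast
        then have "x \<in> ?U S i" using \<open>x \<in> S\<close> by auto
        then show "x \<in> (\<Union>i. ?U S i)" by blast
      qed
    qed (use U \<delta> in auto)
    have "hausdorff_premeasure k \<delta> A + hausdorff_premeasure k \<delta> B \<le>
        (\<Sum>i. hausdorff_gauge k (?U A i)) + (\<Sum>i. hausdorff_gauge k (?U B i))"
      by (intro add_mono cover) auto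
    also have "\<dots> = (\<Sum>i. hausdorff_gauge k (?U A i) + hausdorff_gauge k (?U B i))"
      by (intro suminf_add) auto
    also have "\<dots> \<le> (\<Sum>i. hausdorff_gauge k (U i))"
      using meets by (intro suminf_le) (auto simp: hausdorff_gauge_def)
    finally show "hausdorff_premeasure k \<delta> A + hausdorff_premeasure k \<delta> B \<le>
        (\<Sum>i. hausdorff_gauge k (U i))" .
  qed
  have both: "hausdorff_premeasure k \<delta>1 A + hausdorff_premeasure k \<delta>2 B \<le> hausdorff_outer k (A \<union> B)"
    if "0 < \<delta>1" "0 < \<delta>2" for \<delta>1 \<delta>2
  proof -
    define \<delta> where "\<delta> = min (e / 2) (min \<delta>1 \<delta>2)"
    have "0 < \<delta>" "\<delta> < e" "\<delta> \<le> \<delta>1" "\<delta> \<le> \<delta>2" using that e by (auto simp: \<delta>_def min_less_iff_disj)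
    then show ?thesis
      by (intro order_trans[OF add_mono order_trans[OF split hausdorff_premeasure_le_outer]]
          hausdorff_premeasure_mono) auto
  qed
  have "hausdorff_premeasure k \<delta>1 A + hausdorff_outer k B \<le> hausdorff_outer k (A \<union> B)" if "0 < \<delta>1" for \<delta>1
    unfolding hausdorff_outer_def[of k B]
    by (subst ennreal_SUP_add_right) (auto intro!: SUP_least both that)
  note one = this
  show ?thesis
    unfolding hausdorff_outer_def[of k A]
    by (subst ennreal_SUP_add_left[symmetric]) (auto intro!: SUP_least one)
qed

lemma emeasure_hausdorff_measure:
  assumes "A \<in> sets borel"
  shows "emeasure (hausdorff_measure k) A = hausdorff_outer k A"
  unfolding hausdorff_measure_def
proof (rule metric_outer_measure_space[OF _ _ _ _ assms])
  show "hausdorff_outer k {} = 0"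
    by (rule antisym[OF hausdorff_outer_least]) (auto simp: hausdorff_premeasure_empty)
qed (auto intro: hausdorff_outer_mono hausdorff_outer_countable_subadditive hausdorff_outer_separated)

lemma sets_hausdorff_measure [simp]: "sets (hausdorff_measure k) = sets borel"
  unfolding hausdorff_measure_def by (metis sets.sigma_sets_eq sets_measure_of space_borel top_greatest Pow_UNIV)

lemma space_hausdorff_measure [simp]: "space (hausdorff_measure k) = UNIV"
  using sets_eq_imp_space_eq[OF sets_hausdorff_measure] by simp

section \<open>Comparison with Lebesgue measure under bi-Lipschitz maps\<close>

text \<open>The map \<open>P\<close> takes a cover of the image back to a cover of \<open>E\<close>, and sends a set of diameter \<open>\<delta>\<close> into a
  ball of radius \<open>L \<delta>\<close>, whereas the gauge of that set is the volume of a ball of radius \<open>\<delta> / 2\<close>.\<close>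

lemma lebesgue_le_hausdorff_image:
  fixes \<Psi> :: "'b::euclidean_space \<Rightarrow> 'a::metric_space" and P :: "'a \<Rightarrow> 'b"
  assumes P: "\<And>x y. dist (P x) (P y) \<le> L * dist x y" and "\<And>y. y \<in> E \<Longrightarrow> P (\<Psi> y) = y"
    and "E \<in> sets borel" "0 < L"
  shows "emeasure lborel E \<le> ennreal ((2 * L) ^ DIM('b)) * hausdorff_outer DIM('b) (\<Psi> ` E)"
proof -
  let ?D = "DIM('b)"
  let ?c = "1 / (2 * L) ^ ?D"
  have "ennreal ?c * emeasure lborel E \<le> hausdorff_premeasure ?D 1 (\<Psi> ` E)"
  proof (rule hausdorff_premeasure_greatest)
    fix U :: "nat \<Rightarrow> 'a set"
    assume U: "\<Psi> ` E \<subseteq> (\<Union>i. U i)" "\<And>i. bounded (U i)"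
    define B where "B i = (if U i = {} then {} else cball (P (SOME x. x \<in> U i)) (L * diameter (U i)))" for i
    have "E \<subseteq> (\<Union>i. B i)"
    proof
      fix y assume y: "y \<in> E"
      then obtain i where i: "\<Psi> y \<in> U i" using U(1) by blast
      then have "(SOME x. x \<in> U i) \<in> U i" by (rule someI)
      then have "dist (SOME x. x \<in> U i) (\<Psi> y) \<le> diameter (U i)"
        using i U(2) by (intro diameter_bounded_bound) auto
      then have "dist (P (SOME x. x \<in> U i)) (P (\<Psi> y)) \<le> L * diameter (U i)"
        using P[of "SOME x. x \<in> U i" "\<Psi> y"] \<open>0 < L\<close> by (meson mult_le_cancel_left_pos order_trans)
      then have "y \<in> B i" using i assms(2)[OF y] by (auto simp: B_def)
      then show "y \<in> (\<Union>i. B i)" by blast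
    qed
    moreover have Bm: "range B \<subseteq> sets lborel" by (auto simp: B_def)
    ultimately have "emeasure lborel E \<le> emeasure lborel (\<Union>i. B i)"
      by (intro emeasure_mono) auto
    also have "\<dots> \<le> (\<Sum>i. emeasure lborel (B i))"
      using Bm by (rule emeasure_subadditive_countably)
    finally have "ennreal ?c * emeasure lborel E \<le> (\<Sum>i. ennreal ?c * emeasure lborel (B i))"
      by (simp add: mult_left_mono)
    also have "(\<lambda>i. ennreal ?c * emeasure lborel (B i)) = (\<lambda>i. hausdorff_gauge ?D (U i))"
    proof
      fix i
      have "0 \<le> diameter (U i)" using U(2) by (rule diameter_ge_0)
      then show "ennreal ?c * emeasure lborel (B i) = hausdorff_gauge ?D (U i)"
        using \<open>0 < L\<close> by (auto simp: B_def hausdorff_gauge_def emeasure_cball ennreal_mult'[symmetric]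
            power_mult_distrib power_divide)
    qed
    finally show "ennreal ?c * emeasure lborel E \<le> (\<Sum>i. hausdorff_gauge ?D (U i))" .
  qed
  also have "\<dots> \<le> hausdorff_outer ?D (\<Psi> ` E)" by (rule hausdorff_premeasure_le_outer) simp
  finally have "ennreal ((2 * L) ^ ?D) * (ennreal ?c * emeasure lborel E) \<le>
      ennreal ((2 * L) ^ ?D) * hausdorff_outer ?D (\<Psi> ` E)"
    by (rule mult_left_mono) simp
  moreover have "ennreal ((2 * L) ^ ?D) * (ennreal ?c * emeasure lborel E) = emeasure lborel E"
    using \<open>0 < L\<close> by (simp add: mult.assoc[symmetric] ennreal_mult'[symmetric])
  ultimately show ?thesis by simp
qed

text \<open>The cube is covered by dyadic cubes of a high level. Their number times the power of their side
  length is bounded independently of the level: at most \<open>2 * (x + 1) + 1\<close> lattice points per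
  coordinate direction are needed, and this is at most \<open>5 * x\<close> as soon as the level is so high that
  \<open>x = 2\<^sup>l r\<close> is at least 1.\<close>

lemma hausdorff_cube_image_le:
  fixes \<Psi> :: "'b::euclidean_space \<Rightarrow> 'a::euclidean_space"
  assumes \<Psi>: "\<And>x y. dist (\<Psi> x) (\<Psi> y) \<le> L * dist x y" and "0 < L" "0 < r"
  shows "hausdorff_outer DIM('b) (\<Psi> ` cbox (z - r *\<^sub>R One) (z + r *\<^sub>R One)) \<le>
    ennreal (unit_ball_vol DIM('b) * (5 * L * DIM('b)) ^ DIM('b) * r ^ DIM('b))"
proof (rule hausdorff_outer_least)
  let ?D = "DIM('b)"
  let ?Q = "cbox (z - r *\<^sub>R One) (z + r *\<^sub>R One)"
  fix \<delta> :: real assume \<delta>: "0 < \<delta>"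
  obtain l where l: "max (1 / r) (2 * L * real ?D / \<delta>) < 2 ^ l"
    using real_arch_pow[of 2 "max (1 / r) (2 * L * real ?D / \<delta>)"] by auto
  have l1: "1 \<le> 2 ^ l * r" and l2: "L * (real ?D * (2 * 1 / 2 ^ l)) \<le> \<delta>"
    using l \<delta> \<open>0 < r\<close> by (auto simp: field_simps)
  define I where "I = {k \<in> int_lattice. dcube 1 l k \<inter> ?Q \<noteq> {}}"
  have box: "\<bar>k \<bullet> b - (2 ^ l *\<^sub>R z) \<bullet> b\<bar> \<le> 2 ^ l * r + 1" if kb: "k \<in> I" "b \<in> Basis" for k b
  proof -
    obtain x where x: "x \<in> dcube 1 l k" "x \<in> ?Q" using kb(1) unfolding I_def by blast
    have "\<bar>x \<bullet> b - z \<bullet> b\<bar> \<le> r"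
      using x(2) kb(2) by (auto simp: mem_box inner_diff_left inner_add_left abs_le_iff algebra_simps)
    then have "2 ^ l * \<bar>x \<bullet> b - z \<bullet> b\<bar> \<le> 2 ^ l * r" by simp
    then have "\<bar>2 ^ l * (x \<bullet> b) - 2 ^ l * (z \<bullet> b)\<bar> \<le> 2 ^ l * r"
      by (simp add: abs_mult right_diff_distrib[symmetric])
    moreover have "\<bar>2 ^ l * (x \<bullet> b) - k \<bullet> b\<bar> \<le> 1" using x(1) kb(2) by (simp add: mem_dcube_iff)
    ultimately show ?thesis by simp
  qed
  have count: "finite I \<and> real (card I) \<le> (2 * (2 ^ l * r + 1) + 1) ^ ?D"
    using lattice_subset_box_count[of "2 ^ l * r + 1" I "2 ^ l *\<^sub>R z"] box \<open>0 < r\<close>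
    by (auto simp: I_def)
  then have fin: "finite I" by blast
  have "real (card I) \<le> (2 * (2 ^ l * r + 1) + 1) ^ ?D" using count by blast
  also have "\<dots> \<le> (5 * (2 ^ l * r)) ^ ?D"
  proof -
    have "(2 * (x + 1) + 1) ^ ?D \<le> (5 * x) ^ ?D" if "1 \<le> x" for x :: real
      using that by (intro power_mono) auto
    then show ?thesis using l1 .
  qed
  finally have card: "real (card I) \<le> (5 * (2 ^ l * r)) ^ ?D" .
  have small: "hausdorff_premeasure ?D \<delta> (\<Psi> ` dcube 1 l k) \<le>
      ennreal (unit_ball_vol ?D * (L * real ?D / 2 ^ l) ^ ?D)" for k
  proof -
    have "dist x y \<le> L * (real ?D * (2 * 1 / 2 ^ l))" if xy: "x \<in> \<Psi> ` dcube 1 l k" "y \<in> \<Psi> ` dcube 1 l k" for x y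
    proof -
      obtain u v where uv: "x = \<Psi> u" "y = \<Psi> v" "u \<in> dcube 1 l k" "v \<in> dcube 1 l k" using xy by auto
      have "dist x y \<le> L * dist u v" using \<Psi> uv by simp
      also have "\<dots> \<le> L * (real ?D * (2 * 1 / 2 ^ l))"
        using dist_dcube_le[OF uv(3,4)] \<open>0 < L\<close> by (intro mult_left_mono) auto
      finally show ?thesis .
    qed
    then have diam: "diameter (\<Psi> ` dcube 1 l k) \<le> L * (real ?D * (2 * 1 / 2 ^ l))"
      using \<open>0 < L\<close> by (intro diameter_le) (auto simp: dist_norm)
    have bdd: "bounded (\<Psi> ` dcube 1 l k)"
      unfolding dcube_eq_cbox
      by (intro compact_imp_bounded compact_continuous_image compact_cbox
          lipschitz_on_continuous_on[of L] lipschitz_onI) (use \<Psi> \<open>0 < L\<close> in auto)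
    have "hausdorff_premeasure ?D \<delta> (\<Psi> ` dcube 1 l k) \<le> hausdorff_gauge ?D (\<Psi> ` dcube 1 l k)"
      by (rule hausdorff_premeasure_le_gauge[OF \<delta> bdd]) (use diam l2 in linarith)
    also have "\<dots> \<le> ennreal (unit_ball_vol ?D * (L * real ?D / 2 ^ l) ^ ?D)"
      using diam diameter_ge_0[OF bdd]
      by (auto simp: hausdorff_gauge_def intro!: ennreal_leI mult_left_mono power_mono)
    finally show ?thesis .
  qed
  have "\<Psi> ` ?Q \<subseteq> (\<Union>k\<in>I. \<Psi> ` dcube 1 l k)"
  proof
    fix x assume "x \<in> \<Psi> ` ?Q"
    then obtain y where y: "y \<in> ?Q" "x = \<Psi> y" by auto
    moreover obtain k where "k \<in> int_lattice" "y \<in> dcube 1 l k" using ex_dcube[of y l] by auto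
    ultimately show "x \<in> (\<Union>k\<in>I. \<Psi> ` dcube 1 l k)" by (auto simp: I_def)
  qed
  then have "hausdorff_premeasure ?D \<delta> (\<Psi> ` ?Q) \<le> hausdorff_premeasure ?D \<delta> (\<Union>k\<in>I. \<Psi> ` dcube 1 l k)"
    by (rule hausdorff_premeasure_mono) simp
  also have "\<dots> \<le> (\<Sum>k\<in>I. hausdorff_premeasure ?D \<delta> (\<Psi> ` dcube 1 l k))"
    by (rule hausdorff_premeasure_finite_subadditive[OF \<delta> fin])
  also have "\<dots> \<le> (\<Sum>k\<in>I. ennreal (unit_ball_vol ?D * (L * real ?D / 2 ^ l) ^ ?D))"
    by (intro sum_mono small)
  also have "\<dots> = ennreal (real (card I) * (unit_ball_vol ?D * (L * real ?D / 2 ^ l) ^ ?D))"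
    by (simp add: ennreal_mult' ennreal_of_nat_eq_real_of_nat)
  also have "\<dots> \<le> ennreal ((5 * (2 ^ l * r)) ^ ?D * (unit_ball_vol ?D * (L * real ?D / 2 ^ l) ^ ?D))"
    using card \<open>0 < L\<close> by (intro ennreal_leI mult_right_mono) auto
  also have "(5 * (2 ^ l * r)) ^ ?D * (unit_ball_vol ?D * (L * real ?D / 2 ^ l) ^ ?D) =
      unit_ball_vol ?D * (5 * L * ?D) ^ ?D * r ^ ?D"
  proof -
    have "(5 * (2 ^ l * r)) ^ ?D * (L * real ?D / 2 ^ l) ^ ?D = ((5 * (2 ^ l * r)) * (L * real ?D / 2 ^ l)) ^ ?D"
      by (rule power_mult_distrib[symmetric])
    also have "(5 * (2 ^ l * r)) * (L * real ?D / 2 ^ l) = (5 * L * ?D) * r" by simp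
    finally show ?thesis by (simp only: power_mult_distrib mult_ac)
  qed
  finally show "hausdorff_premeasure ?D \<delta> (\<Psi> ` ?Q) \<le>
      ennreal (unit_ball_vol ?D * (5 * L * ?D) ^ ?D * r ^ ?D)" .
qed

text \<open>The set is covered by countably many cubes of almost the same total volume. The cubes do not
  overlap, so their volumes, taken over the disjoint interiors, add up.\<close>

lemma hausdorff_image_le_lebesgue:
  fixes \<Psi> :: "'b::euclidean_space \<Rightarrow> 'a::euclidean_space"
  assumes \<Psi>: "\<And>x y. dist (\<Psi> x) (\<Psi> y) \<le> L * dist x y" and "0 < L"
    and E: "E \<in> sets borel" "bounded E"
  shows "hausdorff_outer DIM('b) (\<Psi> ` E) \<le>
    ennreal (unit_ball_vol DIM('b) * (5 * L * DIM('b)) ^ DIM('b)) * emeasure lborel E"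
proof (rule ennreal_le_epsilon)
  let ?D = "DIM('b)"
  let ?C = "unit_ball_vol ?D * (5 * L * ?D) ^ ?D"
  have C: "0 < ?C" using \<open>0 < L\<close> by (simp add: unit_ball_vol_pos)
  fix e :: real assume "0 < e"
  obtain \<rho> where \<rho>: "\<And>x. x \<in> E \<Longrightarrow> norm x \<le> \<rho>" using E(2) by (auto simp: bounded_iff)
  define R where "R = \<bar>\<rho>\<bar> + 1"
  have "E \<subseteq> cbox (- R *\<^sub>R One) (R *\<^sub>R One)"
  proof
    fix x assume "x \<in> E"
    then have "\<bar>x \<bullet> b\<bar> \<le> R" if "b \<in> Basis" for b
      using \<rho>[of x] Basis_le_norm[OF that, of x] by (auto simp: R_def)
    then show "x \<in> cbox (- R *\<^sub>R One) (R *\<^sub>R One)" by (auto simp: mem_box abs_le_iff minus_le_iff)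
  qed
  moreover have Elm: "E \<in> lmeasurable" using E by (intro bounded_set_imp_lmeasurable) auto
  moreover have "0 < e / ?C" using \<open>0 < e\<close> C by simp
  ultimately obtain \<D> where D: "countable \<D>"
    "\<And>K. K \<in> \<D> \<Longrightarrow> K \<subseteq> cbox (- R *\<^sub>R One) (R *\<^sub>R One) \<and> K \<noteq> {} \<and> (\<exists>c d. K = cbox c d)"
    "pairwise (\<lambda>A B. interior A \<inter> interior B = {}) \<D>"
    "\<And>u v. cbox u v \<in> \<D> \<Longrightarrow> \<exists>n. \<forall>i\<in>Basis. v \<bullet> i - u \<bullet> i = ((R *\<^sub>R One) \<bullet> i - (- R *\<^sub>R One) \<bullet> i) / 2 ^ n"
    "E \<subseteq> \<Union>\<D>" "\<Union>\<D> \<in> lmeasurable" "measure lebesgue (\<Union>\<D>) \<le> measure lebesgue E + e / ?C"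
    using measurable_outer_intervals_bounded[of E "- R *\<^sub>R One" "R *\<^sub>R One" "e / ?C"] by metis
  have cube: "hausdorff_outer ?D (\<Psi> ` K) \<le> ennreal ?C * emeasure lborel (interior K)" if K: "K \<in> \<D>" for K
  proof -
    obtain u v where uv: "K = cbox u v" using D(2)[OF K] by auto
    obtain n where n: "\<And>i. i \<in> Basis \<Longrightarrow> v \<bullet> i - u \<bullet> i = 2 * R / 2 ^ n"
      using D(4)[of u v] K uv by auto
    define r where "r = R / 2 ^ n"
    have r: "0 < r" by (simp add: r_def R_def)
    have vu: "v \<bullet> i = u \<bullet> i + 2 * r" if "i \<in> Basis" for i using n[OF that] by (simp add: r_def)
    define z where "z = u + r *\<^sub>R One"
    have "u = z - r *\<^sub>R One" by (simp add: z_def)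
    moreover have "v = z + r *\<^sub>R One"
      by (rule euclidean_eqI) (simp add: z_def inner_add_left vu)
    ultimately have "hausdorff_outer ?D (\<Psi> ` K) \<le> ennreal (?C * r ^ ?D)"
      unfolding uv using hausdorff_cube_image_le[OF \<Psi> \<open>0 < L\<close> r, of z] by simp
    also have "\<dots> \<le> ennreal (?C * (\<Prod>b\<in>(Basis :: 'b set). 2 * r))"
      using C r by (intro ennreal_leI mult_left_mono) (auto intro!: power_mono)
    also have "\<dots> = ennreal ?C * ennreal (\<Prod>b\<in>Basis. (v - u) \<bullet> b)"
      using C by (simp add: ennreal_mult' inner_diff_left vu)
    also have "ennreal (\<Prod>b\<in>Basis. (v - u) \<bullet> b) = emeasure lborel (interior K)"
      unfolding uv interior_cbox using r vu by (subst emeasure_lborel_box) auto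
    finally show ?thesis .
  qed
  define V where "V n = (if n \<in> to_nat_on \<D> ` \<D> then inv_into \<D> (to_nat_on \<D>) n else {})" for n
  have V: "V n \<in> \<D>" if "n \<in> to_nat_on \<D> ` \<D>" for n using that by (auto simp: V_def inv_into_into)
  have inj: "inj_on (to_nat_on \<D>) \<D>" using D(1) by (rule inj_on_to_nat_on)
  have UV: "(\<Union>n. V n) = \<Union>\<D>"
  proof
    show "(\<Union>n. V n) \<subseteq> \<Union>\<D>"
    proof
      fix x assume "x \<in> (\<Union>n. V n)"
      then obtain n where n: "x \<in> V n" by blast
      then have "n \<in> to_nat_on \<D> ` \<D>" by (auto simp: V_def split: if_splits)
      then show "x \<in> \<Union>\<D>" using V n by blast
    qed
    show "\<Union>\<D> \<subseteq> (\<Union>n. V n)"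
    proof
      fix x assume "x \<in> \<Union>\<D>"
      then obtain K where K: "K \<in> \<D>" "x \<in> K" by auto
      then have "V (to_nat_on \<D> K) = K" using inv_into_f_f[OF inj] by (simp add: V_def)
      then show "x \<in> (\<Union>n. V n)" using K by blast
    qed
  qed
  have disj: "disjoint_family (\<lambda>n. interior (V n))"
  proof (unfold disjoint_family_on_def, intro ballI impI)
    fix m n :: nat assume "m \<noteq> n"
    show "interior (V m) \<inter> interior (V n) = {}"
    proof (cases "m \<in> to_nat_on \<D> ` \<D> \<and> n \<in> to_nat_on \<D> ` \<D>")
      case True
      then have "V m \<noteq> V n" using \<open>m \<noteq> n\<close> inv_into_injective[of \<D> "to_nat_on \<D>" m n] by (auto simp: V_def)
      then show ?thesis using D(3) V True by (auto simp: pairwise_def)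
    qed (auto simp: V_def)
  qed
  have outer_empty: "hausdorff_outer ?D {} = (0::ennreal)"
    by (rule antisym[OF hausdorff_outer_least]) (auto simp: hausdorff_premeasure_empty)
  have "hausdorff_outer ?D (\<Psi> ` E) \<le> hausdorff_outer ?D (\<Union>n. \<Psi> ` V n)"
    using D(5) UV by (intro hausdorff_outer_mono) (auto simp: image_UN[symmetric])
  also have "\<dots> \<le> (\<Sum>n. hausdorff_outer ?D (\<Psi> ` V n))" by (rule hausdorff_outer_countable_subadditive)
  also have "\<dots> \<le> (\<Sum>n. ennreal ?C * emeasure lborel (interior (V n)))"
  proof (intro suminf_le)
    fix n show "hausdorff_outer ?D (\<Psi> ` V n) \<le> ennreal ?C * emeasure lborel (interior (V n))"
    proof (cases "n \<in> to_nat_on \<D> ` \<D>")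
      case False
      then have "V n = {}" by (simp add: V_def)
      then show ?thesis
        using outer_empty by simp
    qed (use cube V in auto)
  qed auto
  also have "\<dots> = ennreal ?C * emeasure lborel (\<Union>n. interior (V n))"
    using disj by (simp add: suminf_emeasure image_subset_iff)
  also have "emeasure lborel (\<Union>n. interior (V n)) \<le> emeasure lebesgue (\<Union>\<D>)"
  proof -
    have "(\<Union>n. interior (V n)) \<subseteq> \<Union>\<D>" using UV interior_subset by blast
    then have "emeasure lebesgue (\<Union>n. interior (V n)) \<le> emeasure lebesgue (\<Union>\<D>)"
      using D(6) by (intro emeasure_mono) auto
    then show ?thesis by simp
  qed
  also have "emeasure lebesgue (\<Union>\<D>) = ennreal (measure lebesgue (\<Union>\<D>))"
    using D(6) by (rule emeasure_eq_measure2)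
  also have "\<dots> \<le> ennreal (measure lebesgue E + e / ?C)" using D(7) by (rule ennreal_leI)
  also have "\<dots> = emeasure lebesgue E + ennreal (e / ?C)"
    using emeasure_eq_measure2[OF Elm] \<open>0 < e\<close> C by simp
  also have "ennreal ?C * (emeasure lebesgue E + ennreal (e / ?C)) =
      ennreal ?C * emeasure lborel E + ennreal e"
  proof -
    have "ennreal c * (x + ennreal (e / c)) = ennreal c * x + ennreal e" if "0 < c" for c :: real and x
      using that by (simp add: distrib_left ennreal_mult'[symmetric])
    from this[OF C] show ?thesis using E(1) by simp
  qed
  finally show "hausdorff_outer ?D (\<Psi> ` E) \<le> ennreal ?C * emeasure lborel E + ennreal e"
    by (simp add: mult_left_mono)
qed

lemma Lp_qnorm_comp_le:
  assumes "0 < p" "0 < C" and T: "T \<in> measurable N M" and f: "f \<in> borel_measurable M"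
    and le: "\<And>A. A \<in> sets M \<Longrightarrow> emeasure N (T -` A \<inter> space N) \<le> ennreal C * emeasure M A"
  shows "Lp_qnorm N p (\<lambda>x. f (T x)) \<le> ennreal (C powr enn2real (inverse p)) * Lp_qnorm M p f"
  using assms(1)
proof (cases rule: Lp_qnorm_cases)
  case (finite r)
  have "(\<integral>\<^sup>+ x. ennpowr (f (T x)) r \<partial>N) = (\<integral>\<^sup>+ x. ennpowr (f x) r \<partial>distr N M T)"
    using T f by (subst nn_integral_distr) auto
  also have "\<dots> \<le> (\<integral>\<^sup>+ x. ennpowr (f x) r \<partial>scale_measure (ennreal C) M)"
    using le T by (intro nn_integral_mono_measure) (auto simp: le_measure emeasure_distr)
  also have "\<dots> = ennreal C * (\<integral>\<^sup>+ x. ennpowr (f x) r \<partial>M)"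
    using f by (intro nn_integral_scale_measure) auto
  also have "\<dots> = ennpowr (ennreal (C powr (1 / r)) * Lp_qnorm M p f) r"
    using finite(1,4) \<open>0 < C\<close> Lp_qnorm_powr[OF assms(1) finite(3), of M f]
    by (simp add: ennpowr_mult ennpowr_ennreal powr_powr)
  finally show ?thesis
    unfolding Lp_qnorm_le_iff_finite[OF assms(1) finite(3)] finite(4,5) .
next
  case infinite
  have fT: "(\<lambda>x. f (T x)) \<in> borel_measurable N" using T f by (rule measurable_compose)
  have "AE x in M. f x \<le> Lp_qnorm M p f"
    using Lp_qnorm_le_iff_infinite[OF f] infinite(1) by blast
  then have "emeasure M {x \<in> space M. \<not> f x \<le> Lp_qnorm M p f} = 0"
    using f by (subst (asm) AE_iff_measurable[OF _ refl]) auto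
  then have "emeasure N (T -` {x \<in> space M. \<not> f x \<le> Lp_qnorm M p f} \<inter> space N) = 0"
    using le[of "{x \<in> space M. \<not> f x \<le> Lp_qnorm M p f}"] f by simp
  then have "AE x in N. f (T x) \<le> Lp_qnorm M p f"
    using fT measurable_space[OF T]
    by (subst AE_iff_measurable[OF _ refl]) (auto simp: vimage_def Int_def conj_commute cong: conj_cong)
  then have "Lp_qnorm N p (\<lambda>x. f (T x)) \<le> Lp_qnorm M p f"
    using Lp_qnorm_le_iff_infinite[OF fT] infinite(1) by blast
  then show ?thesis using infinite(2) \<open>0 < C\<close> by simp
qed

lemma Lp_qnorm_le_comp:
  assumes "0 < p" "0 < C" and T: "T \<in> measurable N M" and f: "f \<in> borel_measurable M"
    and V: "V \<inter> space M \<in> sets M" "\<And>x. x \<in> space M \<Longrightarrow> x \<notin> V \<Longrightarrow> f x = 0"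
    and le: "\<And>A. A \<in> sets M \<Longrightarrow> emeasure M (A \<inter> V) \<le> ennreal C * emeasure N (T -` A \<inter> space N)"
  shows "Lp_qnorm M p f \<le> ennreal (C powr enn2real (inverse p)) * Lp_qnorm N p (\<lambda>x. f (T x))"
  using assms(1)
proof (cases rule: Lp_qnorm_cases)
  case (finite r)
  let ?V = "indicator (V \<inter> space M) :: _ \<Rightarrow> ennreal"
  have AV: "emeasure (density M ?V) A = emeasure M (A \<inter> V)" if "A \<in> sets M" for A
    using that V(1) sets.sets_into_space[OF that]
    by (auto simp: emeasure_density indicator_inter_arith[symmetric] intro!: arg_cong[where f="emeasure M"])
  have "(\<integral>\<^sup>+ x. ennpowr (f x) r \<partial>M) = (\<integral>\<^sup>+ x. ?V x * ennpowr (f x) r \<partial>M)"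
    using V(2) by (intro nn_integral_cong) (auto simp: indicator_def)
  also have "\<dots> = (\<integral>\<^sup>+ x. ennpowr (f x) r \<partial>density M ?V)"
    using V(1) f by (subst nn_integral_density) auto
  also have "\<dots> \<le> (\<integral>\<^sup>+ x. ennpowr (f x) r \<partial>scale_measure (ennreal C) (distr N M T))"
    using le T AV by (intro nn_integral_mono_measure) (auto simp: le_measure emeasure_distr)
  also have "\<dots> = ennreal C * (\<integral>\<^sup>+ x. ennpowr (f x) r \<partial>distr N M T)"
    using f by (intro nn_integral_scale_measure) auto
  also have "\<dots> = ennreal C * (\<integral>\<^sup>+ x. ennpowr (f (T x)) r \<partial>N)"
    using T f by (subst nn_integral_distr) auto
  also have "\<dots> = ennpowr (ennreal (C powr (1 / r)) * Lp_qnorm N p (\<lambda>x. f (T x))) r"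
    using finite(1,4) \<open>0 < C\<close> Lp_qnorm_powr[OF assms(1) finite(3), of N "\<lambda>x. f (T x)"]
    by (simp add: ennpowr_mult ennpowr_ennreal powr_powr)
  finally show ?thesis
    unfolding Lp_qnorm_le_iff_finite[OF assms(1) finite(3)] finite(4,5) .
next
  case infinite
  define z where "z = Lp_qnorm N p (\<lambda>x. f (T x))"
  have fT: "(\<lambda>x. f (T x)) \<in> borel_measurable N" using T f by (rule measurable_compose)
  define A where "A = {x \<in> space M. \<not> f x \<le> z}"
  have A: "A \<in> sets M" using f unfolding A_def by simp
  have "AE x in N. f (T x) \<le> z"
    using Lp_qnorm_le_iff_infinite[OF fT] infinite(1) unfolding z_def by blast
  then have "emeasure N {x \<in> space N. \<not> f (T x) \<le> z} = 0"
    using fT by (subst (asm) AE_iff_measurable[OF _ refl]) auto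
  moreover have "T -` A \<inter> space N = {x \<in> space N. \<not> f (T x) \<le> z}"
    using measurable_space[OF T] by (auto simp: A_def)
  ultimately have "emeasure M (A \<inter> V) = 0" using le[OF A] by simp
  moreover have "A \<inter> V = A" using V(2) by (force simp: A_def not_le)
  ultimately have "AE x in M. f x \<le> z"
    using f by (subst AE_iff_measurable[OF _ refl]) (auto simp: A_def)
  then have "Lp_qnorm M p f \<le> z"
    using Lp_qnorm_le_iff_infinite[OF f] infinite(1) by blast
  then show ?thesis using infinite(2) \<open>0 < C\<close> by (simp add: z_def)
qed

section \<open>Charts of a Lipschitz boundary\<close>

lemma lipschitz_diffeo_lipschitz:
  fixes \<psi> :: "'a::euclidean_space \<Rightarrow> 'a"
  assumes "lipschitz_diffeo \<psi>"
  obtains L where "0 < L" "\<And>x y. dist (\<psi> x) (\<psi> y) \<le> L * dist x y"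
proof -
  have "\<forall>b\<in>Basis. \<exists>L. L-lipschitz_on UNIV (\<lambda>x. \<psi> x \<bullet> b)"
    using assms by (simp add: lipschitz_diffeo_def)
  then obtain l where l: "\<And>b. b \<in> Basis \<Longrightarrow> (l b)-lipschitz_on UNIV (\<lambda>x. \<psi> x \<bullet> b)" by metis
  define L where "L = 1 + (\<Sum>b\<in>Basis. l b)"
  have l0: "0 \<le> l b" if "b \<in> Basis" for b using l[OF that] by (rule lipschitz_on_nonneg)
  have L: "0 < L" unfolding L_def using l0 by (intro add_pos_nonneg sum_nonneg) auto
  have "dist (\<psi> x) (\<psi> y) \<le> real DIM('a) * (L * dist x y)" for x y
  proof (rule dist_le_DIM_mult)
    fix b :: 'a assume b: "b \<in> Basis"
    have "\<bar>\<psi> x \<bullet> b - \<psi> y \<bullet> b\<bar> \<le> l b * dist x y"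
      using lipschitz_onD[OF l[OF b], of x y] by (simp add: dist_real_def)
    also have "l b \<le> L" using member_le_sum[OF b, of l] l0 by (auto simp: L_def)
    finally show "\<bar>\<psi> x \<bullet> b - \<psi> y \<bullet> b\<bar> \<le> L * dist x y" by (simp add: mult_right_mono)
  qed
  then show ?thesis using that[of "real DIM('a) * L"] L by (simp add: mult.assoc)
qed

text \<open>The lower bound is assumed for close points only. Along a short segment in the image the
  preimages cannot leave a ball of radius 1, as they would have to cross its boundary; long segments
  are cut into short ones. That preimages vary continuously at all is invariance of domain.\<close>

lemma lipschitz_diffeo_inv_lipschitz:
  fixes \<psi> :: "'a::euclidean_space \<Rightarrow> 'a"
  assumes "lipschitz_diffeo \<psi>"
  obtains L where "0 < L" "\<And>u v. dist (inv \<psi> u) (inv \<psi> v) \<le> L * dist u v"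
proof -
  have bij: "bij \<psi>" using assms by (simp add: lipschitz_diffeo_def)
  then have inv: "\<psi> (inv \<psi> u) = u" for u by (simp add: bij_is_surj surj_f_inv_f)
  obtain c where c: "0 < c" and close: "\<And>x y. dist x y \<le> 1 \<Longrightarrow> c * dist x y \<le> dist (\<psi> x) (\<psi> y)"
    using assms unfolding lipschitz_diffeo_def by blast
  obtain L where L: "0 < L" "\<And>x y. dist (\<psi> x) (\<psi> y) \<le> L * dist x y"
    using lipschitz_diffeo_lipschitz[OF assms] by blast
  have cont: "continuous_on UNIV \<psi>"
    by (rule lipschitz_on_continuous_on[of L], rule lipschitz_onI) (use L in auto)
  have cont_inv: "continuous_on UNIV (inv \<psi>)"
    unfolding continuous_on_open_vimage[OF open_UNIV]
  proof (intro allI impI)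
    fix B :: "'a set" assume "open B"
    then have "open (\<psi> ` B)"
      by (intro invariance_of_domain continuous_on_subset[OF cont])
        (auto intro: inj_on_subset[OF bij_is_inj[OF bij]])
    moreover have "inv \<psi> -` B \<inter> UNIV = \<psi> ` B"
      using bij_vimage_eq_inv_image[OF bij_imp_bij_inv[OF bij], of B] inv_inv_eq[OF bij] by simp
    ultimately show "open (inv \<psi> -` B \<inter> UNIV)" by simp
  qed
  have short: "c * dist (inv \<psi> u) (inv \<psi> v) \<le> dist u v" if uv: "dist u v < c" for u v
  proof -
    define g where "g t = dist (inv \<psi> u) (inv \<psi> (u + t *\<^sub>R (v - u)))" for t :: real
    have g: "continuous_on {0..1} g"
      unfolding g_def by (intro continuous_intros continuous_on_compose2[OF cont_inv]) auto
    have "g 1 < 1"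
    proof (rule ccontr)
      assume "\<not> g 1 < 1"
      then obtain t where t: "0 \<le> t" "t \<le> 1" "g t = 1"
        using IVT'[of g 0 1 1] g by (auto simp: g_def)
      have "c * g t \<le> dist u (u + t *\<^sub>R (v - u))"
        using close[of "inv \<psi> u" "inv \<psi> (u + t *\<^sub>R (v - u))"] t(3) by (simp add: g_def inv)
      also have "\<dots> = t * dist u v" using t by (simp add: dist_norm norm_minus_commute)
      also have "\<dots> \<le> dist u v" using t mult_right_mono[of t 1 "dist u v"] by simp
      finally show False using t(3) uv by simp
    qed
    then show ?thesis using close[of "inv \<psi> u" "inv \<psi> v"] by (simp add: g_def inv)
  qed
  have "dist (inv \<psi> u) (inv \<psi> v) \<le> 1 / c * dist u v" for u v
  proof -
    obtain n :: nat where n: "dist u v / c < real n" using reals_Archimedean2 by blast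
    then have n0: "0 < real n" using c zero_le_dist[of u v] by (meson divide_nonneg_pos le_less_trans)
    define w where "w i = u + (real i / real n) *\<^sub>R (v - u)" for i
    have step: "dist (inv \<psi> (w i)) (inv \<psi> (w (Suc i))) \<le> dist u v / real n / c" for i
    proof -
      have "w i - w (Suc i) = (- 1 / real n) *\<^sub>R (v - u)"
        by (simp add: w_def algebra_simps add_divide_distrib)
      then have d: "dist (w i) (w (Suc i)) = dist u v / real n"
        using n0 by (simp add: dist_norm norm_minus_commute)
      moreover have "dist u v / real n < c" using n n0 c by (simp add: field_simps)
      ultimately have "c * dist (inv \<psi> (w i)) (inv \<psi> (w (Suc i))) \<le> dist u v / real n"
        using short by metis
      then show ?thesis using c by (simp only: pos_le_divide_eq mult.commute)
    qed
    have "dist (inv \<psi> (w 0)) (inv \<psi> (w i)) \<le> real i * (dist u v / real n / c)" for i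
    proof (induction i)
      case (Suc i)
      have "real (Suc i) * (dist u v / real n / c) =
          real i * (dist u v / real n / c) + dist u v / real n / c"
        by (simp only: of_nat_Suc distrib_right mult_1)
      then show ?case
        using Suc step[of i] dist_triangle[of "inv \<psi> (w 0)" "inv \<psi> (w (Suc i))" "inv \<psi> (w i)"]
        by linarith
    qed simp
    from this[of n] show ?thesis using n0 by (simp add: w_def)
  qed
  then show ?thesis using that[of "1 / c"] c by simp
qed

lemma space_surface_measure [simp]: "space (surface_measure \<Gamma>) = \<Gamma>"
  by (simp add: surface_measure_def space_restrict_space)

text \<open>\<open>\<Psi>\<close> parametrises the part of the boundary in \<open>V\<close> by the parameter domain \<open>W\<close>, and \<open>P\<close> is a left
  inverse of \<open>\<Psi>\<close>.\<close>

locale lipschitz_chart =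
  fixes \<Gamma> V :: "'a::euclidean_space set" and W :: "'b::euclidean_space set"
    and \<Psi> :: "'b \<Rightarrow> 'a" and P :: "'a \<Rightarrow> 'b" and L :: real
  assumes L: "1 \<le> L"
    and \<Psi>_lip: "dist (\<Psi> x) (\<Psi> y) \<le> L * dist x y"
    and P_lip: "dist (P u) (P v) \<le> L * dist u v"
    and P_\<Psi>: "P (\<Psi> y) = y"
    and W_iff: "y \<in> W \<longleftrightarrow> \<Psi> y \<in> \<Gamma> \<inter> V"
    and \<Psi>_P: "u \<in> \<Gamma> \<Longrightarrow> u \<in> V \<Longrightarrow> \<Psi> (P u) = u"
    and open_W: "open W" and bounded_W: "bounded W" and open_V: "open V"
    and compact_\<Gamma>: "compact \<Gamma>"
    and dim: "DIM('a) - 1 = DIM('b)"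
begin

lemma closed_\<Gamma>: "closed \<Gamma>"
  using compact_\<Gamma> by (rule compact_imp_closed)

lemma continuous_\<Psi>: "continuous_on S \<Psi>"
  by (rule lipschitz_on_continuous_on[of L], rule lipschitz_onI) (use \<Psi>_lip L in auto)

lemma dist_le_dist_\<Psi>: "dist x y \<le> L * dist (\<Psi> x) (\<Psi> y)"
  using P_lip[of "\<Psi> x" "\<Psi> y"] by (simp add: P_\<Psi>)

text \<open>Surface measure and Lebesgue measure are comparable in the chart. The inequalities hold for
  Borel sets by the comparison above, and pass to the completions because null sets correspond.\<close>

lemma surface_measure_comparable:
  obtains C where "0 < C" "\<Psi> \<in> measurable (lebesgue_on W) (surface_measure \<Gamma>)"
    and "\<And>A. A \<in> sets (surface_measure \<Gamma>) \<Longrightarrow>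
      emeasure (lebesgue_on W) (\<Psi> -` A \<inter> space (lebesgue_on W)) \<le> ennreal C * emeasure (surface_measure \<Gamma>) A"
    and "\<And>A. A \<in> sets (surface_measure \<Gamma>) \<Longrightarrow>
      emeasure (surface_measure \<Gamma>) (A \<inter> V) \<le>
        ennreal C * emeasure (lebesgue_on W) (\<Psi> -` A \<inter> space (lebesgue_on W))"
proof -
  let ?D = "DIM('b)"
  let ?H = "hausdorff_measure ?D :: 'a measure"
  let ?M0 = "restrict_space ?H \<Gamma>"
  have M: "surface_measure \<Gamma> = completion ?M0" unfolding surface_measure_def dim ..
  define C where "C = max ((2 * L) ^ ?D) (unit_ball_vol ?D * (5 * L * ?D) ^ ?D)"
  have C: "0 < C" using L by (auto simp: C_def less_max_iff_disj)
  have \<Gamma>: "\<Gamma> \<inter> space ?H \<in> sets ?H" using closed_\<Gamma> by auto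
  have W: "W \<inter> space lebesgue \<in> sets lebesgue" using open_W by auto
  have M0: "A \<in> sets ?M0 \<longleftrightarrow> A \<subseteq> \<Gamma> \<and> A \<in> sets borel" for A
    by (subst sets_restrict_space_iff[OF \<Gamma>]) auto
  have eM0: "emeasure ?M0 A = hausdorff_outer ?D A" if "A \<in> sets ?M0" for A
    using that M0[of A] by (simp add: emeasure_restrict_space[OF \<Gamma>] emeasure_hausdorff_measure)
  have eN: "emeasure (lebesgue_on W) A = emeasure lebesgue A" if "A \<subseteq> W" for A
    using that by (rule emeasure_restrict_space[OF W])
  have borel: "\<Psi> -` A \<inter> W \<in> sets borel" if "A \<in> sets borel" for A
  proof -
    have "\<Psi> \<in> borel_measurable borel" using continuous_\<Psi> by (rule borel_measurable_continuous_onI)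
    then have "\<Psi> -` A \<inter> space borel \<in> sets borel" using that by (rule measurable_sets)
    then show ?thesis using open_W by auto
  qed
  have image: "\<Psi> ` (\<Psi> -` A \<inter> W) = A \<inter> V" if "A \<subseteq> \<Gamma>" for A
  proof
    show "\<Psi> ` (\<Psi> -` A \<inter> W) \<subseteq> A \<inter> V" using W_iff by auto
    show "A \<inter> V \<subseteq> \<Psi> ` (\<Psi> -` A \<inter> W)"
    proof
      fix u assume u: "u \<in> A \<inter> V"
      then have "\<Psi> (P u) = u" using that \<Psi>_P by auto
      then have "P u \<in> \<Psi> -` A \<inter> W" using u that W_iff[of "P u"] by auto
      then show "u \<in> \<Psi> ` (\<Psi> -` A \<inter> W)" using \<open>\<Psi> (P u) = u\<close> by force
    qed
  qed
  have le1: "emeasure lborel (\<Psi> -` A \<inter> W) \<le> ennreal C * hausdorff_outer ?D A"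
    if "A \<in> sets ?M0" for A
  proof -
    have "emeasure lborel (\<Psi> -` A \<inter> W) \<le>
        ennreal ((2 * L) ^ ?D) * hausdorff_outer ?D (\<Psi> ` (\<Psi> -` A \<inter> W))"
      using P_lip P_\<Psi> borel M0 that L by (intro lebesgue_le_hausdorff_image[of P]) auto
    also have "\<dots> \<le> ennreal C * hausdorff_outer ?D A"
      using image[of A] that M0 by (intro mult_mono ennreal_leI hausdorff_outer_mono) (auto simp: C_def)
    finally show ?thesis .
  qed
  have le2: "hausdorff_outer ?D (A \<inter> V) \<le> ennreal C * emeasure lborel (\<Psi> -` A \<inter> W)"
    if "A \<in> sets ?M0" for A
  proof -
    have "hausdorff_outer ?D (\<Psi> ` (\<Psi> -` A \<inter> W)) \<le>
        ennreal (unit_ball_vol ?D * (5 * L * ?D) ^ ?D) * emeasure lborel (\<Psi> -` A \<inter> W)"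
      using \<Psi>_lip borel M0 that L bounded_W
      by (intro hausdorff_image_le_lebesgue) (auto intro: bounded_subset)
    also have "\<dots> \<le> ennreal C * emeasure lborel (\<Psi> -` A \<inter> W)"
      by (intro mult_right_mono ennreal_leI) (auto simp: C_def)
    finally show ?thesis using image[of A] that M0 by simp
  qed
  have key: "\<Psi> -` A \<inter> W \<in> sets lebesgue \<and>
      emeasure lebesgue (\<Psi> -` A \<inter> W) \<le> ennreal C * emeasure (surface_measure \<Gamma>) A \<and>
      emeasure (surface_measure \<Gamma>) (A \<inter> V) \<le> ennreal C * emeasure lebesgue (\<Psi> -` A \<inter> W)"
    if A: "A \<in> sets (surface_measure \<Gamma>)" for A
  proof -
    obtain S N N' where SN: "A = S \<union> N" "N \<subseteq> N'" "N' \<in> null_sets ?M0" "S \<in> sets ?M0"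
      using A unfolding M by (rule sets_completionE)
    have N': "N' \<in> sets ?M0" "hausdorff_outer ?D N' = 0"
      using null_setsD1[OF SN(3)] null_setsD2[OF SN(3)] eM0[of N'] by auto
    have SN': "S \<union> N' \<in> sets ?M0" using SN(4) N'(1) by auto
    have outer: "hausdorff_outer ?D (S \<union> N') = emeasure (surface_measure \<Gamma>) S"
      using eM0[OF SN'] SN(3,4) by (simp add: emeasure_Un_null_set M)
    have null: "\<Psi> -` N' \<inter> W \<in> null_sets lborel"
      using le1[OF N'(1)] N' borel[of N'] M0 by (auto simp: null_sets_def)
    have "\<Psi> -` N \<inter> W \<in> sets lebesgue"
      by (rule null_sets_completion[OF null]) (use SN(2) in auto)
    moreover have "\<Psi> -` A \<inter> W = (\<Psi> -` S \<inter> W) \<union> (\<Psi> -` N \<inter> W)" using SN(1) by auto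
    moreover have SW: "\<Psi> -` S \<inter> W \<in> sets borel" using SN(4) M0 borel by auto
    ultimately have meas: "\<Psi> -` A \<inter> W \<in> sets lebesgue" by auto
    have B': "\<Psi> -` (S \<union> N') \<inter> W \<in> sets borel" using SN' M0 by (intro borel) blast
    have "emeasure lebesgue (\<Psi> -` A \<inter> W) \<le> emeasure lebesgue (\<Psi> -` (S \<union> N') \<inter> W)"
      using SN(1,2) B' by (intro emeasure_mono) auto
    also have "\<dots> \<le> ennreal C * emeasure (surface_measure \<Gamma>) S"
      using le1[OF SN'] borel[of "S \<union> N'"] SN' M0 by (simp add: outer)
    also have "\<dots> \<le> ennreal C * emeasure (surface_measure \<Gamma>) A"
      using A SN(1) by (intro mult_left_mono emeasure_mono) auto
    finally have 1: "emeasure lebesgue (\<Psi> -` A \<inter> W) \<le> ennreal C * emeasure (surface_measure \<Gamma>) A" .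
    have VN: "(S \<union> N') \<inter> V \<in> sets ?M0" using SN' M0 open_V by auto
    have "emeasure (surface_measure \<Gamma>) (A \<inter> V) \<le> emeasure (surface_measure \<Gamma>) ((S \<union> N') \<inter> V)"
      using SN(1,2) VN by (intro emeasure_mono) (auto simp: M)
    also have "\<dots> = hausdorff_outer ?D ((S \<union> N') \<inter> V)"
      using eM0[OF VN] VN by (simp add: M)
    also have "\<dots> \<le> ennreal C * emeasure lborel (\<Psi> -` (S \<union> N') \<inter> W)"
      by (rule le2[OF SN'])
    also have "\<Psi> -` (S \<union> N') \<inter> W = (\<Psi> -` S \<inter> W) \<union> (\<Psi> -` N' \<inter> W)" by auto
    also have "emeasure lborel \<dots> = emeasure lborel (\<Psi> -` S \<inter> W)"
      using SW null by (intro emeasure_Un_null_set) auto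
    also have "\<dots> = emeasure lebesgue (\<Psi> -` S \<inter> W)" using SW by simp
    also have "\<dots> \<le> emeasure lebesgue (\<Psi> -` A \<inter> W)"
      using meas SN(1) by (intro emeasure_mono) auto
    finally show ?thesis using meas 1 by (simp add: mult_left_mono)
  qed
  show ?thesis
  proof (rule that[OF C])
    show "\<Psi> \<in> measurable (lebesgue_on W) (surface_measure \<Gamma>)"
      using key W_iff by (intro measurableI) (auto simp: sets_restrict_space_iff[OF W])
  next
    fix A assume A: "A \<in> sets (surface_measure \<Gamma>)"
    have eq: "emeasure (lebesgue_on W) (\<Psi> -` A \<inter> space (lebesgue_on W)) = emeasure lebesgue (\<Psi> -` A \<inter> W)"
      by (simp only: space_lebesgue_on eN[OF Int_lower2])
    show "emeasure (lebesgue_on W) (\<Psi> -` A \<inter> space (lebesgue_on W)) \<le>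
        ennreal C * emeasure (surface_measure \<Gamma>) A"
      "emeasure (surface_measure \<Gamma>) (A \<inter> V) \<le>
        ennreal C * emeasure (lebesgue_on W) (\<Psi> -` A \<inter> space (lebesgue_on W))"
      unfolding eq using key[OF A] by blast+
  qed
qed

lemma Lp_transfer:
  assumes "0 < p"
  obtains C where "0 < C" "\<Psi> \<in> measurable (lebesgue_on W) (surface_measure \<Gamma>)"
    and "\<And>f. f \<in> borel_measurable (surface_measure \<Gamma>) \<Longrightarrow>
      Lp_qnorm (lebesgue_on W) p (\<lambda>y. f (\<Psi> y)) \<le> ennreal C * Lp_qnorm (surface_measure \<Gamma>) p f"
    and "\<And>f. f \<in> borel_measurable (surface_measure \<Gamma>) \<Longrightarrow> (\<And>x. x \<in> \<Gamma> \<Longrightarrow> x \<notin> V \<Longrightarrow> f x = 0) \<Longrightarrow>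
      Lp_qnorm (surface_measure \<Gamma>) p f \<le> ennreal C * Lp_qnorm (lebesgue_on W) p (\<lambda>y. f (\<Psi> y))"
proof -
  obtain C where C: "0 < C" "\<Psi> \<in> measurable (lebesgue_on W) (surface_measure \<Gamma>)"
    and 1: "\<And>A. A \<in> sets (surface_measure \<Gamma>) \<Longrightarrow>
      emeasure (lebesgue_on W) (\<Psi> -` A \<inter> space (lebesgue_on W)) \<le> ennreal C * emeasure (surface_measure \<Gamma>) A"
    and 2: "\<And>A. A \<in> sets (surface_measure \<Gamma>) \<Longrightarrow>
      emeasure (surface_measure \<Gamma>) (A \<inter> V) \<le>
        ennreal C * emeasure (lebesgue_on W) (\<Psi> -` A \<inter> space (lebesgue_on W))"
    by (rule surface_measure_comparable) blast
  have V: "V \<inter> \<Gamma> \<in> sets (surface_measure \<Gamma>)"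
  proof -
    have "\<Gamma> \<inter> V \<in> (\<inter>) \<Gamma> ` sets (hausdorff_measure (DIM('a) - 1))"
      by (rule imageI) (simp add: open_V)
    then show ?thesis
      unfolding surface_measure_def by (simp add: sets_restrict_space Int_commute)
  qed
  show ?thesis
  proof (rule that[of "C powr enn2real (inverse p)"])
    show "0 < C powr enn2real (inverse p)" using C(1) by simp
  next
    fix f :: "'a \<Rightarrow> ennreal" assume f: "f \<in> borel_measurable (surface_measure \<Gamma>)"
    show "Lp_qnorm (lebesgue_on W) p (\<lambda>y. f (\<Psi> y)) \<le>
        ennreal (C powr enn2real (inverse p)) * Lp_qnorm (surface_measure \<Gamma>) p f"
      by (rule Lp_qnorm_comp_le[OF assms C f 1])
    assume zero: "\<And>x. x \<in> \<Gamma> \<Longrightarrow> x \<notin> V \<Longrightarrow> f x = 0"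
    show "Lp_qnorm (surface_measure \<Gamma>) p f \<le>
        ennreal (C powr enn2real (inverse p)) * Lp_qnorm (lebesgue_on W) p (\<lambda>y. f (\<Psi> y))"
      by (rule Lp_qnorm_le_comp[OF assms C f _ _ 2]) (use V zero in auto)
  qed (rule C)
qed

end

text \<open>The point is that \<open>W\<close> is open. Near a point of the flattened boundary, the half ball above the
  hyperplane is connected and its preimage avoids the boundary but meets \<open>\<Omega>\<close>, so it lies in \<open>\<Omega>\<close>. Hence
  every nearby point of the hyperplane comes from a limit of points of \<open>\<Omega>\<close>, and not from \<open>\<Omega>\<close> itself,
  which is mapped strictly above the hyperplane.\<close>

lemma lipschitz_chart_of_atlas:
  fixes \<Omega> :: "('b::euclidean_space \<times> real) set"
  assumes "open \<Omega>" "bounded \<Omega>" "open V" "lipschitz_diffeo \<psi>"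
    and pos: "\<psi> ` (V \<inter> \<Omega>) \<subseteq> {x. snd x > 0}" and flat: "\<psi> ` (V \<inter> frontier \<Omega>) \<subseteq> {x. snd x = 0}"
  shows "\<exists>L. lipschitz_chart (frontier \<Omega>) V (chart_image (frontier \<Omega>) V \<psi>)
      (\<lambda>y. inv \<psi> (y, 0)) (\<lambda>x. fst (\<psi> x)) L"
proof -
  let ?\<Gamma> = "frontier \<Omega>"
  let ?W = "chart_image ?\<Gamma> V \<psi>"
  have bij: "bij \<psi>" using assms(4) by (simp add: lipschitz_diffeo_def)
  then have inv: "\<psi> (inv \<psi> u) = u" "inv \<psi> (\<psi> x) = x" for u x
    by (simp_all add: bij_is_surj surj_f_inv_f bij_is_inj)
  obtain L1 where L1: "0 < L1" "\<And>x y. dist (\<psi> x) (\<psi> y) \<le> L1 * dist x y"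
    using lipschitz_diffeo_lipschitz[OF assms(4)] by blast
  obtain L2 where L2: "0 < L2" "\<And>u v. dist (inv \<psi> u) (inv \<psi> v) \<le> L2 * dist u v"
    using lipschitz_diffeo_inv_lipschitz[OF assms(4)] by blast
  have cont: "continuous_on S \<psi>" for S
    by (rule lipschitz_on_continuous_on[of L1], rule lipschitz_onI) (use L1 in auto)
  have cont_inv: "continuous_on S (inv \<psi>)" for S
    by (rule lipschitz_on_continuous_on[of L2], rule lipschitz_onI) (use L2 in auto)
  have W_iff: "y \<in> ?W \<longleftrightarrow> inv \<psi> (y, 0) \<in> ?\<Gamma> \<inter> V" for y
  proof
    assume "y \<in> ?W"
    then obtain x where "x \<in> ?\<Gamma> \<inter> V" "(y, 0) = \<psi> x" unfolding chart_image_def by blast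
    then show "inv \<psi> (y, 0) \<in> ?\<Gamma> \<inter> V" by (simp add: inv)
  next
    assume "inv \<psi> (y, 0) \<in> ?\<Gamma> \<inter> V"
    then have "\<psi> (inv \<psi> (y, 0)) \<in> \<psi> ` (?\<Gamma> \<inter> V)" by (rule imageI)
    then show "y \<in> ?W" by (simp add: inv chart_image_def)
  qed
  have ret: "inv \<psi> (fst (\<psi> u), 0) = u" if "u \<in> ?\<Gamma>" "u \<in> V" for u
  proof -
    have "snd (\<psi> u) = 0" using flat that by auto
    then have "(fst (\<psi> u), 0) = \<psi> u" by (simp add: prod_eq_iff)
    then show ?thesis by (simp add: inv)
  qed
  have "open ?W"
    unfolding open_dist
  proof
    fix y assume "y \<in> ?W"
    then have x: "inv \<psi> (y, 0) \<in> ?\<Gamma>" "inv \<psi> (y, 0) \<in> V" using W_iff by auto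
    have vimage: "open (f -` S)" if "continuous_on UNIV f" "open S"
      for f :: "'b \<times> real \<Rightarrow> 'b \<times> real" and S
      using that continuous_on_open_vimage[OF open_UNIV, of f] by auto
    have "open (inv \<psi> -` V)" using cont_inv \<open>open V\<close> by (rule vimage)
    then obtain r where r: "0 < r" "ball (y, 0) r \<subseteq> inv \<psi> -` V"
      using x(2) open_contains_ball by (metis vimageI)
    define B where "B = ball (y, 0::real) r \<inter> {z. 0 < snd z}"
    have "B = ball (y, 0) r \<inter> {z. (0::'b, 1::real) \<bullet> z > 0}"
      by (auto simp: B_def inner_prod_def)
    then have "connected B" by (auto intro!: convex_connected convex_Int convex_halfspace_gt simp: convex_halfspace_gt)
    then have conn: "connected (inv \<psi> ` B)" by (intro connected_continuous_image cont_inv)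
    have "inv \<psi> ` B \<inter> ?\<Gamma> = {}"
    proof (rule ccontr)
      assume "inv \<psi> ` B \<inter> ?\<Gamma> \<noteq> {}"
      then obtain z where z: "z \<in> B" "inv \<psi> z \<in> ?\<Gamma>" by auto
      then have "inv \<psi> z \<in> V" using r(2) by (auto simp: B_def)
      then have "snd (\<psi> (inv \<psi> z)) = 0" using flat z(2) by auto
      then show False using z(1) by (simp add: inv B_def)
    qed
    moreover have "inv \<psi> ` B \<inter> \<Omega> \<noteq> {}"
    proof -
      have "open (\<psi> -` ball (y, 0) r)"
        using cont open_ball by (rule vimage)
      moreover have "inv \<psi> (y, 0) \<in> \<psi> -` ball (y, 0) r" using r(1) by (simp add: inv)
      moreover have "inv \<psi> (y, 0) \<in> closure \<Omega>" using x(1) by (simp add: frontier_def)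
      ultimately obtain w where w: "w \<in> \<Omega>" "\<psi> w \<in> ball (y, 0) r"
        by (metis (no_types) disjoint_iff open_Int_closure_eq_empty vimageE)
      then have "w \<in> V" using r(2) inv(2)[of w] by force
      then have "0 < snd (\<psi> w)" using pos w(1) by auto
      then have "\<psi> w \<in> B" using w(2) by (simp add: B_def)
      then show ?thesis using w(1) inv(2)[of w] by (metis disjoint_iff imageI)
    qed
    ultimately have inside: "inv \<psi> ` B \<subseteq> \<Omega>"
      using connected_Int_frontier[OF conn, of \<Omega>] by blast
    have "y' \<in> ?W" if y': "dist y' y < r" for y'
      unfolding W_iff
    proof
      have ball: "(y', 0) \<in> ball (y, 0) r" using y' by (simp add: dist_Pair_Pair dist_commute)
      then show V: "inv \<psi> (y', 0) \<in> V" using r(2) by auto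
      have "inv \<psi> (y', 0) \<in> closure \<Omega>"
        unfolding closure_approachable
      proof (intro allI impI)
        fix e :: real assume "0 < e"
        define t where "t = min (e / (2 * L2)) ((r - dist y' y) / 2)"
        have t: "0 < t" "t < r - dist y' y" "L2 * t < e"
        proof -
          show "0 < t" using \<open>0 < e\<close> L2(1) y' by (simp add: t_def)
          show "t < r - dist y' y" using y' by (auto simp: t_def min_less_iff_disj)
          have "L2 * t \<le> L2 * (e / (2 * L2))" using L2(1) by (intro mult_left_mono) (auto simp: t_def)
          then show "L2 * t < e" using L2(1) \<open>0 < e\<close> by simp
        qed
        have d: "dist (y', t) (y', 0) = t" using t(1) by (simp add: dist_Pair_Pair dist_real_def)
        have "dist (y', t) (y, 0::real) \<le> dist (y', t) (y', 0) + dist (y', 0::real) (y, 0)" by (rule dist_triangle)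
        also have "\<dots> = t + dist y' y" using d by (simp add: dist_Pair_Pair)
        finally have "(y', t) \<in> B" using t by (simp add: B_def dist_commute)
        then have "inv \<psi> (y', t) \<in> \<Omega>" using inside by auto
        moreover have "dist (inv \<psi> (y', t)) (inv \<psi> (y', 0)) < e"
          using L2(2)[of "(y', t)" "(y', 0)"] t(3) unfolding d by linarith
        ultimately show "\<exists>w\<in>\<Omega>. dist w (inv \<psi> (y', 0)) < e" by blast
      qed
      moreover have "inv \<psi> (y', 0) \<notin> \<Omega>" using pos V inv(1)[of "(y', 0)"] by force
      ultimately show "inv \<psi> (y', 0) \<in> ?\<Gamma>"
        using \<open>open \<Omega>\<close> by (simp add: frontier_def interior_open)
    qed
    then show "\<exists>e>0. \<forall>y'. dist y' y < e \<longrightarrow> y' \<in> ?W" using r(1) by blast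
  qed
  moreover have compact: "compact ?\<Gamma>"
    using \<open>bounded \<Omega>\<close> by (simp add: compact_frontier_bounded)
  moreover have "bounded ?W"
  proof (rule bounded_subset)
    show "bounded ((\<lambda>x. fst (\<psi> x)) ` ?\<Gamma>)"
      by (intro compact_imp_bounded compact_continuous_image compact continuous_intros cont)
    show "?W \<subseteq> (\<lambda>x. fst (\<psi> x)) ` ?\<Gamma>"
    proof
      fix y assume "y \<in> ?W"
      then have "inv \<psi> (y, 0) \<in> ?\<Gamma>" using W_iff by auto
      then show "y \<in> (\<lambda>x. fst (\<psi> x)) ` ?\<Gamma>" using inv(1)[of "(y, 0)"] by (metis fst_conv imageI)
    qed
  qed
  moreover have "dist (inv \<psi> (x, 0)) (inv \<psi> (y, 0)) \<le> max 1 (max L1 L2) * dist x y" for x y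
  proof -
    have "dist (inv \<psi> (x, 0)) (inv \<psi> (y, 0)) \<le> L2 * dist x y"
      using L2(2)[of "(x, 0)" "(y, 0)"] by (simp add: dist_Pair_Pair)
    also have "\<dots> \<le> max 1 (max L1 L2) * dist x y" by (intro mult_right_mono) auto
    finally show ?thesis .
  qed
  moreover have "dist (fst (\<psi> u)) (fst (\<psi> v)) \<le> max 1 (max L1 L2) * dist u v" for u v
  proof -
    have "dist (fst (\<psi> u)) (fst (\<psi> v)) \<le> L1 * dist u v"
      using L1(2)[of u v] dist_fst_le[of "\<psi> u" "\<psi> v"] by linarith
    also have "\<dots> \<le> max 1 (max L1 L2) * dist u v" by (intro mult_right_mono) auto
    finally show ?thesis .
  qed
  ultimately have "lipschitz_chart ?\<Gamma> V ?W (\<lambda>y. inv \<psi> (y, 0)) (\<lambda>x. fst (\<psi> x)) (max 1 (max L1 L2))"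
    using W_iff ret \<open>open V\<close> by unfold_locales (auto simp: inv)
  then show ?thesis by blast
qed

section \<open>From Lipschitz building blocks to smooth atoms\<close>

lemma smooth_bd_mono_scale:
  "smooth_bd K R A F \<Longrightarrow> 0 \<le> R \<Longrightarrow> R \<le> R' \<Longrightarrow> smooth_bd K R' A F"
proof (induction K arbitrary: A F)
  case (Suc K)
  have A: "0 \<le> A" using Suc.prems(1) by (rule smooth_bd_nonneg)
  have "\<exists>G. (\<forall>x. ((\<lambda>t. F (x + t *\<^sub>R b)) has_vector_derivative G x) (at 0)) \<and> smooth_bd K R' (R' * A) G"
    if b: "b \<in> Basis" for b
  proof -
    obtain G where G: "\<forall>x. ((\<lambda>t. F (x + t *\<^sub>R b)) has_vector_derivative G x) (at 0)"
      "smooth_bd K R (R * A) G"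
      using Suc.prems(1) b by auto
    have "smooth_bd K R' (R * A) G" using Suc.IH G(2) Suc.prems by blast
    moreover have "R * A \<le> R' * A" using Suc.prems A by (intro mult_right_mono) auto
    ultimately have "smooth_bd K R' (R' * A) G"
      by (rule smooth_bd_mono) (use Suc.prems(2,3) in simp)
    then show ?thesis using G(1) by blast
  qed
  then show ?case using Suc.prems(1) unfolding smooth_bd.simps by blast
qed auto

lemma lattice_near_count:
  fixes z :: "'a::euclidean_space"
  assumes "0 \<le> c" "0 \<le> \<rho>" "S \<subseteq> int_lattice"
    and near: "\<And>k. k \<in> S \<Longrightarrow> \<exists>y\<in>dcube c l k. dist y z \<le> \<rho>"
  shows "finite S" and "real (card S) \<le> (2 * (c + 2 ^ l * \<rho>) + 1) ^ DIM('a)"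
proof -
  have "\<bar>k \<bullet> b - (2 ^ l *\<^sub>R z) \<bullet> b\<bar> \<le> c + 2 ^ l * \<rho>" if kb: "k \<in> S" "b \<in> Basis" for k b
  proof -
    obtain y where y: "y \<in> dcube c l k" "dist y z \<le> \<rho>" using near[OF kb(1)] by auto
    have "2 ^ l * \<bar>y \<bullet> b - z \<bullet> b\<bar> \<le> 2 ^ l * \<rho>"
      using abs_inner_diff_le_dist[OF kb(2), of y z] y(2) by simp
    then have "\<bar>2 ^ l * (y \<bullet> b) - 2 ^ l * (z \<bullet> b)\<bar> \<le> 2 ^ l * \<rho>"
      by (simp add: abs_mult right_diff_distrib[symmetric])
    moreover have "\<bar>2 ^ l * (y \<bullet> b) - k \<bullet> b\<bar> \<le> c" using y(1) kb(2) by (simp add: mem_dcube_iff)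
    ultimately show ?thesis by simp
  qed
  then show "finite S" "real (card S) \<le> (2 * (c + 2 ^ l * \<rho>) + 1) ^ DIM('a)"
    using lattice_subset_box_count[of "c + 2 ^ l * \<rho>" S "2 ^ l *\<^sub>R z"] assms(1-3) by auto
qed

lemma sum_of_real_le_ennreal:
  fixes f :: "'i \<Rightarrow> 'j \<Rightarrow> real"
  assumes "0 \<le> C" "\<And>j. j \<in> J \<Longrightarrow> 0 \<le> w j" "\<And>j m. 0 \<le> f j m"
  shows "ennreal (C * (\<Sum>j\<in>J. w j * (\<Sum>m\<in>R j. f j m))) =
    ennreal C * (\<Sum>j\<in>J. ennreal (w j) * (\<Sum>m\<in>R j. ennreal (f j m)))"
proof -
  have "(\<Sum>j\<in>J. ennreal (w j) * (\<Sum>m\<in>R j. ennreal (f j m))) =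
      (\<Sum>j\<in>J. ennreal (w j * (\<Sum>m\<in>R j. f j m)))"
    using assms by (intro sum.cong refl) (simp add: ennreal_mult sum_nonneg)
  also have "\<dots> = ennreal (\<Sum>j\<in>J. w j * (\<Sum>m\<in>R j. f j m))"
    using assms by (intro sum_ennreal) (simp add: sum_nonneg)
  finally show ?thesis
    using assms by (simp add: ennreal_mult sum_nonneg)
qed

lemma b_qnorm_level_le:
  assumes "0 < q"
  shows "Lp_qnorm (count_space (cube_indices S j)) p (\<lambda>m. ennreal (norm (lam j m))) \<le>
    ennreal (2 powr (- (real j * (s - real k * enn2real (inverse p))))) * b_qnorm k s p q S lam"
proof -
  let ?t = "real j * (s - real k * enn2real (inverse p))"
  let ?n = "Lp_qnorm (count_space (cube_indices S j)) p (\<lambda>m. ennreal (norm (lam j m)))"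
  have "ennreal (2 powr ?t) * ?n \<le> b_qnorm k s p q S lam"
    unfolding b_qnorm_def using assms by (rule le_Lp_qnorm_count_space) simp
  then have "ennreal (2 powr (- ?t)) * (ennreal (2 powr ?t) * ?n) \<le>
      ennreal (2 powr (- ?t)) * b_qnorm k s p q S lam"
    by (rule mult_left_mono) simp
  moreover have "ennreal (2 powr (- ?t)) * (ennreal (2 powr ?t) * ?n) = ?n"
    by (simp add: mult.assoc[symmetric] ennreal_mult[symmetric] powr_add[symmetric])
  ultimately show ?thesis by simp
qed

context lipschitz_chart
begin

text \<open>The threefold dilate of a cube of level \<open>l\<close> contains the centres of all cubes of level \<open>l - 1\<close> that
  meet the cube. These are the sampling points of the coarser level.\<close>

definition coarse_nbrs :: "real \<Rightarrow> nat \<Rightarrow> nat \<Rightarrow> 'b \<Rightarrow> 'a set" where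
  "coarse_nbrs \<delta> j l k = {m \<in> cube_indices \<Gamma> j. j \<le> l \<and> (\<exists>y\<in>dcube 3 l k. \<Psi> y \<in> dcube \<delta> j m)}"

text \<open>Distances agree up to a factor on both sides of the chart, so both counts are counts of lattice
  points near a given point.\<close>

lemma coarse_nbrs_count:
  assumes "0 \<le> \<delta>"
  shows "\<exists>A::nat. (\<forall>j l k. finite (coarse_nbrs \<delta> j l k) \<and> card (coarse_nbrs \<delta> j l k) \<le> A) \<and>
    (\<forall>j l m S. j \<le> l \<longrightarrow> S \<subseteq> int_lattice \<longrightarrow> finite {k\<in>S. m \<in> coarse_nbrs \<delta> j l k} \<and>
      real (card {k\<in>S. m \<in> coarse_nbrs \<delta> j l k}) \<le> real A * 2 ^ ((l - j) * DIM('b)))"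
proof -
  define n where "n = real DIM('a)"
  define D where "D = real DIM('b)"
  have nD: "0 \<le> n" "0 \<le> D" by (auto simp: n_def D_def)
  have L0: "0 \<le> L" using L by simp
  define A1 where "A1 = (2 * (\<delta> + L * (D * 6)) + 1) ^ DIM('a)"
  define A2 where "A2 = (2 * (3 + L * (n * (2 * \<delta>))) + 1) ^ DIM('b)"
  have A: "A1 \<le> real (nat \<lceil>max A1 A2\<rceil>)" "A2 \<le> real (nat \<lceil>max A1 A2\<rceil>)" by linarith+
  have 1: "finite (coarse_nbrs \<delta> j l k) \<and> real (card (coarse_nbrs \<delta> j l k)) \<le> A1" for j l k
  proof (cases "j \<le> l")
    case True
    have near: "\<exists>u\<in>dcube \<delta> j m. dist u (\<Psi> (k /\<^sub>R 2 ^ l)) \<le> L * (D * 6) / 2 ^ j"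
      if m: "m \<in> coarse_nbrs \<delta> j l k" for m
    proof -
      obtain y where y: "y \<in> dcube 3 l k" "\<Psi> y \<in> dcube \<delta> j m" using m by (auto simp: coarse_nbrs_def)
      have "dist (\<Psi> y) (\<Psi> (k /\<^sub>R 2 ^ l)) \<le> L * dist y (k /\<^sub>R 2 ^ l)" by (rule \<Psi>_lip)
      also have "\<dots> \<le> L * (D * (2 * 3 / 2 ^ l))"
        using dist_dcube_le[OF y(1) dcube_centre_mem] L0 by (intro mult_left_mono) (auto simp: D_def)
      also have "\<dots> \<le> L * (D * (2 * 3 / 2 ^ j))"
        using True L0 nD by (intro mult_left_mono divide_left_mono power_increasing) auto
      finally show ?thesis using y(2) by auto
    qed
    have sub: "coarse_nbrs \<delta> j l k \<subseteq> int_lattice" by (auto simp: coarse_nbrs_def cube_indices_def)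
    have nn: "0 \<le> L * (D * 6) / 2 ^ j" using L0 nD by simp
    show ?thesis
      using lattice_near_count[OF assms nn sub near] by (simp add: A1_def)
  qed (use L0 nD assms in \<open>auto simp: coarse_nbrs_def A1_def intro!: zero_le_power add_nonneg_nonneg\<close>)
  have 2: "finite {k\<in>S. m \<in> coarse_nbrs \<delta> j l k} \<and>
      real (card {k\<in>S. m \<in> coarse_nbrs \<delta> j l k}) \<le> A2 * 2 ^ ((l - j) * DIM('b))"
    if jl: "j \<le> l" and S: "S \<subseteq> int_lattice" for j l m S
  proof (cases "{k\<in>S. m \<in> coarse_nbrs \<delta> j l k} = {}")
    case False
    then obtain k0 y0 where y0: "\<Psi> y0 \<in> dcube \<delta> j m" by (auto simp: coarse_nbrs_def)
    have near: "\<exists>y\<in>dcube 3 l k. dist y y0 \<le> L * (n * (2 * \<delta>)) / 2 ^ j"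
      if k: "k \<in> {k\<in>S. m \<in> coarse_nbrs \<delta> j l k}" for k
    proof -
      obtain y where y: "y \<in> dcube 3 l k" "\<Psi> y \<in> dcube \<delta> j m" using k by (auto simp: coarse_nbrs_def)
      have "dist y y0 \<le> L * dist (\<Psi> y) (\<Psi> y0)" by (rule dist_le_dist_\<Psi>)
      also have "\<dots> \<le> L * (n * (2 * \<delta> / 2 ^ j))"
        using dist_dcube_le[OF y(2) y0] L0 by (intro mult_left_mono) (auto simp: n_def)
      finally show ?thesis using y(1) by auto
    qed
    have nn: "0 \<le> L * (n * (2 * \<delta>)) / 2 ^ j" using L0 nD assms by simp
    have sub: "{k\<in>S. m \<in> coarse_nbrs \<delta> j l k} \<subseteq> int_lattice" using S by auto
    define T where "T = (2::real) ^ (l - j)"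
    have T: "1 \<le> T" by (simp add: T_def)
    have "2 ^ l * (L * (n * (2 * \<delta>)) / 2 ^ j) = T * (L * (n * (2 * \<delta>)))"
      using jl by (simp add: T_def power_diff)
    moreover have "2 * (3 + T * x) + 1 \<le> T * (2 * (3 + x) + 1)" for x :: real
      using T by (simp add: algebra_simps)
    ultimately have "2 * (3 + 2 ^ l * (L * (n * (2 * \<delta>)) / 2 ^ j)) + 1 \<le>
        T * (2 * (3 + L * (n * (2 * \<delta>))) + 1)" by (simp only:)
    then have "(2 * (3 + 2 ^ l * (L * (n * (2 * \<delta>)) / 2 ^ j)) + 1) ^ DIM('b) \<le>
        (T * (2 * (3 + L * (n * (2 * \<delta>))) + 1)) ^ DIM('b)"
      by (rule power_mono) (use L0 nD assms in
          \<open>auto intro!: add_nonneg_nonneg mult_nonneg_nonneg divide_nonneg_nonneg\<close>)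
    also have "\<dots> = A2 * 2 ^ ((l - j) * DIM('b))"
      by (simp add: A2_def T_def power_mult_distrib power_mult)
    finally show ?thesis
      using lattice_near_count[OF _ nn sub near] by (auto intro: order_trans)
  next
    case True
    have "0 \<le> A2" unfolding A2_def using L0 nD assms by (intro zero_le_power) simp
    then show ?thesis unfolding True by simp
  qed
  have u1: "real (card {k\<in>S. m \<in> coarse_nbrs \<delta> j l k}) \<le>
      real (nat \<lceil>max A1 A2\<rceil>) * 2 ^ ((l - j) * DIM('b))"
    if "j \<le> l" "S \<subseteq> int_lattice" for j l m S
    using 2[OF that, of m] mult_right_mono[OF A(2), of "2 ^ ((l - j) * DIM('b))"]
    by (meson order_trans zero_le_numeral zero_le_power)
  have u2: "card (coarse_nbrs \<delta> j l k) \<le> nat \<lceil>max A1 A2\<rceil>" for j l k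
  proof -
    have "real (card (coarse_nbrs \<delta> j l k)) \<le> real (nat \<lceil>max A1 A2\<rceil>)" using 1 A(1) order_trans by blast
    then show ?thesis by simp
  qed
  show ?thesis
    using 1 2 u1 u2 by (intro exI[of _ "nat \<lceil>max A1 A2\<rceil>"] conjI allI impI) simp_all
qed

definition block_sum :: "(nat \<Rightarrow> 'a \<Rightarrow> complex) \<Rightarrow> (nat \<Rightarrow> 'a \<Rightarrow> 'b \<Rightarrow> complex) \<Rightarrow> nat \<Rightarrow> 'b \<Rightarrow> complex" where
  "block_sum lam b j y = (\<Sum>m\<in>cube_indices \<Gamma> j. lam j m * b j m y)"

text \<open>What remains of a Lipschitz atom after localisation and passage to the parameter domain. The index
  is still a cube of the ambient lattice, and the normalising constant \<open>B\<close> depends on the chart.\<close>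

definition lipschitz_blocks :: "real \<Rightarrow> real \<Rightarrow> (nat \<Rightarrow> 'a \<Rightarrow> 'b \<Rightarrow> complex) \<Rightarrow> bool" where
  "lipschitz_blocks \<delta> B b \<longleftrightarrow> (\<forall>j. \<forall>m\<in>cube_indices \<Gamma> j. (\<forall>y. b j m y \<noteq> 0 \<longrightarrow> \<Psi> y \<in> dcube \<delta> j m) \<and>
     (\<forall>y. norm (b j m y) \<le> B) \<and> (\<forall>y z. norm (b j m y - b j m z) \<le> B * 2 ^ j * dist y z))"

lemma finite_indices_\<Gamma>: "finite (cube_indices \<Gamma> j)"
  using compact_\<Gamma> by (intro finite_cube_indices compact_imp_bounded)

lemma finite_indices_W: "finite (cube_indices W j)"
  using bounded_W by (rule finite_cube_indices)

lemma block_sum_bound: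
  assumes b: "lipschitz_blocks \<delta> B b" and R: "R \<subseteq> cube_indices \<Gamma> j"
    and sub: "\<And>m. m \<in> cube_indices \<Gamma> j \<Longrightarrow> \<Psi> y \<in> dcube \<delta> j m \<Longrightarrow> m \<in> R"
  shows "norm (block_sum lam b j y) \<le> B * (\<Sum>m\<in>R. norm (lam j m))"
proof -
  have "block_sum lam b j y = (\<Sum>m\<in>R. lam j m * b j m y)"
    unfolding block_sum_def using b R sub
    by (intro sum.mono_neutral_right finite_indices_\<Gamma>) (auto simp: lipschitz_blocks_def)
  also have "norm \<dots> \<le> (\<Sum>m\<in>R. norm (lam j m) * B)"
    using b R by (intro sum_norm_le) (auto simp: norm_mult lipschitz_blocks_def intro!: mult_left_mono)
  finally show ?thesis by (simp add: sum_distrib_left mult.commute)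
qed

lemma block_sum_diff_bound:
  assumes b: "lipschitz_blocks \<delta> B b" and R: "R \<subseteq> cube_indices \<Gamma> j"
    and sub: "\<And>m. m \<in> cube_indices \<Gamma> j \<Longrightarrow> \<Psi> y \<in> dcube \<delta> j m \<or> \<Psi> z \<in> dcube \<delta> j m \<Longrightarrow> m \<in> R"
  shows "norm (block_sum lam b j y - block_sum lam b j z) \<le>
    B * 2 ^ j * dist y z * (\<Sum>m\<in>R. norm (lam j m))"
proof -
  have "block_sum lam b j y - block_sum lam b j z = (\<Sum>m\<in>cube_indices \<Gamma> j. lam j m * (b j m y - b j m z))"
    by (simp add: block_sum_def sum_subtractf right_diff_distrib)
  also have "\<dots> = (\<Sum>m\<in>R. lam j m * (b j m y - b j m z))"
  proof (intro sum.mono_neutral_right finite_indices_\<Gamma> R ballI)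
    fix m assume m: "m \<in> cube_indices \<Gamma> j - R"
    then have "b j m y = 0" "b j m z = 0" using b sub[of m] unfolding lipschitz_blocks_def by blast+
    then show "lam j m * (b j m y - b j m z) = 0" by simp
  qed
  also have "norm \<dots> \<le> (\<Sum>m\<in>R. norm (lam j m) * (B * 2 ^ j * dist y z))"
    using b R by (intro sum_norm_le) (auto simp: norm_mult lipschitz_blocks_def intro!: mult_left_mono)
  finally show ?thesis by (simp add: sum_distrib_left mult_ac)
qed

text \<open>\<open>E\<close> stands for the error of sampling the levels \<open>j \<le> l\<close> on the lattice of level \<open>l\<close>. The level \<open>j\<close>
  contributes \<open>2\<^sup>j\<^sup>-\<^sup>l\<close> times a sum of coefficients of nearby cubes, and its \<open>L\<^sub>p\<close> norm carries another
  \<open>2\<^sup>-\<^sup>j\<^sup>s\<close>; as \<open>s < 1\<close> the sum over \<open>j\<close> is dominated by \<open>2\<^sup>-\<^sup>l\<^sup>s\<close>. The pointwise bound holds for all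
  families \<open>R\<close> of sufficiently many neighbours, so that a family depending measurably on the point can
  be chosen.\<close>

lemma sampling_error_bound:
  assumes "0 < p" "0 < q" "s < 1" "0 \<le> \<delta>" "0 \<le> \<rho>"
  shows "\<exists>C>0. \<forall>lam E l.
    E \<in> borel_measurable (lebesgue_on W) \<longrightarrow>
    (\<forall>x\<in>W. \<forall>R. (\<forall>j\<le>l. R j \<subseteq> cube_indices \<Gamma> j \<and> (\<forall>m\<in>cube_indices \<Gamma> j.
        (\<exists>y. dist x y \<le> \<rho> / 2 ^ l \<and> \<Psi> y \<in> dcube \<delta> j m) \<longrightarrow> m \<in> R j)) \<longrightarrow>
      E x \<le> (\<Sum>j\<le>l. ennreal (2 powr - real (l - j)) * (\<Sum>m\<in>R j. ennreal (norm (lam j m :: complex))))) \<longrightarrow>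
    Lp_qnorm (lebesgue_on W) p E \<le>
      ennreal (C * 2 powr (- (s * real l))) * b_qnorm DIM('b) s p q \<Gamma> lam"
proof -
  define n where "n = real DIM('a)"
  define P where "P = enn2real (inverse p)"
  have P: "0 \<le> P" by (simp add: P_def)
  have L0: "0 \<le> L" using L by simp
  define \<sigma> where "\<sigma> = \<rho> + L * (n * (2 * \<delta>)) + 1"
  have \<sigma>: "0 < \<sigma>" using assms L0 by (auto simp: \<sigma>_def n_def intro!: add_nonneg_pos add_nonneg_nonneg mult_nonneg_nonneg)
  define A where "A = nat \<lceil>(2 * (\<delta> + L * \<sigma>) + 1) ^ DIM('a)\<rceil>"
  define v where "v = unit_ball_vol (real DIM('b)) * \<sigma> ^ DIM('b)"
  have v: "0 < v" using \<sigma> by (simp add: v_def)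
  \<comment> \<open>Neighbourhood is expressed by balls about fixed points \<open>Y j m\<close>, which are measurable sets.\<close>
  define Y where "Y j m = (SOME y. \<Psi> y \<in> dcube \<delta> j m)" for j m
  define N where "N j x = {m \<in> cube_indices \<Gamma> j. (\<exists>y. \<Psi> y \<in> dcube \<delta> j m) \<and> x \<in> cball (Y j m) (\<sigma> / 2 ^ j)}" for j x
  have Y: "\<Psi> (Y j m) \<in> dcube \<delta> j m" if "\<exists>y. \<Psi> y \<in> dcube \<delta> j m" for j m
    unfolding Y_def using that by (rule someI_ex)
  have N_mem: "m \<in> N j x" if m: "m \<in> cube_indices \<Gamma> j" "dist x y \<le> \<rho> / 2 ^ l" "\<Psi> y \<in> dcube \<delta> j m" "j \<le> l"
    for m j l x y
  proof -
    have "dist y (Y j m) \<le> L * dist (\<Psi> y) (\<Psi> (Y j m))" by (rule dist_le_dist_\<Psi>)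
    also have "\<dots> \<le> L * (n * (2 * \<delta> / 2 ^ j))"
      using dist_dcube_le[OF m(3) Y] m(3) L0 by (intro mult_left_mono) (auto simp: n_def)
    finally have 1: "dist y (Y j m) \<le> L * (n * (2 * \<delta>)) / 2 ^ j" by simp
    have "\<rho> / 2 ^ l \<le> \<rho> / 2 ^ j"
      using m(4) assms by (intro divide_left_mono power_increasing) auto
    then have "dist x (Y j m) \<le> \<rho> / 2 ^ j + L * (n * (2 * \<delta>)) / 2 ^ j"
      using 1 m(2) dist_triangle[of x "Y j m" y] by linarith
    also have "\<dots> \<le> \<sigma> / 2 ^ j" by (simp add: \<sigma>_def add_divide_distrib)
    finally show ?thesis using m(1,3) by (auto simp: N_def dist_commute)
  qed
  have N_sub: "N j x \<subseteq> cube_indices \<Gamma> j" for j x by (auto simp: N_def)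
  have N_count: "finite (N j x) \<and> card (N j x) \<le> A" for j x
  proof -
    have sub: "N j x \<subseteq> int_lattice" by (auto simp: N_def cube_indices_def)
    have near: "\<exists>u\<in>dcube \<delta> j m. dist u (\<Psi> x) \<le> L * \<sigma> / 2 ^ j" if m: "m \<in> N j x" for m
    proof -
      have "dist (\<Psi> (Y j m)) (\<Psi> x) \<le> L * dist (Y j m) x" by (rule \<Psi>_lip)
      also have "\<dots> \<le> L * (\<sigma> / 2 ^ j)" using m L0 by (intro mult_left_mono) (auto simp: N_def)
      finally show ?thesis using Y[of j m] m by (auto simp: N_def)
    qed
    have "finite (N j x)" "real (card (N j x)) \<le> (2 * (\<delta> + L * \<sigma>) + 1) ^ DIM('a)"
      using lattice_near_count[OF assms(4) _ sub near] L0 \<sigma> by auto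
    then show ?thesis unfolding A_def by linarith
  qed
  have meas: "(\<lambda>x. \<Sum>m\<in>N j x. ennreal (norm (lam j m :: complex))) \<in> borel_measurable (lebesgue_on W)"
    for j and lam :: "nat \<Rightarrow> 'a \<Rightarrow> complex"
  proof -
    have "(\<Sum>m\<in>N j x. ennreal (norm (lam j m))) =
        (\<Sum>m\<in>{m \<in> cube_indices \<Gamma> j. \<exists>y. \<Psi> y \<in> dcube \<delta> j m}.
          ennreal (norm (lam j m)) * indicator (cball (Y j m) (\<sigma> / 2 ^ j)) x)" for x
      using finite_indices_\<Gamma>[of j]
      by (intro sum.mono_neutral_cong_left) (auto simp: N_def indicator_def)
    moreover have "(\<lambda>x. indicator (cball (Y j m) (\<sigma> / 2 ^ j)) x :: ennreal) \<in> borel_measurable (lebesgue_on W)" for m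
      by (intro measurable_restrict_space1 measurable_completion borel_measurable_indicator) simp
    ultimately show ?thesis by simp
  qed
  have level: "Lp_qnorm (lebesgue_on W) p (\<lambda>x. \<Sum>m\<in>N j x. ennreal (norm (lam j m :: complex))) \<le>
      ennreal (real A * v powr P * 2 powr (- (s * real j))) * b_qnorm DIM('b) s p q \<Gamma> lam"
    for j and lam :: "nat \<Rightarrow> 'a \<Rightarrow> complex"
  proof -
    let ?lam = "\<lambda>m. ennreal (norm (lam j m))"
    have "Lp_qnorm (lebesgue_on W) p (\<lambda>x. \<Sum>m\<in>N j x. ?lam m) \<le>
        ennreal (real A * (v / (2 ^ j) ^ DIM('b)) powr P) * Lp_qnorm (count_space (cube_indices \<Gamma> j)) p ?lam"
      unfolding P_def
    proof (rule Lp_qnorm_neighbour_sum_le[where R="N j" and B="\<lambda>m. cball (Y j m) (\<sigma> / 2 ^ j) \<inter> W"])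
      show "0 < v / (2 ^ j) ^ DIM('b)" using v by simp
      fix m
      show "cball (Y j m) (\<sigma> / 2 ^ j) \<inter> W \<in> sets (lebesgue_on W)"
        using open_W by (subst sets_restrict_space_iff) auto
      have "emeasure (lebesgue_on W) (cball (Y j m) (\<sigma> / 2 ^ j) \<inter> W) =
          emeasure lebesgue (cball (Y j m) (\<sigma> / 2 ^ j) \<inter> W)"
        using open_W by (intro emeasure_restrict_space) auto
      also have "\<dots> \<le> emeasure lebesgue (cball (Y j m) (\<sigma> / 2 ^ j))"
        by (intro emeasure_mono) auto
      also have "\<dots> = ennreal (v / (2 ^ j) ^ DIM('b))"
        using \<sigma> by (simp add: emeasure_cball v_def power_divide)
      finally show "emeasure (lebesgue_on W) (cball (Y j m) (\<sigma> / 2 ^ j) \<inter> W) \<le>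
          ennreal (v / (2 ^ j) ^ DIM('b))" .
    qed (use assms(1) N_count meas countable_cube_indices in \<open>auto simp: N_def\<close>)
    also have "\<dots> \<le> ennreal (real A * (v / (2 ^ j) ^ DIM('b)) powr P) *
        (ennreal (2 powr (- (real j * (s - real DIM('b) * P)))) * b_qnorm DIM('b) s p q \<Gamma> lam)"
      unfolding P_def using assms(2) by (intro mult_left_mono b_qnorm_level_le) auto
    also have "\<dots> = ennreal (real A * (v / (2 ^ j) ^ DIM('b)) powr P *
        2 powr (- (real j * (s - real DIM('b) * P)))) * b_qnorm DIM('b) s p q \<Gamma> lam"
      by (simp add: ennreal_mult mult.assoc)
    also have "real A * (v / (2 ^ j) ^ DIM('b)) powr P * 2 powr (- (real j * (s - real DIM('b) * P))) =
        real A * v powr P * 2 powr (- (s * real j))"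
    proof -
      have "((2::real) ^ j) ^ DIM('b) = 2 powr (real j * real DIM('b))"
        by (simp add: powr_realpow[symmetric] powr_powr)
      then have "(v / (2 ^ j) ^ DIM('b)) powr P = v powr P * 2 powr (- (real j * real DIM('b) * P))"
        by (simp add: powr_divide powr_mult inverse_powr powr_powr powr_minus divide_inverse)
      then show ?thesis
        by (simp add: powr_add[symmetric] algebra_simps)
    qed
    finally show ?thesis .
  qed
  define e where "e = 1 - s"
  have e: "0 < e" using assms by (simp add: e_def)
  from Lp_qnorm_suminf_le[OF \<open>0 < p\<close> e, where 'a='b] obtain C1 :: real where C1: "0 < C1"
    and G: "\<forall>(M::'b measure) u. (\<forall>i. u i \<in> borel_measurable M) \<longrightarrow>
      Lp_qnorm M p (\<lambda>x. \<Sum>i. u i x) \<le>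
        ennreal C1 * (SUP i. ennreal (2 powr (e * real i)) * Lp_qnorm M p (u i))"
    by (elim exE conjE)
  define C where "C = C1 * (real A * v powr P) + 1"
  have C: "0 < C" "C1 * (real A * v powr P) \<le> C" using C1 by (auto simp: C_def add_nonneg_pos)
  show ?thesis
  proof (intro exI[of _ C] conjI allI impI, rule C(1))
    fix lam :: "nat \<Rightarrow> 'a \<Rightarrow> complex" and E :: "'b \<Rightarrow> ennreal" and l :: nat
    assume Em: "E \<in> borel_measurable (lebesgue_on W)"
      and E: "\<forall>x\<in>W. \<forall>R. (\<forall>j\<le>l. R j \<subseteq> cube_indices \<Gamma> j \<and> (\<forall>m\<in>cube_indices \<Gamma> j.
        (\<exists>y. dist x y \<le> \<rho> / 2 ^ l \<and> \<Psi> y \<in> dcube \<delta> j m) \<longrightarrow> m \<in> R j)) \<longrightarrow>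
      E x \<le> (\<Sum>j\<le>l. ennreal (2 powr - real (l - j)) * (\<Sum>m\<in>R j. ennreal (norm (lam j m))))"
    define \<beta> where "\<beta> = b_qnorm DIM('b) s p q \<Gamma> lam"
    define w where "w i x = (if i \<le> l then ennreal (2 powr - real i) *
        (\<Sum>m\<in>N (l - i) x. ennreal (norm (lam (l - i) m))) else 0)" for i x
    have wm: "w i \<in> borel_measurable (lebesgue_on W)" for i
      unfolding w_def using meas[of lam "l - i"] by (cases "i \<le> l") auto
    have "E x \<le> (\<Sum>i. w i x)" if x: "x \<in> W" for x
    proof -
      have "E x \<le> (\<Sum>j\<le>l. ennreal (2 powr - real (l - j)) * (\<Sum>m\<in>N j x. ennreal (norm (lam j m))))"
      proof (rule E[THEN bspec, OF x, THEN spec, of "\<lambda>j. N j x", THEN mp], intro allI impI)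
        fix j assume "j \<le> l"
        then show "N j x \<subseteq> cube_indices \<Gamma> j \<and> (\<forall>m\<in>cube_indices \<Gamma> j.
            (\<exists>y. dist x y \<le> \<rho> / 2 ^ l \<and> \<Psi> y \<in> dcube \<delta> j m) \<longrightarrow> m \<in> N j x)"
          using N_mem N_sub by blast
      qed
      also have "\<dots> = (\<Sum>i\<le>l. w i x)"
        by (rule sum.reindex_bij_witness[of _ "\<lambda>i. l - i" "\<lambda>j. l - j"]) (auto simp: w_def)
      also have "\<dots> \<le> (\<Sum>i. w i x)" by (rule sum_le_suminf) auto
      finally show ?thesis .
    qed
    then have "Lp_qnorm (lebesgue_on W) p E \<le> Lp_qnorm (lebesgue_on W) p (\<lambda>x. \<Sum>i. w i x)"
      using assms(1) Em wm by (intro Lp_qnorm_mono) (auto intro: borel_measurable_suminf)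
    also have "\<dots> \<le> ennreal C1 * (SUP i. ennreal (2 powr (e * real i)) * Lp_qnorm (lebesgue_on W) p (w i))"
      using wm by (intro G[rule_format]) auto
    also have "\<dots> \<le> ennreal C1 * (ennreal (real A * v powr P * 2 powr (- (s * real l))) * \<beta>)"
    proof (intro mult_left_mono SUP_least)
      fix i
      show "ennreal (2 powr (e * real i)) * Lp_qnorm (lebesgue_on W) p (w i) \<le>
          ennreal (real A * v powr P * 2 powr (- (s * real l))) * \<beta>"
      proof (cases "i \<le> l")
        case True
        have "Lp_qnorm (lebesgue_on W) p (w i) \<le> ennreal (2 powr - real i) *
            Lp_qnorm (lebesgue_on W) p (\<lambda>x. \<Sum>m\<in>N (l - i) x. ennreal (norm (lam (l - i) m)))"
          unfolding w_def using True assms(1) meas[of lam "l - i"] by (simp add: Lp_qnorm_cmult_le)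
        also have "\<dots> \<le> ennreal (2 powr - real i) *
            (ennreal (real A * v powr P * 2 powr (- (s * real (l - i)))) * \<beta>)"
          unfolding \<beta>_def by (intro mult_left_mono level) auto
        finally have "ennreal (2 powr (e * real i)) * Lp_qnorm (lebesgue_on W) p (w i) \<le>
            ennreal (2 powr (e * real i)) * (ennreal (2 powr - real i) *
            (ennreal (real A * v powr P * 2 powr (- (s * real (l - i)))) * \<beta>))"
          by (rule mult_left_mono) simp
        also have "\<dots> = ennreal (2 powr (e * real i) * (2 powr - real i *
            (real A * v powr P * 2 powr (- (s * real (l - i)))))) * \<beta>"
          by (simp add: ennreal_mult mult.assoc)
        also have "2 powr (e * real i) * (2 powr - real i *
            (real A * v powr P * 2 powr (- (s * real (l - i))))) =
            real A * v powr P * (2 powr (e * real i) * 2 powr - real i * 2 powr (- (s * real (l - i))))"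
          by simp
        also have "2 powr (e * real i) * 2 powr - real i * 2 powr (- (s * real (l - i))) =
            2 powr (- (s * real l))"
          using True by (simp add: powr_add[symmetric] e_def of_nat_diff algebra_simps)
        finally show ?thesis .
      next
        case False
        then have "w i = (\<lambda>x. 0)" by (auto simp: w_def)
        moreover have "Lp_qnorm (lebesgue_on W) p (\<lambda>x. 0) = 0"
          using Lp_qnorm_eq_0_iff[OF assms(1), of "\<lambda>x. 0" "lebesgue_on W"] by simp
        ultimately show ?thesis by simp
      qed
    qed simp
    also have "\<dots> = ennreal (C1 * (real A * v powr P) * 2 powr (- (s * real l))) * \<beta>"
      using C1 by (simp add: ennreal_mult mult.assoc)
    also have "\<dots> \<le> ennreal (C * 2 powr (- (s * real l))) * \<beta>"
      using C(2) by (intro mult_right_mono ennreal_leI) auto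
    finally show "Lp_qnorm (lebesgue_on W) p E \<le>
        ennreal (C * 2 powr (- (s * real l))) * b_qnorm DIM('b) s p q \<Gamma> lam"
      by (simp add: \<beta>_def)
  qed
qed

text \<open>Sampling on the dyadic lattice of level \<open>l\<close> gives smooth approximations \<open>T\<^sub>l\<close> of the partial sums
  \<open>h\<^sub>l\<close>, whose increments are the new series. An increment localised at a cube is a smooth function
  times a difference of values of \<open>h\<^sub>l\<^sub>-\<^sub>1\<close> at two neighbouring points, plus a value of the block of level
  \<open>l\<close>; the Lipschitz bound makes the block of level \<open>j\<close> contribute \<open>2\<^sup>j\<^sup>-\<^sup>l\<close> times its coefficients.\<close>

theorem smooth_atoms_of_lipschitz_blocks:
  fixes K :: nat and d \<delta> B s :: real
  assumes "0 < p" "0 < q" "0 < s" "s < 1" "1 \<le> d" "0 \<le> \<delta>" "0 < B"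
  shows "\<exists>C>0. \<forall>lam b f. lipschitz_blocks \<delta> B b \<longrightarrow> f \<in> borel_measurable (lebesgue_on W) \<longrightarrow>
    (\<lambda>J. Lp_qnorm (lebesgue_on W) p (\<lambda>y. ennreal (norm (f y - (\<Sum>j<J. block_sum lam b j y))))) \<longlonglongrightarrow> 0 \<longrightarrow>
    b_qnorm DIM('b) s p q \<Gamma> lam < \<infinity> \<longrightarrow>
    (\<exists>lam' a'. K_atomic_repr d K p W f lam' a' \<and>
      b_qnorm DIM('b) s p q W lam' \<le> ennreal C * b_qnorm DIM('b) s p q \<Gamma> lam)"
proof -
  define D where "D = real DIM('b)"
  have D: "1 \<le> D" using DIM_positive[where 'a='b] by (simp add: D_def Suc_le_eq[symmetric] del: DIM_positive)
  from smooth_dyadic_partition[of K, where 'a='b] obtain \<eta> :: "nat \<Rightarrow> 'b \<Rightarrow> 'b \<Rightarrow> complex" and A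
    where A: "0 < A" and \<eta>: "\<forall>l k. smooth_bd K (2 ^ l) A (\<eta> l k)"
    "\<forall>l k x. \<eta> l k x \<noteq> 0 \<longrightarrow> x \<in> dcube 1 l k"
    "\<forall>l x S. finite S \<longrightarrow> S \<subseteq> int_lattice \<longrightarrow> {k \<in> int_lattice. x \<in> dcube 1 l k} \<subseteq> S \<longrightarrow>
      (\<Sum>k\<in>S. \<eta> l k x) = 1"
    by (elim exE conjE)
  note \<eta>_bd = \<eta>(1)[rule_format] and \<eta>_supp = \<eta>(2)[rule_format] and \<eta>_sum = \<eta>(3)[rule_format]
  obtain A1 :: nat where count1: "\<And>j l k. finite (coarse_nbrs \<delta> j l k) \<and> card (coarse_nbrs \<delta> j l k) \<le> A1"
    and count2: "\<And>j l m S. j \<le> l \<Longrightarrow> S \<subseteq> int_lattice \<Longrightarrow> finite {k\<in>S. m \<in> coarse_nbrs \<delta> j l k} \<and>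
      real (card {k\<in>S. m \<in> coarse_nbrs \<delta> j l k}) \<le> real A1 * 2 ^ ((l - j) * DIM('b))"
    using coarse_nbrs_count[OF \<open>0 \<le> \<delta>\<close>] by blast
  define A2 where "A2 = (2 * (1 + D) + 1) ^ DIM('b)"
  have A2: "0 \<le> A2" using D by (simp add: A2_def)
  define C1 where "C1 = 2 ^ K * A * (B + A2 * (3 * D * B * A))"
  have C1: "0 < C1" unfolding C1_def using A A2 D assms by (intro mult_pos_pos add_pos_nonneg) auto
  from sequence_norm_refinement[OF assms(1,2,4) less_imp_le[OF C1], where 'b='a and 'c='b and D="DIM('b)" and A=A1]
  obtain C2 :: real where C2: "0 < C2" and seq: "\<forall>(I :: nat \<Rightarrow> 'a set) (J :: nat \<Rightarrow> 'b set)
      (R :: nat \<Rightarrow> nat \<Rightarrow> 'b \<Rightarrow> 'a set) (lam :: nat \<Rightarrow> 'a \<Rightarrow> ennreal) (c :: nat \<Rightarrow> 'b \<Rightarrow> ennreal).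
    (\<forall>j. countable (I j)) \<longrightarrow>
    (\<forall>j l k. k \<in> J l \<longrightarrow> finite (R j l k) \<and> card (R j l k) \<le> A1 \<and> R j l k \<subseteq> I j) \<longrightarrow>
    (\<forall>j l m. j \<le> l \<longrightarrow> m \<in> I j \<longrightarrow> finite {k\<in>J l. m \<in> R j l k} \<and>
       real (card {k\<in>J l. m \<in> R j l k}) \<le> real A1 * 2 ^ ((l - j) * DIM('b))) \<longrightarrow>
    (\<forall>l k. k \<in> J l \<longrightarrow>
       c l k \<le> ennreal C1 * (\<Sum>j\<le>l. ennreal (2 powr - real (l - j)) * (\<Sum>m\<in>R j l k. lam j m))) \<longrightarrow>
    Lp_qnorm (count_space UNIV) q (\<lambda>l. ennreal (2 powr (real l * (s - real DIM('b) * enn2real (inverse p)))) *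
        Lp_qnorm (count_space (J l)) p (c l)) \<le>
    ennreal C2 * Lp_qnorm (count_space UNIV) q
      (\<lambda>j. ennreal (2 powr (real j * (s - real DIM('b) * enn2real (inverse p)))) *
        Lp_qnorm (count_space (I j)) p (lam j))"
    by (elim exE conjE)
  \<comment> \<open>\<open>\<rho> / 2 ^ l\<close> bounds the diameter of a cube of level \<open>l\<close>.\<close>
  define \<rho> where "\<rho> = 2 * D"
  have \<rho>: "0 \<le> \<rho>" using D by (simp add: \<rho>_def)
  from sampling_error_bound[OF assms(1,2,4,6) \<rho>]
  obtain C3 :: real where C3: "0 < C3" and err: "\<forall>lam E l.
    E \<in> borel_measurable (lebesgue_on W) \<longrightarrow>
    (\<forall>x\<in>W. \<forall>R. (\<forall>j\<le>l. R j \<subseteq> cube_indices \<Gamma> j \<and> (\<forall>m\<in>cube_indices \<Gamma> j.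
        (\<exists>y. dist x y \<le> \<rho> / 2 ^ l \<and> \<Psi> y \<in> dcube \<delta> j m) \<longrightarrow> m \<in> R j)) \<longrightarrow>
      E x \<le> (\<Sum>j\<le>l. ennreal (2 powr - real (l - j)) * (\<Sum>m\<in>R j. ennreal (norm (lam j m :: complex))))) \<longrightarrow>
    Lp_qnorm (lebesgue_on W) p E \<le>
      ennreal (C3 * 2 powr (- (s * real l))) * b_qnorm DIM('b) s p q \<Gamma> lam"
    by (elim exE conjE)
  from Lp_qnorm_add_le[OF assms(1), where 'a='b] obtain C4 :: real where C4: "0 < C4"
    and tri: "\<forall>(M::'b measure) f g. f \<in> borel_measurable M \<longrightarrow> g \<in> borel_measurable M \<longrightarrow>
      Lp_qnorm M p (\<lambda>x. f x + g x) \<le> ennreal C4 * (Lp_qnorm M p f + Lp_qnorm M p g)"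
    by (elim exE conjE)
  show ?thesis
  proof (intro exI[of _ C2] conjI allI impI, rule C2)
    fix lam :: "nat \<Rightarrow> 'a \<Rightarrow> complex" and b :: "nat \<Rightarrow> 'a \<Rightarrow> 'b \<Rightarrow> complex" and f :: "'b \<Rightarrow> complex"
    assume b: "lipschitz_blocks \<delta> B b" and f: "f \<in> borel_measurable (lebesgue_on W)"
      and lim: "(\<lambda>J. Lp_qnorm (lebesgue_on W) p
        (\<lambda>y. ennreal (norm (f y - (\<Sum>j<J. block_sum lam b j y))))) \<longlonglongrightarrow> 0"
      and fin: "b_qnorm DIM('b) s p q \<Gamma> lam < \<infinity>"
    let ?pt = "\<lambda>l k. k /\<^sub>R 2 ^ l :: 'b"
    define h where "h l y = (\<Sum>j\<le>l. block_sum lam b j y)" for l y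
    define nbrs where "nbrs l k = {k' \<in> int_lattice. dcube 1 (l - 1) k' \<inter> dcube 1 l k \<noteq> {}}" for l and k :: 'b
    \<comment> \<open>The bracket is the sample of \<open>h l\<close> at the centre of the cube \<open>k\<close> minus the approximation of level
      \<open>l - 1\<close>: the sample of \<open>h (l - 1)\<close> can be put under the sum over \<open>k'\<close>, as the functions
      \<open>\<eta> (l - 1) k'\<close> add up to 1.\<close>
    define F where "F l k x = \<eta> l k x * (block_sum lam b l (?pt l k) +
      (if l = 0 then 0 else \<Sum>k'\<in>nbrs l k. (h (l - 1) (?pt l k) - h (l - 1) (?pt (l - 1) k')) * \<eta> (l - 1) k' x))"
      for l k x
    define \<gamma> where "\<gamma> l k = (\<Sum>j\<le>l. 2 powr - real (l - j) * (\<Sum>m\<in>coarse_nbrs \<delta> j l k. norm (lam j m)))"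
      for l k
    have \<gamma>0: "0 \<le> \<gamma> l k" for l k unfolding \<gamma>_def by (intro sum_nonneg mult_nonneg_nonneg) auto
    have sub: "coarse_nbrs \<delta> j l k \<subseteq> cube_indices \<Gamma> j" for j l k by (auto simp: coarse_nbrs_def)
    have pow: "2 ^ j / 2 ^ l = 2 powr - real (l - j)" if "j \<le> l" for j l :: nat
    proof -
      have "(2::real) ^ l = 2 ^ j * 2 ^ (l - j)" using that by (simp add: power_add[symmetric])
      moreover have "2 powr - real n = 1 / 2 ^ n" for n :: nat
        by (simp add: powr_minus powr_realpow divide_inverse)
      ultimately show ?thesis by (simp only:) simp
    qed
    have centre: "?pt l k \<in> dcube 1 l k" for l k by (rule dcube_centre_mem) simp
    have nbr_point: "?pt (l - 1) k' \<in> dcube 3 l k" if l: "l \<noteq> 0" and k': "k' \<in> nbrs l k" for l k k'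
    proof -
      obtain i where i: "l = Suc i" using l by (cases l) auto
      obtain z where z: "z \<in> dcube 1 i k'" "z \<in> dcube 1 l k" using k' i by (auto simp: nbrs_def)
      show ?thesis
        unfolding mem_dcube_iff
      proof
        fix c :: 'b assume c: "c \<in> Basis"
        have "\<bar>2 ^ i * (z \<bullet> c) - k' \<bullet> c\<bar> \<le> 1" "\<bar>2 ^ l * (z \<bullet> c) - k \<bullet> c\<bar> \<le> 1"
          using z c by (auto simp: mem_dcube_iff)
        moreover have "2 ^ l * (?pt (l - 1) k' \<bullet> c) = 2 * (k' \<bullet> c)" by (simp add: i)
        moreover have "2 ^ l * (z \<bullet> c) = 2 * (2 ^ i * (z \<bullet> c))" by (simp add: i)
        ultimately show "\<bar>2 ^ l * (?pt (l - 1) k' \<bullet> c) - k \<bullet> c\<bar> \<le> 3" by linarith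
      qed
    qed
    have nbrs: "finite (nbrs l k)" "real (card (nbrs l k)) \<le> A2" if l: "l \<noteq> 0" for l k
    proof -
      have near: "\<exists>y\<in>dcube 1 (l - 1) k'. dist y (?pt l k) \<le> D * 2 / 2 ^ l" if k': "k' \<in> nbrs l k" for k'
      proof -
        obtain z where z: "z \<in> dcube 1 (l - 1) k'" "z \<in> dcube 1 l k" using k' by (auto simp: nbrs_def)
        then show ?thesis using dist_dcube_le[OF z(2) centre] by (auto simp: D_def)
      qed
      have "(2::real) ^ (l - 1) * (D * 2 / 2 ^ l) = D" using l by (cases l) auto
      then show "finite (nbrs l k)" "real (card (nbrs l k)) \<le> A2"
        using lattice_near_count[of 1 "D * 2 / 2 ^ l" "nbrs l k" "l - 1", OF _ _ _ near] D
        by (auto simp: A2_def nbrs_def)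
    qed
    have sample: "norm (block_sum lam b l (?pt l k)) \<le> B * \<gamma> l k" for l k
    proof -
      have "norm (block_sum lam b l (?pt l k)) \<le> B * (\<Sum>m\<in>coarse_nbrs \<delta> l l k. norm (lam l m))"
        using centre[of l k] dcube_mono[of 1 3 l k]
        by (intro block_sum_bound[OF b sub]) (auto simp: coarse_nbrs_def)
      also have "(\<Sum>m\<in>coarse_nbrs \<delta> l l k. norm (lam l m)) \<le> \<gamma> l k"
        unfolding \<gamma>_def using member_le_sum[of l "{..l}" "\<lambda>j. 2 powr - real (l - j) *
          (\<Sum>m\<in>coarse_nbrs \<delta> j l k. norm (lam j m))"] by (auto simp: sum_nonneg)
      finally show ?thesis using assms(7) by simp
    qed
    have increment: "norm (h i (?pt l k) - h i z) \<le> 3 * D * B * \<gamma> l k"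
      if i: "i \<le> l" and z: "z \<in> dcube 3 l k" "dist (?pt l k) z \<le> 3 * D / 2 ^ l" for i l k z
    proof -
      have "norm (h i (?pt l k) - h i z) \<le>
          (\<Sum>j\<le>i. norm (block_sum lam b j (?pt l k) - block_sum lam b j z))"
        unfolding h_def sum_subtractf[symmetric] by (rule norm_sum)
      also have "\<dots> \<le> (\<Sum>j\<le>i. 3 * D * B * (2 powr - real (l - j) *
          (\<Sum>m\<in>coarse_nbrs \<delta> j l k. norm (lam j m))))"
      proof (rule sum_mono)
        fix j assume j: "j \<in> {..i}"
        have "norm (block_sum lam b j (?pt l k) - block_sum lam b j z) \<le>
            B * 2 ^ j * dist (?pt l k) z * (\<Sum>m\<in>coarse_nbrs \<delta> j l k. norm (lam j m))"
          using centre[of l k] dcube_mono[of 1 3 l k] z(1) j i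
          by (intro block_sum_diff_bound[OF b sub]) (auto simp: coarse_nbrs_def)
        also have "\<dots> \<le> B * 2 ^ j * (3 * D / 2 ^ l) * (\<Sum>m\<in>coarse_nbrs \<delta> j l k. norm (lam j m))"
          using z(2) assms(7) by (intro mult_right_mono mult_left_mono sum_nonneg) auto
        also have "B * 2 ^ j * (3 * D / 2 ^ l) = 3 * D * B * (2 ^ j / 2 ^ l)" by simp
        also have "2 ^ j / 2 ^ l = (2::real) powr - real (l - j)" using j i by (intro pow) auto
        finally show "norm (block_sum lam b j (?pt l k) - block_sum lam b j z) \<le>
            3 * D * B * (2 powr - real (l - j) * (\<Sum>m\<in>coarse_nbrs \<delta> j l k. norm (lam j m)))"
          by (simp only: mult.assoc)
      qed
      also have "\<dots> = 3 * D * B * (\<Sum>j\<le>i. 2 powr - real (l - j) *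
          (\<Sum>m\<in>coarse_nbrs \<delta> j l k. norm (lam j m)))"
        by (simp only: sum_distrib_left)
      also have "\<dots> \<le> 3 * D * B * \<gamma> l k"
        unfolding \<gamma>_def using i D assms(7)
        by (intro mult_left_mono sum_mono2) (auto intro!: mult_nonneg_nonneg sum_nonneg)
      finally show ?thesis .
    qed
    have F_bd: "smooth_bd K (2 ^ l) (C1 * \<gamma> l k) (F l k)" for l k
    proof -
      have zero: "smooth_bd K (2 ^ l) (A2 * (3 * D * B * A) * \<gamma> l k) (\<lambda>x. if l = 0 then 0 else
          \<Sum>k'\<in>nbrs l k. (h (l - 1) (?pt l k) - h (l - 1) (?pt (l - 1) k')) * \<eta> (l - 1) k' x)"
      proof (cases "l = 0")
        case True
        then show ?thesis using A A2 D assms(7) \<gamma>0 by (auto intro!: smooth_bd_zero mult_nonneg_nonneg)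
      next
        case False
        have "smooth_bd K (2 ^ l) (3 * D * B * \<gamma> l k * A)
            (\<lambda>x. (h (l - 1) (?pt l k) - h (l - 1) (?pt (l - 1) k')) * \<eta> (l - 1) k' x)"
          if k': "k' \<in> nbrs l k" for k'
        proof (rule smooth_bd_mono)
          show "smooth_bd K (2 ^ l) (norm (h (l - 1) (?pt l k) - h (l - 1) (?pt (l - 1) k')) * A)
              (\<lambda>x. (h (l - 1) (?pt l k) - h (l - 1) (?pt (l - 1) k')) * \<eta> (l - 1) k' x)"
            by (intro smooth_bd_cmult smooth_bd_mono_scale[OF \<eta>_bd]) (auto intro: power_increasing)
          have "?pt (l - 1) k' \<in> dcube 3 l k" by (rule nbr_point[OF False k'])
          moreover from this have "dist (?pt l k) (?pt (l - 1) k') \<le> 3 * D / 2 ^ l"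
          proof -
            have "dist (?pt l k) (?pt (l - 1) k') \<le> real DIM('b) * (3 / 2 ^ l)"
            proof (rule dist_le_DIM_mult)
              fix c :: 'b assume "c \<in> Basis"
              with \<open>?pt (l - 1) k' \<in> dcube 3 l k\<close> have "\<bar>?pt (l - 1) k' \<bullet> c - k \<bullet> c / 2 ^ l\<bar> \<le> 3 / 2 ^ l"
                by (auto simp: dcube_def)
              then show "\<bar>?pt l k \<bullet> c - ?pt (l - 1) k' \<bullet> c\<bar> \<le> 3 / 2 ^ l"
                by (simp add: abs_minus_commute divide_inverse mult.commute)
            qed
            then show ?thesis by (simp add: D_def mult.commute)
          qed
          ultimately have "norm (h (l - 1) (?pt l k) - h (l - 1) (?pt (l - 1) k')) \<le> 3 * D * B * \<gamma> l k"
            by (intro increment) auto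
          then show "norm (h (l - 1) (?pt l k) - h (l - 1) (?pt (l - 1) k')) * A \<le> 3 * D * B * \<gamma> l k * A"
            using A by (intro mult_right_mono) auto
        qed simp
        then have "smooth_bd K (2 ^ l) (\<Sum>k'\<in>nbrs l k. 3 * D * B * \<gamma> l k * A) (\<lambda>x.
            \<Sum>k'\<in>nbrs l k. (h (l - 1) (?pt l k) - h (l - 1) (?pt (l - 1) k')) * \<eta> (l - 1) k' x)"
          using nbrs(1)[OF False] by (intro smooth_bd_sum) auto
        moreover have "(\<Sum>k'\<in>nbrs l k. 3 * D * B * \<gamma> l k * A) \<le> A2 * (3 * D * B * A) * \<gamma> l k"
          using mult_right_mono[OF nbrs(2)[OF False, of k], of "3 * D * B * A * \<gamma> l k"] A D assms(7) \<gamma>0[of l k]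
          by (simp add: mult_ac)
        ultimately have "smooth_bd K (2 ^ l) (A2 * (3 * D * B * A) * \<gamma> l k) (\<lambda>x.
            \<Sum>k'\<in>nbrs l k. (h (l - 1) (?pt l k) - h (l - 1) (?pt (l - 1) k')) * \<eta> (l - 1) k' x)"
          by (rule smooth_bd_mono) simp
        then show ?thesis using False by simp
      qed
      have "smooth_bd K (2 ^ l) (2 ^ K * A * (B * \<gamma> l k + A2 * (3 * D * B * A) * \<gamma> l k)) (F l k)"
        unfolding F_def
        by (intro smooth_bd_mult \<eta>_bd smooth_bd_add smooth_bd_const sample zero) auto
      moreover have "2 ^ K * A * (B * \<gamma> l k + A2 * (3 * D * B * A) * \<gamma> l k) = C1 * \<gamma> l k"
        by (simp add: C1_def algebra_simps)
      ultimately show ?thesis by simp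
    qed
    define T where "T l x = (\<Sum>k\<in>cube_indices W l. h l (?pt l k) * \<eta> l k x)" for l x
    have lattice: "cube_indices W l \<subseteq> int_lattice" for l by (auto simp: cube_indices_def)
    have unity: "(\<Sum>k\<in>cube_indices W l. \<eta> l k x) = 1" if x: "x \<in> W" for l x
      using x by (intro \<eta>_sum finite_indices_W lattice) (auto simp: cube_indices_def)
    have F_sum: "(\<Sum>k\<in>cube_indices W l. F l k x) = (if l = 0 then T 0 x else T l x - T (l - 1) x)"
      if x: "x \<in> W" for l x
    proof (cases l)
      case 0
      then show ?thesis by (simp add: F_def T_def h_def mult.commute)
    next
      case (Suc i)
      have "F l k x = \<eta> l k x * (h l (?pt l k) - T i x)" for k
      proof (cases "\<eta> l k x = 0")
        case False
        then have xk: "x \<in> dcube 1 l k" by (rule \<eta>_supp)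
        have "(\<Sum>k'\<in>nbrs l k. (h i (?pt l k) - h i (?pt i k')) * \<eta> i k' x) =
            h i (?pt l k) * (\<Sum>k'\<in>nbrs l k. \<eta> i k' x) - (\<Sum>k'\<in>nbrs l k. h i (?pt i k') * \<eta> i k' x)"
          by (simp add: left_diff_distrib sum_subtractf sum_distrib_left)
        also have "(\<Sum>k'\<in>nbrs l k. \<eta> i k' x) = 1"
          using nbrs(1)[of l k] Suc xk by (intro \<eta>_sum) (auto simp: nbrs_def)
        also have "(\<Sum>k'\<in>nbrs l k. h i (?pt i k') * \<eta> i k' x) = T i x"
          unfolding T_def
          using nbrs(1)[of l k] finite_indices_W[of i] Suc xk x \<eta>_supp[of i _ x]
          by (intro sum.mono_neutral_cong) (auto simp: nbrs_def cube_indices_def)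
        finally show ?thesis using Suc by (simp add: F_def h_def)
      qed (simp add: F_def)
      then have "(\<Sum>k\<in>cube_indices W l. F l k x) =
          (\<Sum>k\<in>cube_indices W l. h l (?pt l k) * \<eta> l k x) - T i x * (\<Sum>k\<in>cube_indices W l. \<eta> l k x)"
        by (simp add: right_diff_distrib sum_subtractf sum_distrib_left mult.commute)
      then show ?thesis using unity[OF x, of l] Suc by (simp add: T_def)
    qed
    have telescope: "(\<Sum>l<Suc J. \<Sum>k\<in>cube_indices W l. F l k x) = T J x" if x: "x \<in> W" for J x
      by (induction J) (simp_all add: F_sum[OF x])
    define lam' where "lam' l k = complex_of_real (C1 * \<gamma> l k)" for l k
    define a' where "a' l k = (\<lambda>x. of_real (1 / (C1 * \<gamma> l k)) * F l k x)" for l k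
    have F0: "F l k x = 0" if "\<gamma> l k = 0" for l k x
      using smooth_bd_bound[OF F_bd[of l k], of x] that by simp
    have recover: "lam' l k * a' l k x = F l k x" for l k x
      using C1 F0[of l k x] by (cases "\<gamma> l k = 0") (simp_all add: lam'_def a'_def)
    have atom: "K_atom d K l k (a' l k)" for l k
    proof (rule K_atom_of_smooth_bd)
      have "smooth_bd K (2 ^ l) (norm (of_real (1 / (C1 * \<gamma> l k)) :: complex) * (C1 * \<gamma> l k)) (a' l k)"
        unfolding a'_def by (intro smooth_bd_cmult F_bd) simp
      then show "smooth_bd K (2 ^ l) 1 (a' l k)"
      proof (rule smooth_bd_mono)
        have "norm (of_real (1 / x) :: complex) * x \<le> 1" if "0 \<le> x" for x
          unfolding norm_of_real using that by simp
        then show "norm (of_real (1 / (C1 * \<gamma> l k)) :: complex) * (C1 * \<gamma> l k) \<le> 1"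
          using C1 \<gamma>0[of l k] by (meson less_imp_le mult_nonneg_nonneg)
      qed simp
      have "{x. a' l k x \<noteq> 0} \<subseteq> dcube 1 l k"
        using \<eta>_supp by (auto simp: a'_def F_def)
      also have "\<dots> \<subseteq> dcube d l k" using assms(5) by (rule dcube_mono)
      finally show "closure {x. a' l k x \<noteq> 0} \<subseteq> dcube d l k"
        by (rule closure_minimal[OF _ closed_dcube])
    qed
    have norm_le: "b_qnorm DIM('b) s p q W lam' \<le> ennreal C2 * b_qnorm DIM('b) s p q \<Gamma> lam"
      unfolding b_qnorm_def
    proof (rule seq[rule_format, where R="coarse_nbrs \<delta>"])
      fix l k
      have "ennreal (norm (lam' l k)) = ennreal (C1 * \<gamma> l k)"
        using C1 \<gamma>0[of l k] by (simp add: lam'_def norm_mult)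
      also have "\<dots> = ennreal C1 * (\<Sum>j\<le>l. ennreal (2 powr - real (l - j)) *
          (\<Sum>m\<in>coarse_nbrs \<delta> j l k. ennreal (norm (lam j m))))"
        unfolding \<gamma>_def using C1 by (intro sum_of_real_le_ennreal) auto
      finally show "ennreal (norm (lam' l k)) \<le> ennreal C1 * (\<Sum>j\<le>l. ennreal (2 powr - real (l - j)) *
          (\<Sum>m\<in>coarse_nbrs \<delta> j l k. ennreal (norm (lam j m))))"
        by simp
    qed (use count1 count2[OF _ lattice] sub countable_cube_indices in auto)
    have block_cont: "continuous_on S (block_sum lam b j)" for S j
    proof -
      have "continuous_on S (b j m)" if m: "m \<in> cube_indices \<Gamma> j" for m
      proof (rule lipschitz_on_continuous_on, rule lipschitz_onI)
        show "dist (b j m x) (b j m y) \<le> B * 2 ^ j * dist x y" for x y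
          using b m unfolding lipschitz_blocks_def dist_norm[of "b j m x"] by blast
      qed (use assms(7) in simp)
      then show ?thesis unfolding block_sum_def by (intro continuous_intros) auto
    qed
    have W_leb: "W \<in> sets lebesgue" using open_W by auto
    have meas: "g \<in> borel_measurable (lebesgue_on W)" if "continuous_on W g" for g :: "'b \<Rightarrow> complex"
      by (rule continuous_imp_measurable_on_sets_lebesgue[OF that W_leb])
    have h_meas: "h l \<in> borel_measurable (lebesgue_on W)" for l
      unfolding h_def by (intro meas continuous_intros block_cont)
    have T_meas: "T l \<in> borel_measurable (lebesgue_on W)" for l
      unfolding T_def by (intro meas continuous_intros continuous_on_subset[OF smooth_bd_continuous[OF \<eta>_bd]]) auto
    define C5 where "C5 = 3 ^ DIM('b) * (A * (3 * D * B)) "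
    have C5: "0 < C5" unfolding C5_def using A D assms(7) by simp
    have error: "Lp_qnorm (lebesgue_on W) p (\<lambda>x. ennreal (norm (h l x - T l x))) \<le>
        ennreal C5 * (ennreal (C3 * 2 powr (- (s * real l))) * b_qnorm DIM('b) s p q \<Gamma> lam)" for l
    proof -
      define E where "E x = ennreal (norm (h l x - T l x) / C5)" for x
      have "Lp_qnorm (lebesgue_on W) p E \<le> ennreal (C3 * 2 powr (- (s * real l))) * b_qnorm DIM('b) s p q \<Gamma> lam"
      proof (rule err[THEN spec, THEN spec, THEN spec, THEN mp, THEN mp]; (intro ballI allI impI)?)
        show "E \<in> borel_measurable (lebesgue_on W)"
          unfolding E_def using h_meas[of l] T_meas[of l] by measurable
        fix x R assume x: "x \<in> W"
          and R: "\<forall>j\<le>l. R j \<subseteq> cube_indices \<Gamma> j \<and> (\<forall>m\<in>cube_indices \<Gamma> j.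
            (\<exists>y. dist x y \<le> \<rho> / 2 ^ l \<and> \<Psi> y \<in> dcube \<delta> j m) \<longrightarrow> m \<in> R j)"
        define Q where "Q = (\<Sum>j\<le>l. 2 powr - real (l - j) * (\<Sum>m\<in>R j. norm (lam j m)))"
        define N where "N = {k \<in> cube_indices W l. x \<in> dcube 1 l k}"
        have N: "finite N" "real (card N) \<le> 3 ^ DIM('b)"
        proof -
          have "\<exists>y\<in>dcube 1 l k. dist y x \<le> 0" if "k \<in> N" for k using that by (auto simp: N_def)
          from lattice_near_count[of 1 0 N l, OF _ _ _ this]
          show "finite N" "real (card N) \<le> 3 ^ DIM('b)" by (auto simp: N_def cube_indices_def)
        qed
        have "h l x - T l x = (\<Sum>k\<in>cube_indices W l. \<eta> l k x * (h l x - h l (?pt l k)))"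
          using unity[OF x, of l]
          by (simp add: T_def right_diff_distrib sum_subtractf sum_distrib_right[symmetric]
              mult.commute[of "h l _"])
        also have "\<dots> = (\<Sum>k\<in>N. \<eta> l k x * (h l x - h l (?pt l k)))"
          using finite_indices_W[of l] \<eta>_supp[of l _ x] by (intro sum.mono_neutral_right) (auto simp: N_def)
        also have "norm \<dots> \<le> (\<Sum>k\<in>N. A * (3 * D * B * Q))"
        proof (rule sum_norm_le)
          fix k assume k: "k \<in> N"
          have d1: "dist x (?pt l k) \<le> \<rho> / 2 ^ l"
            using k dist_dcube_le[OF _ centre, of x l k] by (auto simp: N_def \<rho>_def D_def mult.commute)
          have d2: "dist x (?pt l k) \<le> 3 * D / 2 ^ l"
            by (rule order_trans[OF d1 divide_right_mono]) (use D in \<open>auto simp: \<rho>_def\<close>)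
          have "norm (h l x - h l (?pt l k)) \<le> (\<Sum>j\<le>l. norm (block_sum lam b j x - block_sum lam b j (?pt l k)))"
            unfolding h_def sum_subtractf[symmetric] by (rule norm_sum)
          also have "\<dots> \<le> (\<Sum>j\<le>l. 3 * D * B * (2 powr - real (l - j) * (\<Sum>m\<in>R j. norm (lam j m))))"
          proof (rule sum_mono)
            fix j assume j: "j \<in> {..l}"
            have "norm (block_sum lam b j x - block_sum lam b j (?pt l k)) \<le>
                B * 2 ^ j * dist x (?pt l k) * (\<Sum>m\<in>R j. norm (lam j m))"
            proof (rule block_sum_diff_bound[OF b])
              show "R j \<subseteq> cube_indices \<Gamma> j" using R j by auto
              have "dist x x \<le> \<rho> / 2 ^ l" using \<rho> by simp
              then show "m \<in> R j" if "m \<in> cube_indices \<Gamma> j" "\<Psi> x \<in> dcube \<delta> j m \<or> \<Psi> (?pt l k) \<in> dcube \<delta> j m" for m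
                using R j that d1 by blast
            qed
            also have "\<dots> \<le> B * 2 ^ j * (3 * D / 2 ^ l) * (\<Sum>m\<in>R j. norm (lam j m))"
              using d2 assms(7) by (intro mult_right_mono mult_left_mono sum_nonneg) auto
            also have "B * 2 ^ j * (3 * D / 2 ^ l) = 3 * D * B * (2 ^ j / 2 ^ l)" by simp
            also have "2 ^ j / 2 ^ l = (2::real) powr - real (l - j)" using j by (intro pow) auto
            finally show "norm (block_sum lam b j x - block_sum lam b j (?pt l k)) \<le>
                3 * D * B * (2 powr - real (l - j) * (\<Sum>m\<in>R j. norm (lam j m)))"
              by (simp only: mult.assoc)
          qed
          also have "\<dots> = 3 * D * B * Q" by (simp only: Q_def sum_distrib_left)
          finally show "norm (\<eta> l k x * (h l x - h l (?pt l k))) \<le> A * (3 * D * B * Q)"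
            unfolding norm_mult using smooth_bd_bound[OF \<eta>_bd] A by (intro mult_mono) auto
        qed
        also have "\<dots> \<le> C5 * Q"
        proof -
          have "0 \<le> A * (3 * D * B * Q)"
            using A D assms(7) by (intro mult_nonneg_nonneg) (auto simp: Q_def intro!: sum_nonneg mult_nonneg_nonneg)
          then show ?thesis using mult_right_mono[OF N(2), of "A * (3 * D * B * Q)"]
            by (simp add: C5_def mult_ac)
        qed
        finally have "norm (h l x - T l x) / C5 \<le> Q" using C5 by (simp add: pos_divide_le_eq mult.commute)
        then have "E x \<le> ennreal (1 * Q)" unfolding E_def by (simp add: ennreal_leI)
        also have "\<dots> = ennreal 1 * (\<Sum>j\<le>l. ennreal (2 powr - real (l - j)) * (\<Sum>m\<in>R j. ennreal (norm (lam j m))))"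
          unfolding Q_def by (intro sum_of_real_le_ennreal) auto
        finally show "E x \<le> (\<Sum>j\<le>l. ennreal (2 powr - real (l - j)) * (\<Sum>m\<in>R j. ennreal (norm (lam j m))))"
          by simp
      qed
      note E_le = this
      have E_meas: "E \<in> borel_measurable (lebesgue_on W)"
        unfolding E_def using h_meas[of l] T_meas[of l] by measurable
      have "ennreal (norm (h l x - T l x)) = ennreal C5 * E x" for x
        using C5 by (simp add: E_def ennreal_mult'[symmetric])
      then have "Lp_qnorm (lebesgue_on W) p (\<lambda>x. ennreal (norm (h l x - T l x))) =
          Lp_qnorm (lebesgue_on W) p (\<lambda>x. ennreal C5 * E x)" by simp
      also have "\<dots> \<le> ennreal C5 * Lp_qnorm (lebesgue_on W) p E"
        by (rule Lp_qnorm_cmult_le[OF assms(1) E_meas])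
      also have "\<dots> \<le> ennreal C5 * (ennreal (C3 * 2 powr (- (s * real l))) * b_qnorm DIM('b) s p q \<Gamma> lam)"
        by (rule mult_left_mono[OF E_le]) simp
      finally show ?thesis .
    qed
    let ?\<beta> = "b_qnorm DIM('b) s p q \<Gamma> lam"
    let ?e = "\<lambda>J. Lp_qnorm (lebesgue_on W) p (\<lambda>y. ennreal (norm (f y - (\<Sum>j<J. block_sum lam b j y))))"
    have series: "atomic_series_Lp (lebesgue_on W) p W lam' a' f"
      unfolding atomic_series_Lp_def
    proof (rule filterlim_sequentially_Suc[THEN iffD1], rule tendsto_sandwich)
      show "eventually (\<lambda>J. 0 \<le> Lp_qnorm (lebesgue_on W) p (\<lambda>x. ennreal (norm
        (f x - (\<Sum>j<Suc J. \<Sum>\<^sub>\<infinity>m\<in>cube_indices W j. lam' j m * a' j m x))))) sequentially" by simp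
      show "eventually (\<lambda>J. Lp_qnorm (lebesgue_on W) p (\<lambda>x. ennreal (norm
        (f x - (\<Sum>j<Suc J. \<Sum>\<^sub>\<infinity>m\<in>cube_indices W j. lam' j m * a' j m x)))) \<le>
        ennreal C4 * (?e (Suc J) + ennreal C5 * (ennreal (C3 * 2 powr (- (s * real J))) * ?\<beta>))) sequentially"
      proof (rule always_eventually, rule allI)
        fix J
        have eq: "(\<Sum>j<Suc J. \<Sum>\<^sub>\<infinity>m\<in>cube_indices W j. lam' j m * a' j m x) = T J x" if "x \<in> W" for x
          using telescope[OF that, of J] finite_indices_W by (simp add: recover del: sum.lessThan_Suc)
        have hS: "(\<Sum>j<Suc J. block_sum lam b j x) = h J x" for x
          by (simp add: h_def lessThan_Suc_atMost)
        have "Lp_qnorm (lebesgue_on W) p (\<lambda>x. ennreal (norm (f x -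
            (\<Sum>j<Suc J. \<Sum>\<^sub>\<infinity>m\<in>cube_indices W j. lam' j m * a' j m x)))) =
            Lp_qnorm (lebesgue_on W) p (\<lambda>x. ennreal (norm (f x - T J x)))"
          by (rule Lp_qnorm_cong) (simp only: space_lebesgue_on eq)
        also have "\<dots> \<le> Lp_qnorm (lebesgue_on W) p
            (\<lambda>x. ennreal (norm (f x - h J x)) + ennreal (norm (h J x - T J x)))"
        proof (rule Lp_qnorm_mono[OF assms(1)])
          show "ennreal (norm (f x - T J x)) \<le> ennreal (norm (f x - h J x)) + ennreal (norm (h J x - T J x))" for x
            using norm_triangle_ineq[of "f x - h J x" "h J x - T J x"]
            by (simp add: ennreal_plus[symmetric] del: ennreal_plus)
        qed (use f h_meas[of J] T_meas[of J] in measurable)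
        also have "\<dots> \<le> ennreal C4 * (Lp_qnorm (lebesgue_on W) p (\<lambda>x. ennreal (norm (f x - h J x))) +
            Lp_qnorm (lebesgue_on W) p (\<lambda>x. ennreal (norm (h J x - T J x))))"
          using f h_meas[of J] T_meas[of J] by (intro tri[rule_format]; measurable)
        also have "\<dots> \<le> ennreal C4 * (?e (Suc J) + ennreal C5 * (ennreal (C3 * 2 powr (- (s * real J))) * ?\<beta>))"
          unfolding hS by (intro mult_left_mono add_mono error) auto
        finally show "Lp_qnorm (lebesgue_on W) p (\<lambda>x. ennreal (norm (f x -
            (\<Sum>j<Suc J. \<Sum>\<^sub>\<infinity>m\<in>cube_indices W j. lam' j m * a' j m x)))) \<le>
            ennreal C4 * (?e (Suc J) + ennreal C5 * (ennreal (C3 * 2 powr (- (s * real J))) * ?\<beta>))" .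
      qed
      have "(\<lambda>J. 2 powr (- (s * real J))) \<longlonglongrightarrow> 0"
      proof -
        have "(\<lambda>J. (2 powr (- s)) ^ J) \<longlonglongrightarrow> (0::real)"
          using assms(3) by (intro LIMSEQ_realpow_zero) (auto simp: powr_minus_divide)
        moreover have "(2 powr (- s)) ^ J = 2 powr (- (s * real J))" for J :: nat
          by (simp add: powr_powr flip: powr_realpow)
        ultimately show ?thesis by simp
      qed
      then have "(\<lambda>J. ennreal (C3 * 2 powr (- (s * real J)))) \<longlonglongrightarrow> ennreal (C3 * 0)"
        by (intro tendsto_intros)
      then have "(\<lambda>J. ennreal C5 * (?\<beta> * ennreal (C3 * 2 powr (- (s * real J))))) \<longlonglongrightarrow> ennreal C5 * (?\<beta> * 0)"
        using fin by (intro ennreal_tendsto_cmult) auto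
      then have "(\<lambda>J. ?e (Suc J) + ennreal C5 * (ennreal (C3 * 2 powr (- (s * real J))) * ?\<beta>)) \<longlonglongrightarrow> 0 + 0"
        by (intro tendsto_add LIMSEQ_Suc[OF lim]) (simp add: mult.commute[of ?\<beta>])
      then have "(\<lambda>J. ennreal C4 * (?e (Suc J) + ennreal C5 * (ennreal (C3 * 2 powr (- (s * real J))) * ?\<beta>)))
          \<longlonglongrightarrow> ennreal C4 * 0"
        by (intro ennreal_tendsto_cmult) auto
      then show "(\<lambda>J. ennreal C4 * (?e (Suc J) + ennreal C5 * (ennreal (C3 * 2 powr (- (s * real J))) * ?\<beta>)))
          \<longlonglongrightarrow> 0" by simp
    qed simp
    show "\<exists>lam' a'. K_atomic_repr d K p W f lam' a' \<and>
        b_qnorm DIM('b) s p q W lam' \<le> ennreal C2 * b_qnorm DIM('b) s p q \<Gamma> lam"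
      using atom series norm_le unfolding K_atomic_repr_def by blast
  qed
qed

end

section \<open>The quasi-norm given by Lipschitz atoms\<close>

lemma le_cmult_INF:
  fixes z :: ennreal
  assumes "0 < c" "\<And>x. x \<in> S \<Longrightarrow> z \<le> ennreal c * g x"
  shows "z \<le> ennreal c * (INF x\<in>S. g x)"
proof -
  have inv: "ennreal (1 / c) * (ennreal c * x) = x" "ennreal c * (ennreal (1 / c) * x) = x" for x
    using assms(1) by (simp_all add: mult.assoc[symmetric] ennreal_mult'[symmetric])
  have "ennreal (1 / c) * z \<le> (INF x\<in>S. g x)"
  proof (rule INF_greatest)
    fix x assume "x \<in> S"
    then have "ennreal (1 / c) * z \<le> ennreal (1 / c) * (ennreal c * g x)"
      using assms(2) by (intro mult_left_mono) auto
    then show "ennreal (1 / c) * z \<le> g x" by (simp add: inv)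
  qed
  then have "ennreal c * (ennreal (1 / c) * z) \<le> ennreal c * (INF x\<in>S. g x)"
    by (rule mult_left_mono) simp
  then show ?thesis by (simp add: inv)
qed

lemma ennreal_tendsto_0_le:
  fixes f g :: "nat \<Rightarrow> ennreal"
  assumes "\<And>n. f n \<le> g n" "g \<longlonglongrightarrow> 0"
  shows "f \<longlonglongrightarrow> 0"
  by (rule tendsto_sandwich[OF _ _ tendsto_const assms(2)]) (use assms(1) in auto)

lemma b_qnorm_cmult_le:
  assumes "0 < p" "0 < q"
  shows "b_qnorm k s p q S (\<lambda>j m. c * lam j m) \<le> ennreal (norm c) * b_qnorm k s p q S lam"
proof -
  let ?w = "\<lambda>j. ennreal (2 powr (real j * (s - real k * enn2real (inverse p))))"
  let ?n = "\<lambda>j. Lp_qnorm (count_space (cube_indices S j)) p (\<lambda>m. ennreal (norm (lam j m)))"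
  have "?w j * Lp_qnorm (count_space (cube_indices S j)) p (\<lambda>m. ennreal (norm (c * lam j m))) \<le>
      ennreal (norm c) * (?w j * ?n j)" for j
  proof -
    have "Lp_qnorm (count_space (cube_indices S j)) p (\<lambda>m. ennreal (norm (c * lam j m))) =
        Lp_qnorm (count_space (cube_indices S j)) p (\<lambda>m. ennreal (norm c) * ennreal (norm (lam j m)))"
      by (simp add: norm_mult ennreal_mult)
    also have "\<dots> \<le> ennreal (norm c) * ?n j"
      using assms(1) by (intro Lp_qnorm_cmult_le) auto
    finally have "?w j * Lp_qnorm (count_space (cube_indices S j)) p (\<lambda>m. ennreal (norm (c * lam j m))) \<le>
        ?w j * (ennreal (norm c) * ?n j)" by (rule mult_left_mono) simp
    then show ?thesis by (simp only: mult.left_commute)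
  qed
  then have "b_qnorm k s p q S (\<lambda>j m. c * lam j m) \<le>
      Lp_qnorm (count_space UNIV) q (\<lambda>j. ennreal (norm c) * (?w j * ?n j))"
    unfolding b_qnorm_def using assms(2) by (intro Lp_qnorm_mono) auto
  also have "\<dots> \<le> ennreal (norm c) * b_qnorm k s p q S lam"
    unfolding b_qnorm_def using assms(2) by (intro Lp_qnorm_cmult_le) auto
  finally show ?thesis .
qed

lemma b_qnorm_add_le:
  assumes "0 < p" "0 < q"
  shows "\<exists>C>0. \<forall>k s (S :: 'a::euclidean_space set) lam lam'.
    b_qnorm k s p q S (\<lambda>j m. of_real (norm (lam j m) + norm (lam' j m))) \<le>
      ennreal C * (b_qnorm k s p q S lam + b_qnorm k s p q S lam')"
proof -
  from Lp_qnorm_add_le[OF assms(1), where 'a='a] obtain C1 :: real where C1: "0 < C1"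
    and tri1: "\<forall>(M::'a measure) f g. f \<in> borel_measurable M \<longrightarrow> g \<in> borel_measurable M \<longrightarrow>
      Lp_qnorm M p (\<lambda>x. f x + g x) \<le> ennreal C1 * (Lp_qnorm M p f + Lp_qnorm M p g)"
    by (elim exE conjE)
  from Lp_qnorm_add_le[OF assms(2), where 'a=nat] obtain C2 :: real where C2: "0 < C2"
    and tri2: "\<forall>(M::nat measure) f g. f \<in> borel_measurable M \<longrightarrow> g \<in> borel_measurable M \<longrightarrow>
      Lp_qnorm M q (\<lambda>x. f x + g x) \<le> ennreal C2 * (Lp_qnorm M q f + Lp_qnorm M q g)"
    by (elim exE conjE)
  show ?thesis
  proof (intro exI[of _ "C1 * C2"] conjI allI)
    show "0 < C1 * C2" using C1 C2 by simp
    fix k s and S :: "'a set" and lam lam' :: "nat \<Rightarrow> 'a \<Rightarrow> complex"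
    let ?w = "\<lambda>j. ennreal (2 powr (real j * (s - real k * enn2real (inverse p))))"
    let ?n = "\<lambda>lam j. Lp_qnorm (count_space (cube_indices S j)) p (\<lambda>m. ennreal (norm (lam j m)))"
    let ?sum = "\<lambda>j m. complex_of_real (norm (lam j m) + norm (lam' j m))"
    have "?w j * ?n ?sum j \<le> ennreal C1 * (?w j * ?n lam j + ?w j * ?n lam' j)" for j
    proof -
      have "ennreal (norm (?sum j m)) = ennreal (norm (lam j m)) + ennreal (norm (lam' j m))" for m
        unfolding norm_of_real by (simp add: ennreal_plus[symmetric] del: ennreal_plus)
      then have "?n ?sum j = Lp_qnorm (count_space (cube_indices S j)) p
          (\<lambda>m. ennreal (norm (lam j m)) + ennreal (norm (lam' j m)))"
        by (simp only:)
      also have "\<dots> \<le> ennreal C1 * (?n lam j + ?n lam' j)" by (intro tri1[rule_format]) auto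
      finally have "?w j * ?n ?sum j \<le> ?w j * (ennreal C1 * (?n lam j + ?n lam' j))"
        by (rule mult_left_mono) simp
      then show ?thesis by (simp only: mult.left_commute distrib_left)
    qed
    then have "b_qnorm k s p q S ?sum \<le> Lp_qnorm (count_space UNIV) q
        (\<lambda>j. ennreal C1 * (?w j * ?n lam j + ?w j * ?n lam' j))"
      unfolding b_qnorm_def using assms(2) by (intro Lp_qnorm_mono) auto
    also have "\<dots> \<le> ennreal C1 * Lp_qnorm (count_space UNIV) q (\<lambda>j. ?w j * ?n lam j + ?w j * ?n lam' j)"
      using assms(2) by (intro Lp_qnorm_cmult_le) auto
    also have "\<dots> \<le> ennreal C1 * (ennreal C2 * (b_qnorm k s p q S lam + b_qnorm k s p q S lam'))"
      unfolding b_qnorm_def by (intro mult_left_mono tri2[rule_format]) auto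
    finally show "b_qnorm k s p q S ?sum \<le>
        ennreal (C1 * C2) * (b_qnorm k s p q S lam + b_qnorm k s p q S lam')"
      using C1 C2 by (simp add: ennreal_mult mult.assoc)
  qed
qed

locale compact_boundary =
  fixes \<Gamma> :: "'a::euclidean_space set"
  assumes compact: "compact \<Gamma>"
begin

abbreviation "\<sigma> \<equiv> surface_measure \<Gamma>"

lemma closed: "closed \<Gamma>"
  using compact by (rule compact_imp_closed)

lemma finite_indices: "finite (cube_indices \<Gamma> j)"
  using compact by (intro finite_cube_indices compact_imp_bounded)

lemma continuous_measurable:
  assumes "continuous_on \<Gamma> (f :: 'a \<Rightarrow> 'c::topological_space)"
  shows "f \<in> borel_measurable \<sigma>"
  unfolding surface_measure_def
proof (rule measurable_completion)
  have "f \<in> borel_measurable (restrict_space borel \<Gamma>)"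
    using assms by (rule borel_measurable_continuous_on_restrict)
  then show "f \<in> borel_measurable (restrict_space (hausdorff_measure (DIM('a) - 1)) \<Gamma>)"
    using measurable_cong_sets[OF sets_restrict_space_cong[OF sets_hausdorff_measure] refl] by blast
qed

lemma Lip_atom_measurable: "Lip_atom d j m \<Gamma> a \<Longrightarrow> a \<in> borel_measurable \<sigma>"
  unfolding Lip_atom_def by (intro continuous_measurable lipschitz_on_continuous_on) auto

lemma Lip_atomI:
  assumes "{x\<in>\<Gamma>. a x \<noteq> 0} \<subseteq> dcube d j m" "\<And>x. x \<in> \<Gamma> \<Longrightarrow> norm (a x) \<le> 1"
    and "\<And>x y. x \<in> \<Gamma> \<Longrightarrow> y \<in> \<Gamma> \<Longrightarrow> norm (a x - a y) \<le> 2 ^ j * dist x y"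
  shows "Lip_atom d j m \<Gamma> a"
proof -
  have lip: "(2 ^ j)-lipschitz_on \<Gamma> a" using assms(3) by (intro lipschitz_onI) (auto simp: dist_norm)
  then have "a \<in> borel_measurable \<sigma>" by (intro continuous_measurable lipschitz_on_continuous_on)
  then have "(\<lambda>x. ennreal (norm (a x))) \<in> borel_measurable \<sigma>" by measurable
  then have "Lp_qnorm \<sigma> \<infinity> (\<lambda>x. ennreal (norm (a x))) \<le> 1"
    using assms(2) by (subst Lp_qnorm_le_iff_infinite) (auto simp: ennreal_le_1)
  moreover have "closure {x\<in>\<Gamma>. a x \<noteq> 0} \<subseteq> dcube d j m \<inter> \<Gamma>"
    using assms(1) by (intro closure_minimal closed_Int closed_dcube closed) auto
  ultimately show ?thesis using lip by (simp add: Lip_atom_def)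
qed

lemma Lip_atom_bounds:
  assumes "Lip_atom d j m \<Gamma> a"
  shows "\<And>x. x \<in> \<Gamma> \<Longrightarrow> a x \<noteq> 0 \<Longrightarrow> x \<in> dcube d j m"
    and "\<And>x y. x \<in> \<Gamma> \<Longrightarrow> y \<in> \<Gamma> \<Longrightarrow> norm (a x - a y) \<le> 2 ^ j * dist x y"
proof -
  show "x \<in> dcube d j m" if "x \<in> \<Gamma>" "a x \<noteq> 0" for x
    using assms closure_subset[of "{x\<in>\<Gamma>. a x \<noteq> 0}"] that unfolding Lip_atom_def by blast
  have "(2 ^ j)-lipschitz_on \<Gamma> a" using assms by (simp add: Lip_atom_def)
  note lip = lipschitz_onD[OF this]
  show "norm (a x - a y) \<le> 2 ^ j * dist x y" if "x \<in> \<Gamma>" "y \<in> \<Gamma>" for x y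
    using lip[OF that] unfolding dist_norm[of "a x" "a y"] .
qed

definition partial_sum :: "(nat \<Rightarrow> 'a \<Rightarrow> complex) \<Rightarrow> (nat \<Rightarrow> 'a \<Rightarrow> 'a \<Rightarrow> complex) \<Rightarrow> nat \<Rightarrow> 'a \<Rightarrow> complex" where
  "partial_sum lam a J x = (\<Sum>j<J. \<Sum>m\<in>cube_indices \<Gamma> j. lam j m * a j m x)"

lemma atomic_series_iff:
  "atomic_series_Lp M p \<Gamma> lam a f \<longleftrightarrow>
    (\<lambda>J. Lp_qnorm M p (\<lambda>x. ennreal (norm (f x - partial_sum lam a J x)))) \<longlonglongrightarrow> 0"
  unfolding atomic_series_Lp_def partial_sum_def using finite_indices by simp

lemma partial_sum_measurable:
  assumes "\<forall>j. \<forall>m\<in>cube_indices \<Gamma> j. Lip_atom d j m \<Gamma> (a j m)"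
  shows "partial_sum lam a J \<in> borel_measurable \<sigma>"
  unfolding partial_sum_def using assms Lip_atom_measurable
  by (intro borel_measurable_sum borel_measurable_times borel_measurable_const) blast

lemma Lip_atomic_repr_cong_AE:
  assumes "0 < p" "f \<in> borel_measurable \<sigma>" "g \<in> borel_measurable \<sigma>" "AE x in \<sigma>. f x = g x"
    and "Lip_atomic_repr d p \<Gamma> f lam a"
  shows "Lip_atomic_repr d p \<Gamma> g lam a"
proof -
  have m: "partial_sum lam a J \<in> borel_measurable \<sigma>" for J
    using assms(5) partial_sum_measurable unfolding Lip_atomic_repr_def by blast
  have "Lp_qnorm \<sigma> p (\<lambda>x. ennreal (norm (f x - partial_sum lam a J x))) =
      Lp_qnorm \<sigma> p (\<lambda>x. ennreal (norm (g x - partial_sum lam a J x)))" for J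
    using assms(4) by (intro Lp_qnorm_cong_AE assms(1)) (use assms(2,3) m[of J] in \<open>auto elim: eventually_mono\<close>)
  then show ?thesis using assms(5) by (simp add: Lip_atomic_repr_def atomic_series_iff)
qed

lemma Lip_atomic_qnorm_cong_AE:
  assumes "0 < p" "f \<in> borel_measurable \<sigma>" "g \<in> borel_measurable \<sigma>" "AE x in \<sigma>. f x = g x"
  shows "Lip_atomic_qnorm d s p q \<Gamma> f = Lip_atomic_qnorm d s p q \<Gamma> g"
proof -
  have "AE x in \<sigma>. g x = f x" using assms(4) by (auto elim: eventually_mono)
  then have "Lip_atomic_repr d p \<Gamma> f lam a \<longleftrightarrow> Lip_atomic_repr d p \<Gamma> g lam a" for lam a
    using Lip_atomic_repr_cong_AE assms by blast
  then show ?thesis by (simp add: Lip_atomic_qnorm_def)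
qed

lemma Lip_atomic_qnorm_le: "Lip_atomic_repr d p \<Gamma> f lam a \<Longrightarrow>
    Lip_atomic_qnorm d s p q \<Gamma> f \<le> b_qnorm_bd s p q \<Gamma> lam"
  unfolding Lip_atomic_qnorm_def by (rule INF_lower2[of "(lam, a)"]) auto

lemma Lip_atomic_qnorm_less:
  assumes "Lip_atomic_qnorm d s p q \<Gamma> f < z"
  obtains lam a where "Lip_atomic_repr d p \<Gamma> f lam a" "b_qnorm_bd s p q \<Gamma> lam < z"
  using assms unfolding Lip_atomic_qnorm_def by (auto simp: INF_less_iff)

lemma Lip_atomic_qnorm_zero:
  assumes "0 < p" "0 < q"
  shows "Lip_atomic_qnorm d s p q \<Gamma> (\<lambda>x. 0) = 0"
proof -
  have z: "Lp_qnorm M p (\<lambda>x. 0) = 0" for M :: "'z measure"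
    using Lp_qnorm_eq_0_iff[OF assms(1), of "\<lambda>x. 0" M] by simp
  have zq: "Lp_qnorm M q (\<lambda>x. 0) = 0" for M :: "'z measure"
    using Lp_qnorm_eq_0_iff[OF assms(2), of "\<lambda>x. 0" M] by simp
  have "Lip_atomic_repr d p \<Gamma> (\<lambda>x. 0) (\<lambda>j m. 0) (\<lambda>j m x. 0)"
    unfolding Lip_atomic_repr_def atomic_series_iff
    by (auto intro!: Lip_atomI simp: partial_sum_def z)
  from Lip_atomic_qnorm_le[OF this, of s q] show ?thesis
    by (simp add: b_qnorm_bd_def b_qnorm_def z zq)
qed

lemma Lip_atomic_qnorm_cmult_le:
  assumes "0 < p" "0 < q" "f \<in> borel_measurable \<sigma>" "c \<noteq> 0"
  shows "Lip_atomic_qnorm d s p q \<Gamma> (\<lambda>x. c * f x) \<le> ennreal (norm c) * Lip_atomic_qnorm d s p q \<Gamma> f"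
proof -
  have "Lip_atomic_qnorm d s p q \<Gamma> (\<lambda>x. c * f x) \<le> ennreal (norm c) * b_qnorm_bd s p q \<Gamma> lam"
    if rep: "Lip_atomic_repr d p \<Gamma> f lam a" for lam a
  proof -
    have m: "partial_sum lam a J \<in> borel_measurable \<sigma>" for J
      using rep partial_sum_measurable unfolding Lip_atomic_repr_def by blast
    have "Lp_qnorm \<sigma> p (\<lambda>x. ennreal (norm (c * f x - partial_sum (\<lambda>j m. c * lam j m) a J x))) \<le>
        ennreal (norm c) * Lp_qnorm \<sigma> p (\<lambda>x. ennreal (norm (f x - partial_sum lam a J x)))" for J
    proof -
      have "partial_sum (\<lambda>j m. c * lam j m) a J x = c * partial_sum lam a J x" for x
        by (simp add: partial_sum_def sum_distrib_left mult.assoc)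
      then have "ennreal (norm (c * f x - partial_sum (\<lambda>j m. c * lam j m) a J x)) =
          ennreal (norm c) * ennreal (norm (f x - partial_sum lam a J x))" for x
        by (simp add: right_diff_distrib[symmetric] norm_mult ennreal_mult)
      then show ?thesis
        using Lp_qnorm_cmult_le[OF assms(1), of "\<lambda>x. ennreal (norm (f x - partial_sum lam a J x))" \<sigma>]
          assms(3) m[of J] by simp
    qed
    moreover have "(\<lambda>J. ennreal (norm c) *
        Lp_qnorm \<sigma> p (\<lambda>x. ennreal (norm (f x - partial_sum lam a J x)))) \<longlonglongrightarrow> ennreal (norm c) * 0"
      using rep by (intro ennreal_tendsto_cmult) (auto simp: Lip_atomic_repr_def atomic_series_iff)
    ultimately have "(\<lambda>J. Lp_qnorm \<sigma> p (\<lambda>x. ennreal (norm (c * f x -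
        partial_sum (\<lambda>j m. c * lam j m) a J x)))) \<longlonglongrightarrow> 0"
      unfolding mult_zero_right by (rule ennreal_tendsto_0_le)
    then have "Lip_atomic_repr d p \<Gamma> (\<lambda>x. c * f x) (\<lambda>j m. c * lam j m) a"
      using rep unfolding Lip_atomic_repr_def atomic_series_iff by blast
    from Lip_atomic_qnorm_le[OF this] show ?thesis
      using b_qnorm_cmult_le[OF assms(1,2)] unfolding b_qnorm_bd_def by (rule order_trans)
  qed
  then show ?thesis
    unfolding Lip_atomic_qnorm_def[of _ _ _ _ _ f] using assms(4) by (intro le_cmult_INF) auto
qed

lemma Lip_atomic_qnorm_cmult:
  assumes "0 < p" "0 < q" "f \<in> borel_measurable \<sigma>"
  shows "Lip_atomic_qnorm d s p q \<Gamma> (\<lambda>x. c * f x) = ennreal (norm c) * Lip_atomic_qnorm d s p q \<Gamma> f"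
proof (cases "c = 0")
  case False
  have "Lip_atomic_qnorm d s p q \<Gamma> (\<lambda>x. 1 / c * (c * f x)) \<le>
      ennreal (norm (1 / c)) * Lip_atomic_qnorm d s p q \<Gamma> (\<lambda>x. c * f x)"
    using assms False by (intro Lip_atomic_qnorm_cmult_le) auto
  then have "ennreal (norm c) * Lip_atomic_qnorm d s p q \<Gamma> f \<le>
      ennreal (norm c) * (ennreal (norm (1 / c)) * Lip_atomic_qnorm d s p q \<Gamma> (\<lambda>x. c * f x))"
    using False by (intro mult_left_mono) auto
  also have "\<dots> = Lip_atomic_qnorm d s p q \<Gamma> (\<lambda>x. c * f x)"
    using False by (simp add: mult.assoc[symmetric] ennreal_mult[symmetric] norm_divide)
  finally show ?thesis using Lip_atomic_qnorm_cmult_le[OF assms False] by (rule antisym[rotated])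
qed (simp add: Lip_atomic_qnorm_zero[OF assms(1,2)])

text \<open>Two Lipschitz atoms at the same cube, weighted with their coefficients and divided by the sum of
  the moduli, are again an atom.\<close>

lemma Lip_atomic_qnorm_add_le:
  assumes "0 < p" "0 < q"
  shows "\<exists>C>0. \<forall>f g. f \<in> borel_measurable \<sigma> \<longrightarrow> g \<in> borel_measurable \<sigma> \<longrightarrow>
    Lip_atomic_qnorm d s p q \<Gamma> (\<lambda>x. f x + g x) \<le>
      ennreal C * (Lip_atomic_qnorm d s p q \<Gamma> f + Lip_atomic_qnorm d s p q \<Gamma> g)"
proof -
  from b_qnorm_add_le[OF assms, where 'a='a] obtain C1 :: real where C1: "0 < C1"
    and add: "\<forall>k s (S :: 'a set) lam lam'.
      b_qnorm k s p q S (\<lambda>j m. of_real (norm (lam j m) + norm (lam' j m))) \<le>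
        ennreal C1 * (b_qnorm k s p q S lam + b_qnorm k s p q S lam')"
    by (elim exE conjE)
  from Lp_qnorm_add_le[OF assms(1), where 'a='a] obtain C2 :: real where C2: "0 < C2"
    and tri: "\<forall>(M::'a measure) f g. f \<in> borel_measurable M \<longrightarrow> g \<in> borel_measurable M \<longrightarrow>
      Lp_qnorm M p (\<lambda>x. f x + g x) \<le> ennreal C2 * (Lp_qnorm M p f + Lp_qnorm M p g)"
    by (elim exE conjE)
  have repr: "Lip_atomic_qnorm d s p q \<Gamma> (\<lambda>x. f x + g x) \<le>
      ennreal C1 * (b_qnorm_bd s p q \<Gamma> lam + b_qnorm_bd s p q \<Gamma> lam')"
    if f: "f \<in> borel_measurable \<sigma>" "Lip_atomic_repr d p \<Gamma> f lam a"
      and g: "g \<in> borel_measurable \<sigma>" "Lip_atomic_repr d p \<Gamma> g lam' a'" for f g lam lam' a a'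
  proof -
    define \<mu> where "\<mu> j m = norm (lam j m) + norm (lam' j m)" for j m
    define c where "c j m x = of_real (1 / \<mu> j m) * (lam j m * a j m x + lam' j m * a' j m x)" for j m x
    have \<mu>0: "0 \<le> \<mu> j m" for j m by (simp add: \<mu>_def)
    have recover: "of_real (\<mu> j m) * c j m x = lam j m * a j m x + lam' j m * a' j m x" for j m x
    proof (cases "\<mu> j m = 0")
      case True
      then have "lam j m = 0" "lam' j m = 0"
        by (simp_all add: \<mu>_def add_nonneg_eq_0_iff)
      then show ?thesis by (simp add: True)
    qed (simp add: c_def)
    have ratio: "norm (of_real (1 / \<mu> j m) * z) \<le> r" if "norm z \<le> \<mu> j m * r" "0 \<le> r" for j m r and z :: complex
    proof (cases "\<mu> j m = 0")
      case False
      then have "0 < \<mu> j m" using \<mu>0[of j m] by simp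
      then show ?thesis using that(1) by (simp add: norm_mult norm_divide pos_divide_le_eq mult.commute)
    qed (use that in simp)
    have "Lip_atom d j m \<Gamma> (c j m)" if m: "m \<in> cube_indices \<Gamma> j" for j m
    proof -
      have a: "Lip_atom d j m \<Gamma> (a j m)" "Lip_atom d j m \<Gamma> (a' j m)"
        using f(2) g(2) m by (auto simp: Lip_atomic_repr_def)
      note A = Lip_atom_bounds[OF a(1)] and A' = Lip_atom_bounds[OF a(2)]
      have diff: "norm (c j m x - c j m y) \<le> 2 ^ j * dist x y" if xy: "x \<in> \<Gamma>" "y \<in> \<Gamma>" for x y
      proof -
        have "norm (lam j m * (a j m x - a j m y) + lam' j m * (a' j m x - a' j m y)) \<le>
            norm (lam j m) * (2 ^ j * dist x y) + norm (lam' j m) * (2 ^ j * dist x y)"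
          using A(2)[OF xy] A'(2)[OF xy]
          by (intro norm_triangle_mono) (auto simp: norm_mult intro: mult_left_mono)
        also have "\<dots> = \<mu> j m * (2 ^ j * dist x y)" by (simp add: \<mu>_def distrib_right)
        finally have "norm (of_real (1 / \<mu> j m) *
            (lam j m * (a j m x - a j m y) + lam' j m * (a' j m x - a' j m y))) \<le> 2 ^ j * dist x y"
          by (rule ratio) simp
        then show ?thesis by (simp add: c_def algebra_simps)
      qed
      have supp: "{x\<in>\<Gamma>. c j m x \<noteq> 0} \<subseteq> dcube d j m"
      proof clarify
        fix x assume x: "x \<in> \<Gamma>" "c j m x \<noteq> 0"
        then have "a j m x \<noteq> 0 \<or> a' j m x \<noteq> 0" by (auto simp: c_def)
        then show "x \<in> dcube d j m" using A(1) A'(1) x(1) by blast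
      qed
      have lip: "(2 ^ j)-lipschitz_on \<Gamma> (c j m)" using diff by (intro lipschitz_onI) (auto simp: dist_norm)
      then have "c j m \<in> borel_measurable \<sigma>" by (intro continuous_measurable lipschitz_on_continuous_on)
      then have cm: "(\<lambda>x. ennreal (norm (c j m x))) \<in> borel_measurable \<sigma>" by measurable
      have am: "(\<lambda>x. ennreal (norm (a j m x))) \<in> borel_measurable \<sigma>"
        "(\<lambda>x. ennreal (norm (a' j m x))) \<in> borel_measurable \<sigma>"
        using Lip_atom_measurable[OF a(1)] Lip_atom_measurable[OF a(2)] by auto
      have "AE x in \<sigma>. ennreal (norm (a j m x)) \<le> 1" "AE x in \<sigma>. ennreal (norm (a' j m x)) \<le> 1"
        using a am by (auto simp only: Lip_atom_def Lp_qnorm_le_iff_infinite)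
      then have "AE x in \<sigma>. ennreal (norm (c j m x)) \<le> 1"
      proof eventually_elim
        case (elim x)
        have "norm (lam j m * a j m x + lam' j m * a' j m x) \<le> norm (lam j m) * 1 + norm (lam' j m) * 1"
          using elim by (intro norm_triangle_mono) (auto simp: norm_mult ennreal_le_1 intro!: mult_left_le)
        then have "norm (c j m x) \<le> 1" unfolding c_def by (intro ratio) (auto simp: \<mu>_def)
        then show ?case by (simp add: ennreal_le_1)
      qed
      then have "Lp_qnorm \<sigma> \<infinity> (\<lambda>x. ennreal (norm (c j m x))) \<le> 1"
        by (simp only: Lp_qnorm_le_iff_infinite[OF cm])
      moreover have "closure {x\<in>\<Gamma>. c j m x \<noteq> 0} \<subseteq> dcube d j m \<inter> \<Gamma>"
        using supp by (intro closure_minimal closed_Int closed_dcube closed) auto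
      ultimately show ?thesis using lip by (simp add: Lip_atom_def)
    qed
    moreover have "atomic_series_Lp \<sigma> p \<Gamma> (\<lambda>j m. of_real (\<mu> j m)) c (\<lambda>x. f x + g x)"
      unfolding atomic_series_iff
    proof (rule ennreal_tendsto_0_le)
      let ?e = "\<lambda>f lam a J. Lp_qnorm \<sigma> p (\<lambda>x. ennreal (norm (f x - partial_sum lam a J x)))"
      have "(\<lambda>J. ennreal C2 * (?e f lam a J + ?e g lam' a' J)) \<longlonglongrightarrow> ennreal C2 * (0 + 0)"
        using f(2) g(2) by (intro ennreal_tendsto_cmult tendsto_add) (auto simp: Lip_atomic_repr_def atomic_series_iff)
      then show "(\<lambda>J. ennreal C2 * (?e f lam a J + ?e g lam' a' J)) \<longlonglongrightarrow> 0" by simp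
      show "?e (\<lambda>x. f x + g x) (\<lambda>j m. of_real (\<mu> j m)) c J \<le> ennreal C2 * (?e f lam a J + ?e g lam' a' J)" for J
      proof -
        have ps: "partial_sum (\<lambda>j m. of_real (\<mu> j m)) c J x = partial_sum lam a J x + partial_sum lam' a' J x" for x
          by (simp add: partial_sum_def recover sum.distrib)
        have m: "partial_sum lam a J \<in> borel_measurable \<sigma>" "partial_sum lam' a' J \<in> borel_measurable \<sigma>"
          using f(2) g(2) partial_sum_measurable unfolding Lip_atomic_repr_def by blast+
        have "?e (\<lambda>x. f x + g x) (\<lambda>j m. of_real (\<mu> j m)) c J \<le>
            Lp_qnorm \<sigma> p (\<lambda>x. ennreal (norm (f x - partial_sum lam a J x)) +
              ennreal (norm (g x - partial_sum lam' a' J x)))"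
        proof (rule Lp_qnorm_mono[OF assms(1)])
          show "ennreal (norm (f x + g x - partial_sum (\<lambda>j m. of_real (\<mu> j m)) c J x)) \<le>
              ennreal (norm (f x - partial_sum lam a J x)) + ennreal (norm (g x - partial_sum lam' a' J x))" for x
            using norm_triangle_ineq[of "f x - partial_sum lam a J x" "g x - partial_sum lam' a' J x"]
            by (simp add: ps ennreal_plus[symmetric] algebra_simps del: ennreal_plus)
        qed (use f(1) g(1) m in \<open>simp_all add: ps\<close>)
        also have "\<dots> \<le> ennreal C2 * (?e f lam a J + ?e g lam' a' J)"
          using f(1) g(1) m by (intro tri[rule_format]; measurable)
        finally show ?thesis .
      qed
    qed
    ultimately have "Lip_atomic_repr d p \<Gamma> (\<lambda>x. f x + g x) (\<lambda>j m. of_real (\<mu> j m)) c"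
      by (simp add: Lip_atomic_repr_def)
    from Lip_atomic_qnorm_le[OF this, of s q] show ?thesis
      using add[rule_format, of "DIM('a) - 1" s \<Gamma> lam lam'] unfolding b_qnorm_bd_def \<mu>_def by (rule order_trans)
  qed
  show ?thesis
  proof (intro exI[of _ C1] conjI allI impI, rule C1)
    fix f g :: "'a \<Rightarrow> complex" assume fg: "f \<in> borel_measurable \<sigma>" "g \<in> borel_measurable \<sigma>"
    let ?\<nu> = "Lip_atomic_qnorm d s p q \<Gamma>"
    have half: "?\<nu> (\<lambda>x. f x + g x) \<le> ennreal C1 * (b_qnorm_bd s p q \<Gamma> lam + ?\<nu> g)"
      if "Lip_atomic_repr d p \<Gamma> f lam a" for lam a
    proof -
      have "?\<nu> (\<lambda>x. f x + g x) \<le> ennreal C1 * (INF x\<in>{(lam', a'). Lip_atomic_repr d p \<Gamma> g lam' a'}.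
          b_qnorm_bd s p q \<Gamma> lam + b_qnorm_bd s p q \<Gamma> (fst x))"
        using C1 repr[OF fg(1) that fg(2)] by (intro le_cmult_INF) auto
      also have "\<dots> \<le> ennreal C1 * (b_qnorm_bd s p q \<Gamma> lam + ?\<nu> g)"
      proof (rule mult_left_mono)
        show "(INF x\<in>{(lam', a'). Lip_atomic_repr d p \<Gamma> g lam' a'}.
            b_qnorm_bd s p q \<Gamma> lam + b_qnorm_bd s p q \<Gamma> (fst x)) \<le> b_qnorm_bd s p q \<Gamma> lam + ?\<nu> g"
        proof (rule ennreal_le_epsilon)
          fix e :: real assume fin: "b_qnorm_bd s p q \<Gamma> lam + ?\<nu> g < top" and "0 < e"
          have "?\<nu> g < ?\<nu> g + ennreal e"
            using fin \<open>0 < e\<close> by (cases "?\<nu> g") (auto simp: ennreal_plus[symmetric] ennreal_less_iff simp del: ennreal_plus)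
          then obtain lam' a' where rep: "Lip_atomic_repr d p \<Gamma> g lam' a'" "b_qnorm_bd s p q \<Gamma> lam' < ?\<nu> g + ennreal e"
            by (rule Lip_atomic_qnorm_less)
          have "(INF x\<in>{(lam', a'). Lip_atomic_repr d p \<Gamma> g lam' a'}.
            b_qnorm_bd s p q \<Gamma> lam + b_qnorm_bd s p q \<Gamma> (fst x)) \<le> b_qnorm_bd s p q \<Gamma> lam + b_qnorm_bd s p q \<Gamma> lam'"
            by (rule INF_lower2[of "(lam', a')"]) (use rep in auto)
          also have "\<dots> \<le> b_qnorm_bd s p q \<Gamma> lam + (?\<nu> g + ennreal e)"
            using rep(2) by (intro add_left_mono) auto
          finally show "(INF x\<in>{(lam', a'). Lip_atomic_repr d p \<Gamma> g lam' a'}.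
            b_qnorm_bd s p q \<Gamma> lam + b_qnorm_bd s p q \<Gamma> (fst x)) \<le> b_qnorm_bd s p q \<Gamma> lam + ?\<nu> g + ennreal e"
            by (simp add: add.assoc)
        qed
      qed simp
      finally show ?thesis .
    qed
    show "?\<nu> (\<lambda>x. f x + g x) \<le> ennreal C1 * (?\<nu> f + ?\<nu> g)"
    proof (rule ennreal_le_epsilon)
      fix e :: real assume fin: "ennreal C1 * (?\<nu> f + ?\<nu> g) < top" and "0 < e"
      have "?\<nu> f < top" using fin C1 by (auto simp: ennreal_mult_less_top less_top[symmetric])
      then have "?\<nu> f < ?\<nu> f + ennreal (e / C1)"
        using \<open>0 < e\<close> C1 by (cases "?\<nu> f") (auto simp: ennreal_plus[symmetric] ennreal_less_iff simp del: ennreal_plus)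
      then obtain lam a where rep: "Lip_atomic_repr d p \<Gamma> f lam a" "b_qnorm_bd s p q \<Gamma> lam < ?\<nu> f + ennreal (e / C1)"
        by (rule Lip_atomic_qnorm_less)
      have "?\<nu> (\<lambda>x. f x + g x) \<le> ennreal C1 * (b_qnorm_bd s p q \<Gamma> lam + ?\<nu> g)"
        by (rule half[OF rep(1)])
      also have "\<dots> \<le> ennreal C1 * (?\<nu> f + ennreal (e / C1) + ?\<nu> g)"
        using rep(2) by (intro mult_left_mono add_right_mono) auto
      also have "\<dots> = ennreal C1 * (?\<nu> f + ?\<nu> g) + ennreal C1 * ennreal (e / C1)"
        by (simp only: distrib_left ac_simps)
      also have "ennreal C1 * ennreal (e / C1) = ennreal e"
        using C1 \<open>0 < e\<close> by (simp add: ennreal_mult'[symmetric])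
      finally show "?\<nu> (\<lambda>x. f x + g x) \<le> ennreal C1 * (?\<nu> f + ?\<nu> g) + ennreal e" .
    qed
  qed
qed

lemma Lip_atomic_qnorm_sum_le:
  assumes "0 < p" "0 < q" "finite I"
  shows "\<exists>C>0. \<forall>F. (\<forall>i\<in>I. F i \<in> borel_measurable \<sigma>) \<longrightarrow>
    Lip_atomic_qnorm d s p q \<Gamma> (\<lambda>x. \<Sum>i\<in>I. F i x) \<le>
      ennreal C * (\<Sum>i\<in>I. Lip_atomic_qnorm d s p q \<Gamma> (F i))"
  using assms(3)
proof (induction I rule: finite_induct)
  case empty
  then show ?case
    using Lip_atomic_qnorm_zero[OF assms(1,2)] by (intro exI[of _ 1]) auto
next
  case (insert i I)
  let ?\<nu> = "Lip_atomic_qnorm d s p q \<Gamma>"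
  from insert.IH obtain C1 :: real where C1: "0 < C1"
    and ih: "\<forall>F. (\<forall>i\<in>I. F i \<in> borel_measurable \<sigma>) \<longrightarrow>
      ?\<nu> (\<lambda>x. \<Sum>i\<in>I. F i x) \<le> ennreal C1 * (\<Sum>i\<in>I. ?\<nu> (F i))"
    by (elim exE conjE)
  from Lip_atomic_qnorm_add_le[OF assms(1,2), of d s] obtain C2 :: real where C2: "0 < C2"
    and add: "\<forall>f g. f \<in> borel_measurable \<sigma> \<longrightarrow> g \<in> borel_measurable \<sigma> \<longrightarrow>
      ?\<nu> (\<lambda>x. f x + g x) \<le> ennreal C2 * (?\<nu> f + ?\<nu> g)"
    by (elim exE conjE)
  define C where "C = C2 * (1 + C1)"
  show ?case
  proof (intro exI[of _ C] conjI allI impI)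
    show "0 < C" using C1 C2 by (simp add: C_def)
    fix F :: "_ \<Rightarrow> 'a \<Rightarrow> complex" assume F: "\<forall>i\<in>insert i I. F i \<in> borel_measurable \<sigma>"
    have "?\<nu> (\<lambda>x. \<Sum>i\<in>insert i I. F i x) = ?\<nu> (\<lambda>x. F i x + (\<Sum>i\<in>I. F i x))"
      using insert by simp
    also have "\<dots> \<le> ennreal C2 * (?\<nu> (F i) + ?\<nu> (\<lambda>x. \<Sum>i\<in>I. F i x))"
      using F by (intro add[rule_format] borel_measurable_sum) auto
    also have "\<dots> \<le> ennreal C2 * (ennreal (1 + C1) * ?\<nu> (F i) + ennreal (1 + C1) * (\<Sum>i\<in>I. ?\<nu> (F i)))"
    proof (intro mult_left_mono add_mono)
      have "ennreal 1 * ?\<nu> (F i) \<le> ennreal (1 + C1) * ?\<nu> (F i)"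
        using C1 by (intro mult_right_mono ennreal_leI) auto
      then show "?\<nu> (F i) \<le> ennreal (1 + C1) * ?\<nu> (F i)" by simp
      have "ennreal C1 * (\<Sum>i\<in>I. ?\<nu> (F i)) \<le> ennreal (1 + C1) * (\<Sum>i\<in>I. ?\<nu> (F i))"
        by (intro mult_right_mono ennreal_leI) auto
      then show "?\<nu> (\<lambda>x. \<Sum>i\<in>I. F i x) \<le> ennreal (1 + C1) * (\<Sum>i\<in>I. ?\<nu> (F i))"
        using ih[rule_format, of F] F by (meson insertI2 order_trans)
    qed simp
    also have "\<dots> = ennreal C * (\<Sum>i\<in>insert i I. ?\<nu> (F i))"
      using insert C1 C2 by (simp only: sum.insert distrib_left[symmetric] C_def ennreal_mult'' mult.assoc) (simp add: ennreal_mult' mult.assoc)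
    finally show "?\<nu> (\<lambda>x. \<Sum>i\<in>insert i I. F i x) \<le> ennreal C * (\<Sum>i\<in>insert i I. ?\<nu> (F i))" .
  qed
qed

end

section \<open>Transfer of atomic representations between boundary and charts\<close>

lemma K_atom_bounds:
  assumes "K_atom d K j k a"
  shows "norm (a x) \<le> 1" and "a x \<noteq> 0 \<Longrightarrow> x \<in> dcube d j k" and "continuous_on S a"
proof -
  have "norm (iter_partial [] a x) \<le> 2 ^ (length ([] :: 'a list) * j)"
    using assms unfolding K_atom_def by (metis empty_subsetI le0 list.set(1) list.size(3))
  then show "norm (a x) \<le> 1" by simp
  show "a x \<noteq> 0 \<Longrightarrow> x \<in> dcube d j k"
    using assms closure_subset[of "{x. a x \<noteq> 0}"] unfolding K_atom_def by blast
  have "continuous_on UNIV (iter_partial [] a)"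
    using assms unfolding K_atom_def C_class_def by (metis empty_subsetI le0 list.set(1) list.size(3))
  then show "continuous_on S a" by (auto intro: continuous_on_subset)
qed

text \<open>The level \<open>j\<close> of a series contributes at most \<open>2\<^sup>-\<^sup>j\<^sup>s\<close> to the \<open>L\<^sub>p\<close> norm, and \<open>s > 0\<close>.\<close>

lemma Lp_qnorm_le_b_qnorm:
  fixes W :: "'b::euclidean_space set"
  assumes "0 < p" "0 < q" "0 < s" "1 \<le> d" "W \<in> sets lebesgue" "bounded W"
  shows "\<exists>C>0. \<forall>f lam a. f \<in> borel_measurable (lebesgue_on W) \<longrightarrow> K_atomic_repr d K p W f lam a \<longrightarrow>
    Lp_qnorm (lebesgue_on W) p (\<lambda>x. ennreal (norm (f x))) \<le> ennreal C * b_qnorm DIM('b) s p q W lam"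
proof -
  define P where "P = enn2real (inverse p)"
  define A where "A = nat \<lceil>(2 * d + 1) ^ DIM('b)\<rceil>"
  define v where "v = (2 * d) ^ DIM('b)"
  have v: "0 < v" using assms by (simp add: v_def)
  from Lp_qnorm_suminf_le[OF \<open>0 < p\<close> \<open>0 < s\<close>, where 'a='b] obtain C1 :: real where C1: "0 < C1"
    and G: "\<forall>(M::'b measure) u. (\<forall>i. u i \<in> borel_measurable M) \<longrightarrow>
      Lp_qnorm M p (\<lambda>x. \<Sum>i. u i x) \<le>
        ennreal C1 * (SUP i. ennreal (2 powr (s * real i)) * Lp_qnorm M p (u i))"
    by (elim exE conjE)
  from Lp_qnorm_add_le[OF assms(1), where 'a='b] obtain C2 :: real where C2: "0 < C2"
    and tri: "\<forall>(M::'b measure) f g. f \<in> borel_measurable M \<longrightarrow> g \<in> borel_measurable M \<longrightarrow>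
      Lp_qnorm M p (\<lambda>x. f x + g x) \<le> ennreal C2 * (Lp_qnorm M p f + Lp_qnorm M p g)"
    by (elim exE conjE)
  define C where "C = C2 * (C1 * (real A * v powr P)) + 1"
  have fin: "finite (cube_indices W j)" for j using assms(6) by (rule finite_cube_indices)
  have C0: "0 \<le> C2 * (C1 * (real A * v powr P))" using C1 C2 by simp
  show ?thesis
  proof (intro exI[of _ C] conjI allI impI)
    show "0 < C" using C0 by (simp add: C_def add_nonneg_pos)
    fix f lam a assume f: "f \<in> borel_measurable (lebesgue_on W)" and rep: "K_atomic_repr d K p W f lam a"
    define \<beta> where "\<beta> = b_qnorm DIM('b) s p q W lam"
    define u where "u j x = ennreal (\<Sum>k\<in>cube_indices W j. norm (lam j k) * norm (a j k x))" for j x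
    have atom: "K_atom d K j k (a j k)" if "k \<in> cube_indices W j" for j k
      using rep that by (simp add: K_atomic_repr_def)
    have am: "a j k \<in> borel_measurable (lebesgue_on W)" if "k \<in> cube_indices W j" for j k
      using K_atom_bounds(3)[OF atom[OF that]] assms(5)
      by (rule continuous_imp_measurable_on_sets_lebesgue)
    have um: "u j \<in> borel_measurable (lebesgue_on W)" for j
      unfolding u_def using am by (intro measurable_compose[OF _ measurable_ennreal] borel_measurable_sum) auto
    have level: "Lp_qnorm (lebesgue_on W) p (u j) \<le>
        ennreal (real A * v powr P * 2 powr (- (s * real j))) * \<beta>" for j
    proof -
      let ?R = "\<lambda>x. {k \<in> cube_indices W j. x \<in> dcube d j k}"
      have "Lp_qnorm (lebesgue_on W) p (u j) \<le> ennreal (real A * (v / (2 ^ j) ^ DIM('b)) powr P) *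
          Lp_qnorm (count_space (cube_indices W j)) p (\<lambda>k. ennreal (norm (lam j k)))"
        unfolding P_def
      proof (rule Lp_qnorm_neighbour_sum_le[where R="?R" and B="\<lambda>k. dcube d j k \<inter> W"])
        show "0 < v / (2 ^ j) ^ DIM('b)" using v by simp
      next
        fix x assume "x \<in> space (lebesgue_on W)"
        have "\<exists>y\<in>dcube d j k. dist y x \<le> 0" if "k \<in> ?R x" for k using that by auto
        from lattice_near_count[of d 0 "?R x" j, OF _ _ _ this] assms(4)
        have "finite (?R x)" "real (card (?R x)) \<le> (2 * d + 1) ^ DIM('b)"
          by (auto simp: cube_indices_def)
        moreover from this have "card (?R x) \<le> A" unfolding A_def by linarith
        ultimately show "finite (?R x) \<and> card (?R x) \<le> A \<and> ?R x \<subseteq> cube_indices W j" by blast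
      next
        fix k
        show "dcube d j k \<inter> W \<in> sets (lebesgue_on W)"
          using assms(5) unfolding dcube_eq_cbox by (subst sets_restrict_space_iff) auto
        have "emeasure (lebesgue_on W) (dcube d j k \<inter> W) = emeasure lebesgue (dcube d j k \<inter> W)"
          using assms(5) by (intro emeasure_restrict_space) auto
        also have "\<dots> \<le> emeasure lebesgue (dcube d j k)"
          unfolding dcube_eq_cbox using assms(5) by (intro emeasure_mono) auto
        also have "\<dots> = ennreal (\<Prod>b\<in>(Basis :: 'b set). 2 * d / 2 ^ j)"
          unfolding dcube_eq_cbox using assms(4)
          by (simp add: emeasure_lborel_cbox inner_diff_left inner_add_left)
        also have "\<dots> = ennreal (v / (2 ^ j) ^ DIM('b))" by (simp add: v_def power_divide)
        finally show "emeasure (lebesgue_on W) (dcube d j k \<inter> W) \<le> ennreal (v / (2 ^ j) ^ DIM('b))" .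
      next
        fix x
        have "(\<Sum>k\<in>cube_indices W j. norm (lam j k) * norm (a j k x)) =
            (\<Sum>k\<in>?R x. norm (lam j k) * norm (a j k x))"
          using fin K_atom_bounds(2)[OF atom] by (intro sum.mono_neutral_right) auto
        also have "\<dots> \<le> (\<Sum>k\<in>?R x. norm (lam j k))"
          using K_atom_bounds(1)[OF atom] by (intro sum_mono) (auto intro!: mult_left_le)
        finally have "u j x \<le> ennreal (\<Sum>k\<in>?R x. norm (lam j k))"
          unfolding u_def by (rule ennreal_leI)
        then show "u j x \<le> (\<Sum>k\<in>?R x. ennreal (norm (lam j k)))" by (simp add: sum_ennreal)
      qed (use assms(1) um countable_cube_indices in auto)
      also have "\<dots> \<le> ennreal (real A * (v / (2 ^ j) ^ DIM('b)) powr P) *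
          (ennreal (2 powr (- (real j * (s - real DIM('b) * P)))) * \<beta>)"
        unfolding P_def \<beta>_def using assms(2) by (intro mult_left_mono b_qnorm_level_le) auto
      also have "\<dots> = ennreal (real A * (v / (2 ^ j) ^ DIM('b)) powr P *
          2 powr (- (real j * (s - real DIM('b) * P)))) * \<beta>"
        by (simp add: ennreal_mult mult.assoc)
      also have "real A * (v / (2 ^ j) ^ DIM('b)) powr P * 2 powr (- (real j * (s - real DIM('b) * P))) =
          real A * v powr P * 2 powr (- (s * real j))"
      proof -
        have "((2::real) ^ j) ^ DIM('b) = 2 powr (real j * real DIM('b))"
          by (simp add: powr_realpow[symmetric] powr_powr)
        then have "(v / (2 ^ j) ^ DIM('b)) powr P = v powr P * 2 powr (- (real j * real DIM('b) * P))"
          by (simp add: powr_divide powr_mult inverse_powr powr_powr powr_minus divide_inverse)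
        then show ?thesis by (simp add: powr_add[symmetric] algebra_simps)
      qed
      finally show ?thesis .
    qed
    define S where "S J x = (\<Sum>j<J. \<Sum>k\<in>cube_indices W j. lam j k * a j k x)" for J x
    have Sm: "S J \<in> borel_measurable (lebesgue_on W)" for J
      unfolding S_def using am by (intro borel_measurable_sum borel_measurable_times borel_measurable_const)
    have "Lp_qnorm (lebesgue_on W) p (\<lambda>x. \<Sum>j. u j x) \<le>
        ennreal C1 * (SUP j. ennreal (2 powr (s * real j)) * Lp_qnorm (lebesgue_on W) p (u j))"
      using um by (intro G[rule_format]) auto
    also have "\<dots> \<le> ennreal C1 * (ennreal (real A * v powr P) * \<beta>)"
    proof (intro mult_left_mono SUP_least)
      fix j
      have "ennreal (2 powr (s * real j)) * Lp_qnorm (lebesgue_on W) p (u j) \<le> ennreal (2 powr (s * real j)) *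
          (ennreal (real A * v powr P * 2 powr (- (s * real j))) * \<beta>)"
        by (rule mult_left_mono[OF level]) simp
      also have "\<dots> = ennreal (2 powr (s * real j) * (real A * v powr P * 2 powr (- (s * real j)))) * \<beta>"
        by (simp add: ennreal_mult mult.assoc)
      also have "2 powr (s * real j) * (real A * v powr P * 2 powr (- (s * real j))) =
          real A * v powr P * (2 powr (s * real j) * 2 powr (- (s * real j)))" by simp
      also have "2 powr (s * real j) * 2 powr (- (s * real j)) = (1::real)"
        by (simp add: powr_add[symmetric])
      finally show "ennreal (2 powr (s * real j)) * Lp_qnorm (lebesgue_on W) p (u j) \<le>
          ennreal (real A * v powr P) * \<beta>" by simp
    qed simp
    finally have total: "Lp_qnorm (lebesgue_on W) p (\<lambda>x. \<Sum>j. u j x) \<le>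
        ennreal C1 * (ennreal (real A * v powr P) * \<beta>)" .
    let ?e = "\<lambda>J. Lp_qnorm (lebesgue_on W) p (\<lambda>x. ennreal (norm (f x - S J x)))"
    have bound: "Lp_qnorm (lebesgue_on W) p (\<lambda>x. ennreal (norm (f x))) \<le>
        ennreal C2 * (?e J + ennreal C1 * (ennreal (real A * v powr P) * \<beta>))" for J
    proof -
      have "ennreal (norm (S J x)) \<le> (\<Sum>j. u j x)" for x
      proof -
        have "norm (S J x) \<le> (\<Sum>j<J. \<Sum>k\<in>cube_indices W j. norm (lam j k) * norm (a j k x))"
          unfolding S_def norm_mult[symmetric] by (intro order_trans[OF norm_sum] sum_mono norm_sum)
        then have "ennreal (norm (S J x)) \<le> (\<Sum>j<J. u j x)"
          unfolding u_def by (subst sum_ennreal) (auto intro!: ennreal_leI sum_nonneg)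
        also have "\<dots> \<le> (\<Sum>j. u j x)" by (rule sum_le_suminf) auto
        finally show ?thesis .
      qed
      then have S_le: "Lp_qnorm (lebesgue_on W) p (\<lambda>x. ennreal (norm (S J x))) \<le>
          Lp_qnorm (lebesgue_on W) p (\<lambda>x. \<Sum>j. u j x)"
        using Sm[of J] um by (intro Lp_qnorm_mono assms(1)) auto
      have "Lp_qnorm (lebesgue_on W) p (\<lambda>x. ennreal (norm (f x))) \<le>
          Lp_qnorm (lebesgue_on W) p (\<lambda>x. ennreal (norm (f x - S J x)) + ennreal (norm (S J x)))"
      proof (rule Lp_qnorm_mono[OF assms(1)])
        show "ennreal (norm (f x)) \<le> ennreal (norm (f x - S J x)) + ennreal (norm (S J x))" for x
          using norm_triangle_ineq[of "f x - S J x" "S J x"]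
          by (simp add: ennreal_plus[symmetric] del: ennreal_plus)
      qed (use f Sm[of J] in measurable)
      also have "\<dots> \<le> ennreal C2 * (?e J + Lp_qnorm (lebesgue_on W) p (\<lambda>x. ennreal (norm (S J x))))"
        using f Sm[of J] by (intro tri[rule_format]; measurable)
      also have "\<dots> \<le> ennreal C2 * (?e J + ennreal C1 * (ennreal (real A * v powr P) * \<beta>))"
        using S_le total by (intro mult_left_mono add_left_mono) auto
      finally show ?thesis .
    qed
    have "?e \<longlonglongrightarrow> 0"
      using rep fin unfolding K_atomic_repr_def atomic_series_Lp_def S_def by simp
    then have "(\<lambda>J. ennreal C2 * (?e J + ennreal C1 * (ennreal (real A * v powr P) * \<beta>)))
        \<longlonglongrightarrow> ennreal C2 * (0 + ennreal C1 * (ennreal (real A * v powr P) * \<beta>))"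
      by (intro ennreal_tendsto_cmult tendsto_add tendsto_const) auto
    then have "Lp_qnorm (lebesgue_on W) p (\<lambda>x. ennreal (norm (f x))) \<le>
        ennreal C2 * (0 + ennreal C1 * (ennreal (real A * v powr P) * \<beta>))"
      by (rule tendsto_lowerbound) (use bound in auto)
    also have "\<dots> = ennreal (C2 * (C1 * (real A * v powr P))) * \<beta>"
      using C1 C2 by (simp add: ennreal_mult mult.assoc)
    also have "\<dots> \<le> ennreal C * \<beta>" unfolding C_def by (intro mult_right_mono ennreal_leI) auto
    finally show "Lp_qnorm (lebesgue_on W) p (\<lambda>x. ennreal (norm (f x))) \<le>
        ennreal C * b_qnorm DIM('b) s p q W lam"
      by (simp add: \<beta>_def)
  qed
qed

sublocale lipschitz_chart \<subseteq> compact_boundary \<Gamma>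
  by unfold_locales (rule compact_\<Gamma>)

context lipschitz_chart
begin

text \<open>Surface measure charges every nonempty relatively open part of \<open>\<Gamma> \<inter> V\<close>, so an essential bound of a
  continuous function carries over to every point there.\<close>

lemma atom_bounded_on_chart:
  "\<exists>C>0. \<forall>d j m a. Lip_atom d j m \<Gamma> a \<longrightarrow> (\<forall>y\<in>W. norm (a (\<Psi> y)) \<le> C)"
proof (rule Lp_transfer[of \<infinity>])
  show "(0::ennreal) < \<infinity>" by simp
  fix C :: real
  assume C: "0 < C" and "\<Psi> \<in> measurable (lebesgue_on W) \<sigma>"
    and tr: "\<And>f. f \<in> borel_measurable \<sigma> \<Longrightarrow>
      Lp_qnorm (lebesgue_on W) \<infinity> (\<lambda>y. f (\<Psi> y)) \<le> ennreal C * Lp_qnorm \<sigma> \<infinity> f"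
  show ?thesis
  proof (intro exI[of _ C] conjI allI impI ballI, rule C)
    fix d :: real and j and m :: 'a and a y assume a: "Lip_atom d j m \<Gamma> a" and y: "y \<in> W"
    have am: "(\<lambda>x. ennreal (norm (a x))) \<in> borel_measurable \<sigma>"
      using Lip_atom_measurable[OF a] by measurable
    have "continuous_on W (\<lambda>y. a (\<Psi> y))"
      using a W_iff unfolding Lip_atom_def
      by (intro continuous_on_compose2[OF lipschitz_on_continuous_on continuous_\<Psi>]) auto
    then have "open (W \<inter> (\<lambda>y. norm (a (\<Psi> y))) -` {C<..})"
      using open_W by (intro continuous_open_preimage continuous_intros) auto
    then have op: "open {y \<in> W. C < norm (a (\<Psi> y))}"
      by (simp add: vimage_def Int_def)
    have aW: "(\<lambda>y. ennreal (norm (a (\<Psi> y)))) \<in> borel_measurable (lebesgue_on W)"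
      using measurable_compose[OF \<open>\<Psi> \<in> measurable (lebesgue_on W) \<sigma>\<close> am] .
    have "Lp_qnorm (lebesgue_on W) \<infinity> (\<lambda>y. ennreal (norm (a (\<Psi> y)))) \<le> ennreal C * 1"
      using tr[OF am] a unfolding Lip_atom_def by (meson mult_left_mono order_trans zero_le)
    then have "AE y in lebesgue_on W. ennreal (norm (a (\<Psi> y))) \<le> ennreal C"
      unfolding Lp_qnorm_le_iff_infinite[OF aW] by simp
    then have "AE y in lebesgue_on W. norm (a (\<Psi> y)) \<le> C"
      using C by (auto simp: ennreal_le_iff)
    then have "AE y in lebesgue. y \<in> W \<longrightarrow> norm (a (\<Psi> y)) \<le> C"
      using open_W by (subst (asm) AE_restrict_space_iff) auto
    then have "negligible {y \<in> W. C < norm (a (\<Psi> y))}"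
      unfolding eventually_ae_filter negligible_iff_null_sets
      using op by (auto simp: not_le completion.complete2 subset_iff intro: null_sets_subset)
    then have "{y \<in> W. C < norm (a (\<Psi> y))} = {}"
      using op open_not_negligible by blast
    then show "norm (a (\<Psi> y)) \<le> C" using y by (auto simp: not_less[symmetric])
  qed
qed

text \<open>A localised Lipschitz atom, read in the chart and extended by zero, is a Lipschitz block: its
  support has a positive distance from the complement of \<open>W\<close>.\<close>

theorem besov_of_Lip_atoms:
  fixes K :: nat and d d' s :: real and \<phi> :: "'a \<Rightarrow> real"
  assumes "0 < p" "0 < q" "0 < s" "s < 1" "1 \<le> d" "0 \<le> d'"
    and \<phi>_bd: "\<And>x. \<bar>\<phi> x\<bar> \<le> B" and \<phi>_lip: "\<And>x y. \<bar>\<phi> x - \<phi> y\<bar> \<le> B * dist x y"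
    and supp: "closure {x. \<phi> x \<noteq> 0} \<subseteq> V"
  shows "\<exists>C>0. \<forall>f lam a. f \<in> Lp_space \<sigma> p \<longrightarrow> Lip_atomic_repr d' p \<Gamma> f lam a \<longrightarrow>
    b_qnorm DIM('b) s p q \<Gamma> lam < \<infinity> \<longrightarrow>
    (\<lambda>y. of_real (\<phi> (\<Psi> y)) * f (\<Psi> y)) \<in> besov_space d K s p q W \<and>
    besov_qnorm d K s p q W (\<lambda>y. of_real (\<phi> (\<Psi> y)) * f (\<Psi> y)) \<le> ennreal C * b_qnorm DIM('b) s p q \<Gamma> lam"
proof -
  have B: "0 \<le> B" using \<phi>_bd[of undefined] by linarith
  have L0: "0 \<le> L" using L by simp
  from atom_bounded_on_chart obtain A :: real where A: "0 < A"
    and bound: "\<forall>d j m a. Lip_atom d j m \<Gamma> a \<longrightarrow> (\<forall>y\<in>W. norm (a (\<Psi> y)) \<le> A)"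
    by (elim exE conjE)
  define Q where "Q = {y. \<Psi> y \<in> \<Gamma> \<inter> closure {x. \<phi> x \<noteq> 0}}"
  have QW: "Q \<subseteq> W" using supp W_iff by (auto simp: Q_def)
  have "closed (\<Psi> -` (\<Gamma> \<inter> closure {x. \<phi> x \<noteq> 0}))"
    using continuous_closed_preimage[OF continuous_\<Psi>[of UNIV] closed_UNIV, of "\<Gamma> \<inter> closure {x. \<phi> x \<noteq> 0}"]
      closed_\<Gamma> by (simp add: closed_Int)
  then have "closed Q" by (simp add: Q_def vimage_def)
  then have "compact Q"
    using bounded_subset[OF bounded_W QW] by (simp add: compact_eq_bounded_closed)
  then obtain \<epsilon> where \<epsilon>: "0 < \<epsilon>" "(\<Union>y\<in>Q. ball y \<epsilon>) \<subseteq> W"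
    using compact_subset_open_imp_ball_epsilon_subset[OF _ open_W QW] by blast
  define B' where "B' = B * A + B * L * (A + 1) + B * A / \<epsilon> + 1"
  have B': "0 < B'" "B * A \<le> B'" "B * L * (A + 1) \<le> B'" "B * A / \<epsilon> \<le> B'"
    using B A L0 \<epsilon> by (auto simp: B'_def intro!: add_nonneg_pos add_nonneg_nonneg mult_nonneg_nonneg)
  from smooth_atoms_of_lipschitz_blocks[OF assms(1-6) B'(1), where K=K] obtain C :: real where C: "0 < C"
    and smooth: "\<forall>lam b f. lipschitz_blocks d' B' b \<longrightarrow> f \<in> borel_measurable (lebesgue_on W) \<longrightarrow>
    (\<lambda>J. Lp_qnorm (lebesgue_on W) p (\<lambda>y. ennreal (norm (f y - (\<Sum>j<J. block_sum lam b j y))))) \<longlonglongrightarrow> 0 \<longrightarrow>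
    b_qnorm DIM('b) s p q \<Gamma> lam < \<infinity> \<longrightarrow>
    (\<exists>lam' a'. K_atomic_repr d K p W f lam' a' \<and>
      b_qnorm DIM('b) s p q W lam' \<le> ennreal C * b_qnorm DIM('b) s p q \<Gamma> lam)"
    by (elim exE conjE)
  show ?thesis
  proof (rule Lp_transfer[OF assms(1)])
    fix C' :: real
    assume C': "0 < C'" and \<Psi>m: "\<Psi> \<in> measurable (lebesgue_on W) \<sigma>"
      and tr: "\<And>f. f \<in> borel_measurable \<sigma> \<Longrightarrow>
        Lp_qnorm (lebesgue_on W) p (\<lambda>y. f (\<Psi> y)) \<le> ennreal C' * Lp_qnorm \<sigma> p f"
    have \<phi>m: "\<phi> \<in> borel_measurable \<sigma>"
      by (intro continuous_measurable lipschitz_on_continuous_on[of B] lipschitz_onI)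
        (use \<phi>_lip B in \<open>auto simp: dist_real_def\<close>)
    have local_le: "Lp_qnorm (lebesgue_on W) p (\<lambda>y. ennreal (norm (of_real (\<phi> (\<Psi> y)) * g (\<Psi> y)))) \<le>
        ennreal B * (ennreal C' * Lp_qnorm \<sigma> p (\<lambda>x. ennreal (norm (g x))))"
      if g: "g \<in> borel_measurable \<sigma>" for g :: "'a \<Rightarrow> complex"
    proof -
      have gm: "(\<lambda>x. ennreal (norm (g x))) \<in> borel_measurable \<sigma>" using g by measurable
      have "Lp_qnorm (lebesgue_on W) p (\<lambda>y. ennreal (norm (of_real (\<phi> (\<Psi> y)) * g (\<Psi> y)))) \<le>
          Lp_qnorm (lebesgue_on W) p (\<lambda>y. ennreal B * ennreal (norm (g (\<Psi> y))))"
      proof (rule Lp_qnorm_mono[OF assms(1)])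
        have "(\<lambda>x. ennreal (norm (of_real (\<phi> x) * g x))) \<in> borel_measurable \<sigma>" using \<phi>m g by measurable
        then show "(\<lambda>y. ennreal (norm (of_real (\<phi> (\<Psi> y)) * g (\<Psi> y)))) \<in> borel_measurable (lebesgue_on W)"
          by (rule measurable_compose[OF \<Psi>m])
        show "(\<lambda>y. ennreal B * ennreal (norm (g (\<Psi> y)))) \<in> borel_measurable (lebesgue_on W)"
          using measurable_compose[OF \<Psi>m gm] by measurable
        show "ennreal (norm (of_real (\<phi> (\<Psi> y)) * g (\<Psi> y))) \<le> ennreal B * ennreal (norm (g (\<Psi> y)))" for y
          using \<phi>_bd B by (simp add: norm_mult ennreal_mult[symmetric] mult_right_mono ennreal_leI)
      qed
      also have "\<dots> \<le> ennreal B * Lp_qnorm (lebesgue_on W) p (\<lambda>y. ennreal (norm (g (\<Psi> y))))"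
        using measurable_compose[OF \<Psi>m gm] by (intro Lp_qnorm_cmult_le assms(1))
      also have "\<dots> \<le> ennreal B * (ennreal C' * Lp_qnorm \<sigma> p (\<lambda>x. ennreal (norm (g x))))"
        by (intro mult_left_mono tr gm) simp
      finally show ?thesis .
    qed
    show ?thesis
    proof (intro exI[of _ C] conjI allI impI)
      show "0 < C" by (rule C)
    next
      fix f lam a
      assume f: "f \<in> Lp_space \<sigma> p" and rep: "Lip_atomic_repr d' p \<Gamma> f lam a"
        and fin: "b_qnorm DIM('b) s p q \<Gamma> lam < \<infinity>"
      have fm: "f \<in> borel_measurable \<sigma>" using f by (simp add: Lp_space_def)
      let ?f = "\<lambda>y. of_real (\<phi> (\<Psi> y)) * f (\<Psi> y)"
      define b where "b j m y = (if y \<in> W then of_real (\<phi> (\<Psi> y)) * a j m (\<Psi> y) else 0)" for j m y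
      have atom: "Lip_atom d' j m \<Gamma> (a j m)" if "m \<in> cube_indices \<Gamma> j" for j m
        using rep that by (simp add: Lip_atomic_repr_def)
      have blocks: "lipschitz_blocks d' B' b"
        unfolding lipschitz_blocks_def
      proof (intro allI ballI conjI impI)
        fix j m y assume m: "m \<in> cube_indices \<Gamma> j"
        note a = Lip_atom_bounds[OF atom[OF m]] and a_bd = bound[rule_format, OF atom[OF m]]
        show "\<Psi> y \<in> dcube d' j m" if "b j m y \<noteq> 0"
          using that a(1)[of "\<Psi> y"] W_iff[of y] by (auto simp: b_def split: if_splits)
        have bd: "norm (b j m y) \<le> B * A" for y
          using \<phi>_bd[of "\<Psi> y"] a_bd[of y] B A by (auto simp: b_def norm_mult intro!: mult_mono)
        then show "norm (b j m y) \<le> B'" using B'(2) order_trans by blast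
        \<comment> \<open>Outside \<open>W\<close> the atom was cut off, but there the point is at distance \<open>\<epsilon>\<close> from the support.\<close>
        have one: "norm (b j m y - b j m z) \<le> B' * 2 ^ j * dist y z" if yz: "z \<notin> W" for y z
        proof (cases "b j m y = 0")
          case False
          then have "y \<in> W" "\<phi> (\<Psi> y) \<noteq> 0" by (auto simp: b_def split: if_splits)
          then have "y \<in> Q" using W_iff[of y] closure_subset[of "{x. \<phi> x \<noteq> 0}"] by (auto simp: Q_def)
          then have "\<epsilon> \<le> dist y z" using \<epsilon>(2) yz by (force simp: not_less[symmetric])
          then have 1: "B * A / \<epsilon> * \<epsilon> \<le> B * A / \<epsilon> * dist y z"
            using B A \<epsilon>(1) by (intro mult_left_mono) auto
          have "norm (b j m y - b j m z) = norm (b j m y)" using yz by (simp add: b_def)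
          also have "\<dots> \<le> B * A / \<epsilon> * dist y z" using bd[of y] 1 \<epsilon>(1) by simp
          also have "\<dots> \<le> B' * 2 ^ j * dist y z"
          proof (intro mult_right_mono)
            have "B' * 1 \<le> B' * 2 ^ j" using B'(1) by (intro mult_left_mono) auto
            then show "B * A / \<epsilon> \<le> B' * 2 ^ j" using B'(4) by linarith
          qed simp
          finally show ?thesis .
        qed (use yz B'(1) in \<open>simp add: b_def\<close>)
        fix z
        show "norm (b j m y - b j m z) \<le> B' * 2 ^ j * dist y z"
        proof (cases "y \<in> W \<and> z \<in> W")
          case True
          then have yz: "\<Psi> y \<in> \<Gamma>" "\<Psi> z \<in> \<Gamma>" using W_iff by auto
          have "b j m y - b j m z = of_real (\<phi> (\<Psi> y) - \<phi> (\<Psi> z)) * a j m (\<Psi> y) +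
              of_real (\<phi> (\<Psi> z)) * (a j m (\<Psi> y) - a j m (\<Psi> z))"
            using True by (simp add: b_def algebra_simps)
          also have "norm \<dots> \<le> (B * dist (\<Psi> y) (\<Psi> z)) * A + B * (2 ^ j * dist (\<Psi> y) (\<Psi> z))"
          proof (rule norm_triangle_mono)
            show "norm (of_real (\<phi> (\<Psi> y) - \<phi> (\<Psi> z)) * a j m (\<Psi> y)) \<le> B * dist (\<Psi> y) (\<Psi> z) * A"
              unfolding norm_mult norm_of_real using \<phi>_lip a_bd[of y] True B by (intro mult_mono) auto
            show "norm (of_real (\<phi> (\<Psi> z)) * (a j m (\<Psi> y) - a j m (\<Psi> z))) \<le> B * (2 ^ j * dist (\<Psi> y) (\<Psi> z))"
              unfolding norm_mult norm_of_real using \<phi>_bd a(2)[OF yz] B by (intro mult_mono) auto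
          qed
          also have "\<dots> = B * (A + 2 ^ j) * dist (\<Psi> y) (\<Psi> z)" by (simp add: algebra_simps)
          also have "\<dots> \<le> B * ((A + 1) * 2 ^ j) * (L * dist y z)"
          proof (intro mult_mono mult_left_mono \<Psi>_lip B)
            have "A * 1 \<le> A * 2 ^ j" using A by (intro mult_left_mono) auto
            then show "A + 2 ^ j \<le> (A + 1) * 2 ^ j" by (simp add: distrib_right)
          qed (use A B in auto)
          also have "\<dots> = (B * L * (A + 1)) * (2 ^ j * dist y z)" by (simp add: mult_ac)
          also have "\<dots> \<le> B' * (2 ^ j * dist y z)" using B'(3) by (intro mult_right_mono) auto
          finally show ?thesis by (simp add: mult.assoc)
        next
          case False
          then show ?thesis using one[of z y] one[of y z] by (auto simp: norm_minus_commute dist_commute)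
        qed
      qed
      have f_meas: "?f \<in> borel_measurable (lebesgue_on W)"
      proof -
        have "(\<lambda>x. of_real (\<phi> x) * f x) \<in> borel_measurable \<sigma>" using \<phi>m fm by measurable
        then show ?thesis by (rule measurable_compose[OF \<Psi>m])
      qed
      have "Lp_qnorm \<sigma> p (\<lambda>x. ennreal (norm (f x))) < \<infinity>" using f by (simp add: Lp_space_def)
      then have "ennreal B * (ennreal C' * Lp_qnorm \<sigma> p (\<lambda>x. ennreal (norm (f x)))) < \<infinity>"
        by (simp add: ennreal_mult_less_top)
      then have f_Lp: "?f \<in> Lp_space (lebesgue_on W) p"
        using local_le[OF fm] f_meas unfolding Lp_space_def by (auto intro: le_less_trans)
      have conv: "(\<lambda>J. Lp_qnorm (lebesgue_on W) p
          (\<lambda>y. ennreal (norm (?f y - (\<Sum>j<J. block_sum lam b j y))))) \<longlonglongrightarrow> 0"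
      proof (rule ennreal_tendsto_0_le)
        let ?e = "\<lambda>J. Lp_qnorm \<sigma> p (\<lambda>x. ennreal (norm (f x - partial_sum lam a J x)))"
        have "(\<lambda>J. ennreal B * (ennreal C' * ?e J)) \<longlonglongrightarrow> ennreal B * (ennreal C' * 0)"
          using rep by (intro ennreal_tendsto_cmult) (auto simp: Lip_atomic_repr_def atomic_series_iff)
        then show "(\<lambda>J. ennreal B * (ennreal C' * ?e J)) \<longlonglongrightarrow> 0" by simp
        fix J
        show "Lp_qnorm (lebesgue_on W) p (\<lambda>y. ennreal (norm (?f y - (\<Sum>j<J. block_sum lam b j y)))) \<le>
            ennreal B * (ennreal C' * ?e J)"
        proof -
          have pm: "partial_sum lam a J \<in> borel_measurable \<sigma>"
            using atom by (intro partial_sum_measurable) auto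
          have "Lp_qnorm (lebesgue_on W) p (\<lambda>y. ennreal (norm (?f y - (\<Sum>j<J. block_sum lam b j y)))) =
            Lp_qnorm (lebesgue_on W) p
              (\<lambda>y. ennreal (norm (of_real (\<phi> (\<Psi> y)) * (f (\<Psi> y) - partial_sum lam a J (\<Psi> y)))))"
          proof (rule Lp_qnorm_cong)
            fix y assume "y \<in> space (lebesgue_on W)"
            then have y: "y \<in> W" by simp
            have "(\<Sum>j<J. block_sum lam b j y) = of_real (\<phi> (\<Psi> y)) * partial_sum lam a J (\<Psi> y)"
              using y by (simp add: block_sum_def partial_sum_def b_def sum_distrib_left mult.left_commute)
            then show "ennreal (norm (?f y - (\<Sum>j<J. block_sum lam b j y))) =
                ennreal (norm (of_real (\<phi> (\<Psi> y)) * (f (\<Psi> y) - partial_sum lam a J (\<Psi> y))))"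
              by (simp only: right_diff_distrib)
          qed
          also have "\<dots> \<le> ennreal B * (ennreal C' * ?e J)"
            using fm pm by (intro local_le[of "\<lambda>x. f x - partial_sum lam a J x"]) auto
          finally show ?thesis .
        qed
      qed
      from smooth[THEN spec, THEN spec, THEN spec, THEN mp, THEN mp, THEN mp, THEN mp, OF blocks f_meas conv fin]
      obtain lam' a' where K: "K_atomic_repr d K p W ?f lam' a'"
        "b_qnorm DIM('b) s p q W lam' \<le> ennreal C * b_qnorm DIM('b) s p q \<Gamma> lam"
        by (elim exE conjE)
      have "besov_qnorm d K s p q W ?f \<le> b_qnorm DIM('b) s p q W lam'"
        unfolding besov_qnorm_def by (rule INF_lower2[of "(lam', a')"]) (use K(1) in auto)
      then show "besov_qnorm d K s p q W ?f \<le> ennreal C * b_qnorm DIM('b) s p q \<Gamma> lam"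
        using K(2) by (rule order_trans)
      have "b_qnorm DIM('b) s p q W lam' < \<infinity>"
        using K(2) fin by (auto intro: le_less_trans simp: ennreal_mult_less_top)
      then show "?f \<in> besov_space d K s p q W"
        using f_Lp K(1) unfolding besov_space_def by blast
    qed
  qed
qed

lemma boundary_nbrs_count:
  assumes "0 \<le> d"
  defines "R \<equiv> \<lambda>j m. {k \<in> cube_indices W j. \<exists>x\<in>dcube 1 j m \<inter> \<Gamma> \<inter> V. P x \<in> dcube d j k}"
  shows "\<exists>A::nat. (\<forall>j m. finite (R j m) \<and> card (R j m) \<le> A) \<and>
    (\<forall>j k S. S \<subseteq> int_lattice \<longrightarrow> finite {m\<in>S. k \<in> R j m} \<and> card {m\<in>S. k \<in> R j m} \<le> A)"
proof -
  define n where "n = real DIM('a)"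
  define D where "D = real DIM('b)"
  have nD: "0 \<le> n" "0 \<le> D" by (auto simp: n_def D_def)
  have L0: "0 \<le> L" using L by simp
  define A1 where "A1 = (2 * (d + L * (n * 2)) + 1) ^ DIM('b)"
  define A2 where "A2 = (2 * (1 + L * (D * (2 * d))) + 1) ^ DIM('a)"
  have 1: "finite (R j m)" "real (card (R j m)) \<le> A1" for j m
  proof -
    have "finite (R j m) \<and> real (card (R j m)) \<le> A1"
    proof (cases "dcube 1 j m \<inter> \<Gamma> \<inter> V = {}")
      case False
      then obtain x0 where x0: "x0 \<in> dcube 1 j m" by auto
      have near: "\<exists>u\<in>dcube d j k. dist u (P x0) \<le> L * (n * 2) / 2 ^ j" if k: "k \<in> R j m" for k
      proof -
        obtain x where x: "x \<in> dcube 1 j m" "P x \<in> dcube d j k" using k by (auto simp: R_def)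
        have "dist (P x) (P x0) \<le> L * dist x x0" by (rule P_lip)
        also have "\<dots> \<le> L * (n * (2 * 1 / 2 ^ j))"
          using dist_dcube_le[OF x(1) x0] L0 by (intro mult_left_mono) (auto simp: n_def)
        finally show ?thesis using x(2) by auto
      qed
      have sub: "R j m \<subseteq> int_lattice" by (auto simp: R_def cube_indices_def)
      have nn: "0 \<le> L * (n * 2) / 2 ^ j" using L0 nD by simp
      show ?thesis using lattice_near_count[OF assms(1) nn sub near] by (simp add: A1_def)
    next
      case True
      then have "R j m = {}" by (auto simp: R_def)
      moreover have "0 \<le> A1" unfolding A1_def using L0 nD assms(1) by (intro zero_le_power) simp
      ultimately show ?thesis by simp
    qed
    then show "finite (R j m)" "real (card (R j m)) \<le> A1" by auto
  qed
  have 2: "finite {m\<in>S. k \<in> R j m} \<and> real (card {m\<in>S. k \<in> R j m}) \<le> A2" if S: "S \<subseteq> int_lattice" for j k S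
  proof (cases "{m\<in>S. k \<in> R j m} = {}")
    case False
    then obtain x0 where x0: "x0 \<in> \<Gamma>" "x0 \<in> V" "P x0 \<in> dcube d j k" by (auto simp: R_def)
    have near: "\<exists>x\<in>dcube 1 j m. dist x x0 \<le> L * (D * (2 * d)) / 2 ^ j" if m: "m \<in> {m\<in>S. k \<in> R j m}" for m
    proof -
      obtain x where x: "x \<in> dcube 1 j m" "x \<in> \<Gamma>" "x \<in> V" "P x \<in> dcube d j k" using m by (auto simp: R_def)
      have "dist x x0 = dist (\<Psi> (P x)) (\<Psi> (P x0))" using \<Psi>_P x x0 by simp
      also have "\<dots> \<le> L * dist (P x) (P x0)" by (rule \<Psi>_lip)
      also have "\<dots> \<le> L * (D * (2 * d / 2 ^ j))"
        using dist_dcube_le[OF x(4) x0(3)] L0 by (intro mult_left_mono) (auto simp: D_def)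
      finally show ?thesis using x(1) by auto
    qed
    have sub: "{m\<in>S. k \<in> R j m} \<subseteq> int_lattice" using S by auto
    have nn: "0 \<le> L * (D * (2 * d)) / 2 ^ j" using L0 nD assms(1) by simp
    show ?thesis using lattice_near_count[OF _ nn sub near] by (simp add: A2_def)
  next
    case True
    have "0 \<le> A2" unfolding A2_def using L0 nD assms(1) by (intro zero_le_power) simp
    then show ?thesis unfolding True by simp
  qed
  have le: "x \<le> nat \<lceil>max A1 A2\<rceil>" if "real x \<le> A1 \<or> real x \<le> A2" for x using that by linarith
  show ?thesis
  proof (intro exI[of _ "nat \<lceil>max A1 A2\<rceil>"] conjI allI impI)
    show "card (R j m) \<le> nat \<lceil>max A1 A2\<rceil>" for j m using le 1(2) by blast
    show "card {m\<in>S. k \<in> R j m} \<le> nat \<lceil>max A1 A2\<rceil>" if "S \<subseteq> int_lattice" for j k S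
      using le 2[OF that] by blast
  qed (use 1 2 in auto)
qed

text \<open>A smooth atom composed with the chart is Lipschitz, but its support need not lie in the dilate of
  a single cube of the ambient lattice. A partition of unity on that lattice cuts it into boundedly
  many pieces that do, and all pieces at one cube are collected into one atom.\<close>

theorem Lip_atoms_of_smooth_atoms:
  fixes K :: nat and d d' s :: real and \<zeta> :: "'a \<Rightarrow> real"
  assumes "0 < p" "0 < q" "s < 1" "1 \<le> d" "1 \<le> K" "1 \<le> d'"
    and \<zeta>_bd: "\<And>x. \<bar>\<zeta> x\<bar> \<le> 1" and \<zeta>_lip: "\<And>x y. \<bar>\<zeta> x - \<zeta> y\<bar> \<le> B * dist x y"
    and \<zeta>_supp: "\<And>x. \<zeta> x \<noteq> 0 \<Longrightarrow> x \<in> V"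
  shows "\<exists>C>0. \<forall>F G lam a. F \<in> borel_measurable \<sigma> \<longrightarrow> G \<in> borel_measurable (lebesgue_on W) \<longrightarrow>
    (\<forall>x\<in>\<Gamma>. F x = of_real (\<zeta> x) * G (P x)) \<longrightarrow> K_atomic_repr d K p W G lam a \<longrightarrow>
    Lip_atomic_qnorm d' s p q \<Gamma> F \<le> ennreal C * b_qnorm DIM('b) s p q W lam"
proof -
  have L0: "0 \<le> L" using L by simp
  have B0: "0 \<le> B"
  proof -
    obtain b :: 'a where "b \<in> Basis" using nonempty_Basis by blast
    then have "0 \<le> B * 1" using \<zeta>_lip[of 0 b] abs_ge_zero[of "\<zeta> 0 - \<zeta> b"] by simp
    then show ?thesis by simp
  qed
  from smooth_dyadic_partition[of 1, where 'a='a] obtain \<eta> :: "nat \<Rightarrow> 'a \<Rightarrow> 'a \<Rightarrow> complex" and A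
    where A: "0 < A" and \<eta>: "\<forall>l k. smooth_bd 1 (2 ^ l) A (\<eta> l k)"
    "\<forall>l k x. \<eta> l k x \<noteq> 0 \<longrightarrow> x \<in> dcube 1 l k"
    "\<forall>l x S. finite S \<longrightarrow> S \<subseteq> int_lattice \<longrightarrow> {k \<in> int_lattice. x \<in> dcube 1 l k} \<subseteq> S \<longrightarrow>
      (\<Sum>k\<in>S. \<eta> l k x) = 1"
    by (elim exE conjE)
  note \<eta>_bd = \<eta>(1)[rule_format] and \<eta>_supp = \<eta>(2)[rule_format] and \<eta>_sum = \<eta>(3)[rule_format]
  define R where "R = (\<lambda>j m. {k \<in> cube_indices W j. \<exists>x\<in>dcube 1 j m \<inter> \<Gamma> \<inter> V. P x \<in> dcube d j k})"
  have "\<exists>A::nat. (\<forall>j m. finite (R j m) \<and> card (R j m) \<le> A) \<and>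
    (\<forall>j k S. S \<subseteq> int_lattice \<longrightarrow> finite {m\<in>S. k \<in> R j m} \<and> card {m\<in>S. k \<in> R j m} \<le> A)"
    unfolding R_def using assms(4) by (intro boundary_nbrs_count) simp
  then obtain A1 :: nat where count: "\<forall>j m. finite (R j m) \<and> card (R j m) \<le> A1"
    "\<forall>j k S. S \<subseteq> int_lattice \<longrightarrow> finite {m\<in>S. k \<in> R j m} \<and> card {m\<in>S. k \<in> R j m} \<le> A1"
    by (elim exE conjE)
  define C1 where "C1 = A * (1 + real DIM('a) + B + real DIM('b) * L)"
  have C1: "0 < C1" "A \<le> C1"
    using A B0 L0 by (auto simp: C1_def intro!: mult_pos_pos add_pos_nonneg add_nonneg_nonneg)
  from sequence_norm_refinement[OF assms(1,2,3) less_imp_le[OF C1(1)], where 'b='b and 'c='a and D="DIM('b)" and A=A1]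
  obtain C2 :: real where C2: "0 < C2" and seq: "\<forall>(I :: nat \<Rightarrow> 'b set) (J :: nat \<Rightarrow> 'a set)
      (R :: nat \<Rightarrow> nat \<Rightarrow> 'a \<Rightarrow> 'b set) (lam :: nat \<Rightarrow> 'b \<Rightarrow> ennreal) (c :: nat \<Rightarrow> 'a \<Rightarrow> ennreal).
    (\<forall>j. countable (I j)) \<longrightarrow>
    (\<forall>j l k. k \<in> J l \<longrightarrow> finite (R j l k) \<and> card (R j l k) \<le> A1 \<and> R j l k \<subseteq> I j) \<longrightarrow>
    (\<forall>j l m. j \<le> l \<longrightarrow> m \<in> I j \<longrightarrow> finite {k\<in>J l. m \<in> R j l k} \<and>
       real (card {k\<in>J l. m \<in> R j l k}) \<le> real A1 * 2 ^ ((l - j) * DIM('b))) \<longrightarrow>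
    (\<forall>l k. k \<in> J l \<longrightarrow>
       c l k \<le> ennreal C1 * (\<Sum>j\<le>l. ennreal (2 powr - real (l - j)) * (\<Sum>m\<in>R j l k. lam j m))) \<longrightarrow>
    Lp_qnorm (count_space UNIV) q (\<lambda>l. ennreal (2 powr (real l * (s - real DIM('b) * enn2real (inverse p)))) *
        Lp_qnorm (count_space (J l)) p (c l)) \<le>
    ennreal C2 * Lp_qnorm (count_space UNIV) q
      (\<lambda>j. ennreal (2 powr (real j * (s - real DIM('b) * enn2real (inverse p)))) *
        Lp_qnorm (count_space (I j)) p (lam j))"
    by (elim exE conjE)
  show ?thesis
  proof (rule Lp_transfer[OF assms(1)])
    fix C' :: real
    assume C': "0 < C'" and \<Psi>m: "\<Psi> \<in> measurable (lebesgue_on W) \<sigma>"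
      and tr: "\<And>f. f \<in> borel_measurable \<sigma> \<Longrightarrow> (\<And>x. x \<in> \<Gamma> \<Longrightarrow> x \<notin> V \<Longrightarrow> f x = 0) \<Longrightarrow>
        Lp_qnorm \<sigma> p f \<le> ennreal C' * Lp_qnorm (lebesgue_on W) p (\<lambda>y. f (\<Psi> y))"
    show ?thesis
    proof (intro exI[of _ C2] conjI allI impI, rule C2)
      fix F :: "'a \<Rightarrow> complex" and G :: "'b \<Rightarrow> complex" and lam a
      assume Fm: "F \<in> borel_measurable \<sigma>" and Gm: "G \<in> borel_measurable (lebesgue_on W)"
        and FG: "\<forall>x\<in>\<Gamma>. F x = of_real (\<zeta> x) * G (P x)" and rep: "K_atomic_repr d K p W G lam a"
      have atom: "K_atom d K j k (a j k)" if "k \<in> cube_indices W j" for j k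
        using rep that by (simp add: K_atomic_repr_def)
      define t where "t j m k x = \<eta> j m x * (of_real (\<zeta> x) * a j k (P x))" for j m k x
      have t_bd: "norm (t j m k x) \<le> A" if k: "k \<in> cube_indices W j" for j m k x
      proof -
        have "norm (of_real (\<zeta> x) * a j k (P x)) \<le> 1 * 1"
          unfolding norm_mult norm_of_real using \<zeta>_bd K_atom_bounds(1)[OF atom[OF k]] by (intro mult_mono) auto
        then have "norm (\<eta> j m x * (of_real (\<zeta> x) * a j k (P x))) \<le> A * 1"
          unfolding norm_mult[of "\<eta> j m x"] using smooth_bd_bound[OF \<eta>_bd] A by (intro mult_mono) auto
        then show ?thesis by (simp add: t_def)
      qed
      have t_lip: "norm (t j m k x - t j m k y) \<le> C1 * 2 ^ j * dist x y" if k: "k \<in> cube_indices W j" for j m k x y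
      proof -
        note aj = K_atom_bounds(1)[OF atom[OF k]]
        have 1: "norm (\<eta> j m x - \<eta> j m y) \<le> 2 ^ j * A * real DIM('a) * dist x y"
          by (rule smooth_bd_lipschitz[OF \<eta>_bd]) simp
        have 2: "norm (a j k (P x) - a j k (P y)) \<le> 2 ^ j * real DIM('b) * (L * dist x y)"
          using K_atom_lipschitz[OF atom[OF k] assms(5), of "P x" "P y"] P_lip[of x y]
          by (meson mult_left_mono mult_nonneg_nonneg of_nat_0_le_iff order_trans zero_le_numeral zero_le_power)
        have "t j m k x - t j m k y = (\<eta> j m x - \<eta> j m y) * (of_real (\<zeta> x) * a j k (P x)) +
            (\<eta> j m y * (of_real (\<zeta> x - \<zeta> y) * a j k (P x)) +
             \<eta> j m y * (of_real (\<zeta> y) * (a j k (P x) - a j k (P y))))"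
          by (simp add: t_def algebra_simps)
        also have "norm \<dots> \<le> (2 ^ j * A * real DIM('a) * dist x y) * (1 * 1) +
            (A * ((B * dist x y) * 1) + A * (1 * (2 ^ j * real DIM('b) * (L * dist x y))))"
          unfolding norm_mult norm_of_real
          by (intro norm_triangle_mono)
            (unfold norm_mult norm_of_real, intro mult_mono 1 2 \<zeta>_bd \<zeta>_lip aj smooth_bd_bound[OF \<eta>_bd]
              mult_nonneg_nonneg norm_ge_zero abs_ge_zero; use A B0 L0 in simp)+
        also have "\<dots> = A * (2 ^ j * real DIM('a) + B + 2 ^ j * (real DIM('b) * L)) * dist x y"
          by (simp add: algebra_simps)
        also have "\<dots> \<le> A * ((1 + real DIM('a) + B + real DIM('b) * L) * 2 ^ j) * dist x y"
        proof -
          have "B * 1 \<le> B * 2 ^ j" using B0 by (intro mult_left_mono) auto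
          then have "2 ^ j * real DIM('a) + B + 2 ^ j * (real DIM('b) * L) \<le>
              (1 + real DIM('a) + B + real DIM('b) * L) * 2 ^ j"
          proof -
            have "(1 + n + B + x) * T = T + T * n + B * T + T * x" for n x T :: real
              by (simp add: algebra_simps)
            moreover have "B \<le> 2 ^ j + B * 2 ^ j"
              using \<open>B * 1 \<le> B * 2 ^ j\<close> zero_le_power[of "2::real" j] by linarith
            ultimately show ?thesis by simp
          qed
          then show ?thesis using A by (intro mult_right_mono mult_left_mono) auto
        qed
        finally show ?thesis by (simp add: C1_def mult.assoc)
      qed
      define S where "S j m x = (\<Sum>k\<in>R j m. lam j k * t j m k x)" for j m x
      define \<gamma> where "\<gamma> j m = (\<Sum>k\<in>R j m. norm (lam j k))" for j m
      have \<gamma>0: "0 \<le> \<gamma> j m" for j m by (simp add: \<gamma>_def sum_nonneg)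
      have RW: "k \<in> cube_indices W j" if "k \<in> R j m" for j m k using that by (simp add: R_def)
      have S_bd: "norm (S j m x) \<le> C1 * \<gamma> j m" for j m x
      proof -
        have "norm (S j m x) \<le> (\<Sum>k\<in>R j m. norm (lam j k) * C1)"
          unfolding S_def using order_trans[OF t_bd C1(2)] RW
          by (intro sum_norm_le) (auto simp: norm_mult intro!: mult_left_mono)
        then show ?thesis by (simp add: \<gamma>_def sum_distrib_left mult.commute)
      qed
      have S_lip: "norm (S j m x - S j m y) \<le> C1 * \<gamma> j m * (2 ^ j * dist x y)" for j m x y
      proof -
        have "S j m x - S j m y = (\<Sum>k\<in>R j m. lam j k * (t j m k x - t j m k y))"
          by (simp add: S_def right_diff_distrib sum_subtractf)
        also have "norm \<dots> \<le> (\<Sum>k\<in>R j m. norm (lam j k) * (C1 * 2 ^ j * dist x y))"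
          using t_lip RW by (intro sum_norm_le) (auto simp: norm_mult intro!: mult_left_mono)
        also have "\<dots> = C1 * \<gamma> j m * (2 ^ j * dist x y)"
          unfolding \<gamma>_def sum_distrib_right[symmetric] by simp
        finally show ?thesis .
      qed
      define lam' where "lam' j m = complex_of_real (C1 * \<gamma> j m)" for j m
      define a' where "a' j m x = of_real (1 / (C1 * \<gamma> j m)) * S j m x" for j m x
      have recover: "lam' j m * a' j m x = S j m x" for j m x
        using C1(1) S_bd[of j m x] by (cases "\<gamma> j m = 0") (simp_all add: lam'_def a'_def)
      have ratio: "norm (of_real (1 / (C1 * \<gamma> j m)) * z) \<le> r" if "norm z \<le> C1 * \<gamma> j m * r" "0 \<le> r"
        for j m r and z :: complex
      proof (cases "\<gamma> j m = 0")
        case False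
        then have pos: "0 < C1 * \<gamma> j m" using \<gamma>0[of j m] C1 by simp
        have "norm (of_real (1 / (C1 * \<gamma> j m)) * z) = norm z / (C1 * \<gamma> j m)"
          using pos unfolding norm_mult norm_of_real by simp
        then show ?thesis using that(1) pos by (simp add: pos_divide_le_eq mult.commute)
      qed (use that in simp)
      have Lip: "Lip_atom d' j m \<Gamma> (a' j m)" for j m
      proof (rule Lip_atomI)
        have "S j m x = 0" if "x \<notin> dcube 1 j m" for x
          using \<eta>_supp[of j m x] that by (auto simp: S_def t_def intro!: sum.neutral)
        then have "{x \<in> \<Gamma>. a' j m x \<noteq> 0} \<subseteq> dcube 1 j m" by (auto simp: a'_def)
        also have "\<dots> \<subseteq> dcube d' j m" using assms(6) by (rule dcube_mono)
        finally show "{x \<in> \<Gamma>. a' j m x \<noteq> 0} \<subseteq> dcube d' j m" .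
        show "norm (a' j m x) \<le> 1" for x unfolding a'_def using S_bd by (intro ratio) auto
        show "norm (a' j m x - a' j m y) \<le> 2 ^ j * dist x y" for x y
          unfolding a'_def right_diff_distrib[symmetric] using S_lip by (intro ratio) auto
      qed
      have level: "(\<Sum>m\<in>cube_indices \<Gamma> j. S j m x) =
          of_real (\<zeta> x) * (\<Sum>k\<in>cube_indices W j. lam j k * a j k (P x))" if x: "x \<in> \<Gamma>" for j x
      proof (cases "\<zeta> x = 0")
        case True
        then show ?thesis by (simp add: S_def t_def)
      next
        case False
        then have V: "x \<in> V" by (rule \<zeta>_supp)
        have "S j m x = \<eta> j m x * (of_real (\<zeta> x) * (\<Sum>k\<in>cube_indices W j. lam j k * a j k (P x)))" for m
        proof (cases "\<eta> j m x = 0")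
          case False
          then have xm: "x \<in> dcube 1 j m" by (rule \<eta>_supp)
          have "(\<Sum>k\<in>R j m. lam j k * a j k (P x)) = (\<Sum>k\<in>cube_indices W j. lam j k * a j k (P x))"
          proof (intro sum.mono_neutral_left finite_indices_W ballI)
            show "R j m \<subseteq> cube_indices W j" by (auto simp: R_def)
            fix k assume k: "k \<in> cube_indices W j - R j m"
            then have "P x \<notin> dcube d j k" using x V xm by (auto simp: R_def)
            then have "a j k (P x) = 0" using K_atom_bounds(2)[OF atom] k by blast
            then show "lam j k * a j k (P x) = 0" by simp
          qed
          then show ?thesis
            by (simp add: S_def t_def sum_distrib_left[symmetric] mult.left_commute[of "lam j _"])
        qed (simp add: S_def t_def)
        then have "(\<Sum>m\<in>cube_indices \<Gamma> j. S j m x) = (\<Sum>m\<in>cube_indices \<Gamma> j. \<eta> j m x) *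
            (of_real (\<zeta> x) * (\<Sum>k\<in>cube_indices W j. lam j k * a j k (P x)))"
          by (simp add: sum_distrib_right)
        also have "(\<Sum>m\<in>cube_indices \<Gamma> j. \<eta> j m x) = 1"
          using x by (intro \<eta>_sum finite_indices) (auto simp: cube_indices_def)
        finally show ?thesis by simp
      qed
      define Q where "Q J y = (\<Sum>j<J. \<Sum>k\<in>cube_indices W j. lam j k * a j k y)" for J y
      have Qm: "Q J \<in> borel_measurable (lebesgue_on W)" for J
      proof -
        have "a j k \<in> borel_measurable (lebesgue_on W)" if "k \<in> cube_indices W j" for j k
          using K_atom_bounds(3)[OF atom[OF that]] open_W
          by (intro continuous_imp_measurable_on_sets_lebesgue) auto
        then show ?thesis
          unfolding Q_def by (intro borel_measurable_sum borel_measurable_times borel_measurable_const) auto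
      qed
      have ps: "partial_sum lam' a' J x = of_real (\<zeta> x) * Q J (P x)" if "x \<in> \<Gamma>" for J x
        using level[OF that] by (simp add: partial_sum_def recover Q_def sum_distrib_left)
      have "Lip_atomic_repr d' p \<Gamma> F lam' a'"
        unfolding Lip_atomic_repr_def atomic_series_iff
      proof (intro conjI allI ballI Lip, rule ennreal_tendsto_0_le)
        let ?e = "\<lambda>J. Lp_qnorm (lebesgue_on W) p (\<lambda>y. ennreal (norm (G y - Q J y)))"
        have "?e \<longlonglongrightarrow> 0"
          using rep finite_indices_W unfolding K_atomic_repr_def atomic_series_Lp_def Q_def by simp
        then have "(\<lambda>J. ennreal C' * ?e J) \<longlonglongrightarrow> ennreal C' * 0" by (intro ennreal_tendsto_cmult) auto
        then show "(\<lambda>J. ennreal C' * ?e J) \<longlonglongrightarrow> 0" by simp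
        fix J
        let ?E = "\<lambda>x. ennreal (norm (F x - partial_sum lam' a' J x))"
        have Em: "?E \<in> borel_measurable \<sigma>"
          using Fm partial_sum_measurable[of d' a' lam' J] Lip by simp
        have E: "?E x = ennreal (\<bar>\<zeta> x\<bar> * norm (G (P x) - Q J (P x)))" if "x \<in> \<Gamma>" for x
          using FG that ps[OF that] by (simp add: right_diff_distrib[symmetric] norm_mult)
        have "Lp_qnorm \<sigma> p ?E \<le> ennreal C' * Lp_qnorm (lebesgue_on W) p (\<lambda>y. ?E (\<Psi> y))"
        proof (rule tr[OF Em])
          fix x assume "x \<in> \<Gamma>" "x \<notin> V"
          then have "\<zeta> x = 0" using \<zeta>_supp by blast
          then show "?E x = 0" using E[OF \<open>x \<in> \<Gamma>\<close>] by simp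
        qed
        also have "\<dots> \<le> ennreal C' * ?e J"
        proof (rule mult_left_mono[OF Lp_qnorm_mono[OF assms(1)]])
          show "(\<lambda>y. ?E (\<Psi> y)) \<in> borel_measurable (lebesgue_on W)"
            by (rule measurable_compose[OF \<Psi>m Em])
          show "(\<lambda>y. ennreal (norm (G y - Q J y))) \<in> borel_measurable (lebesgue_on W)"
            using Gm Qm[of J] by measurable
          fix y assume "y \<in> space (lebesgue_on W)"
          then have "\<Psi> y \<in> \<Gamma>" using W_iff by simp
          then have "?E (\<Psi> y) = ennreal (\<bar>\<zeta> (\<Psi> y)\<bar> * norm (G y - Q J y))" by (simp add: E P_\<Psi>)
          also have "\<dots> \<le> ennreal (1 * norm (G y - Q J y))"
            using \<zeta>_bd by (intro ennreal_leI mult_right_mono) auto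
          finally show "?E (\<Psi> y) \<le> ennreal (norm (G y - Q J y))" by simp
        qed simp
        finally show "Lp_qnorm \<sigma> p ?E \<le> ennreal C' * ?e J" .
      qed
      then have "Lip_atomic_qnorm d' s p q \<Gamma> F \<le> b_qnorm_bd s p q \<Gamma> lam'"
        by (rule Lip_atomic_qnorm_le)
      also have "\<dots> = b_qnorm DIM('b) s p q \<Gamma> lam'" unfolding b_qnorm_bd_def dim ..
      also have "\<dots> \<le> ennreal C2 * b_qnorm DIM('b) s p q W lam"
        unfolding b_qnorm_def
      proof (rule seq[rule_format, where R="\<lambda>j l m. if j = l then R j m else {}"])
        fix j l :: nat and k
        assume "j \<le> l"
        have lat: "cube_indices \<Gamma> l \<subseteq> int_lattice" by (auto simp: cube_indices_def)
        have "finite {m \<in> cube_indices \<Gamma> l. k \<in> (if j = l then R j m else {})} \<and>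
            card {m \<in> cube_indices \<Gamma> l. k \<in> (if j = l then R j m else {})} \<le> A1"
          using count(2)[rule_format, OF lat, of k j] by (cases "j = l") auto
        moreover have "real A1 * 1 \<le> real A1 * 2 ^ ((l - j) * DIM('b))"
          by (intro mult_left_mono) auto
        ultimately show "finite {m \<in> cube_indices \<Gamma> l. k \<in> (if j = l then R j m else {})} \<and>
            real (card {m \<in> cube_indices \<Gamma> l. k \<in> (if j = l then R j m else {})}) \<le>
              real A1 * 2 ^ ((l - j) * DIM('b))"
          by linarith
      next
        fix l m
        have "ennreal (norm (lam' l m)) = ennreal (C1 * \<gamma> l m)"
          using C1(1) \<gamma>0[of l m] by (simp add: lam'_def norm_mult)
        also have "\<dots> = ennreal C1 * (ennreal (2 powr - real (l - l)) *
            (\<Sum>k\<in>(if l = l then R l m else {}). ennreal (norm (lam l k))))"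
          using C1(1) by (simp add: \<gamma>_def ennreal_mult sum_nonneg)
        also have "\<dots> \<le> ennreal C1 * (\<Sum>j\<le>l. ennreal (2 powr - real (l - j)) *
            (\<Sum>k\<in>(if j = l then R j m else {}). ennreal (norm (lam j k))))"
          using member_le_sum[of l "{..l}" "\<lambda>j. ennreal (2 powr - real (l - j)) *
            (\<Sum>k\<in>(if j = l then R j m else {}). ennreal (norm (lam j k)))"]
          by (intro mult_left_mono) auto
        finally show "ennreal (norm (lam' l m)) \<le> ennreal C1 * (\<Sum>j\<le>l. ennreal (2 powr - real (l - j)) *
            (\<Sum>k\<in>(if j = l then R j m else {}). ennreal (norm (lam j k))))" .
      qed (use count(1) RW countable_cube_indices in auto)
      finally show "Lip_atomic_qnorm d' s p q \<Gamma> F \<le> ennreal C2 * b_qnorm DIM('b) s p q W lam" .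
    qed
  qed
qed

end

section \<open>Cutoff functions\<close>

lemma C_class_bounded_support_lipschitz:
  fixes \<phi> :: "'a::euclidean_space \<Rightarrow> real"
  assumes "C_class 1 \<phi>" "bounded {x. \<phi> x \<noteq> 0}"
  obtains B where "\<And>x. \<bar>\<phi> x\<bar> \<le> B" "\<And>x y. \<bar>\<phi> x - \<phi> y\<bar> \<le> B * dist x y"
proof -
  define S where "S = closure {x. \<phi> x \<noteq> 0}"
  have S: "compact S" using assms(2) by (simp add: S_def compact_closure)
  have zero: "\<phi> x = 0" if "x \<notin> S" for x using that closure_subset[of "{x. \<phi> x \<noteq> 0}"] by (auto simp: S_def)
  have cont: "continuous_on UNIV (iter_partial bs \<phi>)" if "set bs \<subseteq> Basis" "length bs \<le> 1" for bs
    using assms(1) that unfolding C_class_def by blast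
  have deriv: "((\<lambda>t. \<phi> (x + t *\<^sub>R b)) has_vector_derivative iter_partial [b] \<phi> x) (at 0)"
    if "b \<in> Basis" for x b
  proof -
    have "(\<lambda>t. iter_partial [] \<phi> (x + t *\<^sub>R b)) differentiable (at 0)"
      using assms(1) that unfolding C_class_def
      by (metis empty_subsetI le_numeral_extra(4) less_one list.set(1) list.size(3) zero_le)
    then show ?thesis by (simp add: vector_derivative_works)
  qed
  have bdd: "\<exists>M. \<forall>x. \<bar>g x\<bar> \<le> M" if g: "continuous_on UNIV g" and out: "\<And>x. x \<notin> S \<Longrightarrow> g x = 0"
    for g :: "'a \<Rightarrow> real"
  proof -
    have "compact (g ` S)" using continuous_on_subset[OF g] S by (intro compact_continuous_image) auto
    from compact_imp_bounded[OF this] obtain M where "\<And>x. x \<in> S \<Longrightarrow> \<bar>g x\<bar> \<le> M"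
      unfolding bounded_iff by (metis image_eqI real_norm_def)
    then have "\<bar>g x\<bar> \<le> max M 0" for x using out[of x] by (cases "x \<in> S") (auto simp: le_max_iff_disj)
    then show ?thesis by blast
  qed
  have "\<exists>M. \<forall>x. \<bar>iter_partial [b] \<phi> x\<bar> \<le> M" if b: "b \<in> Basis" for b
  proof (rule bdd)
    show "continuous_on UNIV (iter_partial [b] \<phi>)" using b by (intro cont) auto
    fix x assume "x \<notin> S"
    moreover have "open (- S)" using S by (simp add: compact_imp_closed open_Compl)
    ultimately obtain e where e: "0 < e" "ball x e \<subseteq> - S" using open_contains_ball by blast
    have "((\<lambda>t. 0::real) has_vector_derivative iter_partial [b] \<phi> x) (at 0)"
    proof (rule has_vector_derivative_transform_within[OF deriv[OF b] e(1)])
      fix t :: real assume t: "dist t 0 < e"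
      then have "x + t *\<^sub>R b \<in> ball x e" using b by (simp add: dist_norm)
      then show "\<phi> (x + t *\<^sub>R b) = 0" using e(2) zero by blast
    qed simp
    then show "iter_partial [b] \<phi> x = 0"
      using vector_derivative_unique_at has_vector_derivative_const by blast
  qed
  then obtain M where M: "\<And>b x. b \<in> Basis \<Longrightarrow> \<bar>iter_partial [b] \<phi> x\<bar> \<le> M b" by metis
  define M' where "M' = (\<Sum>b\<in>(Basis :: 'a set). \<bar>M b\<bar>)"
  have lip: "norm (\<phi> x - \<phi> y) \<le> M' * real DIM('a) * dist x y" for x y
  proof (rule lipschitz_of_bounded_partials)
    fix x b :: 'a assume b: "b \<in> Basis"
    have "\<bar>M b\<bar> \<le> M'" unfolding M'_def using b by (intro member_le_sum) auto
    then have "norm (iter_partial [b] \<phi> x) \<le> M'" using M[OF b, of x] by simp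
    then show "\<exists>v. ((\<lambda>t. \<phi> (x + t *\<^sub>R b)) has_vector_derivative v) (at 0) \<and> norm v \<le> M'"
      using deriv[OF b] by blast
  qed
  obtain M0 where M0: "\<And>x. \<bar>\<phi> x\<bar> \<le> M0" using bdd[OF cont[of "[]"]] zero by auto
  show ?thesis
  proof (rule that[of "max M0 (M' * real DIM('a))"])
    show "\<bar>\<phi> x\<bar> \<le> max M0 (M' * real DIM('a))" for x using M0[of x] by simp
    show "\<bar>\<phi> x - \<phi> y\<bar> \<le> max M0 (M' * real DIM('a)) * dist x y" for x y
      using lip[of x y] mult_right_mono[of "M' * real DIM('a)" "max M0 (M' * real DIM('a))" "dist x y"]
      by simp
  qed
qed

lemma lipschitz_cutoff:
  fixes Q V :: "'a::euclidean_space set"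
  assumes "compact Q" "open V" "bounded V" "Q \<subseteq> V"
  obtains \<zeta> :: "'a \<Rightarrow> real" and B where "\<And>x. \<bar>\<zeta> x\<bar> \<le> 1" "\<And>x y. \<bar>\<zeta> x - \<zeta> y\<bar> \<le> B * dist x y"
    "\<And>x. \<zeta> x \<noteq> 0 \<Longrightarrow> x \<in> V" "\<And>x. x \<in> Q \<Longrightarrow> \<zeta> x = 1"
proof -
  have ne: "- V \<noteq> {}" using assms(3) not_bounded_UNIV by (metis Compl_empty_eq double_compl)
  obtain e where e: "0 < e" "(\<Union>x\<in>Q. ball x e) \<subseteq> V"
    using compact_subset_open_imp_ball_epsilon_subset[OF assms(1,2,4)] by blast
  define \<zeta> where "\<zeta> x = min 1 (infdist x (- V) / e)" for x
  have far: "e \<le> infdist x (- V)" if "x \<in> Q" for x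
    unfolding infdist_notempty[OF ne]
  proof (rule cINF_greatest[OF ne])
    show "e \<le> dist x y" if "y \<in> - V" for y using \<open>x \<in> Q\<close> e(2) that by (force simp: not_less[symmetric])
  qed
  show ?thesis
  proof (rule that[of \<zeta> "1 / e"])
    show "\<bar>\<zeta> x\<bar> \<le> 1" for x
      using e(1) infdist_nonneg[of x "- V"] by (auto simp: \<zeta>_def min_def abs_le_iff intro: order_trans[of _ 0])
    show "\<bar>\<zeta> x - \<zeta> y\<bar> \<le> 1 / e * dist x y" for x y
    proof -
      have "\<bar>min 1 s - min 1 t\<bar> \<le> \<bar>s - t\<bar>" for s t :: real by (auto simp: min_def)
      then have "\<bar>\<zeta> x - \<zeta> y\<bar> \<le> \<bar>infdist x (- V) / e - infdist y (- V) / e\<bar>" by (simp add: \<zeta>_def)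
      also have "\<dots> = \<bar>infdist x (- V) - infdist y (- V)\<bar> / e"
        using e(1) by (simp add: diff_divide_distrib[symmetric])
      also have "\<dots> \<le> dist x y / e"
        using e(1) infdist_triangle_abs by (intro divide_right_mono) auto
      finally show ?thesis by simp
    qed
    show "x \<in> V" if "\<zeta> x \<noteq> 0" for x
    proof (rule ccontr)
      assume "x \<notin> V"
      then have "infdist x (- V) = 0" by simp
      then show False using that by (simp add: \<zeta>_def)
    qed
    show "\<zeta> x = 1" if "x \<in> Q" for x using far[OF that] e(1) by (simp add: \<zeta>_def min_def)
  qed
qed

section \<open>Quasi-norms of localised functions\<close>

context lipschitz_chart
begin

text \<open>Read on the boundary, the smooth atoms of the local piece may leave \<open>V\<close>, where the chart says
  nothing. A Lipschitz cutoff function that equals 1 on the support of \<open>\<phi>\<close> removes these parts without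
  changing the sum.\<close>

lemma Lip_atomic_qnorm_localised_le:
  fixes K :: nat and d d' s :: real and \<phi> :: "'a \<Rightarrow> real"
  assumes "0 < p" "0 < q" "s < 1" "1 \<le> d" "1 \<le> K" "1 \<le> d'" "bounded V"
    and \<phi>_bd: "\<And>x. \<bar>\<phi> x\<bar> \<le> B" and \<phi>_lip: "\<And>x y. \<bar>\<phi> x - \<phi> y\<bar> \<le> B * dist x y"
    and supp: "closure {x. \<phi> x \<noteq> 0} \<subseteq> V"
  shows "\<exists>C>0. \<forall>f. f \<in> Lp_space \<sigma> p \<longrightarrow>
    (\<lambda>y. of_real (\<phi> (\<Psi> y)) * f (\<Psi> y)) \<in> besov_space d K s p q W \<longrightarrow>
    Lip_atomic_qnorm d' s p q \<Gamma> (\<lambda>x. of_real (\<phi> x) * f x) \<le>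
      ennreal C * besov_qnorm d K s p q W (\<lambda>y. of_real (\<phi> (\<Psi> y)) * f (\<Psi> y))"
proof (rule lipschitz_cutoff[OF _ open_V assms(7) supp])
  have "bounded {x. \<phi> x \<noteq> 0}"
    using bounded_subset[OF assms(7)] supp closure_subset by blast
  then show "compact (closure {x. \<phi> x \<noteq> 0})" by (simp add: compact_closure)
  fix \<zeta> :: "'a \<Rightarrow> real" and B'
  assume \<zeta>: "\<And>x. \<bar>\<zeta> x\<bar> \<le> 1" "\<And>x y. \<bar>\<zeta> x - \<zeta> y\<bar> \<le> B' * dist x y" "\<And>x. \<zeta> x \<noteq> 0 \<Longrightarrow> x \<in> V"
    and one: "\<And>x. x \<in> closure {x. \<phi> x \<noteq> 0} \<Longrightarrow> \<zeta> x = 1"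
  have "\<exists>C>0. \<forall>F G lam a. F \<in> borel_measurable \<sigma> \<longrightarrow> G \<in> borel_measurable (lebesgue_on W) \<longrightarrow>
    (\<forall>x\<in>\<Gamma>. F x = of_real (\<zeta> x) * G (P x)) \<longrightarrow> K_atomic_repr d K p W G lam a \<longrightarrow>
    Lip_atomic_qnorm d' s p q \<Gamma> F \<le> ennreal C * b_qnorm DIM('b) s p q W lam"
    by (rule Lip_atoms_of_smooth_atoms[OF assms(1-6) \<zeta>(1,2)]) (rule \<zeta>(3))
  then obtain C :: real where C: "0 < C"
    and le: "\<forall>F G lam a. F \<in> borel_measurable \<sigma> \<longrightarrow> G \<in> borel_measurable (lebesgue_on W) \<longrightarrow>
    (\<forall>x\<in>\<Gamma>. F x = of_real (\<zeta> x) * G (P x)) \<longrightarrow> K_atomic_repr d K p W G lam a \<longrightarrow>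
    Lip_atomic_qnorm d' s p q \<Gamma> F \<le> ennreal C * b_qnorm DIM('b) s p q W lam"
    by (elim exE conjE)
  have "0 \<le> B" using \<phi>_bd[of undefined] by linarith
  then have \<phi>m: "\<phi> \<in> borel_measurable \<sigma>"
    by (intro continuous_measurable lipschitz_on_continuous_on[of B] lipschitz_onI)
      (use \<phi>_lip in \<open>auto simp: dist_real_def\<close>)
  show ?thesis
  proof (intro exI[of _ C] conjI allI impI, rule C)
    fix f assume f: "f \<in> Lp_space \<sigma> p"
      and besov: "(\<lambda>y. of_real (\<phi> (\<Psi> y)) * f (\<Psi> y)) \<in> besov_space d K s p q W"
    let ?F = "\<lambda>x. of_real (\<phi> x) * f x" and ?G = "\<lambda>y. of_real (\<phi> (\<Psi> y)) * f (\<Psi> y)"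
    have Fm: "?F \<in> borel_measurable \<sigma>" using f \<phi>m by (auto simp: Lp_space_def)
    have Gm: "?G \<in> borel_measurable (lebesgue_on W)" using besov by (simp add: besov_space_def Lp_space_def)
    have FG: "?F x = of_real (\<zeta> x) * ?G (P x)" if "x \<in> \<Gamma>" for x
    proof (cases "\<phi> x = 0")
      case False
      then have "x \<in> closure {x. \<phi> x \<noteq> 0}" using closure_subset[of "{x. \<phi> x \<noteq> 0}"] by auto
      then show ?thesis using one[of x] supp \<Psi>_P[OF that] by auto
    next
      case True
      show ?thesis
      proof (cases "x \<in> V")
        case False
        then have "\<zeta> x = 0" using \<zeta>(3) by blast
        then show ?thesis using True by simp
      qed (use True \<Psi>_P[OF that] in simp)
    qed
    show "Lip_atomic_qnorm d' s p q \<Gamma> ?F \<le> ennreal C * besov_qnorm d K s p q W ?G"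
      unfolding besov_qnorm_def
    proof (rule le_cmult_INF[OF C])
      fix x assume "x \<in> {(lam, a). K_atomic_repr d K p W ?G lam a}"
      then obtain lam a where x: "x = (lam, a)" "K_atomic_repr d K p W ?G lam a" by blast
      have "Lip_atomic_qnorm d' s p q \<Gamma> ?F \<le> ennreal C * b_qnorm DIM('b) s p q W lam"
        using le[THEN spec, THEN spec, THEN spec, THEN spec, THEN mp, THEN mp, THEN mp, THEN mp, OF Fm Gm _ x(2)]
          FG by blast
      then show "Lip_atomic_qnorm d' s p q \<Gamma> ?F \<le>
          ennreal C * (case x of (lam, a) \<Rightarrow> b_qnorm DIM('b) s p q W lam)"
        by (simp add: x(1))
    qed
  qed
qed

text \<open>The local form of the embedding into \<open>L\<^sub>p\<close>, which makes the quasi-norm definite.\<close>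

lemma Lp_qnorm_localised_le:
  fixes K :: nat and d s :: real and \<phi> :: "'a \<Rightarrow> real"
  assumes "0 < p" "0 < q" "0 < s" "1 \<le> d"
    and \<phi>_bd: "\<And>x. \<bar>\<phi> x\<bar> \<le> B" and \<phi>_lip: "\<And>x y. \<bar>\<phi> x - \<phi> y\<bar> \<le> B * dist x y"
    and supp: "closure {x. \<phi> x \<noteq> 0} \<subseteq> V"
  shows "\<exists>C>0. \<forall>f. f \<in> Lp_space \<sigma> p \<longrightarrow>
    (\<lambda>y. of_real (\<phi> (\<Psi> y)) * f (\<Psi> y)) \<in> besov_space d K s p q W \<longrightarrow>
    Lp_qnorm \<sigma> p (\<lambda>x. ennreal (norm (of_real (\<phi> x) * f x))) \<le>
      ennreal C * besov_qnorm d K s p q W (\<lambda>y. of_real (\<phi> (\<Psi> y)) * f (\<Psi> y))"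
proof (rule Lp_transfer[OF assms(1)])
  fix C1 :: real
  assume C1: "0 < C1" and tr: "\<And>f. f \<in> borel_measurable \<sigma> \<Longrightarrow> (\<And>x. x \<in> \<Gamma> \<Longrightarrow> x \<notin> V \<Longrightarrow> f x = 0) \<Longrightarrow>
    Lp_qnorm \<sigma> p f \<le> ennreal C1 * Lp_qnorm (lebesgue_on W) p (\<lambda>y. f (\<Psi> y))"
  have W: "W \<in> sets lebesgue" using open_W by auto
  from Lp_qnorm_le_b_qnorm[OF assms(1-4) W bounded_W, of K] obtain C2 :: real where C2: "0 < C2"
    and emb: "\<forall>f lam a. f \<in> borel_measurable (lebesgue_on W) \<longrightarrow> K_atomic_repr d K p W f lam a \<longrightarrow>
    Lp_qnorm (lebesgue_on W) p (\<lambda>x. ennreal (norm (f x))) \<le> ennreal C2 * b_qnorm DIM('b) s p q W lam"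
    by (elim exE conjE)
  have "0 \<le> B" using \<phi>_bd[of undefined] by linarith
  then have \<phi>m: "\<phi> \<in> borel_measurable \<sigma>"
    by (intro continuous_measurable lipschitz_on_continuous_on[of B] lipschitz_onI)
      (use \<phi>_lip in \<open>auto simp: dist_real_def\<close>)
  show ?thesis
  proof (intro exI[of _ "C1 * C2"] conjI allI impI)
    show "0 < C1 * C2" using C1 C2 by simp
    fix f assume f: "f \<in> Lp_space \<sigma> p"
      and besov: "(\<lambda>y. of_real (\<phi> (\<Psi> y)) * f (\<Psi> y)) \<in> besov_space d K s p q W"
    let ?G = "\<lambda>y. of_real (\<phi> (\<Psi> y)) * f (\<Psi> y)"
    have Gm: "?G \<in> borel_measurable (lebesgue_on W)" using besov by (simp add: besov_space_def Lp_space_def)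
    have "(\<lambda>x. ennreal (norm (of_real (\<phi> x) * f x))) \<in> borel_measurable \<sigma>"
      using f \<phi>m by (auto simp: Lp_space_def)
    then have "Lp_qnorm \<sigma> p (\<lambda>x. ennreal (norm (of_real (\<phi> x) * f x))) \<le>
        ennreal C1 * Lp_qnorm (lebesgue_on W) p (\<lambda>y. ennreal (norm (?G y)))"
      by (rule tr) (use supp closure_subset[of "{x. \<phi> x \<noteq> 0}"] in auto)
    also have "\<dots> \<le> ennreal C1 * (ennreal C2 * besov_qnorm d K s p q W ?G)"
    proof (rule mult_left_mono)
      show "Lp_qnorm (lebesgue_on W) p (\<lambda>y. ennreal (norm (?G y))) \<le> ennreal C2 * besov_qnorm d K s p q W ?G"
        unfolding besov_qnorm_def
      proof (rule le_cmult_INF[OF C2])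
        fix x assume "x \<in> {(lam, a). K_atomic_repr d K p W ?G lam a}"
        then obtain lam a where x: "x = (lam, a)" "K_atomic_repr d K p W ?G lam a" by blast
        show "Lp_qnorm (lebesgue_on W) p (\<lambda>y. ennreal (norm (?G y))) \<le>
            ennreal C2 * (case x of (lam, a) \<Rightarrow> b_qnorm DIM('b) s p q W lam)"
          using emb[THEN spec, THEN spec, THEN spec, THEN mp, THEN mp, OF Gm x(2)] by (simp add: x(1))
      qed
    qed simp
    finally show "Lp_qnorm \<sigma> p (\<lambda>x. ennreal (norm (of_real (\<phi> x) * f x))) \<le>
        ennreal (C1 * C2) * besov_qnorm d K s p q W ?G"
      using C1 C2 by (simp add: ennreal_mult mult.assoc)
  qed
qed

end

section \<open>Atomic characterisation of Besov spaces on the boundary\<close>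

lemma sum_ennreal_mult_le:
  fixes x :: "'i \<Rightarrow> ennreal"
  assumes "finite I" "\<And>i. i \<in> I \<Longrightarrow> 0 \<le> C i"
  shows "(\<Sum>i\<in>I. ennreal (C i) * x i) \<le> ennreal (\<Sum>i\<in>I. C i) * (\<Sum>i\<in>I. x i)"
  unfolding sum_distrib_left
  using assms by (intro sum_mono mult_right_mono ennreal_leI member_le_sum) auto

theorem theorem3p8:
  fixes \<Omega> \<Gamma> :: "((real ^ 'm) \<times> real) set"
    and U :: "nat \<Rightarrow> ((real ^ 'm) \<times> real) set"
    and \<psi> :: "nat \<Rightarrow> (real ^ 'm) \<times> real \<Rightarrow> (real ^ 'm) \<times> real"
    and \<phi> :: "nat \<Rightarrow> (real ^ 'm) \<times> real \<Rightarrow> real"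
    and N K :: nat and s d d' :: real and p q :: ennreal
  defines "\<Gamma> \<equiv> frontier \<Omega>"
  assumes "bounded_lipschitz_domain \<Omega>"
    and "lipschitz_atlas \<Omega> N U \<psi>"
    and "subordinate_partition \<Omega> N U \<phi>"
    and "0 < s" and "s < 1"
    and "0 < p" and "0 < q"
    and "1 < d" and "1 + nat \<lfloor>s\<rfloor> \<le> K"
    and "1 < d'"
  shows "(\<forall>f \<in> Lp_space (surface_measure \<Gamma>) p.
            f \<in> besov_space_bd d K s p q \<Gamma> N U \<psi> \<phi> \<longleftrightarrow>
            (\<exists>lam a. Lip_atomic_repr d' p \<Gamma> f lam a \<and> b_qnorm_bd s p q \<Gamma> lam < \<infinity>)) \<and>
         equivalent_quasi_norm_on (surface_measure \<Gamma>)
           (besov_space_bd d K s p q \<Gamma> N U \<psi> \<phi>)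
           (besov_qnorm_bd d K s p q \<Gamma> N U \<psi> \<phi>)
           (Lip_atomic_qnorm d' s p q \<Gamma>)"
proof -
  let ?D = "DIM(real ^ 'm)"
  let ?W = "\<lambda>i. chart_image \<Gamma> (U i) (\<psi> i)"
  let ?loc = "\<lambda>i. local_piece (\<phi> i) (\<psi> i)"
  let ?V = "besov_space_bd d K s p q \<Gamma> N U \<psi> \<phi>"
  let ?\<nu>\<^sub>0 = "besov_qnorm_bd d K s p q \<Gamma> N U \<psi> \<phi>"
  let ?\<nu> = "Lip_atomic_qnorm d' s p q \<Gamma>"
  let ?n = "\<lambda>i f. besov_qnorm d K s p q (?W i) (?loc i f)"
  have K: "1 \<le> K" and d: "1 \<le> d" "1 \<le> d'" "0 \<le> d'" using assms by auto
  have \<Omega>: "open \<Omega>" "bounded \<Omega>" using assms(2) by (auto simp: bounded_lipschitz_domain_def)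
  have dim: "DIM((real ^ 'm) \<times> real) - 1 = ?D" by simp
  interpret compact_boundary \<Gamma>
    unfolding \<Gamma>_def by unfold_locales (simp add: compact_frontier_bounded \<Omega>)
  have bd_eq: "b_qnorm_bd s p q \<Gamma> = b_qnorm ?D s p q \<Gamma>" unfolding b_qnorm_bd_def dim ..
  have chart: "\<exists>L. lipschitz_chart \<Gamma> (U i) (?W i) (\<lambda>y. inv (\<psi> i) (y, 0)) (\<lambda>x. fst (\<psi> i x)) L"
    and U_bounded: "bounded (U i)" if i: "i \<in> {1..N}" for i
  proof -
    from assms(3) i have *: "\<exists>c r. 0 < r \<and> U i = ball c r" "lipschitz_diffeo (\<psi> i)"
      "\<psi> i ` (U i \<inter> \<Omega>) \<subseteq> {x. snd x > 0}" "\<psi> i ` (U i \<inter> frontier \<Omega>) \<subseteq> {x. snd x = 0}"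
      unfolding lipschitz_atlas_def by blast+
    then show "bounded (U i)" by auto
    have "open (U i)" using *(1) by auto
    then show "\<exists>L. lipschitz_chart \<Gamma> (U i) (?W i) (\<lambda>y. inv (\<psi> i) (y, 0)) (\<lambda>x. fst (\<psi> i x)) L"
      unfolding \<Gamma>_def using \<Omega> * by (intro lipschitz_chart_of_atlas) auto
  qed
  have \<phi>_supp: "closure {x. \<phi> i x \<noteq> 0} \<subseteq> U i" and \<phi>_C: "C_class 1 (\<phi> i)" if "i \<le> N" for i
    using assms(4) that unfolding subordinate_partition_def by blast+
  have \<phi>_lip: "\<exists>B. (\<forall>x. \<bar>\<phi> i x\<bar> \<le> B) \<and> (\<forall>x y. \<bar>\<phi> i x - \<phi> i y\<bar> \<le> B * dist x y)" if i: "i \<in> {1..N}" for i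
  proof (rule C_class_bounded_support_lipschitz[OF \<phi>_C])
    show "i \<le> N" using i by simp
    then show "bounded {x. \<phi> i x \<noteq> 0}"
      using bounded_subset[OF U_bounded[OF i]] \<phi>_supp closure_subset by blast
  qed blast
  have \<phi>_meas: "\<phi> i \<in> borel_measurable (surface_measure \<Gamma>)" if i: "i \<in> {1..N}" for i
  proof -
    obtain B where B: "\<And>x. \<bar>\<phi> i x\<bar> \<le> B" "\<And>x y. \<bar>\<phi> i x - \<phi> i y\<bar> \<le> B * dist x y" using \<phi>_lip[OF i] by blast
    have "0 \<le> B" using B(1)[of undefined] by linarith
    then show ?thesis
      by (intro continuous_measurable lipschitz_on_continuous_on[of B] lipschitz_onI)
        (use B(2) in \<open>auto simp: dist_real_def\<close>)
  qed
  \<comment> \<open>The inner domain stays off the boundary, so \<open>\<phi> 0\<close> does not contribute there.\<close>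
  have one: "(\<Sum>i=1..N. \<phi> i x) = 1" if x: "x \<in> \<Gamma>" for x
  proof -
    have "x \<in> closure \<Omega>" "x \<notin> \<Omega>" using x \<Omega>(1) by (auto simp: \<Gamma>_def frontier_def interior_open)
    then have "(\<Sum>i\<le>N. \<phi> i x) = 1" "x \<notin> closure (U 0)" using assms(4) unfolding subordinate_partition_def by blast+
    moreover have "\<phi> 0 x = 0"
      using \<open>x \<notin> closure (U 0)\<close> \<phi>_supp[of 0] closure_subset[of "{x. \<phi> 0 x \<noteq> 0}"] closure_subset[of "U 0"] by auto
    moreover have "{..N} = insert 0 {1..N}" by auto
    ultimately show ?thesis by simp
  qed
  have "\<forall>i\<in>{1..N}. \<exists>C>0. \<forall>f lam a. f \<in> Lp_space \<sigma> p \<longrightarrow> Lip_atomic_repr d' p \<Gamma> f lam a \<longrightarrow>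
    b_qnorm ?D s p q \<Gamma> lam < \<infinity> \<longrightarrow> ?loc i f \<in> besov_space d K s p q (?W i) \<and>
    ?n i f \<le> ennreal C * b_qnorm ?D s p q \<Gamma> lam"
  proof
    fix i assume i: "i \<in> {1..N}"
    obtain L where L: "lipschitz_chart \<Gamma> (U i) (?W i) (\<lambda>y. inv (\<psi> i) (y, 0)) (\<lambda>x. fst (\<psi> i x)) L"
      using chart[OF i] by blast
    obtain B where "\<And>x. \<bar>\<phi> i x\<bar> \<le> B" "\<And>x y. \<bar>\<phi> i x - \<phi> i y\<bar> \<le> B * dist x y" using \<phi>_lip[OF i] by blast
    from lipschitz_chart.besov_of_Lip_atoms[OF L assms(7,8,5,6) d(1,3) this \<phi>_supp, where K=K] i
    show "\<exists>C>0. \<forall>f lam a. f \<in> Lp_space \<sigma> p \<longrightarrow> Lip_atomic_repr d' p \<Gamma> f lam a \<longrightarrow>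
      b_qnorm ?D s p q \<Gamma> lam < \<infinity> \<longrightarrow> ?loc i f \<in> besov_space d K s p q (?W i) \<and>
      ?n i f \<le> ennreal C * b_qnorm ?D s p q \<Gamma> lam"
      unfolding local_piece_def by simp
  qed
  from bchoice[OF this] obtain C1 :: "nat \<Rightarrow> real" where "\<forall>i\<in>{1..N}. 0 < C1 i \<and>
    (\<forall>f lam a. f \<in> Lp_space \<sigma> p \<longrightarrow> Lip_atomic_repr d' p \<Gamma> f lam a \<longrightarrow>
    b_qnorm ?D s p q \<Gamma> lam < \<infinity> \<longrightarrow> ?loc i f \<in> besov_space d K s p q (?W i) \<and>
    ?n i f \<le> ennreal (C1 i) * b_qnorm ?D s p q \<Gamma> lam)" by (elim exE)
  then have C1: "\<And>i. i \<in> {1..N} \<Longrightarrow> 0 < C1 i"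
    and F1: "\<And>i f lam a. i \<in> {1..N} \<Longrightarrow> f \<in> Lp_space \<sigma> p \<Longrightarrow> Lip_atomic_repr d' p \<Gamma> f lam a \<Longrightarrow>
      b_qnorm ?D s p q \<Gamma> lam < \<infinity> \<Longrightarrow> ?loc i f \<in> besov_space d K s p q (?W i) \<and>
      ?n i f \<le> ennreal (C1 i) * b_qnorm ?D s p q \<Gamma> lam" by blast+
  have "\<forall>i\<in>{1..N}. \<exists>C>0. \<forall>f. f \<in> Lp_space \<sigma> p \<longrightarrow> ?loc i f \<in> besov_space d K s p q (?W i) \<longrightarrow>
    ?\<nu> (\<lambda>x. of_real (\<phi> i x) * f x) \<le> ennreal C * ?n i f"
  proof
    fix i assume i: "i \<in> {1..N}"
    obtain L where L: "lipschitz_chart \<Gamma> (U i) (?W i) (\<lambda>y. inv (\<psi> i) (y, 0)) (\<lambda>x. fst (\<psi> i x)) L"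
      using chart[OF i] by blast
    obtain B where "\<And>x. \<bar>\<phi> i x\<bar> \<le> B" "\<And>x y. \<bar>\<phi> i x - \<phi> i y\<bar> \<le> B * dist x y" using \<phi>_lip[OF i] by blast
    from lipschitz_chart.Lip_atomic_qnorm_localised_le[OF L assms(7,8,6) d(1) K d(2) U_bounded[OF i] this \<phi>_supp] i
    show "\<exists>C>0. \<forall>f. f \<in> Lp_space \<sigma> p \<longrightarrow> ?loc i f \<in> besov_space d K s p q (?W i) \<longrightarrow>
      ?\<nu> (\<lambda>x. of_real (\<phi> i x) * f x) \<le> ennreal C * ?n i f"
      unfolding local_piece_def by simp
  qed
  from bchoice[OF this] obtain C2 :: "nat \<Rightarrow> real" where "\<forall>i\<in>{1..N}. 0 < C2 i \<and>
    (\<forall>f. f \<in> Lp_space \<sigma> p \<longrightarrow> ?loc i f \<in> besov_space d K s p q (?W i) \<longrightarrow>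
    ?\<nu> (\<lambda>x. of_real (\<phi> i x) * f x) \<le> ennreal (C2 i) * ?n i f)" by (elim exE)
  then have C2: "\<And>i. i \<in> {1..N} \<Longrightarrow> 0 < C2 i"
    and F2: "\<And>i f. i \<in> {1..N} \<Longrightarrow> f \<in> Lp_space \<sigma> p \<Longrightarrow> ?loc i f \<in> besov_space d K s p q (?W i) \<Longrightarrow>
      ?\<nu> (\<lambda>x. of_real (\<phi> i x) * f x) \<le> ennreal (C2 i) * ?n i f" by blast+
  have V_Lp: "f \<in> Lp_space \<sigma> p" "\<And>i. i \<in> {1..N} \<Longrightarrow> ?loc i f \<in> besov_space d K s p q (?W i)" if "f \<in> ?V" for f
    using that by (auto simp: besov_space_bd_def)
  have V_meas: "f \<in> borel_measurable \<sigma>" if "f \<in> ?V" for f using V_Lp(1)[OF that] by (simp add: Lp_space_def)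
  from Lip_atomic_qnorm_sum_le[OF assms(7,8) finite_atLeastAtMost[of 1 N], of d' s] obtain C3 :: real where
    C3: "0 < C3" and sum_le: "\<forall>F. (\<forall>i\<in>{1..N}. F i \<in> borel_measurable \<sigma>) \<longrightarrow>
      ?\<nu> (\<lambda>x. \<Sum>i=1..N. F i x) \<le> ennreal C3 * (\<Sum>i=1..N. ?\<nu> (F i))"
    by (elim exE conjE)
  \<comment> \<open>The summand 1, here and in \<open>E\<close>, keeps the constants positive if there are no charts.\<close>
  define A where "A = C3 * (\<Sum>i=1..N. C2 i) + 1"
  have C2_sum: "0 \<le> (\<Sum>i=1..N. C2 i)" using C2 by (intro sum_nonneg) (auto intro: less_imp_le)
  have A: "0 < A" using C3 C2_sum by (simp add: A_def add_nonneg_pos)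
  have upper: "?\<nu> f \<le> ennreal A * ?\<nu>\<^sub>0 f" if f: "f \<in> ?V" for f
  proof -
    let ?F = "\<lambda>i x. of_real (\<phi> i x) * f x"
    have Fm: "?F i \<in> borel_measurable \<sigma>" if "i \<in> {1..N}" for i
      using V_meas[OF f] \<phi>_meas[OF that] by measurable
    have "(\<Sum>i=1..N. ?F i x) = f x" if "x \<in> \<Gamma>" for x
    proof -
      have "(\<Sum>i=1..N. ?F i x) = of_real (\<Sum>i=1..N. \<phi> i x) * f x"
        by (simp add: sum_distrib_right)
      then show ?thesis by (simp only: one[OF that] of_real_1 mult_1)
    qed
    then have "?\<nu> f = ?\<nu> (\<lambda>x. \<Sum>i=1..N. ?F i x)"
      using V_meas[OF f] Fm by (intro Lip_atomic_qnorm_cong_AE[OF assms(7)] borel_measurable_sum) auto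
    also have "\<dots> \<le> ennreal C3 * (\<Sum>i=1..N. ?\<nu> (?F i))" using Fm by (intro sum_le[rule_format]) auto
    also have "\<dots> \<le> ennreal C3 * (\<Sum>i=1..N. ennreal (C2 i) * ?n i f)"
      using V_Lp[OF f] by (intro mult_left_mono sum_mono F2) auto
    also have "\<dots> \<le> ennreal C3 * (ennreal (\<Sum>i=1..N. C2 i) * (\<Sum>i=1..N. ?n i f))"
      using C2 by (intro mult_left_mono sum_ennreal_mult_le) (auto intro: less_imp_le)
    also have "\<dots> = ennreal (C3 * (\<Sum>i=1..N. C2 i)) * ?\<nu>\<^sub>0 f"
      using C3 C2_sum by (simp add: ennreal_mult mult.assoc besov_qnorm_bd_def)
    also have "\<dots> \<le> ennreal A * ?\<nu>\<^sub>0 f" unfolding A_def by (intro mult_right_mono ennreal_leI) auto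
    finally show ?thesis .
  qed
  have \<nu>0_fin: "?\<nu>\<^sub>0 f < \<infinity>" if f: "f \<in> ?V" for f
  proof -
    have "?n i f < \<infinity>" if i: "i \<in> {1..N}" for i
    proof -
      obtain lam a where rep: "K_atomic_repr d K p (?W i) (?loc i f) lam a" "b_qnorm ?D s p q (?W i) lam < \<infinity>"
        using V_Lp(2)[OF f i] by (auto simp: besov_space_def)
      have "?n i f \<le> b_qnorm ?D s p q (?W i) lam"
        unfolding besov_qnorm_def by (rule INF_lower2[of "(lam, a)"]) (use rep(1) in auto)
      then show ?thesis using rep(2) by (rule le_less_trans)
    qed
    then show ?thesis by (simp add: besov_qnorm_bd_def)
  qed
  have \<nu>_fin: "?\<nu> f < \<infinity>" if f: "f \<in> ?V" for f
    using upper[OF f] \<nu>0_fin[OF f] by (auto intro: le_less_trans simp: ennreal_mult_less_top)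
  have into: "f \<in> ?V \<and> ?\<nu>\<^sub>0 f \<le> ennreal (\<Sum>i=1..N. C1 i) * b_qnorm ?D s p q \<Gamma> lam"
    if f: "f \<in> Lp_space \<sigma> p" and rep: "Lip_atomic_repr d' p \<Gamma> f lam a" "b_qnorm ?D s p q \<Gamma> lam < \<infinity>" for f lam a
  proof
    show "f \<in> ?V" using F1[OF _ f rep] f by (simp add: besov_space_bd_def)
    have "?\<nu>\<^sub>0 f \<le> (\<Sum>i=1..N. ennreal (C1 i) * b_qnorm ?D s p q \<Gamma> lam)"
      unfolding besov_qnorm_bd_def using F1[OF _ f rep] by (intro sum_mono) auto
    also have "\<dots> = ennreal (\<Sum>i=1..N. C1 i) * b_qnorm ?D s p q \<Gamma> lam"
      using C1 by (subst sum_distrib_right[symmetric], subst sum_ennreal) (auto intro: less_imp_le)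
    finally show "?\<nu>\<^sub>0 f \<le> ennreal (\<Sum>i=1..N. C1 i) * b_qnorm ?D s p q \<Gamma> lam" .
  qed
  define E where "E = (\<Sum>i=1..N. C1 i) + 1"
  have C1_sum: "0 \<le> (\<Sum>i=1..N. C1 i)" using C1 by (intro sum_nonneg) (auto intro: less_imp_le)
  have E: "0 < E" using C1_sum by (simp add: E_def)
  have lower: "?\<nu>\<^sub>0 f \<le> ennreal E * ?\<nu> f" if f: "f \<in> ?V" for f
    unfolding Lip_atomic_qnorm_def
  proof (rule le_cmult_INF[OF E])
    fix x assume "x \<in> {(lam, a). Lip_atomic_repr d' p \<Gamma> f lam a}"
    then obtain lam a where x: "x = (lam, a)" "Lip_atomic_repr d' p \<Gamma> f lam a" by blast
    have "?\<nu>\<^sub>0 f \<le> ennreal E * b_qnorm ?D s p q \<Gamma> lam"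
    proof (cases "b_qnorm ?D s p q \<Gamma> lam < \<infinity>")
      case True
      have "?\<nu>\<^sub>0 f \<le> ennreal (\<Sum>i=1..N. C1 i) * b_qnorm ?D s p q \<Gamma> lam"
        using into[OF V_Lp(1)[OF f] x(2) True] by blast
      also have "\<dots> \<le> ennreal E * b_qnorm ?D s p q \<Gamma> lam"
        unfolding E_def by (intro mult_right_mono ennreal_leI) auto
      finally show ?thesis .
    next
      case False
      then have "b_qnorm ?D s p q \<Gamma> lam = \<infinity>" by (simp add: less_top[symmetric])
      then show ?thesis using E by (simp add: ennreal_mult_top)
    qed
    then show "?\<nu>\<^sub>0 f \<le> ennreal E * (case x of (lam, a) \<Rightarrow> b_qnorm_bd s p q \<Gamma> lam)"
      by (simp add: x(1) bd_eq)
  qed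
  have definite: "AE x in \<sigma>. f x = 0" if f: "f \<in> ?V" and zero: "?\<nu> f = 0" for f
  proof -
    have "AE x in \<sigma>. of_real (\<phi> i x) * f x = 0" if i: "i \<in> {1..N}" for i
    proof -
      obtain L where L: "lipschitz_chart \<Gamma> (U i) (?W i) (\<lambda>y. inv (\<psi> i) (y, 0)) (\<lambda>x. fst (\<psi> i x)) L"
        using chart[OF i] by blast
      obtain B where "\<And>x. \<bar>\<phi> i x\<bar> \<le> B" "\<And>x y. \<bar>\<phi> i x - \<phi> i y\<bar> \<le> B * dist x y" using \<phi>_lip[OF i] by blast
      from lipschitz_chart.Lp_qnorm_localised_le[OF L assms(7,8,5) d(1) this \<phi>_supp, of K] i
      obtain C :: real where "\<forall>f. f \<in> Lp_space \<sigma> p \<longrightarrow> ?loc i f \<in> besov_space d K s p q (?W i) \<longrightarrow>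
        Lp_qnorm \<sigma> p (\<lambda>x. ennreal (norm (of_real (\<phi> i x) * f x))) \<le> ennreal C * ?n i f"
        unfolding local_piece_def by auto
      then have "Lp_qnorm \<sigma> p (\<lambda>x. ennreal (norm (of_real (\<phi> i x) * f x))) \<le> ennreal C * ?n i f"
        using V_Lp[OF f] i by blast
      moreover have "?n i f \<le> ?\<nu>\<^sub>0 f"
        unfolding besov_qnorm_bd_def using i by (intro member_le_sum) auto
      moreover have "?\<nu>\<^sub>0 f = 0" using lower[OF f] zero by simp
      ultimately have zero: "Lp_qnorm \<sigma> p (\<lambda>x. ennreal (norm (of_real (\<phi> i x) * f x))) = 0" by simp
      have "(\<lambda>x. ennreal (norm (of_real (\<phi> i x) * f x))) \<in> borel_measurable \<sigma>"
        using V_meas[OF f] \<phi>_meas[OF i] by measurable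
      then have "AE x in \<sigma>. ennreal (norm (of_real (\<phi> i x) * f x)) = 0"
        using zero Lp_qnorm_eq_0_iff[OF assms(7)] by blast
      then show ?thesis by (rule AE_mp) (intro AE_I2 impI, simp del: mult_eq_0_iff norm_mult)
    qed
    then have "AE x in \<sigma>. \<forall>i\<in>{1..N}. of_real (\<phi> i x) * f x = 0"
      by (subst AE_ball_countable) auto
    then show ?thesis
    proof (rule AE_mp, intro AE_I2 impI)
      fix x assume x: "x \<in> space \<sigma>" "\<forall>i\<in>{1..N}. of_real (\<phi> i x) * f x = 0"
      have "of_real (\<Sum>i=1..N. \<phi> i x) * f x = (\<Sum>i=1..N. of_real (\<phi> i x) * f x)"
        by (simp add: sum_distrib_right)
      also have "\<dots> = 0" using x(2) by (intro sum.neutral) auto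
      finally have "of_real (\<Sum>i=1..N. \<phi> i x) * f x = 0" .
      moreover have "x \<in> \<Gamma>" using x(1) by simp
      ultimately show "f x = 0" by (simp only: one of_real_1 mult_1)
    qed
  qed
  have "quasi_norm_on \<sigma> ?V ?\<nu>"
    unfolding quasi_norm_on_def
  proof (intro conjI ballI allI impI)
    show "?\<nu> f < \<infinity>" if "f \<in> ?V" for f by (rule \<nu>_fin[OF that])
    show "?\<nu> f = ?\<nu> g" if "f \<in> ?V" "g \<in> ?V" "AE x in \<sigma>. f x = g x" for f g
      using that V_meas by (intro Lip_atomic_qnorm_cong_AE assms(7))
    show "?\<nu> f = 0 \<longleftrightarrow> (AE x in \<sigma>. f x = 0)" if f: "f \<in> ?V" for f
    proof
      assume "AE x in \<sigma>. f x = 0"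
      then have "?\<nu> f = ?\<nu> (\<lambda>x. 0)" using V_meas[OF f] by (intro Lip_atomic_qnorm_cong_AE assms(7)) auto
      then show "?\<nu> f = 0" using Lip_atomic_qnorm_zero[OF assms(7,8)] by simp
    qed (rule definite[OF f])
    show "?\<nu> (\<lambda>x. c * f x) = ennreal (norm c) * ?\<nu> f" if "f \<in> ?V" for f c
      by (rule Lip_atomic_qnorm_cmult[OF assms(7,8) V_meas[OF that]])
    obtain C :: real where "\<forall>f g. f \<in> borel_measurable \<sigma> \<longrightarrow> g \<in> borel_measurable \<sigma> \<longrightarrow>
      ?\<nu> (\<lambda>x. f x + g x) \<le> ennreal C * (?\<nu> f + ?\<nu> g)"
      using Lip_atomic_qnorm_add_le[OF assms(7,8)] by blast
    then show "\<exists>C::real. \<forall>f\<in>?V. \<forall>g\<in>?V. ?\<nu> (\<lambda>x. f x + g x) \<le> ennreal C * (?\<nu> f + ?\<nu> g)"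
      using V_meas by blast
  qed
  moreover have "ennreal (1 / E) * ?\<nu>\<^sub>0 f \<le> ?\<nu> f" if f: "f \<in> ?V" for f
  proof -
    have "ennreal (1 / E) * ?\<nu>\<^sub>0 f \<le> ennreal (1 / E) * (ennreal E * ?\<nu> f)"
      by (rule mult_left_mono[OF lower[OF f]]) simp
    also have "\<dots> = ?\<nu> f" using E by (simp add: mult.assoc[symmetric] ennreal_mult'[symmetric])
    finally show ?thesis .
  qed
  ultimately have equiv: "equivalent_quasi_norm_on \<sigma> ?V ?\<nu>\<^sub>0 ?\<nu>"
    unfolding equivalent_quasi_norm_on_def
    using A E upper by (intro conjI exI[of _ "1 / E"] exI[of _ A]) auto
  have "f \<in> ?V \<longleftrightarrow> (\<exists>lam a. Lip_atomic_repr d' p \<Gamma> f lam a \<and> b_qnorm_bd s p q \<Gamma> lam < \<infinity>)"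
    if f: "f \<in> Lp_space \<sigma> p" for f
  proof
    assume "f \<in> ?V"
    then have "?\<nu> f < \<infinity>" by (rule \<nu>_fin)
    then show "\<exists>lam a. Lip_atomic_repr d' p \<Gamma> f lam a \<and> b_qnorm_bd s p q \<Gamma> lam < \<infinity>"
      using Lip_atomic_qnorm_less by blast
  next
    assume "\<exists>lam a. Lip_atomic_repr d' p \<Gamma> f lam a \<and> b_qnorm_bd s p q \<Gamma> lam < \<infinity>"
    then show "f \<in> ?V" using into[OF f] by (auto simp: bd_eq)
  qed
  then show ?thesis using equiv by blast
qed

end
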